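(* Let $Y$ be the stunted real projective space $\mathbb{R}P^6/\mathbb{R}P^2$, and let $X=Y\vee Y$. Then for all even $k\ge 2$, $$\mathrm{TC}(X)=4\quad\text{and}\quad \mathrm{TC}(X\times S^{k})=5.$$
   Context: $\mathrm{TC}(X)$ is the least integer $n\ge0$ such that $X\times X$ admits a cover by $n+1$ open sets on each of which the evaluation fibration $\pi_X:X^I\to X\times X$, $\gamma\mapsto(\gamma(0),\gamma(1))$, has a continuous local section (so a contractible space has $\mathrm{TC}=0$). *)

theory Defs
  imports "HOL-Analysis.Analysis"
begin

section \<open>Quotient spaces\<close>

text \<open>The set \<open>f ` topspace X\<close> with the quotient (final) topology induced by \<open>f\<close>.\<close>

definition quotient_topology :: "'a topology \<Rightarrow> ('a \<Rightarrow> 'b) \<Rightarrow> 'b topology" where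
  "quotient_topology X f =
     topology (\<lambda>U. U \<subseteq> f ` topspace X \<and> openin X {x \<in> topspace X. f x \<in> U})"

lemma openin_quotient_topology:
  "openin (quotient_topology X f) U \<longleftrightarrow>
     U \<subseteq> f ` topspace X \<and> openin X {x \<in> topspace X. f x \<in> U}"
proof -
  have "istopology (\<lambda>U. U \<subseteq> f ` topspace X \<and> openin X {x \<in> topspace X. f x \<in> U})"
    unfolding istopology_def
  proof (intro conjI allI impI)
    fix S T
    assume S: "S \<subseteq> f ` topspace X \<and> openin X {x \<in> topspace X. f x \<in> S}"
      and T: "T \<subseteq> f ` topspace X \<and> openin X {x \<in> topspace X. f x \<in> T}"
    have "{x \<in> topspace X. f x \<in> S \<inter> T} =
            {x \<in> topspace X. f x \<in> S} \<inter> {x \<in> topspace X. f x \<in> T}"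
      by auto
    with S T show "openin X {x \<in> topspace X. f x \<in> S \<inter> T}"
      by auto
    show "S \<inter> T \<subseteq> f ` topspace X"
      using S by auto
  next
    fix \<K>
    assume K: "\<forall>K\<in>\<K>. K \<subseteq> f ` topspace X \<and> openin X {x \<in> topspace X. f x \<in> K}"
    have "{x \<in> topspace X. f x \<in> \<Union>\<K>} = (\<Union>K\<in>\<K>. {x \<in> topspace X. f x \<in> K})"
      by auto
    with K show "openin X {x \<in> topspace X. f x \<in> \<Union>\<K>}"
      by auto
    show "\<Union>\<K> \<subseteq> f ` topspace X"
      using K by auto
  qed
  then show ?thesis
    by (simp add: quotient_topology_def)
qed

lemma topspace_quotient_topology [simp]:
  "topspace (quotient_topology X f) = f ` topspace X"
proof (rule subset_antisym)
  show "topspace (quotient_topology X f) \<subseteq> f ` topspace X"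
    by (metis openin_quotient_topology openin_topspace)
  have "{x \<in> topspace X. f x \<in> f ` topspace X} = topspace X"
    by auto
  then show "f ` topspace X \<subseteq> topspace (quotient_topology X f)"
    by (metis openin_quotient_topology openin_subset openin_topspace subset_refl)
qed

lemma quotient_map_quotient_topology: "quotient_map X (quotient_topology X f) f"
  by (simp add: quotient_map_def openin_quotient_topology)

text \<open>
  The quotient \<open>X/A\<close> for nonempty \<open>A\<close>. Its points are the equivalence classes: \<open>A\<close> itself, which is
  the canonical base point, and the singletons of the points outside \<open>A\<close>.
\<close>

definition collapse :: "'a topology \<Rightarrow> 'a set \<Rightarrow> 'a set topology" where
  "collapse X A = quotient_topology X (\<lambda>x. if x \<in> A then A else {x})"

definition wedge :: "'a topology \<Rightarrow> 'a \<Rightarrow> 'a topology \<Rightarrow> 'a \<Rightarrow> (bool \<times> 'a) set topology" where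
  "wedge X x Y y =
     collapse (sum_topology (\<lambda>b. if b then Y else X) UNIV) {(False, x), (True, y)}"


section \<open>Real projective spaces\<close>

definition real_projective_space :: "nat \<Rightarrow> (nat \<Rightarrow> real) set topology" where
  "real_projective_space n = quotient_topology (nsphere n) (\<lambda>x. {x, \<lambda>i. - x i})"

text \<open>
  The library realises every sphere inside \<open>nat \<Rightarrow> real\<close>, with the coordinates of index beyond the
  dimension equal to zero. Hence for \<open>m \<le> n\<close> the standard inclusion of the projective spaces is an
  inclusion of point sets.
\<close>

lemma topspace_real_projective_space_mono:
  assumes "m \<le> n"
  shows "topspace (real_projective_space m) \<subseteq> topspace (real_projective_space n)"
proof -
  have "topspace (nsphere m) \<subseteq> topspace (nsphere n)"
  proof
    fix x assume "x \<in> topspace (nsphere m)"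
    then have x: "(\<Sum>i\<le>m. (x i)\<^sup>2) = 1" "\<And>i. i > m \<Longrightarrow> x i = 0"
      by (auto simp: nsphere)
    have "(\<Sum>i\<le>n. (x i)\<^sup>2) = (\<Sum>i\<le>m. (x i)\<^sup>2)"
      using assms x(2) by (intro sum.mono_neutral_right) auto
    with x assms show "x \<in> topspace (nsphere n)"
      by (auto simp: nsphere)
  qed
  then show ?thesis
    by (auto simp: real_projective_space_def)
qed

definition stunted_projective_space :: "nat \<Rightarrow> nat \<Rightarrow> (nat \<Rightarrow> real) set set topology" where
  "stunted_projective_space n m =
     collapse (real_projective_space n) (topspace (real_projective_space m))"


section \<open>Topological complexity\<close>

text \<open>
  The path space \<open>X\<^sup>I\<close> with the compact-open topology. Functions in HOL are total, so a path is made
  unique by requiring it to be \<open>undefined\<close> outside the unit interval. The subbasic set for \<open>K = {}\<close> is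
  the whole path space.
\<close>

definition path_space :: "'a topology \<Rightarrow> (real \<Rightarrow> 'a) topology" where
  "path_space X =
     topology_generated_by
       {{g \<in> extensional {0..1}. pathin X g \<and> g ` K \<subseteq> U} | K U.
          K \<subseteq> {0..1} \<and> compact K \<and> openin X U}"

lemma topspace_path_space: "topspace (path_space X) = {g \<in> extensional {0..1}. pathin X g}"
  unfolding path_space_def topology_generated_by_topspace
proof (intro subset_antisym subsetI)
  fix g assume "g \<in> {g \<in> extensional {0..1}. pathin X g}"
  then have "g \<in> {g \<in> extensional {0..1}. pathin X g \<and> g ` {} \<subseteq> topspace X}"
    by simp
  then show "g \<in> \<Union> {{g \<in> extensional {0..1}. pathin X g \<and> g ` K \<subseteq> U} | K U.
                      K \<subseteq> {0..1} \<and> compact K \<and> openin X U}"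
    by (intro UnionI CollectI exI[of _ "{}"] exI[of _ "topspace X"] conjI refl) auto
qed auto

definition path_ends :: "(real \<Rightarrow> 'a) \<Rightarrow> 'a \<times> 'a" where
  "path_ends g = (g 0, g 1)"

lemma continuous_map_path_ends:
  "continuous_map (path_space X) (prod_topology X X) path_ends"
proof -
  have ev: "continuous_map (path_space X) X (\<lambda>g. g t)" if t: "t \<in> {0..1}" for t
    unfolding continuous_map_def
  proof (intro conjI allI impI)
    show "(\<lambda>g. g t) \<in> topspace (path_space X) \<rightarrow> topspace X"
      using t by (auto simp: topspace_path_space pathin_def continuous_map_def)
  next
    fix U assume U: "openin X U"
    have "{g \<in> topspace (path_space X). g t \<in> U} =
            {g \<in> extensional {0..1}. pathin X g \<and> g ` {t} \<subseteq> U}"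
      by (auto simp: topspace_path_space)
    moreover have "openin (path_space X) {g \<in> extensional {0..1}. pathin X g \<and> g ` {t} \<subseteq> U}"
      unfolding path_space_def
      using t U by (intro topology_generated_by_Basis CollectI exI[of _ "{t}"] exI[of _ U]) auto
    ultimately show "openin (path_space X) {g \<in> topspace (path_space X). g t \<in> U}"
      by simp
  qed
  show ?thesis
    unfolding path_ends_def by (intro continuous_map_pairedI ev) auto
qed

definition has_path_section :: "'a topology \<Rightarrow> ('a \<times> 'a) set \<Rightarrow> bool" where
  "has_path_section X U \<longleftrightarrow>
     (\<exists>s. continuous_map (subtopology (prod_topology X X) U) (path_space X) s \<and>
          (\<forall>p\<in>U. path_ends (s p) = p))"

text \<open>
  The infimum is taken in \<open>enat\<close>, so the value is \<open>\<infinity>\<close> when no finite cover of the required kind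
  exists.
\<close>

definition TC :: "'a topology \<Rightarrow> enat" where
  "TC X =
     Inf {enat n | n. \<exists>U :: nat \<Rightarrow> ('a \<times> 'a) set.
            (\<forall>i\<le>n. openin (prod_topology X X) (U i) \<and> has_path_section X (U i)) \<and>
            (\<Union>i\<le>n. U i) = topspace (prod_topology X X)}"


section \<open>The space under consideration\<close>

definition Y_space :: "(nat \<Rightarrow> real) set set topology" where
  "Y_space = stunted_projective_space 6 2"

text \<open>The wedge is formed at the point to which the smaller projective space is collapsed.\<close>

definition X_space :: "(bool \<times> (nat \<Rightarrow> real) set set) set topology" where
  "X_space =
     wedge Y_space (topspace (real_projective_space 2)) Y_space (topspace (real_projective_space 2))"

lemma base_point_in_Y_space: "topspace (real_projective_space 2) \<in> topspace Y_space"
proof -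
  obtain p where "p \<in> topspace (real_projective_space 2)"
    using in_topspace_nsphere[of 2] by (auto simp: real_projective_space_def)
  moreover from this have "p \<in> topspace (real_projective_space 6)"
    using topspace_real_projective_space_mono[of 2 6] by auto
  ultimately show ?thesis
    by (force simp: Y_space_def stunted_projective_space_def collapse_def)
qed

end

theory Submission
  imports Defs "HOL-Library.Z2"
begin

text \<open>
  Lower bounds. A mod 2 cochain assigns a bit to tuples of points. Suppose that \<open>X \<times>
  X\<close> is covered by \<open>r\<close> open sets with local sections, and \<open>r\<close>
  zero divisors are given. On sufficiently fine tuples of points of the \<open>i\<close>-th set
  the \<open>i\<close>-th zero divisor is the coboundary of a cochain on \<open>X \<times>
  X\<close>. Subtracting these coboundaries makes the cup product of the zero divisors vanish on
  fine tuples, so the product itself is a coboundary there. The cube of the degree one class of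
  either projective space exists on \<open>X\<close>. Let \<open>a\<close> and \<open>b\<close> be
  the zero divisors of these two cubes. On \<open>S^6 \<times> S^6\<close> the product \<open>a a
  b b\<close> counts sign changes of coordinates, and Stokes' theorem on a fine chain filling a
  product of hemispheres evaluates it to 1. Hence four sets do not suffice for \<open>X\<close>. A
  further zero divisor from the sphere excludes five sets for \<open>X \<times> S^k\<close>.

  Upper bounds. A point \<open>(u, v, w)\<close> of \<open>S^6\<close>, with \<open>u\<close> and
  \<open>v\<close> in \<open>R^3\<close> and \<open>w\<close> real, is moved to the base point of
  \<open>X\<close> along the segment towards \<open>u\<close>, \<open>v\<close> or
  \<open>w\<close> placed in the first three coordinates. These three regions and a staircase
  construction for products give 4 for \<open>X\<close>. For \<open>X \<times> S^k\<close> the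
  region of the contraction towards \<open>v\<close> is deformed, depending on the pair of points
  of \<open>S^k\<close>, into one which uses that the path towards \<open>d\<close> is homotopic
  to the path towards \<open>-d\<close>; for even \<open>k\<close> it can be arranged that four
  rather than five regions move \<open>(x, s)\<close> to \<open>(*, s')\<close>.
\<close>

section \<open>Mod 2 cochains on tuples of points\<close>

text \<open>Cochains on arbitrary tuples, tested only on fine ones as in Alexander-Spanier theory,
  replace subdivision: every fine tuple lies in one set of the cover, so one corrected factor
  vanishes on it. The class that survives the collapse of \<open>RP^2\<close> has degree 3 and its
  square is the top class of a copy; hence \<open>a a b b\<close> has degree 12.

  For the product with a sphere the staircase adds three indices, each at most 2: for contracting
  \<open>x\<close>, for moving \<open>s\<close> to \<open>s'\<close>, and for expanding to
  \<open>x'\<close>. This gives only 6. One is saved by coupling the second regions of the first two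
  tasks so that both indices are never 2. Near \<open>s' = -s\<close> the sphere needs a direction
  \<open>m\<close> not parallel to \<open>s\<close>; on an even sphere this fails somewhere, and the
  region for \<open>x\<close> has to cover what remains. It is therefore given by a vector
  \<open>g\<close> that depends on \<open>s\<close>. Where it meets the construction with
  \<open>v\<close>, it equals \<open>- s 0 * V\<close>, so its sign relative to \<open>v\<close>
  changes with \<open>s 0\<close>. This forces the path towards \<open>d\<close> to be deformed into
  the one towards \<open>-d\<close>. The loop from \<open>e6\<close> to \<open>-e6\<close> between
  them is trivial in \<open>Y\<close> because \<open>RP^2\<close> is collapsed.\<close>

declare add_bit_eq_xor [simp del] mult_bit_eq_and [simp del]

text \<open>With addition and multiplication of bits no longer rewritten to XOR and AND, the ring
  rules apply; this rule and the next add characteristic 2.\<close>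

lemma bit_add_self [simp]: "(b::bit) + b = 0"
  by (cases b) (simp_all add: add_bit_eq_xor)

lemma bit_add_self_left [simp]: "(b::bit) + (b + c) = c"
  by (simp flip: add.assoc)

text \<open>Simplices are infinite sequences, so that one type serves all dimensions; the dimension
  is carried by the operations.\<close>

definition face :: "nat \<Rightarrow> (nat \<Rightarrow> 'a) \<Rightarrow> nat \<Rightarrow> 'a" where
  "face i s = (\<lambda>j. if j < i then s j else s (Suc j))"

text \<open>A \<open>p\<close>-simplex is a sequence of points of which only the entries with index at most \<open>p\<close> matter.\<close>

definition cochain :: "nat \<Rightarrow> ((nat \<Rightarrow> 'a) \<Rightarrow> bit) \<Rightarrow> bool" where
  "cochain p \<phi> \<longleftrightarrow> (\<forall>s t. (\<forall>i\<le>p. s i = t i) \<longrightarrow> \<phi> s = \<phi> t)"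

text \<open>The index is the degree of the result: \<open>cobd p\<close> leads from degree
  \<open>p - 1\<close> to degree \<open>p\<close>.\<close>

definition cobd :: "nat \<Rightarrow> ((nat \<Rightarrow> 'a) \<Rightarrow> bit) \<Rightarrow> (nat \<Rightarrow> 'a) \<Rightarrow> bit" where
  "cobd p \<phi> s = (\<Sum>i\<le>p. \<phi> (face i s))"

text \<open>The Alexander-Whitney product: front face times back face, sharing the vertex
  \<open>p\<close>.\<close>

definition cup :: "nat \<Rightarrow> ((nat \<Rightarrow> 'a) \<Rightarrow> bit) \<Rightarrow> ((nat \<Rightarrow> 'a) \<Rightarrow> bit) \<Rightarrow> (nat \<Rightarrow> 'a) \<Rightarrow> bit" where
  "cup p \<phi> \<psi> s = \<phi> s * \<psi> (\<lambda>i. s (i + p))"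

lemma cochainD: "cochain p \<phi> \<Longrightarrow> (\<And>i. i \<le> p \<Longrightarrow> s i = t i) \<Longrightarrow> \<phi> s = \<phi> t"
  by (auto simp: cochain_def)

lemma cochain_cobd: "cochain p \<phi> \<Longrightarrow> cochain (Suc p) (cobd (Suc p) \<phi>)"
  unfolding cochain_def cobd_def
  by (intro allI impI sum.cong refl) (simp add: face_def)

lemma cochain_cup:
  assumes "cochain p \<phi>" "cochain q \<psi>" shows "cochain (p + q) (cup p \<phi> \<psi>)"
  unfolding cochain_def cup_def
proof (intro allI impI)
  fix s t :: "nat \<Rightarrow> 'a" assume *: "\<forall>i\<le>p + q. s i = t i"
  have "\<phi> s = \<phi> t" by (rule cochainD[OF assms(1)]) (use * in auto)
  moreover have "\<psi> (\<lambda>i. s (i + p)) = \<psi> (\<lambda>i. t (i + p))"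
    by (rule cochainD[OF assms(2)]) (use * in auto)
  ultimately show "\<phi> s * \<psi> (\<lambda>i. s (i + p)) = \<phi> t * \<psi> (\<lambda>i. t (i + p))" by simp
qed

lemma cochain_add: "cochain p \<phi> \<Longrightarrow> cochain p \<psi> \<Longrightarrow> cochain p (\<lambda>s. \<phi> s + \<psi> s)"
  unfolding cochain_def by metis

lemma cobd_add: "cobd p (\<lambda>s. \<phi> s + \<psi> s) s = cobd p \<phi> s + cobd p \<psi> s"
  by (simp add: cobd_def sum.distrib)

lemma sum_atMost_split:
  fixes h :: "nat \<Rightarrow> bit"
  shows "(\<Sum>i\<le>Suc (p + q). h i) = (\<Sum>i\<le>p. h i) + (\<Sum>i\<le>q. h (Suc (i + p)))"
  by (induction q) (auto simp: add_ac)

text \<open>Leibniz rule mod 2. The right-hand side contains the last face of the front and the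
  first face of the back, both contributing \<open>\<phi> s * \<psi> u\<close>; they cancel, and
  what remains are the faces of \<open>s\<close>.\<close>

lemma cobd_cup:
  assumes "cochain p \<phi>"
  shows "cobd (Suc (p + q)) (cup p \<phi> \<psi>) s =
           cup (Suc p) (cobd (Suc p) \<phi>) \<psi> s + cup p \<phi> (cobd (Suc q) \<psi>) s"
proof -
  define u where "u = (\<lambda>i. s (i + Suc p))"
  define v where "v = (\<lambda>i. s (i + p))"
  have 1: "(\<lambda>j. face i s (j + p)) = u" if "i \<le> p" for i
    using that by (auto simp: face_def u_def fun_eq_iff)
  have 2: "(\<lambda>j. face (Suc (i + p)) s (j + p)) = face (Suc i) v" for i
    by (auto simp: face_def v_def fun_eq_iff)
  have 3: "\<phi> (face (Suc (i + p)) s) = \<phi> s" for i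
    by (rule cochainD[OF assms]) (auto simp: face_def)
  have 4: "face 0 v = u" by (auto simp: face_def u_def v_def fun_eq_iff)
  have "cobd (Suc (p + q)) (cup p \<phi> \<psi>) s =
        (\<Sum>i\<le>p. \<phi> (face i s)) * \<psi> u + \<phi> s * (\<Sum>i\<le>q. \<psi> (face (Suc i) v))"
    unfolding cobd_def sum_atMost_split cup_def
    by (simp add: 1 2 3 sum_distrib_left sum_distrib_right)
  also have "\<dots> = ((\<Sum>i\<le>p. \<phi> (face i s)) * \<psi> u + \<phi> s * \<psi> u) +
      (\<phi> s * \<psi> u + \<phi> s * (\<Sum>i\<le>q. \<psi> (face (Suc i) v)))"
    by (simp only: add.assoc bit_add_self_left)
  also have "\<dots> = cup (Suc p) (cobd (Suc p) \<phi>) \<psi> s + cup p \<phi> (cobd (Suc q) \<psi>) s"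
  proof -
    have "cobd (Suc p) \<phi> s = (\<Sum>i\<le>p. \<phi> (face i s)) + \<phi> s"
      using 3[of 0] by (simp add: cobd_def)
    moreover have "cobd (Suc q) \<psi> v = \<psi> u + (\<Sum>i\<le>q. \<psi> (face (Suc i) v))"
      by (simp add: cobd_def 4 sum.atMost_Suc_shift del: sum.atMost_Suc)
    ultimately show ?thesis
      unfolding cup_def u_def[symmetric] v_def[symmetric] by (simp add: distrib_left distrib_right)
  qed
  finally show ?thesis .
qed

lemma cobd_cobd: "cobd (Suc p) (cobd p \<phi>) s = 0"
proof -
  define A where "A = (\<lambda>i j. \<phi> (face j (face i s)))"
  have comm: "A i j = A (Suc j) i" if "i \<le> j" for i j
  proof -
    have "face j (face i s) = face i (face (Suc j) s)"
      using that by (auto simp: face_def fun_eq_iff)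
    then show ?thesis by (simp add: A_def)
  qed
  have "cobd (Suc p) (cobd p \<phi>) s = (\<Sum>i\<le>Suc p. \<Sum>j\<le>p. A i j)"
    by (simp add: cobd_def A_def)
  also have "\<dots> = (\<Sum>(i,j)\<in>{..Suc p} \<times> {..p}. A i j)"
    by (simp only: sum.cartesian_product)
  also have "{..Suc p} \<times> {..p} = {(i,j). i \<le> j \<and> j \<le> p} \<union> {(i,j). j < i \<and> i \<le> Suc p}"
    by auto
  also have "(\<Sum>(i,j)\<in>{(i,j). i \<le> j \<and> j \<le> p} \<union> {(i,j). j < i \<and> i \<le> Suc p}. A i j) =
     (\<Sum>(i,j)\<in>{(i,j). i \<le> j \<and> j \<le> p}. A i j) + (\<Sum>(i,j)\<in>{(i,j). j < i \<and> i \<le> Suc p}. A i j)"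
  proof (rule sum.union_disjoint)
    show "finite {(i,j). i \<le> j \<and> j \<le> p}"
      by (rule finite_subset[of _ "{..p} \<times> {..p}"]) auto
    show "finite {(i,j). j < i \<and> i \<le> Suc p}"
      by (rule finite_subset[of _ "{..Suc p} \<times> {..p}"]) auto
  qed auto
  also have "(\<Sum>(i,j)\<in>{(i,j). j < i \<and> i \<le> Suc p}. A i j) = (\<Sum>(i,j)\<in>{(i,j). i \<le> j \<and> j \<le> p}. A i j)"
    by (rule sum.reindex_bij_witness[where i = "\<lambda>(i,j). (Suc j, i)" and j = "\<lambda>(i,j). (j, i - 1)"])
       (auto simp: comm)
  finally show ?thesis by simp
qed

section \<open>Prism operators\<close>

definition mix :: "nat \<Rightarrow> ('a \<Rightarrow> 'b) \<Rightarrow> ('a \<Rightarrow> 'b) \<Rightarrow> (nat \<Rightarrow> 'a) \<Rightarrow> nat \<Rightarrow> 'b" where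
  "mix j f g s = (\<lambda>i. if i \<le> j then f (s i) else g (s (i - 1)))"

text \<open>The simplices \<open>mix j f g s\<close> with \<open>j < p\<close> triangulate the prism
  between \<open>f\<close> and \<open>g\<close> over a simplex of dimension \<open>p - 1\<close>;
  here \<open>p\<close> is the degree of the argument \<open>\<phi>\<close>.\<close>

definition prism :: "nat \<Rightarrow> ('a \<Rightarrow> 'b) \<Rightarrow> ('a \<Rightarrow> 'b) \<Rightarrow> ((nat \<Rightarrow> 'b) \<Rightarrow> bit) \<Rightarrow> (nat \<Rightarrow> 'a) \<Rightarrow> bit" where
  "prism p f g \<phi> s = (\<Sum>j<p. \<phi> (mix j f g s))"

text \<open>The chain homotopy formula mod 2. The faces \<open>j\<close> and \<open>Suc j\<close> of
  the \<open>j\<close>-th prism simplex give \<open>b j\<close> and \<open>b (Suc j)\<close>, which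
  telescope to the two ends; all other faces are prism simplices over faces of
  \<open>s\<close>.\<close>

lemma prism_identity:
  assumes "cochain p \<phi>"
  shows "prism (Suc p) f g (cobd (Suc p) \<phi>) s + cobd p (prism p f g \<phi>) s =
           \<phi> (\<lambda>i. f (s i)) + \<phi> (\<lambda>i. g (s i))"
proof -
  define A where "A = (\<lambda>i j. \<phi> (mix j f g (face i s)))"
  define b where "b = (\<lambda>j. \<phi> (\<lambda>i. if i < j then f (s i) else g (s i)))"
  have lt: "\<phi> (face i (mix (Suc j) f g s)) = A i j" if "i \<le> j" for i j
  proof -
    have "face i (mix (Suc j) f g s) = mix j f g (face i s)"
      using that by (auto simp: face_def mix_def fun_eq_iff)
    then show ?thesis by (simp add: A_def)
  qed
  have eq: "\<phi> (face j (mix j f g s)) = b j" for j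
    unfolding b_def by (rule arg_cong[where f = \<phi>]) (auto simp: face_def mix_def fun_eq_iff)
  have Seq: "\<phi> (face (Suc j) (mix j f g s)) = b (Suc j)" for j
    unfolding b_def by (rule arg_cong[where f = \<phi>]) (auto simp: face_def mix_def fun_eq_iff)
  have gt: "\<phi> (face (Suc i) (mix j f g s)) = A i j" if "j < i" for i j
  proof -
    have "face (Suc i) (mix j f g s) = mix j f g (face i s)"
      using that by (auto simp: face_def mix_def fun_eq_iff)
    then show ?thesis by (simp add: A_def)
  qed
  have inner: "(\<Sum>i\<le>Suc p. \<phi> (face i (mix j f g s))) =
      ((\<Sum>i<j. \<phi> (face i (mix j f g s))) + (\<Sum>i\<in>{Suc j..p}. A i j)) + (b j + b (Suc j))"
    if "j \<le> p" for j
  proof -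
    have "{..Suc p} = {..<j} \<union> {j, Suc j} \<union> Suc ` {Suc j..p}"
      using that by (auto simp: image_iff)
    then have "(\<Sum>i\<le>Suc p. \<phi> (face i (mix j f g s))) =
       (\<Sum>i\<in>{..<j} \<union> {j, Suc j} \<union> Suc ` {Suc j..p}. \<phi> (face i (mix j f g s)))" by simp
    also have "\<dots> = (\<Sum>i\<in>{..<j} \<union> {j, Suc j}. \<phi> (face i (mix j f g s))) +
        (\<Sum>i\<in>Suc ` {Suc j..p}. \<phi> (face i (mix j f g s)))"
      by (rule sum.union_disjoint) auto
    also have "(\<Sum>i\<in>{..<j} \<union> {j, Suc j}. \<phi> (face i (mix j f g s))) =
        (\<Sum>i<j. \<phi> (face i (mix j f g s))) + (\<Sum>i\<in>{j, Suc j}. \<phi> (face i (mix j f g s)))"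
      by (rule sum.union_disjoint) auto
    also have "(\<Sum>i\<in>{j, Suc j}. \<phi> (face i (mix j f g s))) = b j + b (Suc j)"
      by (simp add: eq Seq)
    also have "(\<Sum>i\<in>Suc ` {Suc j..p}. \<phi> (face i (mix j f g s))) = (\<Sum>i\<in>{Suc j..p}. A i j)"
      by (subst sum.reindex) (auto simp: gt)
    finally show ?thesis by (simp add: add_ac)
  qed
  have tele: "(\<Sum>j\<le>n. b j + b (Suc j)) = b 0 + b (Suc n)" for n
    by (induction n) (auto simp: add_ac)
  have "prism (Suc p) f g (cobd (Suc p) \<phi>) s = (\<Sum>j\<le>p. \<Sum>i\<le>Suc p. \<phi> (face i (mix j f g s)))"
    by (simp only: prism_def cobd_def lessThan_Suc_atMost)
  also have "\<dots> = (\<Sum>j\<le>p. (\<Sum>i<j. \<phi> (face i (mix j f g s)))) + (\<Sum>j\<le>p. \<Sum>i\<in>{Suc j..p}. A i j) +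
      (b 0 + b (Suc p))"
  proof -
    have "(\<Sum>j\<le>p. \<Sum>i\<le>Suc p. \<phi> (face i (mix j f g s))) =
      (\<Sum>j\<le>p. ((\<Sum>i<j. \<phi> (face i (mix j f g s))) + (\<Sum>i\<in>{Suc j..p}. A i j)) + (b j + b (Suc j)))"
      by (intro sum.cong refl inner) simp
    then show ?thesis by (simp only: sum.distrib flip: tele)
  qed
  also have "(\<Sum>j\<le>p. (\<Sum>i<j. \<phi> (face i (mix j f g s)))) = (\<Sum>j<p. \<Sum>i\<le>j. A i j)"
  proof (cases p)
    case (Suc n)
    then show ?thesis
      by (simp add: sum.atMost_Suc_shift lessThan_Suc_atMost lt del: sum.atMost_Suc sum.lessThan_Suc)
  qed simp
  also have "(\<Sum>j\<le>p. \<Sum>i\<in>{Suc j..p}. A i j) = (\<Sum>j<p. \<Sum>i\<in>{Suc j..p}. A i j)"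
    by (simp flip: lessThan_Suc_atMost)
  also have "(\<Sum>j<p. \<Sum>i\<le>j. A i j) + (\<Sum>j<p. \<Sum>i\<in>{Suc j..p}. A i j) = (\<Sum>j<p. \<Sum>i\<le>p. A i j)"
  proof (subst sum.distrib[symmetric], rule sum.cong[OF refl])
    fix j assume "j \<in> {..<p}"
    then have "{..p} = {..j} \<union> {Suc j..p}" by auto
    then show "(\<Sum>i\<le>j. A i j) + (\<Sum>i\<in>{Suc j..p}. A i j) = (\<Sum>i\<le>p. A i j)"
      by (simp add: sum.union_disjoint)
  qed
  also have "\<dots> = cobd p (prism p f g \<phi>) s"
    unfolding cobd_def prism_def A_def by (rule sum.swap)
  finally have "prism (Suc p) f g (cobd (Suc p) \<phi>) s + cobd p (prism p f g \<phi>) s = b 0 + b (Suc p)"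
    by (simp add: add_ac)
  moreover have "b 0 = \<phi> (\<lambda>i. g (s i))" by (simp add: b_def)
  moreover have "b (Suc p) = \<phi> (\<lambda>i. f (s i))"
    unfolding b_def by (rule cochainD[OF assms]) auto
  ultimately show ?thesis by (simp add: add.commute)
qed

lemma cochain_prism: "cochain (Suc p) \<phi> \<Longrightarrow> cochain p (prism (Suc p) f g \<phi>)"
  unfolding cochain_def prism_def
  by (intro allI impI sum.cong refl) (auto simp: mix_def elim!: allE)

section \<open>Chains and fillings\<close>

definition ev :: "((nat \<Rightarrow> 'a) \<Rightarrow> bit) \<Rightarrow> (nat \<Rightarrow> 'a) list \<Rightarrow> bit" where
  "ev \<phi> z = sum_list (map \<phi> z)"

lemma ev_simps [simp]: "ev \<phi> [] = 0" "ev \<phi> (s # z) = \<phi> s + ev \<phi> z" "ev \<phi> (z @ w) = ev \<phi> z + ev \<phi> w"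
  by (auto simp: ev_def)

lemma ev_map: "ev \<phi> (map h z) = ev (\<lambda>s. \<phi> (h s)) z"
  by (simp add: ev_def comp_def)

lemma ev_concat: "ev \<phi> (concat zs) = sum_list (map (ev \<phi>) zs)"
  by (induction zs) auto

lemma ev_add: "ev (\<lambda>s. \<phi> s + \<psi> s) z = ev \<phi> z + ev \<psi> z"
  by (simp add: ev_def sum_list_addf)

lemma ev_cong: "(\<And>s. s \<in> set z \<Longrightarrow> \<phi> s = \<psi> s) \<Longrightarrow> ev \<phi> z = ev \<psi> z"
  unfolding ev_def by (metis map_cong)

lemma ev_const_even: "even (length z) \<Longrightarrow> ev (\<lambda>s. c) z = 0"
  by (cases c) (auto simp: ev_def sum_list_triv)

text \<open>Boundaries of chains are only used in dual form.\<close>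

definition bounds :: "nat \<Rightarrow> (nat \<Rightarrow> 'a) list \<Rightarrow> (nat \<Rightarrow> 'a) list \<Rightarrow> bool" where
  "bounds n z w \<longleftrightarrow> (\<forall>\<phi>. cochain n \<phi> \<longrightarrow> ev (cobd (Suc n) \<phi>) z = ev \<phi> w)"

text \<open>All entries lie in \<open>D\<close>, also those beyond \<open>n\<close>, so that maps
  and symmetries of \<open>D\<close> can be applied to whole sequences; only the entries up to
  \<open>n\<close> have to be close.\<close>

definition fine_chain :: "'a::metric_space set \<Rightarrow> real \<Rightarrow> nat \<Rightarrow> (nat \<Rightarrow> 'a) list \<Rightarrow> bool" where
  "fine_chain D \<eta> n z \<longleftrightarrow>
     (\<forall>s\<in>set z. (\<forall>i. s i \<in> D) \<and> (\<forall>i\<le>n. \<forall>j\<le>n. dist (s i) (s j) < \<eta>))"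

text \<open>The prisms over the steps of a finely divided contraction fill \<open>w\<close>. At the
  end of the contraction the simplices are constant at \<open>a\<close> and all have the same value;
  an even number of them adds up to zero.\<close>

lemma fill_contractible:
  fixes D :: "'a::metric_space set" and c :: "real \<Rightarrow> 'a \<Rightarrow> 'a"
  assumes D: "compact D" and c: "continuous_on ({0..1} \<times> D) (\<lambda>(t, x). c t x)"
    and cD: "\<And>t x. t \<in> {0..1} \<Longrightarrow> x \<in> D \<Longrightarrow> c t x \<in> D"
    and c0: "\<And>x. x \<in> D \<Longrightarrow> c 0 x = x" and c1: "\<And>x. x \<in> D \<Longrightarrow> c 1 x = a" and "\<eta> > 0"
  obtains \<eta>' where "\<eta>' > 0"
    "\<And>n w. fine_chain D \<eta>' n w \<Longrightarrow> even (length w) \<Longrightarrow>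
       (\<And>m \<psi>. n = Suc m \<Longrightarrow> cochain m \<psi> \<Longrightarrow> ev (cobd n \<psi>) w = 0) \<Longrightarrow>
       \<exists>z. fine_chain D \<eta> (Suc n) z \<and> bounds n z w"
proof -
  have "uniformly_continuous_on ({0..1} \<times> D) (\<lambda>(t, x). c t x)"
    using c D by (intro compact_uniformly_continuous compact_Times) auto
  then obtain d where d: "d > 0"
    "\<And>p q. p \<in> {0..1} \<times> D \<Longrightarrow> q \<in> {0..1} \<times> D \<Longrightarrow> dist p q < d \<Longrightarrow>
       dist (case p of (t, x) \<Rightarrow> c t x) (case q of (t, x) \<Rightarrow> c t x) < \<eta>"
    using \<open>\<eta> > 0\<close> unfolding uniformly_continuous_on_def by metis
  \<comment> \<open>One time step together with a distance below \<open>d / 2\<close> in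
    \<open>D\<close> stays below \<open>d\<close> in the product.\<close>
  obtain M :: nat where M: "M > 0" "1 / real M < d / 2"
    using d(1) by (metis half_gt_zero nat_approx_posE zero_less_Suc)
  define f where "f = (\<lambda>m x. c (real m / real M) x)"
  have f_close: "dist (f m x) (f m' y) < \<eta>"
    if "x \<in> D" "y \<in> D" "dist x y < d / 2" "m \<le> M" "m' \<le> M" "m' = m \<or> m' = Suc m \<or> m = Suc m'" for x y m m'
  proof -
    have "dist (real m / real M) (real m' / real M) \<le> 1 / real M"
      using that(6) M by (auto simp: dist_real_def divide_simps)
    then have "dist (real m / real M, x) (real m' / real M, y) < d"
      using M that(3) dist_Pair_Pair[of "real m / real M" x "real m' / real M" y]
        sqrt_sum_squares_le_sum[of "dist (real m / real M) (real m' / real M)" "dist x y"]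
      by (smt (verit) field_sum_of_halves zero_le_dist)
    then show ?thesis
      using d(2)[of "(real m / real M, x)" "(real m' / real M, y)"] that M by (auto simp: f_def)
  qed
  have fD: "f m x \<in> D" if "x \<in> D" "m \<le> M" for m x
    unfolding f_def using that M by (intro cD) auto
  show ?thesis
  proof (rule that)
    show "d / 2 > 0" using d by simp
    fix n w
    assume w: "fine_chain D (d / 2) n w" "even (length w)"
      and cl: "\<And>m \<psi>. n = Suc m \<Longrightarrow> cochain m \<psi> \<Longrightarrow> ev (cobd n \<psi>) w = 0"
    define z where "z = concat (map (\<lambda>m. concat (map (\<lambda>s.
        map (\<lambda>j. mix j (f m) (f (Suc m)) s) [0..<Suc n]) w)) [0..<M])"
    have inD: "s i \<in> D" if "s \<in> set w" for s i using w(1) that by (auto simp: fine_chain_def)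
    have "fine_chain D \<eta> (Suc n) z"
      unfolding fine_chain_def
    proof (intro ballI conjI allI impI)
      fix s assume "s \<in> set z"
      then obtain m t j where s: "m < M" "t \<in> set w" "j \<le> n" "s = mix j (f m) (f (Suc m)) t"
        by (auto simp: z_def less_Suc_eq_le simp del: upt_Suc)
      show "s i \<in> D" for i
        using s inD[OF s(2)] by (auto simp: mix_def intro!: fD)
      fix i k assume ik: "i \<le> Suc n" "k \<le> Suc n"
      have cl: "dist (t x) (t y) < d / 2" if "x \<le> n" "y \<le> n" for x y
        using w(1) s(2) that by (auto simp: fine_chain_def)
      show "dist (s i) (s k) < \<eta>"
        unfolding s(4) mix_def using s(1,3) ik
        by (auto intro!: f_close inD[OF s(2)] cl)
    qed
    moreover have "bounds n z w"
      unfolding bounds_def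
    proof (intro allI impI)
      fix \<phi> :: "(nat \<Rightarrow> 'a) \<Rightarrow> bit" assume \<phi>: "cochain n \<phi>"
      have list: "ev \<phi>' (map h [0..<k]) = (\<Sum>j<k. \<phi>' (h j))" for \<phi>' :: "(nat \<Rightarrow> 'a) \<Rightarrow> bit" and h k
        by (simp add: ev_def comp_def interv_sum_list_conv_sum_set_nat atLeast0LessThan)
      have inner: "ev \<phi>' (concat (map (\<lambda>s. map (\<lambda>j. mix j (f m) (f (Suc m)) s) [0..<Suc n]) w)) =
             ev (prism (Suc n) (f m) (f (Suc m)) \<phi>') w" for \<phi>' m
        unfolding ev_concat map_map comp_def list prism_def by (simp add: ev_def)
      have "ev (cobd (Suc n) \<phi>) z =
          (\<Sum>m<M. ev (prism (Suc n) (f m) (f (Suc m)) (cobd (Suc n) \<phi>)) w)"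
        unfolding z_def
        by (subst ev_concat) (simp add: comp_def inner interv_sum_list_conv_sum_set_nat
            atLeast0LessThan del: upt_Suc)
      also have "\<dots> = (\<Sum>m<M. ev (\<lambda>s. \<phi> (\<lambda>i. f m (s i))) w + ev (\<lambda>s. \<phi> (\<lambda>i. f (Suc m) (s i))) w)"
      proof (rule sum.cong[OF refl])
        fix m
        have "prism (Suc n) (f m) (f (Suc m)) (cobd (Suc n) \<phi>) =
            (\<lambda>s. (\<phi> (\<lambda>i. f m (s i)) + \<phi> (\<lambda>i. f (Suc m) (s i))) + cobd n (prism n (f m) (f (Suc m)) \<phi>) s)"
          unfolding prism_identity[OF \<phi>, symmetric] by (simp add: add.assoc)
        moreover have "ev (cobd n (prism n (f m) (f (Suc m)) \<phi>)) w = 0"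
        proof (cases n)
          \<comment> \<open>In degree 0 nothing is assumed about coboundaries; the prism term is an
            empty sum.\<close>
          case 0
          then have "cobd n (prism n (f m) (f (Suc m)) \<phi>) = (\<lambda>s. 0)"
            by (simp add: cobd_def prism_def fun_eq_iff)
          then show ?thesis
            using ev_const_even[OF w(2), of 0] by simp
        next
          case (Suc k)
          then show ?thesis using cl[OF Suc cochain_prism] \<phi> by simp
        qed
        ultimately show "ev (prism (Suc n) (f m) (f (Suc m)) (cobd (Suc n) \<phi>)) w =
            ev (\<lambda>s. \<phi> (\<lambda>i. f m (s i))) w + ev (\<lambda>s. \<phi> (\<lambda>i. f (Suc m) (s i))) w"
          by (simp add: ev_add)
      qed
      also have "\<dots> = ev (\<lambda>s. \<phi> (\<lambda>i. f 0 (s i))) w + ev (\<lambda>s. \<phi> (\<lambda>i. f M (s i))) w"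
      proof -
        have "(\<Sum>m<k. g m + g (Suc m)) = g 0 + g k" for g :: "nat \<Rightarrow> bit" and k
          by (induction k) (auto simp: add_ac)
        then show ?thesis .
      qed
      also have "ev (\<lambda>s. \<phi> (\<lambda>i. f 0 (s i))) w = ev \<phi> w"
        by (rule ev_cong) (simp add: f_def c0 inD)
      also have "ev (\<lambda>s. \<phi> (\<lambda>i. f M (s i))) w = ev (\<lambda>s. \<phi> (\<lambda>i. a)) w"
        using M by (intro ev_cong) (simp add: f_def c1 inD)
      also have "\<dots> = 0" by (rule ev_const_even[OF w(2)])
      finally show "ev (cobd (Suc n) \<phi>) z = ev \<phi> w" by simp
    qed
    ultimately show "\<exists>z. fine_chain D \<eta> (Suc n) z \<and> bounds n z w" by blast
  qed
qed

section \<open>Fine chains in products of hemispheres\<close>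

definition sph :: "nat \<Rightarrow> (nat \<Rightarrow> real) set" where
  "sph n = {x. (\<Sum>i\<le>n. (x i)\<^sup>2) = 1 \<and> (\<forall>i>n. x i = 0)}"

lemma topspace_nsphere: "topspace (nsphere n) = sph n"
  by (auto simp: nsphere sph_def)

lemma nsphere_eq_top_of_set: "nsphere n = top_of_set (sph n)"
  by (simp add: nsphere sph_def euclidean_product_topology)

lemma abs_le_1_sph:
  assumes "x \<in> sph n" shows "\<bar>x i\<bar> \<le> 1"
proof (cases "i \<le> n")
  case True
  have "(x i)\<^sup>2 \<le> (\<Sum>i\<le>n. (x i)\<^sup>2)" using True by (intro member_le_sum) auto
  then show ?thesis using assms abs_square_le_1[of "x i"] by (auto simp: sph_def)
qed (use assms in \<open>auto simp: sph_def\<close>)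

lemma sph_minus: "x \<in> sph n \<Longrightarrow> (\<lambda>i. - x i) \<in> sph n"
  by (auto simp: sph_def)

lemma sph_nonzero: "x \<in> sph n \<Longrightarrow> x \<noteq> (\<lambda>_. 0)"
  by (auto simp: sph_def)

lemma sph_mono:
  assumes "m \<le> n" shows "sph m \<subseteq> sph n"
proof
  fix x assume x: "x \<in> sph m"
  then have "(\<Sum>i\<le>n. (x i)\<^sup>2) = (\<Sum>i\<le>m. (x i)\<^sup>2)"
    using assms by (intro sum.mono_neutral_right) (auto simp: sph_def)
  with x assms show "x \<in> sph n" by (auto simp: sph_def)
qed

lemma continuous_on_coord:
  "continuous_on S f \<Longrightarrow> continuous_on S (\<lambda>x. f x (i::'i) :: 'b::topological_space)"
  by (rule continuous_on_product_then_coordinatewise)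

lemma continuous_on_apply [continuous_intros]: "continuous_on S (\<lambda>x. x i)"
  by (rule continuous_on_coord) (rule continuous_on_id)

lemma continuous_on_apply2 [continuous_intros]: "continuous_on S (\<lambda>x. x i j)"
  by (rule continuous_on_coord) (rule continuous_on_apply)

lemma compact_Collect_coord:
  fixes S :: "'i \<Rightarrow> 'b::topological_space set"
  assumes "\<And>i. compact (S i)"
  shows "compact {x. \<forall>i. x i \<in> S i}"
proof -
  have "compactin (product_topology (\<lambda>i. euclidean) UNIV) (PiE UNIV S)"
    using assms by (auto simp: compactin_PiE)
  then show ?thesis
    by (simp add: euclidean_product_topology PiE_def Pi_def)
qed

lemma closed_sph: "closed (sph n)"
proof -
  have "closed {x::nat\<Rightarrow>real. (\<Sum>i\<le>n. (x i)\<^sup>2) = 1}"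
    by (intro closed_Collect_eq continuous_intros)
  moreover have "closed (\<Inter>i\<in>{n<..}. {x::nat\<Rightarrow>real. x i = 0})"
    by (intro closed_INT ballI closed_Collect_eq continuous_on_const continuous_on_apply)
  moreover have "sph n = {x. (\<Sum>i\<le>n. (x i)\<^sup>2) = 1} \<inter> (\<Inter>i\<in>{n<..}. {x. x i = 0})"
    by (auto simp: sph_def)
  ultimately show ?thesis by (simp only: closed_Int)
qed

lemma compact_sph: "compact (sph n)"
proof -
  have "compact {x::nat\<Rightarrow>real. \<forall>i. x i \<in> {-1..1}}"
    by (rule compact_Collect_coord) auto
  then have "compact ({x. \<forall>i. x i \<in> {-1..1}} \<inter> sph n)"
    using closed_sph by (rule compact_Int_closed)
  moreover have "{x. \<forall>i. x i \<in> {-1..1}} \<inter> sph n = sph n"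
    using abs_le_1_sph by (auto simp: abs_le_iff minus_le_iff)
  ultimately show ?thesis by (simp only:)
qed

definition flip :: "nat \<Rightarrow> (nat \<Rightarrow> nat \<Rightarrow> real) \<Rightarrow> nat \<Rightarrow> nat \<Rightarrow> real" where
  "flip \<alpha> x = x(\<alpha> := \<lambda>i. - x \<alpha> i)"

lemma flip_flip [simp]: "flip \<alpha> (flip \<alpha> x) = x"
  by (auto simp: flip_def fun_eq_iff)

lemma flip_commute: "flip \<alpha> (flip \<beta> x) = flip \<beta> (flip \<alpha> x)"
  by (auto simp: flip_def fun_eq_iff)

lemma flip_apply: "flip \<alpha> x \<beta> = (if \<beta> = \<alpha> then (\<lambda>i. - x \<alpha> i) else x \<beta>)"
  by (auto simp: flip_def)

lemma dist_flip: "dist (flip \<alpha> x) (flip \<alpha> y) = dist x y"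
proof -
  have "dist (\<lambda>i. - a i) (\<lambda>i. - b i) = dist a b" for a b :: "nat \<Rightarrow> real"
    by (simp add: dist_fun_def dist_minus)
  then have "dist (flip \<alpha> x i) (flip \<alpha> y i) = dist (x i) (y i)" for i
    by (auto simp: flip_def)
  then show ?thesis by (simp add: dist_fun_def)
qed

text \<open>For \<open>\<mu> \<alpha> = 0\<close> the hemisphere is the single point 1 of
  \<open>S^0\<close>, which starts the induction over cells. Components from \<open>r\<close> on are
  fixed to zero so that all products share one type.\<close>

definition cells :: "nat \<Rightarrow> (nat \<Rightarrow> nat) \<Rightarrow> (nat \<Rightarrow> nat \<Rightarrow> real) set" where
  "cells r \<mu> = {x. (\<forall>\<alpha><r. x \<alpha> \<in> sph (\<mu> \<alpha>) \<and> x \<alpha> (\<mu> \<alpha>) \<ge> 0) \<and> (\<forall>\<alpha>\<ge>r. x \<alpha> = (\<lambda>_. 0))}"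

definition spheres :: "nat \<Rightarrow> (nat \<Rightarrow> nat) \<Rightarrow> (nat \<Rightarrow> nat \<Rightarrow> real) set" where
  "spheres r n = {x. (\<forall>\<alpha><r. x \<alpha> \<in> sph (n \<alpha>)) \<and> (\<forall>\<alpha>\<ge>r. x \<alpha> = (\<lambda>_. 0))}"

lemma cells_subset_spheres: "cells r \<mu> \<subseteq> spheres r \<mu>"
  by (auto simp: cells_def spheres_def)

lemma flip_spheres: "x \<in> spheres r n \<Longrightarrow> \<alpha> < r \<Longrightarrow> flip \<alpha> x \<in> spheres r n"
  by (auto simp: spheres_def flip_def sph_minus)

lemma compact_spheres: "compact (spheres r n)"
proof -
  have "compact {x. \<forall>\<alpha>. x \<alpha> \<in> (if \<alpha> < r then sph (n \<alpha>) else {\<lambda>_. 0})}"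
    by (rule compact_Collect_coord) (auto simp: compact_sph)
  also have "{x. \<forall>\<alpha>. x \<alpha> \<in> (if \<alpha> < r then sph (n \<alpha>) else {\<lambda>_. 0})} = spheres r n"
    by (auto simp: spheres_def not_less)
  finally show ?thesis .
qed

lemma compact_cells: "compact (cells r \<mu>)"
proof -
  have "closed (\<Inter>\<alpha>\<in>{..<r}. {x::nat\<Rightarrow>nat\<Rightarrow>real. 0 \<le> x \<alpha> (\<mu> \<alpha>)})"
    by (intro closed_INT ballI closed_Collect_le continuous_on_const continuous_on_apply2)
  moreover have "cells r \<mu> = spheres r \<mu> \<inter> (\<Inter>\<alpha>\<in>{..<r}. {x. 0 \<le> x \<alpha> (\<mu> \<alpha>)})"
    by (auto simp: cells_def spheres_def)
  ultimately show ?thesis using compact_Int_closed[OF compact_spheres] by simp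
qed

definition cell_centre :: "nat \<Rightarrow> (nat \<Rightarrow> nat) \<Rightarrow> nat \<Rightarrow> nat \<Rightarrow> real" where
  "cell_centre r \<mu> = (\<lambda>\<alpha> i. if \<alpha> < r \<and> i = \<mu> \<alpha> then 1 else 0)"

text \<open>Normalised segments to the poles: for \<open>t > 0\<close> the last coordinate is
  positive, and for \<open>t = 0\<close> the vector is a unit vector, so the denominator never
  vanishes.\<close>

lemma cells_contraction:
  obtains c :: "real \<Rightarrow> (nat \<Rightarrow> nat \<Rightarrow> real) \<Rightarrow> nat \<Rightarrow> nat \<Rightarrow> real" where
    "continuous_on ({0..1} \<times> cells r \<mu>) (\<lambda>(t, x). c t x)"
    "\<And>t x. t \<in> {0..1} \<Longrightarrow> x \<in> cells r \<mu> \<Longrightarrow> c t x \<in> cells r \<mu>"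
    "\<And>x. x \<in> cells r \<mu> \<Longrightarrow> c 0 x = x" "\<And>x. x \<in> cells r \<mu> \<Longrightarrow> c 1 x = cell_centre r \<mu>"
proof -
  define l where "l = (\<lambda>t (x::nat\<Rightarrow>nat\<Rightarrow>real) \<alpha> i. (1 - t) * x \<alpha> i + t * cell_centre r \<mu> \<alpha> i)"
  define nr where "nr = (\<lambda>t x \<alpha>. sqrt (\<Sum>i\<le>\<mu> \<alpha>. (l t x \<alpha> i)\<^sup>2))"
  define c where "c = (\<lambda>t x \<alpha> i. if \<alpha> < r then l t x \<alpha> i / nr t x \<alpha> else 0)"
  have nz: "(\<Sum>i\<le>\<mu> \<alpha>. (l t x \<alpha> i)\<^sup>2) > 0" if "t \<in> {0..1}" "x \<in> cells r \<mu>" "\<alpha> < r" for t x \<alpha>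
  proof -
    have x: "x \<alpha> \<in> sph (\<mu> \<alpha>)" "x \<alpha> (\<mu> \<alpha>) \<ge> 0" using that by (auto simp: cells_def)
    have "\<exists>i\<le>\<mu> \<alpha>. l t x \<alpha> i \<noteq> 0"
    proof (cases "t = 0")
      case True
      then show ?thesis using x(1) by (auto simp: l_def sph_def intro: ccontr)
    next
      case False
      then have "l t x \<alpha> (\<mu> \<alpha>) > 0"
        using that x(2) by (auto simp: l_def cell_centre_def intro!: add_nonneg_pos)
      then show ?thesis by force
    qed
    then obtain i where "i \<le> \<mu> \<alpha>" "l t x \<alpha> i \<noteq> 0" by blast
    then have "0 < (l t x \<alpha> i)\<^sup>2" "(l t x \<alpha> i)\<^sup>2 \<le> (\<Sum>i\<le>\<mu> \<alpha>. (l t x \<alpha> i)\<^sup>2)"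
      by (auto intro!: member_le_sum)
    then show ?thesis by linarith
  qed
  have nr1: "nr 0 x \<alpha> = 1" if "x \<in> cells r \<mu>" "\<alpha> < r" for x \<alpha>
    using that by (auto simp: nr_def l_def cells_def sph_def)
  have nr2: "nr 1 x \<alpha> = 1" if "\<alpha> < r" for x \<alpha>
    using that by (simp add: nr_def l_def cell_centre_def if_distrib[where f = "\<lambda>x. x ^ 2"] cong: if_cong)
  show ?thesis
  proof (rule that[of c])
    show "continuous_on ({0..1} \<times> cells r \<mu>) (\<lambda>(t, x). c t x)"
    proof -
      have "continuous_on ({0..1} \<times> cells r \<mu>) (\<lambda>p. c (fst p) (snd p) \<alpha> i)" for \<alpha> i
      proof (cases "\<alpha> < r")
        case True
        have "continuous_on ({0..1} \<times> cells r \<mu>) (\<lambda>p. l (fst p) (snd p) \<alpha> i / nr (fst p) (snd p) \<alpha>)"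
        proof -
          have x: "continuous_on ({0..1} \<times> cells r \<mu>) (\<lambda>p. snd p \<alpha> j)" for j
            by (rule continuous_on_compose2[OF continuous_on_apply2 continuous_on_snd[OF continuous_on_id]]) auto
          have "nr (fst p) (snd p) \<alpha> \<noteq> 0" if "p \<in> {0..1} \<times> cells r \<mu>" for p
            using nz[OF _ _ True, of "fst p" "snd p"] that by (auto simp: nr_def)
          then show ?thesis
            unfolding l_def nr_def by (intro continuous_intros x) auto
        qed
        then show ?thesis using True by (simp add: c_def)
      qed (simp add: c_def)
      then have "continuous_on ({0..1} \<times> cells r \<mu>) (\<lambda>p. c (fst p) (snd p))"
        by (rule continuous_on_coordinatewise_then_product[OF continuous_on_coordinatewise_then_product])
      then show ?thesis by (simp add: case_prod_beta')
    qed
    show "c t x \<in> cells r \<mu>" if "t \<in> {0..1}" "x \<in> cells r \<mu>" for t x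
    proof -
      have "(\<Sum>i\<le>\<mu> \<alpha>. (c t x \<alpha> i)\<^sup>2) = 1" if "\<alpha> < r" for \<alpha>
        using nz[OF \<open>t \<in> {0..1}\<close> \<open>x \<in> cells r \<mu>\<close> that] that
        by (simp add: c_def nr_def power_divide flip: sum_divide_distrib)
      moreover have "c t x \<alpha> i = 0" if "\<alpha> < r" "i > \<mu> \<alpha>" for \<alpha> i
        using \<open>x \<in> cells r \<mu>\<close> that by (auto simp: c_def l_def cell_centre_def cells_def sph_def)
      moreover have "c t x \<alpha> (\<mu> \<alpha>) \<ge> 0" if "\<alpha> < r" for \<alpha>
        using \<open>x \<in> cells r \<mu>\<close> \<open>t \<in> {0..1}\<close> that
        by (auto simp: c_def nr_def l_def cell_centre_def cells_def intro!: divide_nonneg_nonneg sum_nonneg)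
      ultimately show ?thesis by (auto simp: cells_def sph_def c_def)
    qed
    show "c 0 x = x" if "x \<in> cells r \<mu>" for x
      using nr1[OF that] that by (auto simp: c_def l_def cells_def fun_eq_iff)
    show "c 1 x = cell_centre r \<mu>" if "x \<in> cells r \<mu>" for x
      using nr2 by (auto simp: c_def l_def cell_centre_def fun_eq_iff)
  qed
qed

section \<open>Chains of products of hemispheres\<close>

definition dcr :: "(nat \<Rightarrow> nat) \<Rightarrow> nat \<Rightarrow> nat \<Rightarrow> nat" where
  "dcr \<mu> \<alpha> = \<mu>(\<alpha> := \<mu> \<alpha> - 1)"

text \<open>On the boundary of a hemisphere its last coordinate vanishes, so the antipode of a
  boundary point is again in the hemisphere.\<close>

lemma cells_dcr: "\<mu> \<alpha> > 0 \<Longrightarrow> x \<in> cells r (dcr \<mu> \<alpha>) \<Longrightarrow> x \<in> cells r \<mu>"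
  and flip_cells_dcr: "\<mu> \<alpha> > 0 \<Longrightarrow> \<alpha> < r \<Longrightarrow> x \<in> cells r (dcr \<mu> \<alpha>) \<Longrightarrow> flip \<alpha> x \<in> cells r \<mu>"
proof -
  assume *: "\<mu> \<alpha> > 0" "x \<in> cells r (dcr \<mu> \<alpha>)"
  have sub: "sph (\<mu> \<alpha> - 1) \<subseteq> sph (\<mu> \<alpha>)" by (rule sph_mono) simp
  have z: "y (\<mu> \<alpha>) = 0" if "y \<in> sph (\<mu> \<alpha> - 1)" for y
    using that *(1) by (auto simp: sph_def)
  show "x \<in> cells r \<mu>"
    unfolding cells_def
  proof (intro CollectI conjI allI impI)
    fix \<beta> assume "\<beta> < r"
    then have "x \<beta> \<in> sph (dcr \<mu> \<alpha> \<beta>)" "x \<beta> (dcr \<mu> \<alpha> \<beta>) \<ge> 0" using * by (auto simp: cells_def)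
    then show "x \<beta> \<in> sph (\<mu> \<beta>)" "x \<beta> (\<mu> \<beta>) \<ge> 0"
      using sub z[of "x \<beta>"] by (auto simp: dcr_def split: if_splits)
  qed (use * in \<open>auto simp: cells_def\<close>)
  assume "\<alpha> < r"
  then have "x \<alpha> \<in> sph (\<mu> \<alpha> - 1)" using * by (auto simp: cells_def dcr_def)
  then have "x \<alpha> (\<mu> \<alpha>) = 0" by (rule z)
  then show "flip \<alpha> x \<in> cells r \<mu>"
    using \<open>x \<in> cells r \<mu>\<close> \<open>\<alpha> < r\<close> by (auto simp: cells_def flip_def sph_minus)
qed

definition deg :: "nat \<Rightarrow> (nat \<Rightarrow> nat) \<Rightarrow> nat" where
  "deg r \<mu> = (\<Sum>\<alpha><r. \<mu> \<alpha>)"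

definition bdlist :: "nat \<Rightarrow> ((nat \<Rightarrow> nat) \<Rightarrow> (nat \<Rightarrow> nat \<Rightarrow> nat \<Rightarrow> real) list) \<Rightarrow> (nat \<Rightarrow> nat) \<Rightarrow>
    (nat \<Rightarrow> nat \<Rightarrow> nat \<Rightarrow> real) list" where
  "bdlist r E \<mu> = concat (map (\<lambda>\<alpha>. if \<mu> \<alpha> > 0
      then E (dcr \<mu> \<alpha>) @ map (\<lambda>s i. flip \<alpha> (s i)) (E (dcr \<mu> \<alpha>)) else []) [0..<r])"

text \<open>
  The boundary of the hemisphere of \<open>S^n\<close> is \<open>S^(n-1)\<close>, which consists
  of a hemisphere and its antipodal image. This gives the summands of \<open>bdlist\<close>, by
  the Leibniz rule mod 2.
\<close>

definition hemisphere_chains :: "nat \<Rightarrow> nat \<Rightarrow> real \<Rightarrow> ((nat \<Rightarrow> nat) \<Rightarrow> (nat \<Rightarrow> nat \<Rightarrow> nat \<Rightarrow> real) list) \<Rightarrow> bool" where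
  "hemisphere_chains r N \<eta> E \<longleftrightarrow>
     (\<forall>\<mu>. (\<forall>\<alpha>\<ge>r. \<mu> \<alpha> = 0) \<and> deg r \<mu> \<le> N \<longrightarrow>
        fine_chain (cells r \<mu>) \<eta> (deg r \<mu>) (E \<mu>) \<and>
        (deg r \<mu> = 0 \<longrightarrow> length (E \<mu>) = 1) \<and>
        (\<forall>n. deg r \<mu> = Suc n \<longrightarrow> bounds n (E \<mu>) (bdlist r E \<mu>)))"

lemma deg_dcr: "\<alpha> < r \<Longrightarrow> \<mu> \<alpha> > 0 \<Longrightarrow> Suc (deg r (dcr \<mu> \<alpha>)) = deg r \<mu>"
proof -
  assume a: "\<alpha> < r" "\<mu> \<alpha> > 0"
  have "deg r \<nu> = \<nu> \<alpha> + (\<Sum>\<beta>\<in>{..<r} - {\<alpha>}. \<nu> \<beta>)" for \<nu>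
    unfolding deg_def using a by (intro sum.remove) auto
  then show ?thesis using a by (simp add: dcr_def)
qed

lemma ev_bdlist:
  "ev \<phi> (bdlist r E \<mu>) = (\<Sum>\<alpha><r. if \<mu> \<alpha> > 0
      then ev \<phi> (E (dcr \<mu> \<alpha>)) + ev (\<lambda>s. \<phi> (\<lambda>i. flip \<alpha> (s i))) (E (dcr \<mu> \<alpha>)) else 0)"
proof -
  have "ev \<phi> (concat (map g [0..<r])) = (\<Sum>\<alpha><r. ev \<phi> (g \<alpha>))" for g
    unfolding ev_concat by (simp add: comp_def interv_sum_list_conv_sum_set_nat atLeast0LessThan)
  then show ?thesis
    unfolding bdlist_def by (auto intro!: sum.cong simp: ev_map)
qed

lemma sum_symmetric_bit:
  fixes t :: "nat \<Rightarrow> nat \<Rightarrow> bit"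
  assumes "\<And>i j. t i j = t j i" "\<And>i. t i i = 0"
  shows "(\<Sum>i<r. \<Sum>j<r. t i j) = 0"
proof (induction r)
  case (Suc r)
  have "(\<Sum>i<r. t i r) = (\<Sum>j<r. t r j)" using assms(1) by (intro sum.cong) auto
  then show ?case using Suc by (simp add: sum.distrib assms(2))
qed simp

lemma cobd_comp: "cobd p \<phi> (\<lambda>i. h (s i)) = cobd p (\<lambda>s. \<phi> (\<lambda>i. h (s i))) s"
proof -
  have "face j (\<lambda>i. h (s i)) = (\<lambda>i. h (face j s i))" for j
    by (auto simp: face_def fun_eq_iff)
  then show ?thesis by (simp add: cobd_def)
qed

lemma cochain_comp: "cochain p \<phi> \<Longrightarrow> cochain p (\<lambda>s. \<phi> (\<lambda>i. h (s i)))"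
  unfolding cochain_def by auto

text \<open>Taking the boundary twice gives one contribution per pair
  \<open>(\<alpha>, \<beta>)\<close>. The contributions are symmetric, and on the diagonal the four
  summands cancel in pairs since \<open>flip\<close> is an involution.\<close>

lemma bdlist_closed:
  assumes E: "hemisphere_chains r (Suc m) \<eta> E" and \<mu>: "\<And>\<alpha>. \<alpha> \<ge> r \<Longrightarrow> \<mu> \<alpha> = 0" "deg r \<mu> = Suc (Suc m)"
    and \<psi>: "cochain m \<psi>"
  shows "ev (cobd (Suc m) \<psi>) (bdlist r E \<mu>) = 0"
proof -
  define h where "h = (\<lambda>\<alpha> s (i::nat). flip \<alpha> (s i))"
  define t where "t = (\<lambda>\<alpha> \<beta>. if \<mu> \<alpha> > 0 \<and> dcr \<mu> \<alpha> \<beta> > 0 then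
     ev (\<lambda>s. (\<psi> s + \<psi> (h \<beta> s)) + (\<psi> (h \<alpha> s) + \<psi> (h \<alpha> (h \<beta> s)))) (E (dcr (dcr \<mu> \<alpha>) \<beta>)) else 0)"
  have bd: "ev (cobd (Suc m) \<phi>) (E (dcr \<mu> \<alpha>)) = ev \<phi> (bdlist r E (dcr \<mu> \<alpha>))"
    if "\<alpha> < r" "\<mu> \<alpha> > 0" "cochain m \<phi>" for \<phi> \<alpha>
  proof -
    have "deg r (dcr \<mu> \<alpha>) = Suc m" using deg_dcr[of \<alpha> r \<mu>] that \<mu>(2) by simp
    moreover have "\<forall>\<beta>\<ge>r. dcr \<mu> \<alpha> \<beta> = 0" using \<mu>(1) that by (auto simp: dcr_def)
    ultimately have "bounds m (E (dcr \<mu> \<alpha>)) (bdlist r E (dcr \<mu> \<alpha>))"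
      using E unfolding hemisphere_chains_def by simp
    then show ?thesis using that(3) by (simp add: bounds_def)
  qed
  have "ev (cobd (Suc m) \<psi>) (bdlist r E \<mu>) = (\<Sum>\<alpha><r. \<Sum>\<beta><r. t \<alpha> \<beta>)"
    unfolding ev_bdlist[of "cobd (Suc m) \<psi>"]
  proof (rule sum.cong[OF refl])
    fix \<alpha> assume "\<alpha> \<in> {..<r}"
    then have \<alpha>: "\<alpha> < r" by simp
    show "(if \<mu> \<alpha> > 0 then ev (cobd (Suc m) \<psi>) (E (dcr \<mu> \<alpha>)) +
        ev (\<lambda>s. cobd (Suc m) \<psi> (\<lambda>i. flip \<alpha> (s i))) (E (dcr \<mu> \<alpha>)) else 0) = (\<Sum>\<beta><r. t \<alpha> \<beta>)"
    proof (cases "\<mu> \<alpha> > 0")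
      case True
      have "ev (cobd (Suc m) \<psi>) (E (dcr \<mu> \<alpha>)) +
        ev (\<lambda>s. cobd (Suc m) \<psi> (\<lambda>i. flip \<alpha> (s i))) (E (dcr \<mu> \<alpha>)) =
        ev \<psi> (bdlist r E (dcr \<mu> \<alpha>)) + ev (\<lambda>s. \<psi> (h \<alpha> s)) (bdlist r E (dcr \<mu> \<alpha>))"
        unfolding cobd_comp using bd[OF \<alpha> True \<psi>] bd[OF \<alpha> True cochain_comp[OF \<psi>]]
        by (simp add: h_def)
      also have "\<dots> = (\<Sum>\<beta><r. t \<alpha> \<beta>)"
        unfolding ev_bdlist sum.distrib[symmetric]
        using True by (intro sum.cong) (auto simp: t_def h_def ev_add)
      finally show ?thesis using True by simp
    qed (simp add: t_def)
  qed
  also have "\<dots> = 0"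
  proof (rule sum_symmetric_bit)
    have hh: "h \<alpha> (h \<alpha> s) = s" for \<alpha> s by (simp add: h_def)
    have hc: "h \<alpha> (h \<beta> s) = h \<beta> (h \<alpha> s)" for \<alpha> \<beta> s by (simp add: h_def flip_commute)
    show "t i i = 0" for i
      by (cases "\<mu> i > 0 \<and> dcr \<mu> i i > 0") (simp_all add: t_def hh ac_simps ev_def)
    have dc: "dcr (dcr \<mu> i) j = dcr (dcr \<mu> j) i" for i j by (auto simp: dcr_def fun_eq_iff)
    have cond: "\<mu> i > 0 \<and> dcr \<mu> i j > 0 \<longleftrightarrow> \<mu> j > 0 \<and> dcr \<mu> j i > 0" for i j
      by (auto simp: dcr_def)
    show "t i j = t j i" for i j
      unfolding t_def cond[of i j] dc[of i j] hc[of i j] by (simp add: ac_simps)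
  qed
  finally show ?thesis .
qed

text \<open>Induction on the degree. The chains of degree at most \<open>N\<close> must be so fine
  that their boundary lists can be filled by chains of fineness \<open>\<eta>\<close>. Only finitely
  many multi-indices have the new degree, so one fineness \<open>\<eta>'\<close> serves all of
  them.\<close>

lemma hemisphere_chains_exist:
  assumes "\<eta> > 0"
  shows "\<exists>E. hemisphere_chains r N \<eta> E"
  using assms
proof (induction N arbitrary: \<eta>)
  case 0
  define E where "E = (\<lambda>\<mu>::nat\<Rightarrow>nat. [\<lambda>i::nat. cell_centre r (\<lambda>_. 0)])"
  have "cell_centre r (\<lambda>_. 0) \<in> cells r \<mu>" if "\<mu> = (\<lambda>_. 0)" for \<mu>
    using that by (auto simp: cells_def cell_centre_def sph_def)
  moreover have "\<mu> = (\<lambda>_. 0)" if "\<forall>\<alpha>\<ge>r. \<mu> \<alpha> = 0" "deg r \<mu> = 0" for \<mu>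
  proof
    show "\<mu> \<alpha> = 0" for \<alpha>
      by (cases "\<alpha> < r") (use that in \<open>auto simp: deg_def\<close>)
  qed
  ultimately have "hemisphere_chains r 0 \<eta> E"
    unfolding hemisphere_chains_def fine_chain_def using 0 by (auto simp: E_def)
  then show ?case by blast
next
  case (Suc N)
  define I where "I = {\<mu>::nat\<Rightarrow>nat. (\<forall>\<alpha>\<ge>r. \<mu> \<alpha> = 0) \<and> deg r \<mu> = Suc N}"
  have "finite I"
  proof (rule finite_subset)
    show "I \<subseteq> {f. \<forall>x. (x \<in> {..<r} \<longrightarrow> f x \<in> {..Suc N}) \<and> (x \<notin> {..<r} \<longrightarrow> f x = 0)}"
    proof
      fix \<mu> assume "\<mu> \<in> I"
      moreover have "\<mu> x \<le> deg r \<mu>" if "x < r" for x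
        unfolding deg_def using that by (intro member_le_sum) auto
      ultimately show "\<mu> \<in> {f. \<forall>x. (x \<in> {..<r} \<longrightarrow> f x \<in> {..Suc N}) \<and> (x \<notin> {..<r} \<longrightarrow> f x = 0)}"
        by (auto simp: I_def)
    qed
    show "finite {f. \<forall>x. (x \<in> {..<r} \<longrightarrow> f x \<in> {..Suc N}) \<and> (x \<notin> {..<r} \<longrightarrow> f x = (0::nat))}"
      by (rule finite_set_of_finite_funs) auto
  qed
  have "\<exists>\<eta>'>0. \<forall>n w. fine_chain (cells r \<mu>) \<eta>' n w \<longrightarrow> even (length w) \<longrightarrow>
       (\<forall>m \<psi>. n = Suc m \<longrightarrow> cochain m \<psi> \<longrightarrow> ev (cobd n \<psi>) w = 0) \<longrightarrow>
       (\<exists>z. fine_chain (cells r \<mu>) \<eta> (Suc n) z \<and> bounds n z w)" for \<mu>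
  proof -
    obtain c :: "real \<Rightarrow> (nat \<Rightarrow> nat \<Rightarrow> real) \<Rightarrow> nat \<Rightarrow> nat \<Rightarrow> real" where
      c: "continuous_on ({0..1} \<times> cells r \<mu>) (\<lambda>(t, x). c t x)"
      "\<And>t x. t \<in> {0..1} \<Longrightarrow> x \<in> cells r \<mu> \<Longrightarrow> c t x \<in> cells r \<mu>"
      "\<And>x. x \<in> cells r \<mu> \<Longrightarrow> c 0 x = x" "\<And>x. x \<in> cells r \<mu> \<Longrightarrow> c 1 x = cell_centre r \<mu>"
      using cells_contraction by blast
    from fill_contractible[OF compact_cells c \<open>\<eta> > 0\<close>] show ?thesis by metis
  qed
  then obtain h where h: "\<And>\<mu>. h \<mu> > (0::real)"
    "\<And>\<mu> n w. fine_chain (cells r \<mu>) (h \<mu>) n w \<Longrightarrow> even (length w) \<Longrightarrow>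
       (\<forall>m \<psi>. n = Suc m \<longrightarrow> cochain m \<psi> \<longrightarrow> ev (cobd n \<psi>) w = 0) \<Longrightarrow>
       \<exists>z. fine_chain (cells r \<mu>) \<eta> (Suc n) z \<and> bounds n z w"
    by metis
  define \<eta>' where "\<eta>' = Min (insert \<eta> (h ` I))"
  have \<eta>': "\<eta>' > 0" "\<eta>' \<le> \<eta>" "\<And>\<mu>. \<mu> \<in> I \<Longrightarrow> \<eta>' \<le> h \<mu>"
    using \<open>finite I\<close> h(1) Suc.prems by (auto simp: \<eta>'_def)
  obtain E where E: "hemisphere_chains r N \<eta>' E" using Suc.IH[OF \<eta>'(1)] by blast
  have "\<exists>z. fine_chain (cells r \<mu>) \<eta> (Suc N) z \<and> bounds N z (bdlist r E \<mu>)" if "\<mu> \<in> I" for \<mu>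
  proof (rule h(2))
    have \<mu>: "\<And>\<alpha>. \<alpha> \<ge> r \<Longrightarrow> \<mu> \<alpha> = 0" "deg r \<mu> = Suc N" using that by (auto simp: I_def)
    have fc: "fine_chain (cells r (dcr \<mu> \<alpha>)) \<eta>' N (E (dcr \<mu> \<alpha>))" if "\<alpha> < r" "\<mu> \<alpha> > 0" for \<alpha>
    proof -
      have "deg r (dcr \<mu> \<alpha>) = N" using deg_dcr[of \<alpha> r \<mu>] that \<mu>(2) by simp
      moreover have "\<forall>\<beta>\<ge>r. dcr \<mu> \<alpha> \<beta> = 0" using \<mu>(1) that by (auto simp: dcr_def)
      ultimately show ?thesis using E unfolding hemisphere_chains_def by blast
    qed
    show "fine_chain (cells r \<mu>) (h \<mu>) N (bdlist r E \<mu>)"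
      unfolding fine_chain_def
    proof (intro ballI)
      fix s assume "s \<in> set (bdlist r E \<mu>)"
      then obtain \<alpha> s' where a: "\<alpha> < r" "\<mu> \<alpha> > 0" "s' \<in> set (E (dcr \<mu> \<alpha>))"
          "s = s' \<or> s = (\<lambda>i. flip \<alpha> (s' i))"
        by (auto simp: bdlist_def split: if_splits)
      have s': "\<And>i. s' i \<in> cells r (dcr \<mu> \<alpha>)" "\<And>i j. i \<le> N \<Longrightarrow> j \<le> N \<Longrightarrow> dist (s' i) (s' j) < \<eta>'"
        using fc[OF a(1,2)] a(3) by (auto simp: fine_chain_def)
      have "s i \<in> cells r \<mu>" for i
        using a s'(1) cells_dcr[of \<mu> \<alpha> _ r] flip_cells_dcr[of \<mu> \<alpha> r] by auto
      moreover have "dist (s i) (s j) < h \<mu>" if "i \<le> N" "j \<le> N" for i j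
        using a(4) s'(2)[OF that] \<eta>'(3)[OF \<open>\<mu> \<in> I\<close>] by (auto simp: dist_flip)
      ultimately show "(\<forall>i. s i \<in> cells r \<mu>) \<and> (\<forall>i\<le>N. \<forall>j\<le>N. dist (s i) (s j) < h \<mu>)" by blast
    qed
    \<comment> \<open>Every simplex of a boundary list comes together with its antipodal
      image.\<close>
    have "even (length (concat (map (\<lambda>\<alpha>. if P \<alpha> then g \<alpha> @ map (f \<alpha>) (g \<alpha>) else []) xs)))"
      for P and g :: "nat \<Rightarrow> 'z list" and f xs
      by (induction xs) auto
    then show "even (length (bdlist r E \<mu>))" unfolding bdlist_def .
    show "\<forall>m \<psi>. N = Suc m \<longrightarrow> cochain m \<psi> \<longrightarrow> ev (cobd N \<psi>) (bdlist r E \<mu>) = 0"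
    proof (intro allI impI)
      fix m and \<psi> :: "(nat \<Rightarrow> nat \<Rightarrow> nat \<Rightarrow> real) \<Rightarrow> bit" assume m: "N = Suc m" "cochain m \<psi>"
      show "ev (cobd N \<psi>) (bdlist r E \<mu>) = 0"
        unfolding m(1) by (rule bdlist_closed) (use E \<mu> m in auto)
    qed
  qed
  then obtain F where F: "\<And>\<mu>. \<mu> \<in> I \<Longrightarrow> fine_chain (cells r \<mu>) \<eta> (Suc N) (F \<mu>) \<and> bounds N (F \<mu>) (bdlist r E \<mu>)"
    by metis
  define E' where "E' = (\<lambda>\<mu>. if \<mu> \<in> I then F \<mu> else E \<mu>)"
  \<comment> \<open>A boundary list refers to chains of one degree less, on which \<open>E\<close>
    and \<open>E'\<close> agree.\<close>
  have bd: "bdlist r E' \<mu> = bdlist r E \<mu>" if "deg r \<mu> \<le> Suc N" for \<mu>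
  proof -
    have "dcr \<mu> \<alpha> \<notin> I" if "\<alpha> < r" "\<mu> \<alpha> > 0" for \<alpha>
      using deg_dcr[of \<alpha> r \<mu>] that \<open>deg r \<mu> \<le> Suc N\<close> by (auto simp: I_def)
    then show ?thesis unfolding bdlist_def E'_def by (intro arg_cong[where f = concat] map_cong) auto
  qed
  have "hemisphere_chains r (Suc N) \<eta> E'"
    unfolding hemisphere_chains_def
  proof (intro allI impI)
    fix \<mu> assume \<mu>: "(\<forall>\<alpha>\<ge>r. \<mu> \<alpha> = 0) \<and> deg r \<mu> \<le> Suc N"
    show "fine_chain (cells r \<mu>) \<eta> (deg r \<mu>) (E' \<mu>) \<and> (deg r \<mu> = 0 \<longrightarrow> length (E' \<mu>) = 1) \<and>
        (\<forall>n. deg r \<mu> = Suc n \<longrightarrow> bounds n (E' \<mu>) (bdlist r E' \<mu>))"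
    proof (cases "\<mu> \<in> I")
      case True
      then have "E' \<mu> = F \<mu>" "deg r \<mu> = Suc N" by (simp_all add: E'_def I_def)
      then show ?thesis using F[OF True] bd[of \<mu>] by simp
    next
      case False
      then have "deg r \<mu> \<le> N" using \<mu> by (auto simp: I_def)
      then have "fine_chain (cells r \<mu>) \<eta>' (deg r \<mu>) (E \<mu>) \<and> (deg r \<mu> = 0 \<longrightarrow> length (E \<mu>) = 1) \<and>
        (\<forall>n. deg r \<mu> = Suc n \<longrightarrow> bounds n (E \<mu>) (bdlist r E \<mu>))"
        using E \<mu> unfolding hemisphere_chains_def by blast
      moreover have "fine_chain (cells r \<mu>) \<eta>' (deg r \<mu>) (E \<mu>) \<Longrightarrow> fine_chain (cells r \<mu>) \<eta> (deg r \<mu>) (E \<mu>)"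
        using \<eta>'(2) unfolding fine_chain_def by force
      ultimately show ?thesis using False \<mu> bd[of \<mu>] by (simp add: E'_def)
    qed
  qed
  then show ?case by blast
qed

section \<open>Products of sign changes\<close>

definition odd_fun :: "((nat \<Rightarrow> real) \<Rightarrow> bit) \<Rightarrow> bool" where
  "odd_fun \<epsilon> \<longleftrightarrow> (\<forall>a. a \<noteq> (\<lambda>_. 0) \<longrightarrow> \<epsilon> (\<lambda>i. - a i) = \<epsilon> a + 1)"

text \<open>Each letter is the coboundary of a vertex function on spheres. As
  \<open>\<epsilon>\<close> is odd, the letter is invariant under antipodes and represents the
  degree one class of the projective space of the factor \<open>\<alpha>\<close>. A word is a cup
  product of such classes.\<close>

fun word :: "(nat \<times> ((nat \<Rightarrow> real) \<Rightarrow> bit)) list \<Rightarrow> (nat \<Rightarrow> nat \<Rightarrow> nat \<Rightarrow> real) \<Rightarrow> bit" where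
  "word [] = (\<lambda>s. 1)"
| "word ((\<alpha>, \<epsilon>) # ws) = cup 1 (\<lambda>s. \<epsilon> (s 0 \<alpha>) + \<epsilon> (s 1 \<alpha>)) (word ws)"

lemma cochain_word: "cochain (length ws) (word ws)"
proof (induction ws rule: word.induct)
  case (2 \<alpha> \<epsilon> ws)
  have "cochain 1 (\<lambda>s. \<epsilon> (s 0 \<alpha>) + \<epsilon> (s 1 \<alpha>))" by (auto simp: cochain_def)
  from cochain_cup[OF this 2] show ?case by simp
qed (simp add: cochain_def)

lemma word_eq_cobd:
  assumes "\<And>s. cobd (Suc (length ws)) (word ws) s = 0"
  shows "word ((\<alpha>, \<epsilon>) # ws) = cobd (Suc (length ws)) (cup 0 (\<lambda>s. \<epsilon> (s 0 \<alpha>)) (word ws))"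
proof
  fix s
  have "cochain 0 (\<lambda>s. \<epsilon> (s 0 \<alpha>))" by (auto simp: cochain_def)
  note cobd_cup[OF this, of "length ws" "word ws" s]
  moreover have "cobd (Suc 0) (\<lambda>s. \<epsilon> (s 0 \<alpha>)) = (\<lambda>s. \<epsilon> (s 0 \<alpha>) + \<epsilon> (s 1 \<alpha>))"
    by (simp add: cobd_def face_def fun_eq_iff add.commute)
  moreover have "cobd (Suc (length ws)) (word ws) = (\<lambda>s. 0)"
    using assms by (simp add: fun_eq_iff)
  ultimately show "word ((\<alpha>, \<epsilon>) # ws) s = cobd (Suc (length ws)) (cup 0 (\<lambda>s. \<epsilon> (s 0 \<alpha>)) (word ws)) s"
    by (simp add: cup_def)
qed

lemma cobd_word: "cobd (Suc (length ws)) (word ws) s = 0"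
proof (induction ws arbitrary: s)
  case Nil
  then show ?case by (simp add: cobd_def)
next
  case (Cons w ws)
  obtain \<alpha> \<epsilon> where w: "w = (\<alpha>, \<epsilon>)" by (cases w)
  show ?case unfolding w word_eq_cobd[OF Cons.IH] by (simp only: length_Cons cobd_cobd)
qed

lemma odd_fun_edge_flip:
  assumes "odd_fun \<epsilon>" "x \<in> spheres r n" "y \<in> spheres r n" "\<alpha> < r"
  shows "\<epsilon> (flip \<beta> x \<alpha>) + \<epsilon> (flip \<beta> y \<alpha>) = \<epsilon> (x \<alpha>) + \<epsilon> (y \<alpha>)"
proof -
  have "x \<alpha> \<noteq> (\<lambda>_. 0)" "y \<alpha> \<noteq> (\<lambda>_. 0)" using assms sph_nonzero by (auto simp: spheres_def)
  then show ?thesis using assms(1) by (auto simp: flip_apply odd_fun_def ac_simps)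
qed

lemma word_flip:
  assumes "\<And>i. s i \<in> spheres r n" "\<And>\<alpha> \<epsilon>. (\<alpha>, \<epsilon>) \<in> set ws \<Longrightarrow> \<alpha> < r \<and> odd_fun \<epsilon>"
  shows "word ws (\<lambda>i. flip \<beta> (s i)) = word ws s"
  using assms
proof (induction ws arbitrary: s rule: word.induct)
  case (2 \<alpha> \<epsilon> ws)
  have "\<alpha> < r" "odd_fun \<epsilon>" using "2.prems"(2) by auto
  then show ?case
    using "2.IH"[of "\<lambda>i. s (i + 1)", OF "2.prems"(1)] "2.prems" odd_fun_edge_flip[of \<epsilon> "s 0" r n "s 1" \<alpha> \<beta>]
    by (auto simp: cup_def)
qed simp

text \<open>Stokes' theorem removes one letter at a time. The word is the coboundary of
  \<open>v\<close>, its first vertex function times the rest. In a boundary direction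
  \<open>\<beta>\<close> other than \<open>\<alpha>\<close> the cochain \<open>v\<close> takes the
  same value on a simplex and its antipode, so the two cancel. In direction \<open>\<alpha>\<close>
  the values differ by the remaining word, to which the induction hypothesis applies.\<close>

theorem ev_word_hemisphere_chain:
  assumes "hemisphere_chains r N \<eta> E"
  shows "(\<And>\<alpha>. \<mu> \<alpha> = length (filter (\<lambda>w. fst w = \<alpha>) ws)) \<Longrightarrow>
    (\<And>\<alpha> \<epsilon>. (\<alpha>, \<epsilon>) \<in> set ws \<Longrightarrow> \<alpha> < r \<and> odd_fun \<epsilon>) \<Longrightarrow> length ws \<le> N \<Longrightarrow>
    deg r \<mu> = length ws \<and> ev (word ws) (E \<mu>) = 1"
proof (induction ws arbitrary: \<mu>)
  case Nil
  then have "deg r \<mu> = 0" by (simp add: deg_def)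
  then have "length (E \<mu>) = 1" using assms Nil unfolding hemisphere_chains_def by auto
  then obtain s where "E \<mu> = [s]" by (metis length_0_conv length_Suc_conv One_nat_def)
  then show ?case using \<open>deg r \<mu> = 0\<close> by simp
next
  case (Cons w ws)
  obtain \<alpha> \<epsilon> where w: "w = (\<alpha>, \<epsilon>)" by (cases w)
  have \<alpha>: "\<alpha> < r" "odd_fun \<epsilon>" and ws: "\<And>\<alpha> \<epsilon>. (\<alpha>, \<epsilon>) \<in> set ws \<Longrightarrow> \<alpha> < r \<and> odd_fun \<epsilon>"
    using Cons.prems(2) w by auto
  have \<mu>\<alpha>: "\<mu> \<alpha> > 0" using Cons.prems(1)[of \<alpha>] w by simp
  have dc: "dcr \<mu> \<alpha> \<beta> = length (filter (\<lambda>w. fst w = \<beta>) ws)" for \<beta>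
    using Cons.prems(1)[of \<beta>] w by (auto simp: dcr_def)
  have IH: "deg r (dcr \<mu> \<alpha>) = length ws" "ev (word ws) (E (dcr \<mu> \<alpha>)) = 1"
    using Cons.IH[of "dcr \<mu> \<alpha>", OF dc ws] Cons.prems(3) by auto
  have deg: "deg r \<mu> = Suc (length ws)" using deg_dcr[of \<alpha> r \<mu>] \<alpha> \<mu>\<alpha> IH by simp
  have \<mu>r: "\<mu> \<beta> = 0" if "\<beta> \<ge> r" for \<beta>
  proof -
    have "fst x \<noteq> \<beta>" if "x \<in> set (w # ws)" for x
      using Cons.prems(2)[of "fst x" "snd x"] that \<open>\<beta> \<ge> r\<close> by auto
    then have "filter (\<lambda>w. fst w = \<beta>) (w # ws) = []" by (simp add: filter_empty_conv del: filter.simps)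
    then show ?thesis using Cons.prems(1)[of \<beta>] by simp
  qed
  define v where "v = cup 0 (\<lambda>s. \<epsilon> (s 0 \<alpha>)) (word ws)"
  have cv: "cochain (length ws) v"
    using cochain_cup[of 0 "\<lambda>s. \<epsilon> (s 0 \<alpha>)", OF _ cochain_word[of ws]] by (simp add: v_def cochain_def)
  have "bounds (length ws) (E \<mu>) (bdlist r E \<mu>)"
    using assms \<mu>r deg Cons.prems(3) unfolding hemisphere_chains_def by simp
  then have "ev (word (w # ws)) (E \<mu>) = ev v (bdlist r E \<mu>)"
    unfolding w word_eq_cobd[OF cobd_word] v_def[symmetric] bounds_def using cv by blast
  also have "\<dots> = (\<Sum>\<beta><r. if \<beta> = \<alpha> then ev (word ws) (E (dcr \<mu> \<alpha>)) else 0)"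
    unfolding ev_bdlist
  proof (rule sum.cong[OF refl])
    fix \<beta> assume "\<beta> \<in> {..<r}"
    then have \<beta>: "\<beta> < r" by simp
    have pts: "s i \<in> spheres r (dcr \<mu> \<beta>)" if "s \<in> set (E (dcr \<mu> \<beta>))" "\<mu> \<beta> > 0" for s i
    proof -
      have "deg r (dcr \<mu> \<beta>) \<le> N" using deg_dcr[of \<beta> r \<mu>] \<beta> that(2) deg Cons.prems(3) by simp
      moreover have "\<forall>\<gamma>\<ge>r. dcr \<mu> \<beta> \<gamma> = 0" using \<mu>r by (auto simp: dcr_def)
      ultimately have "fine_chain (cells r (dcr \<mu> \<beta>)) \<eta> (deg r (dcr \<mu> \<beta>)) (E (dcr \<mu> \<beta>))"
        using assms unfolding hemisphere_chains_def by blast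
      then show ?thesis using that cells_subset_spheres by (fastforce simp: fine_chain_def)
    qed
    have "v s + v (\<lambda>i. flip \<beta> (s i)) = (if \<beta> = \<alpha> then word ws s else 0)"
      if "s \<in> set (E (dcr \<mu> \<beta>))" "\<mu> \<beta> > 0" for s
    proof -
      have "word ws (\<lambda>i. flip \<beta> (s i)) = word ws s" 
        by (rule word_flip[of s r "dcr \<mu> \<beta>", OF pts[OF that] ws])
      moreover have "s 0 \<alpha> \<noteq> (\<lambda>_. 0)" using pts[OF that, of 0] \<alpha> sph_nonzero[of "s 0 \<alpha>"] by (auto simp: spheres_def)
      then have "\<epsilon> (flip \<beta> (s 0) \<alpha>) = (if \<beta> = \<alpha> then \<epsilon> (s 0 \<alpha>) + 1 else \<epsilon> (s 0 \<alpha>))"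
        using \<alpha> by (auto simp: flip_apply odd_fun_def)
      ultimately show ?thesis by (auto simp: v_def cup_def distrib_right)
    qed
    then have "ev v (E (dcr \<mu> \<beta>)) + ev (\<lambda>s. v (\<lambda>i. flip \<beta> (s i))) (E (dcr \<mu> \<beta>)) =
       ev (\<lambda>s. if \<beta> = \<alpha> then word ws s else 0) (E (dcr \<mu> \<beta>))" if "\<mu> \<beta> > 0"
      unfolding ev_add[symmetric] using that by (intro ev_cong) auto
    moreover have "ev (\<lambda>s. 0) z = 0" for z :: "(nat \<Rightarrow> nat \<Rightarrow> nat \<Rightarrow> real) list" by (simp add: ev_def)
    ultimately show "(if 0 < \<mu> \<beta> then ev v (E (dcr \<mu> \<beta>)) + ev (\<lambda>s. v (\<lambda>i. flip \<beta> (s i))) (E (dcr \<mu> \<beta>)) else 0) =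
        (if \<beta> = \<alpha> then ev (word ws) (E (dcr \<mu> \<alpha>)) else 0)"
      using \<mu>\<alpha> by (cases "\<beta> = \<alpha>") auto
  qed
  also have "\<dots> = 1" using \<alpha> IH by simp
  finally show ?case using deg by simp
qed

section \<open>A lower bound for topological complexity\<close>

text \<open>In contrast to \<open>fine_chain\<close> only the entries up to \<open>n\<close> are
  constrained.\<close>

definition small_tuple :: "'a::metric_space set \<Rightarrow> real \<Rightarrow> nat \<Rightarrow> (nat \<Rightarrow> 'a) \<Rightarrow> bool" where
  "small_tuple T \<eta> n s \<longleftrightarrow> (\<forall>i\<le>n. s i \<in> T \<and> (\<forall>j\<le>n. dist (s i) (s j) < \<eta>))"

lemma small_tuple_initial: "small_tuple T \<eta> n s \<Longrightarrow> m \<le> n \<Longrightarrow> small_tuple T \<eta> m s"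
  by (auto simp: small_tuple_def)

lemma small_tuple_final: "small_tuple T \<eta> n s \<Longrightarrow> m + p \<le> n \<Longrightarrow> small_tuple T \<eta> m (\<lambda>i. s (i + p))"
  by (auto simp: small_tuple_def)

type_synonym 'a coch = "(nat \<Rightarrow> 'a) \<Rightarrow> bit"

fun cups :: "(nat \<times> 'a coch) list \<Rightarrow> 'a coch" where
  "cups [] = (\<lambda>s. 1)"
| "cups ((p, \<phi>) # ws) = cup p \<phi> (cups ws)"

text \<open>A triple consists of a degree, a cocycle and a cochain of one degree less, whose
  coboundary is meant to agree with the cocycle over the set of the cover that is assigned to
  it.\<close>

abbreviation corrected :: "(nat \<times> 'a coch \<times> 'a coch) list \<Rightarrow> (nat \<times> 'a coch) list" where
  "corrected ws \<equiv> map (\<lambda>(p, \<phi>, a). (p, \<lambda>s. \<phi> s + cobd p a s)) ws"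

abbreviation uncorrected :: "(nat \<times> 'a coch \<times> 'a coch) list \<Rightarrow> (nat \<times> 'a coch) list" where
  "uncorrected ws \<equiv> map (\<lambda>(p, \<phi>, a). (p, \<phi>)) ws"

text \<open>
  Telescoping: the product of the cocycles \<open>\<phi>\<close> and the product of the
  cohomologous cocycles \<open>\<phi> + \<delta> a\<close> differ by the coboundary of this
  cochain.
\<close>

fun primitive :: "(nat \<times> 'a coch \<times> 'a coch) list \<Rightarrow> 'a coch" where
  "primitive [] = (\<lambda>s. 0)"
| "primitive ((p, \<phi>, a) # ws) =
     (\<lambda>s. cup p \<phi> (primitive ws) s + cup (p - 1) a (cups (corrected ws)) s)"

definition cocycle_data :: "'a::metric_space set \<Rightarrow> real \<Rightarrow> (nat \<times> 'a coch \<times> 'a coch) list \<Rightarrow> bool" where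
  "cocycle_data T \<eta> ws \<longleftrightarrow> (\<forall>(p, \<phi>, a) \<in> set ws. p > 0 \<and> cochain p \<phi> \<and> cochain (p - 1) a \<and>
     (\<forall>s. small_tuple T \<eta> (Suc p) s \<longrightarrow> cobd (Suc p) \<phi> s = 0))"

abbreviation total :: "(nat \<times> 'b) list \<Rightarrow> nat" where
  "total ws \<equiv> sum_list (map fst ws)"

lemma cochain_cups: "(\<And>p \<phi>. (p, \<phi>) \<in> set ws \<Longrightarrow> cochain p \<phi>) \<Longrightarrow> cochain (total ws) (cups ws)"
proof (induction ws rule: cups.induct)
  case (2 p \<phi> ws)
  then show ?case using cochain_cup[of p \<phi> "total ws" "cups ws"] by auto
qed (simp add: cochain_def)

lemma cochain_corrected:
  assumes "cocycle_data T \<eta> ws" "(p, \<phi>) \<in> set (corrected ws)"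
  shows "cochain p \<phi>"
proof -
  obtain \<psi> a where *: "(p, \<psi>, a) \<in> set ws" "\<phi> = (\<lambda>s. \<psi> s + cobd p a s)" using assms(2) by auto
  then have "p > 0" "cochain p \<psi>" "cochain (p - 1) a" using assms(1) by (auto simp: cocycle_data_def)
  then show ?thesis
    unfolding *(2) using cochain_cobd[of "p - 1" a] by (intro cochain_add) auto
qed

lemma cobd_cups_corrected:
  assumes "cocycle_data T \<eta> ws" "small_tuple T \<eta> (Suc (total ws)) s"
  shows "cobd (Suc (total ws)) (cups (corrected ws)) s = 0"
  using assms
proof (induction ws arbitrary: s)
  case Nil
  then show ?case by (simp add: cobd_def)
next
  case (Cons w ws)
  obtain p \<phi> a where w: "w = (p, \<phi>, a)" by (cases w)
  define \<phi>' where "\<phi>' = (\<lambda>s. \<phi> s + cobd p a s)"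
  have c: "cochain p \<phi>'"
    using cochain_corrected[OF Cons.prems(1), of p \<phi>'] by (simp add: w \<phi>'_def)
  have ws: "cocycle_data T \<eta> ws" using Cons.prems(1) by (auto simp: cocycle_data_def)
  have "cobd (Suc p) \<phi> s = 0"
    using Cons.prems small_tuple_initial[OF Cons.prems(2), of "Suc p"] by (auto simp: w cocycle_data_def)
  then have 1: "cobd (Suc p) \<phi>' s = 0"
    unfolding \<phi>'_def cobd_add cobd_cobd by simp
  have 2: "cobd (Suc (total ws)) (cups (corrected ws)) (\<lambda>i. s (i + p)) = 0"
    by (rule Cons.IH[OF ws small_tuple_final[OF Cons.prems(2)]]) (simp add: w)
  have t: "total (w # ws) = p + total ws" by (simp add: w)
  have "cups (corrected (w # ws)) = cup p \<phi>' (cups (corrected ws))"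
    by (simp add: w \<phi>'_def)
  moreover have "cobd (Suc (p + total ws)) (cup p \<phi>' (cups (corrected ws))) s = 0"
    unfolding cobd_cup[OF c] by (simp add: cup_def 1 2)
  ultimately show ?case unfolding t by (simp only:)
qed

lemma cups_telescope:
  assumes "cocycle_data T \<eta> ws" "small_tuple T \<eta> (total ws) s"
  shows "cups (uncorrected ws) s + cups (corrected ws) s = cobd (total ws) (primitive ws) s"
  using assms
proof (induction ws arbitrary: s)
  case Nil
  then show ?case by (simp add: cobd_def)
next
  case (Cons w ws)
  obtain p \<phi> a where w: "w = (p, \<phi>, a)" by (cases w)
  have ws: "cocycle_data T \<eta> ws" using Cons.prems(1) by (auto simp: cocycle_data_def)
  have p: "p > 0" "cochain p \<phi>" "cochain (p - 1) a"
    and co: "\<And>s. small_tuple T \<eta> (Suc p) s \<Longrightarrow> cobd (Suc p) \<phi> s = 0"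
    using Cons.prems(1) by (auto simp: cocycle_data_def w)
  have t: "total (w # ws) = p + total ws" by (simp add: w)
  define F where "F = cups (uncorrected ws)"
  define PP where "PP = cups (corrected ws)"
  define K where "K = primitive ws"
  have small: "small_tuple T \<eta> (total ws) (\<lambda>i. s (i + p))"
    by (rule small_tuple_final[OF Cons.prems(2)]) (simp add: w)
  have IH: "F (\<lambda>i. s (i + p)) + PP (\<lambda>i. s (i + p)) = cobd (total ws) K (\<lambda>i. s (i + p))"
    unfolding F_def PP_def K_def by (rule Cons.IH[OF ws small])
  \<comment> \<open>The cocycle condition for \<open>\<phi>\<close> takes \<open>p + 2\<close>
    points. At the last factor only \<open>p + 1\<close> are constrained, but there \<open>K\<close>
    is zero.\<close>
  have 1: "cobd (p + total ws) (cup p \<phi> K) s = \<phi> s * cobd (total ws) K (\<lambda>i. s (i + p))"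
  proof (cases "ws = []")
    case True
    then show ?thesis by (simp add: K_def cobd_def cup_def)
  next
    case False
    then have "total ws > 0"
      using ws by (cases ws) (auto simp: cocycle_data_def)
    then obtain q where q: "total ws = Suc q" using gr0_implies_Suc by blast
    have "cobd (Suc p) \<phi> s = 0"
      using co small_tuple_initial[OF Cons.prems(2), of "Suc p"] t q by simp
    then show ?thesis
      unfolding q using cobd_cup[OF p(2), of q K s] by (simp add: cup_def)
  qed
  obtain p' where p': "p = Suc p'" using p(1) gr0_implies_Suc by blast
  have small': "small_tuple T \<eta> (Suc (total ws)) (\<lambda>i. s (i + p'))"
    by (rule small_tuple_final[OF Cons.prems(2)]) (simp add: w p')
  have 2: "cobd (p + total ws) (cup p' a PP) s = cobd p a s * PP (\<lambda>i. s (i + p))"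
    using cobd_cup[of p' a "total ws" PP s] p(3) cobd_cups_corrected[OF ws small']
    by (simp add: p' cup_def PP_def)
  have "cobd (total (w # ws)) (primitive (w # ws)) s =
     \<phi> s * cobd (total ws) K (\<lambda>i. s (i + p)) + cobd p a s * PP (\<lambda>i. s (i + p))"
    unfolding t using 1 2 by (simp add: w cobd_add K_def[symmetric] PP_def[symmetric] p')
  also have "\<dots> = \<phi> s * F (\<lambda>i. s (i + p)) + (\<phi> s + cobd p a s) * PP (\<lambda>i. s (i + p))"
    unfolding IH[symmetric] by (simp add: distrib_left distrib_right add.assoc)
  finally show ?case by (simp add: w cup_def F_def PP_def)
qed

text \<open>This is where the cover enters: a tuple inside \<open>V\<close> kills the factor whose
  cocycle is a coboundary over \<open>V\<close>, and with it the whole product.\<close>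

lemma cups_corrected_zero:
  assumes "cocycle_data T \<eta> ws" "small_tuple T \<eta> (total ws) s" "l < length ws"
    "\<And>t. small_tuple V \<eta> (fst (ws ! l)) t \<Longrightarrow>
       fst (snd (ws ! l)) t = cobd (fst (ws ! l)) (snd (snd (ws ! l))) t"
    "\<And>i. i \<le> total ws \<Longrightarrow> s i \<in> V"
  shows "cups (corrected ws) s = 0"
  using assms
proof (induction ws arbitrary: s l)
  case (Cons w ws)
  obtain p \<phi> a where w: "w = (p, \<phi>, a)" by (cases w)
  have ws: "cocycle_data T \<eta> ws" using Cons.prems(1) by (auto simp: cocycle_data_def)
  show ?case
  proof (cases l)
    case 0
    have "small_tuple V \<eta> p s"
      using Cons.prems(2,5) by (auto simp: small_tuple_def w)
    then show ?thesis using Cons.prems(4)[of s] 0 by (simp add: w cup_def)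
  next
    case (Suc k)
    have "cups (corrected ws) (\<lambda>i. s (i + p)) = 0"
    proof (rule Cons.IH[OF ws, of _ k])
      show "small_tuple T \<eta> (total ws) (\<lambda>i. s (i + p))"
        by (rule small_tuple_final[OF Cons.prems(2)]) (simp add: w)
    qed (use Cons.prems Suc in \<open>auto simp: w\<close>)
    then show ?thesis by (simp add: w cup_def)
  qed
qed simp

lemma cochain_primitive:
  assumes "cocycle_data T \<eta> ws"
  shows "cochain (total ws - 1) (primitive ws)"
  using assms
proof (induction ws)
  case (Cons w ws)
  obtain p \<phi> a where w: "w = (p, \<phi>, a)" by (cases w)
  have ws: "cocycle_data T \<eta> ws" using Cons.prems by (auto simp: cocycle_data_def)
  have p: "p > 0" "cochain p \<phi>" "cochain (p - 1) a"
    using Cons.prems by (auto simp: cocycle_data_def w)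
  have t: "total ws = sum_list (map fst (corrected ws))"
    by (induction ws) auto
  have "cochain (total ws) (cups (corrected ws))"
    unfolding t by (rule cochain_cups) (rule cochain_corrected[OF ws])
  then have 2: "cochain (p + total ws - 1) (cup (p - 1) a (cups (corrected ws)))"
    using cochain_cup[OF p(3)] p(1) by fastforce
  have 1: "cochain (p + total ws - 1) (cup p \<phi> (primitive ws))"
  proof (cases "ws = []")
    case True
    then show ?thesis by (simp add: cup_def cochain_def)
  next
    case False
    then have "total ws > 0"
      using ws by (cases ws) (auto simp: cocycle_data_def)
    then show ?thesis using cochain_cup[OF p(2) Cons.IH[OF ws]] by simp
  qed
  show ?case using cochain_add[OF 1 2] by (simp add: w)
qed (simp add: cochain_def)

lemma cups_invariant:
  assumes "\<And>p \<phi> s. (p, \<phi>) \<in> set ws \<Longrightarrow> (\<And>i. s i \<in> T) \<Longrightarrow> \<phi> (\<lambda>i. h (s i)) = \<phi> s" "\<And>i. s i \<in> T"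
  shows "cups ws (\<lambda>i. h (s i)) = cups ws s"
  using assms
proof (induction ws arbitrary: s rule: cups.induct)
  case (2 p \<phi> ws)
  have "\<phi> (\<lambda>i. h (s i)) = \<phi> s" by (rule "2.prems"(1)[of p]) (use "2.prems"(2) in auto)
  moreover have "cups ws (\<lambda>i. h (s (i + p))) = cups ws (\<lambda>i. s (i + p))"
  proof (rule "2.IH")
    show "\<psi> (\<lambda>i. h (t i)) = \<psi> t" if "(q, \<psi>) \<in> set ws" "\<And>i. t i \<in> T" for q \<psi> t
      by (rule "2.prems"(1)[of q]) (use that in auto)
  qed (rule "2.prems"(2))
  ultimately show ?case by (simp add: cup_def)
qed simp

text \<open>The chains of the application are cycles only up to antipodes, so the primitive must not
  distinguish lifts of the same points.\<close>

lemma primitive_invariant: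
  assumes "\<And>p \<phi> a s. (p, \<phi>, a) \<in> set ws \<Longrightarrow> (\<And>i. s i \<in> T) \<Longrightarrow>
      \<phi> (\<lambda>i. h (s i)) = \<phi> s \<and> a (\<lambda>i. h (s i)) = a s"
    and hT: "\<And>x. x \<in> T \<Longrightarrow> h x \<in> T" and "\<And>i. s i \<in> T"
  shows "primitive ws (\<lambda>i. h (s i)) = primitive ws s"
  using assms(1,3)
proof (induction ws arbitrary: s rule: primitive.induct)
  case (2 p \<phi> a ws)
  have ca: "\<psi> (\<lambda>i. h (s i)) = \<psi> s"
    if q: "(q, \<psi>) \<in> set (corrected ws)" and sT: "\<And>i. s i \<in> T" for q \<psi> s
  proof -
    obtain \<phi>' a' where *: "(q, \<phi>', a') \<in> set ws" "\<psi> = (\<lambda>s. \<phi>' s + cobd q a' s)" using q by auto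
    have "cobd q (\<lambda>s. a' (\<lambda>i. h (s i))) s = cobd q a' s"
      unfolding cobd_def using "2.prems"(1)[of q \<phi>' a'] * sT
      by (intro sum.cong) (auto simp: face_def)
    then show ?thesis unfolding *(2) cobd_comp using "2.prems"(1)[of q \<phi>' a'] * sT by simp
  qed
  have "cups (corrected ws) (\<lambda>i. h (s (i + q))) = cups (corrected ws) (\<lambda>i. s (i + q))" for q
    by (rule cups_invariant[of _ T]) (use ca 2 in auto)
  moreover have "\<phi> (\<lambda>i. h (s i)) = \<phi> s \<and> a (\<lambda>i. h (s i)) = a s"
    by (rule "2.prems"(1)[of p]) (use "2.prems"(2) in auto)
  moreover have "primitive ws (\<lambda>i. h (s (i + p))) = primitive ws (\<lambda>i. s (i + p))"
  proof (rule "2.IH")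
    show "\<psi> (\<lambda>i. h (t i)) = \<psi> t \<and> b (\<lambda>i. h (t i)) = b t"
      if "(q, \<psi>, b) \<in> set ws" "\<And>i. t i \<in> T" for q \<psi> b t
      by (rule "2.prems"(1)[of q]) (use that in auto)
  qed (rule "2.prems"(2))
  ultimately show ?case by (simp add: cup_def)
qed simp

section \<open>From local sections to coboundaries\<close>

lemma continuous_map_path_eval:
  "continuous_map (prod_topology (path_space X) (top_of_set {0..1})) X (\<lambda>(g, t). g t)"
  unfolding continuous_map_def
proof (intro conjI allI impI)
  show "(\<lambda>(g, t). g t) \<in> topspace (prod_topology (path_space X) (top_of_set {0..1})) \<rightarrow> topspace X"
    by (auto simp: topspace_path_space pathin_def continuous_map_def)
next
  fix U assume U: "openin X U"
  let ?P = "prod_topology (path_space X) (top_of_set {0..1::real})"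
  show "openin ?P {p \<in> topspace ?P. (case p of (g, t) \<Rightarrow> g t) \<in> U}"
  proof (subst openin_subopen, intro ballI)
    fix p assume "p \<in> {p \<in> topspace ?P. (case p of (g, t) \<Rightarrow> g t) \<in> U}"
    then obtain g t where p: "p = (g, t)" and g: "g \<in> extensional {0..1}" "pathin X g" and t: "t \<in> {0..1}"
      and gt: "g t \<in> U"
      by (auto simp: topspace_path_space)
    have "openin (top_of_set {0..1}) {t \<in> {0..1}. g t \<in> U}"
      using openin_continuous_map_preimage[OF _ U, of "top_of_set {0..1}" g] g by (simp add: pathin_def)
    then obtain e where e: "e > 0" "\<And>x. x \<in> {0..1} \<Longrightarrow> dist x t < e \<Longrightarrow> g x \<in> U"
      using t gt unfolding openin_euclidean_subtopology_iff by blast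
    \<comment> \<open>The unit interval is locally compact: a compact neighbourhood of
      \<open>t\<close> that \<open>g\<close> maps into \<open>U\<close> yields a subbasic set of
      paths.\<close>
    define K where "K = cball t (e/2) \<inter> {0..1}"
    define A where "A = {g \<in> extensional {0..1}. pathin X g \<and> g ` K \<subseteq> U}"
    have "openin (path_space X) A"
      unfolding path_space_def A_def
      by (intro topology_generated_by_Basis CollectI exI[of _ K] exI[of _ U] conjI refl)
         (auto simp: K_def U intro: compact_Int_closed)
    moreover have "openin (top_of_set {0..1}) ({0..1} \<inter> ball t (e/2))"
      by (intro openin_open_Int) auto
    ultimately have "openin ?P (A \<times> ({0..1} \<inter> ball t (e/2)))"
      by (simp add: openin_prod_Times_iff)
    moreover have "g \<in> A"
      using g e by (auto simp: A_def K_def dist_commute)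
    moreover have "A \<times> ({0..1} \<inter> ball t (e/2)) \<subseteq> {p \<in> topspace ?P. (case p of (g, t) \<Rightarrow> g t) \<in> U}"
      by (force simp: A_def K_def topspace_path_space)
    ultimately show "\<exists>T. openin ?P T \<and> p \<in> T \<and> T \<subseteq> {p \<in> topspace ?P. (case p of (g, t) \<Rightarrow> g t) \<in> U}"
      using t e(1) p by (intro exI[of _ "A \<times> ({0..1} \<inter> ball t (e/2))"]) auto
  qed
qed

text \<open>
  The space need not be metrizable a priori, so the fineness of tuples is measured by finitely
  many continuous functions.
\<close>

definition local_cocycle :: "'b topology \<Rightarrow> nat \<Rightarrow> 'b coch \<Rightarrow> bool" where
  "local_cocycle B p \<phi> \<longleftrightarrow> cochain p \<phi> \<and> (\<exists>F \<rho>. finite F \<and> \<rho> > 0 \<and>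
     (\<forall>f\<in>F. continuous_map B euclideanreal f) \<and>
     (\<forall>s. (\<forall>i\<le>Suc p. s i \<in> topspace B) \<longrightarrow>
          (\<forall>f\<in>F. \<forall>i\<le>Suc p. \<forall>j\<le>Suc p. \<bar>f (s i) - f (s j)\<bar> < \<rho>) \<longrightarrow> cobd (Suc p) \<phi> s = 0))"

lemma uniformly_close_finite:
  fixes S :: "'z::metric_space set" and G :: "'z \<Rightarrow> 'b" and F :: "('b \<Rightarrow> real) set"
  assumes "compact S" "continuous_map (top_of_set S) B G" "finite F"
    "\<And>f. f \<in> F \<Longrightarrow> continuous_map B euclideanreal f" "\<rho> > 0"
  obtains d where "d > 0" "\<And>f x y. f \<in> F \<Longrightarrow> x \<in> S \<Longrightarrow> y \<in> S \<Longrightarrow> dist x y < d \<Longrightarrow> \<bar>f (G x) - f (G y)\<bar> < \<rho>"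
proof -
  have "\<exists>d>0. \<forall>x\<in>S. \<forall>y\<in>S. dist x y < d \<longrightarrow> \<bar>f (G x) - f (G y)\<bar> < \<rho>" if "f \<in> F" for f
  proof -
    have "continuous_map (top_of_set S) euclideanreal (f \<circ> G)"
      using assms(2) assms(4)[OF that] by (rule continuous_map_compose)
    then have "uniformly_continuous_on S (f \<circ> G)"
      using assms(1) by (intro compact_uniformly_continuous) auto
    then show ?thesis
      using assms(5) unfolding uniformly_continuous_on_def dist_real_def comp_def
      by (metis dist_commute abs_minus_commute)
  qed
  then obtain d where d: "\<And>f. f \<in> F \<Longrightarrow> d f > 0"
    "\<And>f x y. f \<in> F \<Longrightarrow> x \<in> S \<Longrightarrow> y \<in> S \<Longrightarrow> dist x y < d f \<Longrightarrow> \<bar>f (G x) - f (G y)\<bar> < \<rho>"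
    by metis
  show ?thesis
  proof (rule that[of "Min (insert 1 (d ` F))"])
    show "Min (insert 1 (d ` F)) > 0" using d(1) assms(3) by auto
    fix f x y assume *: "f \<in> F" "x \<in> S" "y \<in> S" "dist x y < Min (insert 1 (d ` F))"
    then have "dist x y < d f" using assms(3) by auto
    then show "\<bar>f (G x) - f (G y)\<bar> < \<rho>" using * d(2) by blast
  qed
qed

lemma local_cocycle_pullback:
  fixes T :: "'z::metric_space set"
  assumes "local_cocycle B p \<phi>" "compact T" "continuous_map (top_of_set T) B q"
  obtains \<eta> where "\<eta> > 0" "\<And>s. small_tuple T \<eta> (Suc p) s \<Longrightarrow> cobd (Suc p) (\<lambda>s. \<phi> (\<lambda>i. q (s i))) s = 0"
proof -
  obtain F \<rho> where F: "finite F" "\<rho> > 0" "\<And>f. f \<in> F \<Longrightarrow> continuous_map B euclideanreal f"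
    "\<And>s. (\<forall>i\<le>Suc p. s i \<in> topspace B) \<Longrightarrow>
          (\<forall>f\<in>F. \<forall>i\<le>Suc p. \<forall>j\<le>Suc p. \<bar>f (s i) - f (s j)\<bar> < \<rho>) \<Longrightarrow> cobd (Suc p) \<phi> s = 0"
    using assms(1) unfolding local_cocycle_def by blast
  obtain d where d: "d > 0" "\<And>f x y. f \<in> F \<Longrightarrow> x \<in> T \<Longrightarrow> y \<in> T \<Longrightarrow> dist x y < d \<Longrightarrow> \<bar>f (q x) - f (q y)\<bar> < \<rho>"
    using uniformly_close_finite[OF assms(2,3) F(1,3,2)] by blast
  show ?thesis
  proof (rule that[OF d(1)])
    fix s assume s: "small_tuple T d (Suc p) s"
    show "cobd (Suc p) (\<lambda>s. \<phi> (\<lambda>i. q (s i))) s = 0"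
      unfolding cobd_comp[symmetric]
    proof (rule F(4))
      show "\<forall>i\<le>Suc p. q (s i) \<in> topspace B"
        using s continuous_map_image_subset_topspace[OF assms(3)] by (auto simp: small_tuple_def)
      show "\<forall>f\<in>F. \<forall>i\<le>Suc p. \<forall>j\<le>Suc p. \<bar>f (q (s i)) - f (q (s j))\<bar> < \<rho>"
        using s d(2) by (auto simp: small_tuple_def)
    qed
  qed
qed

definition path_prism :: "nat \<Rightarrow> nat \<Rightarrow> ('z \<Rightarrow> real \<Rightarrow> 'b) \<Rightarrow> 'b coch \<Rightarrow> 'z coch" where
  "path_prism p M \<gamma> \<phi> s = (\<Sum>m<M. prism p (\<lambda>z. \<gamma> z (real m / real M)) (\<lambda>z. \<gamma> z (real (Suc m) / real M)) \<phi> s)"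

lemma cochain_path_prism: "cochain (Suc p) \<phi> \<Longrightarrow> cochain p (path_prism (Suc p) M \<gamma> \<phi>)"
  using cochain_prism unfolding cochain_def path_prism_def
  by (intro allI impI sum.cong refl) blast

text \<open>A prism between adjacent times consists of points on which all test functions are close,
  so the coboundary of \<open>\<phi>\<close> vanishes on it. The prism identities then telescope in
  time.\<close>

lemma homotopy_coboundary:
  fixes V :: "'z::metric_space set"
  assumes V: "compact V" and G: "continuous_map (top_of_set (V \<times> {0..1})) B (\<lambda>(z, t). \<gamma> z t)"
    and \<phi>: "local_cocycle B p \<phi>"
  obtains \<eta> M where "\<eta> > 0"
    "\<And>s. small_tuple V \<eta> p s \<Longrightarrow>
       \<phi> (\<lambda>i. \<gamma> (s i) 0) + \<phi> (\<lambda>i. \<gamma> (s i) 1) = cobd p (path_prism p M \<gamma> \<phi>) s"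
proof -
  obtain F \<rho> where F: "finite F" "\<rho> > 0" "\<And>f. f \<in> F \<Longrightarrow> continuous_map B euclideanreal f"
    "\<And>s. (\<forall>i\<le>Suc p. s i \<in> topspace B) \<Longrightarrow>
          (\<forall>f\<in>F. \<forall>i\<le>Suc p. \<forall>j\<le>Suc p. \<bar>f (s i) - f (s j)\<bar> < \<rho>) \<Longrightarrow> cobd (Suc p) \<phi> s = 0"
    and c: "cochain p \<phi>"
    using \<phi> unfolding local_cocycle_def by blast
  have comp: "compact (V \<times> {0..1::real})" using V by (intro compact_Times) auto
  obtain d where d: "d > 0" "\<And>f x y. f \<in> F \<Longrightarrow> x \<in> V \<times> {0..1} \<Longrightarrow> y \<in> V \<times> {0..1} \<Longrightarrow> dist x y < d \<Longrightarrow>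
      \<bar>f (case x of (z, t) \<Rightarrow> \<gamma> z t) - f (case y of (z, t) \<Rightarrow> \<gamma> z t)\<bar> < \<rho>"
    using uniformly_close_finite[OF comp G F(1,3,2)] by blast
  obtain M :: nat where M: "M > 0" "1 / real M < d / 2"
    using d(1) by (metis half_gt_zero nat_approx_posE zero_less_Suc)
  have close: "\<bar>f (\<gamma> x (real m / real M)) - f (\<gamma> y (real m' / real M))\<bar> < \<rho>"
    if "f \<in> F" "x \<in> V" "y \<in> V" "dist x y < d / 2" "m \<le> M" "m' \<le> M" "m' = m \<or> m' = Suc m \<or> m = Suc m'"
    for f x y m m'
  proof -
    have "dist (real m / real M) (real m' / real M) \<le> 1 / real M"
      using that(7) M by (auto simp: dist_real_def divide_simps)
    then have "dist (x, real m / real M) (y, real m' / real M) < d"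
      using M that(4) dist_Pair_Pair[of x "real m / real M" y "real m' / real M"]
        sqrt_sum_squares_le_sum[of "dist x y" "dist (real m / real M) (real m' / real M)"]
      by (smt (verit) field_sum_of_halves zero_le_dist)
    then show ?thesis
      using d(2)[of f "(x, real m / real M)" "(y, real m' / real M)"] that M by auto
  qed
  have top: "\<gamma> x (real m / real M) \<in> topspace B" if "x \<in> V" "m \<le> M" for x m
  proof -
    have "(x, real m / real M) \<in> topspace (top_of_set (V \<times> {0..1}))" using that M by auto
    then have "(case (x, real m / real M) of (z, t) \<Rightarrow> \<gamma> z t) \<in> topspace B"
      using continuous_map_image_subset_topspace[OF G] by blast
    then show ?thesis by simp
  qed
  show ?thesis
  proof (rule that[of "d / 2" M])
    show "d / 2 > 0" using d by simp
    fix s assume s: "small_tuple V (d / 2) p s"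
    define f where "f = (\<lambda>m z. \<gamma> z (real m / real M))"
    have zero: "prism (Suc p) (f m) (f (Suc m)) (cobd (Suc p) \<phi>) s = 0" if "m < M" for m
      unfolding prism_def
    proof (rule sum.neutral, rule ballI)
      fix j assume j: "j \<in> {..<Suc p}"
      show "cobd (Suc p) \<phi> (mix j (f m) (f (Suc m)) s) = 0"
      proof (rule F(4))
        show "\<forall>i\<le>Suc p. mix j (f m) (f (Suc m)) s i \<in> topspace B"
          using s j that by (auto simp: mix_def f_def small_tuple_def intro!: top simp del: of_nat_Suc)
        show "\<forall>g\<in>F. \<forall>i\<le>Suc p. \<forall>k\<le>Suc p. \<bar>g (mix j (f m) (f (Suc m)) s i) - g (mix j (f m) (f (Suc m)) s k)\<bar> < \<rho>"
          using s j that by (auto simp: mix_def f_def small_tuple_def intro!: close simp del: of_nat_Suc)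
      qed
    qed
    have "cobd p (path_prism p M \<gamma> \<phi>) s = (\<Sum>m<M. cobd p (prism p (f m) (f (Suc m)) \<phi>) s)"
      unfolding cobd_def path_prism_def f_def by (rule sum.swap)
    also have "\<dots> = (\<Sum>m<M. \<phi> (\<lambda>i. f m (s i)) + \<phi> (\<lambda>i. f (Suc m) (s i)))"
    proof (rule sum.cong[OF refl])
      fix m assume "m \<in> {..<M}"
      then show "cobd p (prism p (f m) (f (Suc m)) \<phi>) s = \<phi> (\<lambda>i. f m (s i)) + \<phi> (\<lambda>i. f (Suc m) (s i))"
        using prism_identity[OF c, of "f m" "f (Suc m)" s] zero[of m] by simp
    qed
    also have "\<dots> = \<phi> (\<lambda>i. f 0 (s i)) + \<phi> (\<lambda>i. f M (s i))"
    proof -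
      have "(\<Sum>m<k. g m + g (Suc m)) = g 0 + g k" for g :: "nat \<Rightarrow> bit" and k
        by (induction k) (auto simp: add_ac)
      then show ?thesis .
    qed
    finally show "\<phi> (\<lambda>i. \<gamma> (s i) 0) + \<phi> (\<lambda>i. \<gamma> (s i) 1) = cobd p (path_prism p M \<gamma> \<phi>) s"
      using M by (simp add: f_def)
  qed
qed

lemma path_prism_invariant:
  assumes "\<And>x. x \<in> T \<Longrightarrow> \<gamma> (h x) = \<gamma> x" "\<And>i. s i \<in> T"
  shows "path_prism p M \<gamma> \<phi> (\<lambda>i. h (s i)) = path_prism p M \<gamma> \<phi> s"
proof -
  have "mix j (\<lambda>z. \<gamma> z a) (\<lambda>z. \<gamma> z b) (\<lambda>i. h (s i)) = mix j (\<lambda>z. \<gamma> z a) (\<lambda>z. \<gamma> z b) s" for j a b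
    using assms by (simp add: mix_def fun_eq_iff)
  then show ?thesis by (simp add: path_prism_def prism_def)
qed

text \<open>The class \<open>\<phi> x 1 - 1 x \<phi>\<close> on \<open>B x B\<close>, pulled back
  along \<open>q\<close>.\<close>

definition zero_divisor :: "('z \<Rightarrow> 'b \<times> 'b) \<Rightarrow> 'b coch \<Rightarrow> 'z coch" where
  "zero_divisor q \<phi> s = \<phi> (\<lambda>i. fst (q (s i))) + \<phi> (\<lambda>i. snd (q (s i)))"

text \<open>
  The cochain \<open>K\<close> is constructed on the lifts in \<open>T\<close> but depends only on
  their images in \<open>B \<times> B\<close>; this is the invariance under all \<open>h\<close>
  over \<open>q\<close>.
\<close>

theorem TC_lower_bound:
  fixes T :: "'z::metric_space set" and q :: "'z \<Rightarrow> 'b \<times> 'b" and ws :: "(nat \<times> 'b coch) list"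
  assumes T: "compact T" and q: "continuous_map (top_of_set T) (prod_topology B B) q"
    and ws: "\<And>p \<phi>. (p, \<phi>) \<in> set ws \<Longrightarrow> p > 0 \<and> local_cocycle B p \<phi>"
    and TC: "TC B < enat (length ws)"
  obtains \<eta> where "\<eta> > 0"
    "\<And>z. fine_chain T \<eta> (total ws) z \<Longrightarrow>
       (\<And>K. cochain (total ws - 1) K \<Longrightarrow>
          (\<And>h s. (\<And>x. x \<in> T \<Longrightarrow> h x \<in> T \<and> q (h x) = q x) \<Longrightarrow> (\<And>i. s i \<in> T) \<Longrightarrow> K (\<lambda>i. h (s i)) = K s) \<Longrightarrow>
          ev (cobd (total ws) K) z = 0) \<Longrightarrow>
       ev (cups (map (\<lambda>(p, \<phi>). (p, zero_divisor q \<phi>)) ws)) z = 0"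
proof -
  define r where "r = length ws"
  have "\<exists>n U. n < r \<and> (\<forall>i\<le>n. openin (prod_topology B B) (U i) \<and> has_path_section B (U i)) \<and>
      (\<Union>i\<le>n. U i) = topspace (prod_topology B B)"
  proof -
    obtain x where x: "x \<in> {enat n | n. \<exists>U :: nat \<Rightarrow> ('b \<times> 'b) set.
            (\<forall>i\<le>n. openin (prod_topology B B) (U i) \<and> has_path_section B (U i)) \<and>
            (\<Union>i\<le>n. U i) = topspace (prod_topology B B)}" "x < enat (length ws)"
      using TC unfolding TC_def Inf_less_iff by blast
    then obtain n U where "x = enat n"
      "(\<forall>i\<le>n. openin (prod_topology B B) (U i) \<and> has_path_section B (U i)) \<and>
            (\<Union>i\<le>n. U i) = topspace (prod_topology B B)" by blast
    moreover from this x(2) have "n < r" by (simp add: r_def)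
    ultimately show ?thesis by blast
  qed
  then obtain n U where n: "n < r" and U: "\<And>i. i \<le> n \<Longrightarrow> openin (prod_topology B B) (U i) \<and> has_path_section B (U i)"
    and cov: "(\<Union>i\<le>n. U i) = topspace (prod_topology B B)"
    by blast
  \<comment> \<open>The last set is repeated, so that each of the \<open>r\<close> zero divisors has
    a set of its own.\<close>
  define W where "W = (\<lambda>i. U (min i n))"
  have W: "openin (prod_topology B B) (W i)" "has_path_section B (W i)" for i
    using U[of "min i n"] by (auto simp: W_def)
  have covW: "\<exists>i<r. x \<in> W i" if "x \<in> topspace (prod_topology B B)" for x
  proof -
    have "x \<in> (\<Union>i\<le>n. U i)" using that cov by simp
    then obtain i where "i \<le> n" "x \<in> U i" by auto
    then show ?thesis using n by (intro exI[of _ i]) (auto simp: W_def)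
  qed
  have "\<forall>i. \<exists>s. continuous_map (subtopology (prod_topology B B) (W i)) (path_space B) s \<and>
      (\<forall>x\<in>W i. path_ends (s x) = x)"
    using W(2) unfolding has_path_section_def by (rule allI)
  from choice[OF this] obtain sec where sec: "\<And>i. continuous_map (subtopology (prod_topology B B) (W i)) (path_space B) (sec i)"
      "\<And>i x. x \<in> W i \<Longrightarrow> path_ends (sec i x) = x"
    by blast
  have "\<exists>O'. open O' \<and> {z \<in> T. q z \<in> W i} = T \<inter> O'" for i
    using openin_continuous_map_preimage[OF q W(1)[of i]] by (simp add: openin_open)
  then obtain O' where O': "\<And>i. open (O' i)" "\<And>i. {z \<in> T. q z \<in> W i} = T \<inter> O' i" by metis
  have "T \<subseteq> \<Union> (O' ` {..<r})"
  proof
    fix z assume "z \<in> T"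
    then have "q z \<in> topspace (prod_topology B B)"
      using continuous_map_image_subset_topspace[OF q] by auto
    then obtain i where "i < r" "q z \<in> W i" using covW by blast
    then show "z \<in> \<Union> (O' ` {..<r})" using O'(2)[of i] \<open>z \<in> T\<close> by blast
  qed
  then obtain e where e: "e > 0" "\<And>x. x \<in> T \<Longrightarrow> \<exists>b\<in>O' ` {..<r}. ball x e \<subseteq> b"
    using Heine_Borel_lemma[OF T, of "O' ` {..<r}"] O'(1) by blast
  \<comment> \<open>Compact shrinkings of the preimages of the \<open>W i\<close>. As
    \<open>e\<close> is a Lebesgue number, a tuple of diameter below \<open>e / 2\<close> lies in
    one of them.\<close>
  define V where "V = (\<lambda>i. T \<inter> (\<Inter>y\<in>{y \<in> T. q y \<notin> W i}. {z. e / 2 \<le> dist z y}))"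
  have V: "compact (V i)" for i
    unfolding V_def using T
    by (intro compact_Int_closed closed_INT ballI closed_Collect_le continuous_intros)
  have VW: "z \<in> T \<and> q z \<in> W i" if "z \<in> V i" for z i
    using that e(1) by (auto simp: V_def)
  define \<gamma> where "\<gamma> = (\<lambda>i z. sec i (q z))"
  have \<gamma>: "continuous_map (top_of_set (V i \<times> {0..1})) B (\<lambda>(z, t). \<gamma> i z t)" for i
  proof -
    have "continuous_map (top_of_set (V i)) (subtopology (prod_topology B B) (W i)) q"
      using continuous_map_from_subtopology_mono[OF q, of "V i"] VW[of _ i]
      by (auto simp: continuous_map_in_subtopology)
    then have "continuous_map (top_of_set (V i)) (path_space B) (sec i \<circ> q)"
      by (rule continuous_map_compose[OF _ sec(1)])
    from continuous_map_compose[OF continuous_map_fst this]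
    have s: "continuous_map (prod_topology (top_of_set (V i)) (top_of_set {0..1::real})) (path_space B) (\<lambda>p. (sec i \<circ> q) (fst p))"
      unfolding comp_def .
    have "continuous_map (prod_topology (top_of_set (V i)) (top_of_set {0..1::real})) (prod_topology (path_space B) (top_of_set {0..1}))
        (\<lambda>p. ((sec i \<circ> q) (fst p), snd p))"
      by (intro continuous_map_pairedI s continuous_map_snd)
    from continuous_map_compose[OF this continuous_map_path_eval]
    show ?thesis by (simp add: comp_def \<gamma>_def case_prod_beta' prod_topology_subtopology_eu)
  qed
  have ends: "\<gamma> i z 0 = fst (q z)" "\<gamma> i z 1 = snd (q z)" if "z \<in> V i" for i z
    using sec(2)[of "q z" i] VW[OF that] by (auto simp: \<gamma>_def path_ends_def prod_eq_iff)
  define P where "P = (\<lambda>l. fst (ws ! l))"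
  define F where "F = (\<lambda>l. snd (ws ! l))"
  have PF: "P l > 0" "local_cocycle B (P l) (F l)" if "l < r" for l
    using ws[of "P l" "F l"] that by (auto simp: P_def F_def r_def)
  have cF: "cochain (P l) (F l)" if "l < r" for l using PF(2)[OF that] by (simp add: local_cocycle_def)
  have "\<forall>l\<in>{..<r}. \<exists>\<eta> M. \<eta> > 0 \<and> (\<forall>s. small_tuple (V l) \<eta> (P l) s \<longrightarrow>
       zero_divisor q (F l) s = cobd (P l) (path_prism (P l) M (\<gamma> l) (F l)) s)"
  proof
    fix l assume "l \<in> {..<r}"
    then have l: "l < r" by simp
    obtain \<eta> M where *: "\<eta> > 0" "\<And>s. small_tuple (V l) \<eta> (P l) s \<Longrightarrow>
       F l (\<lambda>i. \<gamma> l (s i) 0) + F l (\<lambda>i. \<gamma> l (s i) 1) = cobd (P l) (path_prism (P l) M (\<gamma> l) (F l)) s"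
      using homotopy_coboundary[OF V \<gamma> PF(2)[OF l]] by blast
    have "zero_divisor q (F l) s = cobd (P l) (path_prism (P l) M (\<gamma> l) (F l)) s"
      if s: "small_tuple (V l) \<eta> (P l) s" for s
    proof -
      have "F l (\<lambda>i. \<gamma> l (s i) 0) = F l (\<lambda>i. fst (q (s i)))" "F l (\<lambda>i. \<gamma> l (s i) 1) = F l (\<lambda>i. snd (q (s i)))"
        using s by (auto intro!: cochainD[OF cF[OF l]] simp: ends small_tuple_def)
      then show ?thesis using *(2)[OF s] by (simp add: zero_divisor_def)
    qed
    then show "\<exists>\<eta> M. \<eta> > 0 \<and> (\<forall>s. small_tuple (V l) \<eta> (P l) s \<longrightarrow>
       zero_divisor q (F l) s = cobd (P l) (path_prism (P l) M (\<gamma> l) (F l)) s)"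
      using *(1) by blast
  qed
  then obtain \<eta>1 M where \<eta>1: "\<And>l. l < r \<Longrightarrow> \<eta>1 l > (0::real)"
    "\<And>l s. l < r \<Longrightarrow> small_tuple (V l) (\<eta>1 l) (P l) s \<Longrightarrow>
       zero_divisor q (F l) s = cobd (P l) (path_prism (P l) (M l) (\<gamma> l) (F l)) s"
    by (metis lessThan_iff)
  have qc: "continuous_map (top_of_set T) B (\<lambda>x. fst (q x))" "continuous_map (top_of_set T) B (\<lambda>x. snd (q x))"
    using continuous_map_compose[OF q continuous_map_fst] continuous_map_compose[OF q continuous_map_snd]
    by (simp_all add: comp_def)
  have "\<forall>l\<in>{..<r}. \<exists>\<eta>>0. \<forall>s. small_tuple T \<eta> (Suc (P l)) s \<longrightarrow> cobd (Suc (P l)) (zero_divisor q (F l)) s = 0"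
  proof
    fix l assume "l \<in> {..<r}"
    then have l: "l < r" by simp
    obtain \<eta>2 where 2: "\<eta>2 > 0" "\<And>s. small_tuple T \<eta>2 (Suc (P l)) s \<Longrightarrow> cobd (Suc (P l)) (\<lambda>s. F l (\<lambda>i. fst (q (s i)))) s = 0"
      using local_cocycle_pullback[OF PF(2)[OF l] T qc(1)] by blast
    obtain \<eta>3 where 3: "\<eta>3 > 0" "\<And>s. small_tuple T \<eta>3 (Suc (P l)) s \<Longrightarrow> cobd (Suc (P l)) (\<lambda>s. F l (\<lambda>i. snd (q (s i)))) s = 0"
      using local_cocycle_pullback[OF PF(2)[OF l] T qc(2)] by blast
    have "cobd (Suc (P l)) (zero_divisor q (F l)) s = 0" if "small_tuple T (min \<eta>2 \<eta>3) (Suc (P l)) s" for s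
    proof -
      have "small_tuple T \<eta>2 (Suc (P l)) s" "small_tuple T \<eta>3 (Suc (P l)) s"
        using that by (auto simp: small_tuple_def)
      then show ?thesis unfolding zero_divisor_def[abs_def] cobd_add using 2 3 by simp
    qed
    then show "\<exists>\<eta>>0. \<forall>s. small_tuple T \<eta> (Suc (P l)) s \<longrightarrow> cobd (Suc (P l)) (zero_divisor q (F l)) s = 0"
      using 2(1) 3(1) by (intro exI[of _ "min \<eta>2 \<eta>3"]) auto
  qed
  then obtain \<eta>2 where \<eta>2: "\<And>l. l < r \<Longrightarrow> \<eta>2 l > (0::real)"
    "\<And>l s. l < r \<Longrightarrow> small_tuple T (\<eta>2 l) (Suc (P l)) s \<Longrightarrow> cobd (Suc (P l)) (zero_divisor q (F l)) s = 0"
    by (metis lessThan_iff)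
  define \<eta> where "\<eta> = Min (insert (e / 2) (\<eta>1 ` {..<r} \<union> \<eta>2 ` {..<r}))"
  have \<eta>: "\<eta> > 0" "\<eta> \<le> e / 2" "\<And>l. l < r \<Longrightarrow> \<eta> \<le> \<eta>1 l" "\<And>l. l < r \<Longrightarrow> \<eta> \<le> \<eta>2 l"
  proof -
    have fin: "finite (insert (e / 2) (\<eta>1 ` {..<r} \<union> \<eta>2 ` {..<r}))" by simp
    show "\<eta> > 0" using e(1) \<eta>1(1) \<eta>2(1) unfolding \<eta>_def by (subst Min_gr_iff) auto
    show "\<eta> \<le> e / 2" "\<And>l. l < r \<Longrightarrow> \<eta> \<le> \<eta>1 l" "\<And>l. l < r \<Longrightarrow> \<eta> \<le> \<eta>2 l"
      unfolding \<eta>_def by (rule Min_le[OF fin], simp)+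
  qed
  define a where "a = (\<lambda>l. path_prism (P l) (M l) (\<gamma> l) (F l))"
  define wd where "wd = map (\<lambda>l. (P l, zero_divisor q (F l), a l)) [0..<r]"
  have un: "uncorrected wd = map (\<lambda>(p, \<phi>). (p, zero_divisor q \<phi>)) ws"
    by (rule nth_equalityI) (auto simp: wd_def r_def P_def F_def case_prod_beta')
  have tot: "total wd = total ws"
  proof -
    have "map fst wd = map fst ws"
      by (rule nth_equalityI) (auto simp: wd_def P_def r_def)
    then show ?thesis by simp
  qed
  have data: "cocycle_data T \<eta> wd"
    unfolding cocycle_data_def
  proof (intro ballI, clarify)
    fix p \<phi> b assume "(p, \<phi>, b) \<in> set wd"
    then obtain l where l: "l < r" "p = P l" "\<phi> = zero_divisor q (F l)" "b = a l" by (auto simp: wd_def)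
    have "cochain p \<phi>"
      unfolding l zero_divisor_def[abs_def]
      by (rule cochain_add[OF cochain_comp[OF cF[OF l(1)]] cochain_comp[OF cF[OF l(1)]]])
    moreover have "cochain (p - 1) b"
      unfolding l a_def using cochain_path_prism[of "P l - 1"] cF[OF l(1)] PF(1)[OF l(1)] by simp
    moreover have "cobd (Suc p) \<phi> s = 0" if "small_tuple T \<eta> (Suc p) s" for s
    proof -
      have "small_tuple T (\<eta>2 l) (Suc p) s"
        using that \<eta>(4)[OF l(1)] by (force simp: small_tuple_def)
      then show ?thesis using \<eta>2(2)[OF l(1)] l by simp
    qed
    ultimately show "0 < p \<and> cochain p \<phi> \<and> cochain (p - 1) b \<and>
        (\<forall>s. small_tuple T \<eta> (Suc p) s \<longrightarrow> cobd (Suc p) \<phi> s = 0)"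
      using PF(1)[OF l(1)] l by simp
  qed
  show ?thesis
  proof (rule that[OF \<eta>(1)])
    fix z
    assume fine: "fine_chain T \<eta> (total ws) z"
      and cyc: "\<And>K. cochain (total ws - 1) K \<Longrightarrow>
          (\<And>h s. (\<And>x. x \<in> T \<Longrightarrow> h x \<in> T \<and> q (h x) = q x) \<Longrightarrow> (\<And>i. s i \<in> T) \<Longrightarrow> K (\<lambda>i. h (s i)) = K s) \<Longrightarrow>
          ev (cobd (total ws) K) z = 0"
    have "cups (uncorrected wd) s = cobd (total ws) (primitive wd) s" if "s \<in> set z" for s
    proof -
      have sT: "s i \<in> T" for i using fine that by (auto simp: fine_chain_def)
      have sm: "small_tuple T \<eta> (total wd) s"
        using fine that by (auto simp: fine_chain_def small_tuple_def tot)
      obtain l where l: "l < r" "ball (s 0) e \<subseteq> O' l" using e(2)[OF sT[of 0]] by auto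
      have "cups (corrected wd) s = 0"
      proof (rule cups_corrected_zero[OF data sm])
        show "l < length wd" using l by (simp add: wd_def)
        show "fst (snd (wd ! l)) t = cobd (fst (wd ! l)) (snd (snd (wd ! l))) t"
          if "small_tuple (V l) \<eta> (fst (wd ! l)) t" for t
        proof -
          have "small_tuple (V l) (\<eta>1 l) (P l) t"
            using that \<eta>(3)[OF l(1)] l(1) by (force simp: small_tuple_def wd_def)
          then show ?thesis using \<eta>1(2)[OF l(1)] l(1) by (simp add: wd_def a_def)
        qed
        fix i assume "i \<le> total wd"
        then have "dist (s 0) (s i) < e / 2"
          using sm \<eta>(2) by (force simp: small_tuple_def)
        have "e / 2 \<le> dist (s i) y" if "y \<in> T" "q y \<notin> W l" for y
        proof (rule ccontr)
          assume "\<not> ?thesis"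
          then have "dist (s 0) y < e"
            using \<open>dist (s 0) (s i) < e / 2\<close> dist_triangle[of "s 0" y "s i"] by linarith
          then have "y \<in> T \<inter> O' l" using l(2) that by auto
          then show False using O'(2)[of l] that by blast
        qed
        then show "s i \<in> V l" using sT by (auto simp: V_def)
      qed
      then show ?thesis using cups_telescope[OF data sm] tot by simp
    qed
    then have "ev (cups (map (\<lambda>(p, \<phi>). (p, zero_divisor q \<phi>)) ws)) z = ev (cobd (total ws) (primitive wd)) z"
      unfolding un by (intro ev_cong) auto
    also have "\<dots> = 0"
    proof (rule cyc)
      show "cochain (total ws - 1) (primitive wd)" using cochain_primitive[OF data] tot by simp
      fix h and s :: "nat \<Rightarrow> 'z" assume h: "\<And>x. x \<in> T \<Longrightarrow> h x \<in> T \<and> q (h x) = q x" and s: "\<And>i. s i \<in> T"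
      show "primitive wd (\<lambda>i. h (s i)) = primitive wd s"
      proof (rule primitive_invariant[of _ T])
        fix p \<phi> b and s :: "nat \<Rightarrow> 'z" assume b: "(p, \<phi>, b) \<in> set wd" and s: "\<And>i. s i \<in> T"
        then obtain l where l: "l < r" "p = P l" "\<phi> = zero_divisor q (F l)" "b = a l" by (auto simp: wd_def)
        show "\<phi> (\<lambda>i. h (s i)) = \<phi> s \<and> b (\<lambda>i. h (s i)) = b s"
        proof
          show "\<phi> (\<lambda>i. h (s i)) = \<phi> s" unfolding l zero_divisor_def using h s by simp
          show "b (\<lambda>i. h (s i)) = b s" unfolding l a_def
            by (rule path_prism_invariant[of T]) (use h s in \<open>auto simp: \<gamma>_def\<close>)
        qed
      qed (use h s in auto)
    qed
    finally show "ev (cups (map (\<lambda>(p, \<phi>). (p, zero_divisor q \<phi>)) ws)) z = 0" .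
  qed
qed

section \<open>The wedge of two stunted projective spaces\<close>

definition Y_pt :: "(nat \<Rightarrow> real) \<Rightarrow> (nat \<Rightarrow> real) set set" where
  "Y_pt a = (if {a, \<lambda>i. - a i} \<in> topspace (real_projective_space 2)
             then topspace (real_projective_space 2) else {{a, \<lambda>i. - a i}})"

text \<open>The point of \<open>X_space\<close> represented by \<open>a\<close> in the sphere over the copy \<open>b\<close> of \<open>Y_space\<close>.\<close>

definition X_pt :: "bool \<Rightarrow> (nat \<Rightarrow> real) \<Rightarrow> (bool \<times> (nat \<Rightarrow> real) set set) set" where
  "X_pt b a = (let B = {(False, topspace (real_projective_space 2)), (True, topspace (real_projective_space 2))}
               in if (b, Y_pt a) \<in> B then B else {(b, Y_pt a)})"

text \<open>For a vector of \<open>S^6\<close> this says that its class lies in \<open>RP^2\<close>,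
  hence that it represents the base point. As a condition on coordinates it also applies to vectors
  of any length.\<close>

definition based :: "(nat \<Rightarrow> real) \<Rightarrow> bool" where
  "based a \<longleftrightarrow> (\<forall>i>2. a i = 0)"

lemma antipodal_pair_eq_iff:
  "{a, \<lambda>i. - a i} = {b, \<lambda>i. - b i} \<longleftrightarrow> b = a \<or> b = (\<lambda>i. - a i :: real)"
  by (auto simp: doubleton_eq_iff fun_eq_iff)

lemma based_iff:
  assumes "a \<in> sph 6"
  shows "{a, \<lambda>i. - a i} \<in> topspace (real_projective_space 2) \<longleftrightarrow> based a"
proof
  assume "{a, \<lambda>i. - a i} \<in> topspace (real_projective_space 2)"
  then obtain b where b: "b \<in> sph 2" "{a, \<lambda>i. - a i} = {b, \<lambda>i. - b i}"
    by (auto simp: real_projective_space_def topspace_nsphere)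
  then have "b = a \<or> b = (\<lambda>i. - a i)" using antipodal_pair_eq_iff by blast
  then show "based a" using b(1) by (auto simp: sph_def based_def)
next
  assume "based a"
  then have *: "\<forall>i>2. a i = 0" by (simp add: based_def)
  have "(\<Sum>i\<le>6. (a i)\<^sup>2) = (\<Sum>i\<le>2. (a i)\<^sup>2)"
    using * by (intro sum.mono_neutral_right) auto
  then have "a \<in> sph 2" using assms * by (auto simp: sph_def)
  then show "{a, \<lambda>i. - a i} \<in> topspace (real_projective_space 2)"
    by (auto simp: real_projective_space_def topspace_nsphere)
qed

text \<open>Points outside the collapsed subspace are singletons, and the base point is the subspace
  itself; this keeps the two kinds apart.\<close>

lemma topspace_rp2_not_singleton: "{{a, \<lambda>i. - a i}} \<noteq> topspace (real_projective_space 2)"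
proof
  assume *: "{{a, \<lambda>i. - a i}} = topspace (real_projective_space 2)"
  define e where "e = (\<lambda>(k::nat) (i::nat). if i = k then 1 else 0 :: real)"
  have "{e k, \<lambda>i. - e k i} \<in> topspace (real_projective_space 2)" if "k \<le> 2" for k :: nat
  proof -
    have "e k \<in> sph 2" using that by (auto simp: sph_def e_def if_distrib[where f = "\<lambda>x. x ^ 2"] cong: if_cong)
    then show ?thesis by (auto simp: real_projective_space_def topspace_nsphere)
  qed
  from this[of 0] this[of 1] have "{e 0, \<lambda>i. - e 0 i} = {e 1, \<lambda>i. - e 1 i}"
    unfolding *[symmetric] by simp
  then have "e 1 = e 0 \<or> e 1 = (\<lambda>i. - e 0 i)" using antipodal_pair_eq_iff by blast
  then show False by (auto simp: e_def fun_eq_iff split: if_splits)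
qed

lemma based_cong: "a' = a \<or> a' = (\<lambda>i. - a i) \<Longrightarrow> based a \<longleftrightarrow> based a'"
  by (elim disjE) (simp_all add: based_def)

lemma Y_pt_alt:
  assumes "a \<in> sph 6"
  shows "Y_pt a = (if based a then topspace (real_projective_space 2) else {{a, \<lambda>i. - a i}})"
  by (simp only: Y_pt_def based_iff[OF assms])

lemma Y_pt_eq_iff:
  assumes "a \<in> sph 6" "a' \<in> sph 6"
  shows "Y_pt a = Y_pt a' \<longleftrightarrow> (based a \<and> based a') \<or> a' = a \<or> a' = (\<lambda>i. - a i)"
proof -
  define R where "R = topspace (real_projective_space 2)"
  have Y: "Y_pt a = (if based a then R else {{a, \<lambda>i. - a i}})" "Y_pt a' = (if based a' then R else {{a', \<lambda>i. - a' i}})"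
    unfolding R_def by (rule Y_pt_alt[OF assms(1)], rule Y_pt_alt[OF assms(2)])
  have R: "{{a, \<lambda>i. - a i}} \<noteq> R" "R \<noteq> {{a', \<lambda>i. - a' i}}"
    using topspace_rp2_not_singleton unfolding R_def by metis+
  note ap = antipodal_pair_eq_iff[of a a']
  have c: "a' = a \<or> a' = (\<lambda>i. - a i) \<Longrightarrow> based a \<longleftrightarrow> based a'" by (rule based_cong)
  consider "based a" "based a'" | "based a" "\<not> based a'" | "\<not> based a" "based a'" | "\<not> based a" "\<not> based a'"
    by blast
  then show ?thesis
  proof cases
    case 1 then show ?thesis unfolding Y by simp
  next
    case 2 then show ?thesis unfolding Y using R(2) c by auto
  next
    case 3 then show ?thesis unfolding Y using R(1) c by auto
  next
    case 4 then show ?thesis unfolding Y using ap by auto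
  qed
qed

lemma Y_pt_base: "a \<in> sph 6 \<Longrightarrow> Y_pt a = topspace (real_projective_space 2) \<longleftrightarrow> based a"
  using Y_pt_alt topspace_rp2_not_singleton by auto

lemma X_pt_eq_iff:
  assumes "a \<in> sph 6" "a' \<in> sph 6"
  shows "X_pt b a = X_pt b' a' \<longleftrightarrow> (based a \<and> based a') \<or> (b' = b \<and> (a' = a \<or> a' = (\<lambda>i. - a i)))"
proof -
  define R where "R = topspace (real_projective_space 2)"
  have X: "X_pt c x = (if based x then {(False, R), (True, R)} else {(c, Y_pt x)})" if "x \<in> sph 6" for c x
  proof -
    have "(c, Y_pt x) \<in> {(False, R), (True, R)} \<longleftrightarrow> Y_pt x = R" by (cases c) simp_all
    then show ?thesis unfolding X_pt_def Let_def R_def[symmetric] using Y_pt_base[OF that] by (simp add: R_def)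
  qed
  have ne: "{(False, R), (True, R)} \<noteq> {(c, y)}" "{(c, y)} \<noteq> {(False, R), (True, R)}" for c y
    by auto
  have c: "a' = a \<or> a' = (\<lambda>i. - a i) \<Longrightarrow> based a \<longleftrightarrow> based a'" by (rule based_cong)
  note Y = Y_pt_eq_iff[OF assms]
  note X = X[OF assms(1), of b] X[OF assms(2), of b']
  consider "based a" "based a'" | "based a" "\<not> based a'" | "\<not> based a" "based a'" | "\<not> based a" "\<not> based a'"
    by blast
  then show ?thesis
  proof cases
    case 1 then show ?thesis unfolding X by simp
  next
    case 2 then show ?thesis unfolding X using ne(1)[of b' "Y_pt a'"] c by auto
  next
    case 3 then show ?thesis unfolding X using ne(2)[of b "Y_pt a"] c by auto
  next
    case 4
    then have "X_pt b a = X_pt b' a' \<longleftrightarrow> b = b' \<and> Y_pt a = Y_pt a'" unfolding X by simp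
    then show ?thesis unfolding Y using 4 by blast
  qed
qed

lemma X_pt_minus: "a \<in> sph 6 \<Longrightarrow> X_pt b (\<lambda>i. - a i) = X_pt b a"
  by (subst X_pt_eq_iff) (simp_all add: sph_minus)

section \<open>Quotient maps onto the wedge\<close>

lemma continuous_map_from_sum_topology:
  assumes "\<And>i. i \<in> I \<Longrightarrow> continuous_map (X i) Z (\<lambda>x. g (i, x))"
  shows "continuous_map (sum_topology X I) Z g"
  unfolding continuous_map_def
proof (intro conjI allI impI)
  show "g \<in> topspace (sum_topology X I) \<rightarrow> topspace Z"
  proof
    fix y assume "y \<in> topspace (sum_topology X I)"
    then obtain i x where y: "y = (i, x)" "i \<in> I" "x \<in> topspace (X i)" by auto
    then show "g y \<in> topspace Z"
      using continuous_map_image_subset_topspace[OF assms[of i]] by auto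
  qed
  fix U assume U: "openin Z U"
  show "openin (sum_topology X I) {x \<in> topspace (sum_topology X I). g x \<in> U}"
    unfolding openin_sum_topology
  proof (intro conjI ballI)
    fix i assume i: "i \<in> I"
    have "{x. (i, x) \<in> {x \<in> topspace (sum_topology X I). g x \<in> U}} = {x \<in> topspace (X i). g (i, x) \<in> U}"
      using i by auto
    then show "openin (X i) {x. (i, x) \<in> {x \<in> topspace (sum_topology X I). g x \<in> U}}"
      using assms[OF i] U by (simp add: continuous_map_def)
  qed auto
qed

definition Y_quot :: "(nat \<Rightarrow> real) set \<Rightarrow> (nat \<Rightarrow> real) set set" where
  "Y_quot c = (if c \<in> topspace (real_projective_space 2) then topspace (real_projective_space 2) else {c})"

definition X_quot :: "bool \<times> (nat \<Rightarrow> real) set set \<Rightarrow> (bool \<times> (nat \<Rightarrow> real) set set) set" where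
  "X_quot y = (let B = {(False, topspace (real_projective_space 2)), (True, topspace (real_projective_space 2))}
               in if y \<in> B then B else {y})"

lemma quotient_map_RP: "quotient_map (nsphere n) (real_projective_space n) (\<lambda>x. {x, \<lambda>i. - x i})"
  unfolding real_projective_space_def by (rule quotient_map_quotient_topology)

lemma quotient_map_Y: "quotient_map (nsphere 6) Y_space Y_pt"
proof -
  have "quotient_map (real_projective_space 6) Y_space Y_quot"
    unfolding Y_space_def stunted_projective_space_def collapse_def Y_quot_def[abs_def]
    by (rule quotient_map_quotient_topology)
  from quotient_map_compose[OF quotient_map_RP this] show ?thesis
    by (simp add: comp_def Y_quot_def Y_pt_def[abs_def])
qed

lemma quotient_map_X: "quotient_map (sum_topology (\<lambda>b. Y_space) UNIV) X_space X_quot"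
proof -
  have "X_space = quotient_topology (sum_topology (\<lambda>b. Y_space) UNIV) X_quot"
    unfolding X_space_def wedge_def collapse_def X_quot_def[abs_def] Let_def if_cancel ..
  then show ?thesis using quotient_map_quotient_topology by metis
qed

lemma X_quot_Y_pt: "X_quot (b, Y_pt a) = X_pt b a"
  by (simp only: X_quot_def X_pt_def)

lemma continuous_map_X_pt: "continuous_map (top_of_set (sph 6)) X_space (X_pt b)"
proof -
  have "continuous_map Y_space (sum_topology (\<lambda>b. Y_space) UNIV) (\<lambda>y. (b, y))"
    using continuous_map_component_injection[of b UNIV "\<lambda>b. Y_space"] by simp
  from continuous_map_compose[OF continuous_map_compose[OF quotient_imp_continuous_map[OF quotient_map_Y] this]
      quotient_imp_continuous_map[OF quotient_map_X]]
  show ?thesis by (simp add: comp_def X_quot_Y_pt nsphere_eq_top_of_set)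
qed

lemma topspace_X: "topspace X_space = (\<Union>b. X_pt b ` sph 6)"
proof -
  have Y: "topspace Y_space = Y_pt ` sph 6"
    using quotient_imp_surjective_map[OF quotient_map_Y] by (simp add: topspace_nsphere)
  show ?thesis
    unfolding quotient_imp_surjective_map[OF quotient_map_X, symmetric]
    by (auto simp: Y simp flip: X_quot_Y_pt)
qed

lemma X_pt_in: "a \<in> sph 6 \<Longrightarrow> X_pt b a \<in> topspace X_space"
  by (auto simp: topspace_X)

lemma continuous_map_from_X:
  assumes "\<And>b. continuous_map (top_of_set (sph 6)) Z (\<lambda>a. g (X_pt b a))"
  shows "continuous_map X_space Z g"
proof (rule continuous_compose_quotient_map[OF quotient_map_X])
  show "continuous_map (sum_topology (\<lambda>b. Y_space) UNIV) Z (g \<circ> X_quot)"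
  proof (rule continuous_map_from_sum_topology)
    fix b
    show "continuous_map Y_space Z (\<lambda>y. (g \<circ> X_quot) (b, y))"
      by (rule continuous_compose_quotient_map[OF quotient_map_Y])
         (use assms[of b] in \<open>simp add: comp_def X_quot_Y_pt nsphere_eq_top_of_set\<close>)
  qed
qed

section \<open>Lifts and separating functions\<close>

definition e0 :: "nat \<Rightarrow> real" where "e0 = (\<lambda>i. if i = 0 then 1 else 0)"

lemma e0_sph [simp]: "e0 \<in> sph n" "(\<lambda>i. if i = 0 then 1 else 0) \<in> sph n"
  by (auto simp: sph_def e0_def if_distrib[where f = "\<lambda>x. x ^ 2"] cong: if_cong)

text \<open>A choice of lifts for the retraction of the wedge onto its copy \<open>b\<close>: the
  other copy is sent to based vectors. No continuity is claimed.\<close>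

definition X_lift :: "bool \<Rightarrow> (bool \<times> (nat \<Rightarrow> real) set set) set \<Rightarrow> nat \<Rightarrow> real" where
  "X_lift b x = (SOME a. a \<in> sph 6 \<and> (X_pt b a = x \<or> (based a \<and> (\<exists>a'\<in>sph 6. X_pt (\<not> b) a' = x))))"

lemma X_lift_eq:
  assumes a: "a \<in> sph 6"
  shows "X_lift b (X_pt b a) \<in> sph 6 \<and>
      ((based a \<and> based (X_lift b (X_pt b a))) \<or> X_lift b (X_pt b a) = a \<or> X_lift b (X_pt b a) = (\<lambda>i. - a i))"
proof -
  let ?P = "\<lambda>c. c \<in> sph 6 \<and> (X_pt b c = X_pt b a \<or> (based c \<and> (\<exists>a'\<in>sph 6. X_pt (\<not> b) a' = X_pt b a)))"
  have "?P (X_lift b (X_pt b a))"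
    unfolding X_lift_def by (rule someI[of ?P a]) (simp add: a)
  then have L: "X_lift b (X_pt b a) \<in> sph 6" and
    "X_pt b a = X_pt b (X_lift b (X_pt b a)) \<or> (based (X_lift b (X_pt b a)) \<and> (\<exists>a'\<in>sph 6. X_pt (\<not> b) a' = X_pt b a))"
    by auto
  then show ?thesis
  proof (elim disjE)
    assume "X_pt b a = X_pt b (X_lift b (X_pt b a))"
    then show ?thesis using L unfolding X_pt_eq_iff[OF a L] by blast
  next
    assume *: "based (X_lift b (X_pt b a)) \<and> (\<exists>a'\<in>sph 6. X_pt (\<not> b) a' = X_pt b a)"
    then obtain a' where a': "a' \<in> sph 6" "X_pt (\<not> b) a' = X_pt b a" by blast
    then have "based a" using X_pt_eq_iff[OF a'(1) a, of "\<not> b" b] by simp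
    then show ?thesis using * L by simp
  qed
qed

lemma X_lift_other:
  assumes a: "a \<in> sph 6"
  shows "X_lift b (X_pt (\<not> b) a) \<in> sph 6 \<and> based (X_lift b (X_pt (\<not> b) a))"
proof -
  let ?P = "\<lambda>c. c \<in> sph 6 \<and> (X_pt b c = X_pt (\<not> b) a \<or> (based c \<and> (\<exists>a'\<in>sph 6. X_pt (\<not> b) a' = X_pt (\<not> b) a)))"
  have "?P (X_lift b (X_pt (\<not> b) a))"
    unfolding X_lift_def by (rule someI[of ?P e0]) (use a in \<open>auto simp: e0_def based_def\<close>)
  then have L: "X_lift b (X_pt (\<not> b) a) \<in> sph 6" and
    "X_pt (\<not> b) a = X_pt b (X_lift b (X_pt (\<not> b) a)) \<or> based (X_lift b (X_pt (\<not> b) a))"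
    by auto
  then show ?thesis using X_pt_eq_iff[OF a L, of "\<not> b" b] by (elim disjE) simp_all
qed

lemma X_lift_sph: "x \<in> topspace X_space \<Longrightarrow> X_lift b x \<in> sph 6"
proof -
  assume "x \<in> topspace X_space"
  then obtain c a where a: "a \<in> sph 6" "x = X_pt c a" by (auto simp: topspace_X)
  show "X_lift b x \<in> sph 6"
  proof (cases "c = b")
    case True
    then show ?thesis using X_lift_eq[OF a(1)] a(2) by simp
  next
    case False
    then have "c = (\<not> b)" by auto
    then show ?thesis using X_lift_other[OF a(1)] a(2) by simp
  qed
qed

text \<open>For \<open>i > 2\<close> the product is even in the lift and vanishes on based vectors.
  It is therefore independent of the choices in \<open>X_lift\<close> and continuous, although the
  lift itself is arbitrary.\<close>

definition X_coord :: "bool \<Rightarrow> nat \<Rightarrow> nat \<Rightarrow> (bool \<times> (nat \<Rightarrow> real) set set) set \<Rightarrow> real" where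
  "X_coord b i j x = X_lift b x i * X_lift b x j"

lemma X_coord_eq: "a \<in> sph 6 \<Longrightarrow> i > 2 \<Longrightarrow> X_coord b i j (X_pt b a) = a i * a j"
  using X_lift_eq[of a b] by (auto simp: X_coord_def based_def)

lemma X_coord_other: "a \<in> sph 6 \<Longrightarrow> i > 2 \<Longrightarrow> X_coord b i j (X_pt (\<not> b) a) = 0"
  using X_lift_other[of a b] by (auto simp: X_coord_def based_def)

lemma continuous_map_X_coord:
  assumes "i > 2" shows "continuous_map X_space euclideanreal (X_coord b i j)"
proof (rule continuous_map_from_X)
  fix b'
  show "continuous_map (top_of_set (sph 6)) euclideanreal (\<lambda>a. X_coord b i j (X_pt b' a))"
  proof (cases "b' = b")
    case True
    have "continuous_map (top_of_set (sph 6)) euclideanreal (\<lambda>a. a i * a j)"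
      unfolding continuous_map_iff_continuous
      by (rule continuous_on_mult[OF continuous_on_apply continuous_on_apply])
    then show ?thesis
      by (rule continuous_map_eq) (use True assms in \<open>simp add: X_coord_eq\<close>)
  next
    case False
    then have "b' = (\<not> b)" by auto
    have "continuous_map (top_of_set (sph 6)) euclideanreal (\<lambda>a. 0)" by simp
    then show ?thesis
      by (rule continuous_map_eq) (use \<open>b' = (\<not> b)\<close> assms in \<open>simp add: X_coord_other\<close>)
  qed
qed

text \<open>Some \<open>a i\<close> with \<open>i > 2\<close> is nonzero. Its square fixes
  \<open>a' i\<close> up to sign, and the products with it then fix all other coordinates.\<close>

lemma tail_products_determine:
  assumes "a \<in> sph 6" "a' \<in> sph 6" "\<And>i j. i > 2 \<Longrightarrow> a i * a j = a' i * a' j" "\<not> based a"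
  shows "a' = a \<or> a' = (\<lambda>i. - a i)"
proof -
  obtain i where i: "i > 2" "a i \<noteq> 0" using assms(4) by (auto simp: based_def)
  have "a' i = a i \<or> a' i = - a i"
    using assms(3)[of i i] i by (metis power2_eq_iff power2_eq_square)
  then show ?thesis
  proof
    assume e: "a' i = a i"
    have "a' j = a j" for j using assms(3)[OF i(1), of j] i(2) by (simp add: e)
    then show ?thesis by (simp add: fun_eq_iff)
  next
    assume e: "a' i = - a i"
    have "a' j = - a j" for j
    proof -
      have "a i * a j = a i * (- a' j)" using assms(3)[OF i(1), of j] e by simp
      then have "a j = - a' j" using i(2) mult_left_cancel by blast
      then show ?thesis by linarith
    qed
    then show ?thesis by (simp add: fun_eq_iff)
  qed
qed

text \<open>The functions \<open>X_coord\<close> separate points: within a copy by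
  \<open>tail_products_determine\<close>, between the copies because the functions of one copy
  vanish on the other.\<close>

lemma Hausdorff_X: "Hausdorff_space X_space"
  unfolding Hausdorff_space_def
proof (intro allI impI)
  fix x y assume xy: "x \<in> topspace X_space \<and> y \<in> topspace X_space \<and> x \<noteq> y"
  obtain b a where x: "a \<in> sph 6" "x = X_pt b a" using xy by (auto simp: topspace_X)
  obtain b' a' where y: "a' \<in> sph 6" "y = X_pt b' a'" using xy by (auto simp: topspace_X)
  have ne: "X_pt b a \<noteq> X_pt b' a'" using xy x y by simp
  have "\<exists>c i j. i > 2 \<and> X_coord c i j x \<noteq> X_coord c i j y"
  proof (rule ccontr)
    assume "\<not> ?thesis"
    then have *: "X_coord c i j x = X_coord c i j y" if "i > 2" for c i j using that by blast
    show False
    proof (cases "b' = b")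
      case True
      have "a i * a j = a' i * a' j" if "i > 2" for i j
        using *[OF that, of b j] x y True X_coord_eq[OF _ that] by simp
      then have "\<not> based a \<Longrightarrow> a' = a \<or> a' = (\<lambda>i. - a i)" "\<not> based a' \<Longrightarrow> a = a' \<or> a = (\<lambda>i. - a' i)"
        using tail_products_determine[OF x(1) y(1)] tail_products_determine[OF y(1) x(1)] by simp_all
      moreover have "a = (\<lambda>i. - a' i) \<Longrightarrow> a' = (\<lambda>i. - a i)" by simp
      ultimately show False
        using ne unfolding X_pt_eq_iff[OF x(1) y(1)] True by blast
    next
      case False
      then have b': "b' = (\<not> b)" "b = (\<not> b')" by auto
      have "a i * a i = 0" if "i > 2" for i
        using *[OF that, of b i] x y X_coord_eq[OF x(1) that, of b i] X_coord_other[OF y(1) that, of b i] b'(1) by simp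
      moreover have "a' i * a' i = 0" if "i > 2" for i
        using *[OF that, of b' i] x y X_coord_eq[OF y(1) that, of b' i] X_coord_other[OF x(1) that, of b' i] b'(2) by simp
      ultimately show False using ne unfolding X_pt_eq_iff[OF x(1) y(1)] based_def by auto
    qed
  qed
  then obtain c i j where f: "i > 2" "X_coord c i j x \<noteq> X_coord c i j y" by blast
  let ?f = "X_coord c i j"
  obtain U V where UV: "open U" "open V" "?f x \<in> U" "?f y \<in> V" "U \<inter> V = {}"
    using hausdorff[OF f(2)] by blast
  show "\<exists>U V. openin X_space U \<and> openin X_space V \<and> x \<in> U \<and> y \<in> V \<and> disjnt U V"
  proof (intro exI conjI)
    show "openin X_space {z \<in> topspace X_space. ?f z \<in> U}" "openin X_space {z \<in> topspace X_space. ?f z \<in> V}"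
      using openin_continuous_map_preimage[OF continuous_map_X_coord[OF f(1)]] UV by auto
  qed (use UV xy in \<open>auto simp: disjnt_def\<close>)
qed

text \<open>The fallback to the first nonzero coordinate makes the sign odd on all nonzero vectors.\<close>

definition sg :: "nat \<Rightarrow> (nat \<Rightarrow> real) \<Rightarrow> bit" where
  "sg i a = of_bool (if a i \<noteq> 0 then a i < 0 else a (LEAST j. a j \<noteq> 0) < 0)"

lemma odd_fun_sg: "odd_fun (sg i)"
  unfolding odd_fun_def
proof (intro allI impI)
  fix a :: "nat \<Rightarrow> real" assume "a \<noteq> (\<lambda>_. 0)"
  then have "\<exists>j. a j \<noteq> 0" by auto
  then have nz: "a (LEAST j. a j \<noteq> 0) \<noteq> 0" by (rule LeastI_ex)
  have m: "(LEAST j. - a j \<noteq> 0) = (LEAST j. a j \<noteq> 0)" by simp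
  show "sg i (\<lambda>i. - a i) = sg i a + 1"
    unfolding sg_def m using nz by (auto simp: not_less less_le)
qed

lemma sg_minus: "a \<in> sph n \<Longrightarrow> sg i (\<lambda>i. - a i) = sg i a + 1"
  using odd_fun_sg[of i] sph_nonzero unfolding odd_fun_def by blast

lemma sg_eq: "a i * b i > 0 \<Longrightarrow> sg i a = sg i b"
  by (auto simp: sg_def zero_less_mult_iff)

lemma mult_pos_of_close:
  fixes x y c :: real
  assumes "\<bar>x - c\<bar> < \<bar>c\<bar>" "\<bar>y - c\<bar> < \<bar>c\<bar>" shows "x * y > 0"
proof (cases "c > 0")
  case True
  then have "x > 0" "y > 0" using assms by auto
  then show ?thesis by simp
next
  case False
  then have "x < 0" "y < 0" using assms by auto
  then show ?thesis by (simp add: mult_neg_neg)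
qed

section \<open>The class of degree three\<close>

definition ip :: "(nat \<Rightarrow> real) \<Rightarrow> (nat \<Rightarrow> real) \<Rightarrow> real" where
  "ip a b = (\<Sum>j\<le>6. a j * b j)"

text \<open>On \<open>S^6\<close> this vanishes exactly over the base point and serves as a distance
  from it.\<close>

definition tailsq :: "(nat \<Rightarrow> real) \<Rightarrow> real" where
  "tailsq a = (\<Sum>i\<in>{3..6}. (a i)\<^sup>2)"

text \<open>Closeness of the points represented, expressed by the functions \<open>X_coord\<close>
  on lifts. The tolerance is small against the gap between the thresholds 1/4 and 1/2 for
  \<open>tailsq\<close>.\<close>

definition yclose :: "(nat \<Rightarrow> real) \<Rightarrow> (nat \<Rightarrow> real) \<Rightarrow> bool" where
  "yclose a b \<longleftrightarrow> (\<forall>i\<in>{3..6}. \<forall>j\<le>6. \<bar>a i * a j - b i * b j\<bar> < 1/100)"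

definition xi :: "nat \<Rightarrow> (nat \<Rightarrow> real) \<Rightarrow> (nat \<Rightarrow> real) \<Rightarrow> bit" where
  "xi i a b = sg i a + sg i b + of_bool (ip a b < 0)"

definition edge3 :: "(nat \<Rightarrow> real) coch" where
  "edge3 t = (sg 0 (t 0) + sg 0 (t 1)) * ((sg 1 (t 1) + sg 1 (t 2)) * (sg 2 (t 2) + sg 2 (t 3)))"

text \<open>
  The cube of the generator of the first cohomology of the projective space. The sign of the inner
  product in \<open>xi\<close> makes the value independent of the chosen lifts of a fine tuple.
  Near the subspace \<open>tailsq = 0\<close>, where the cube vanishes on fine tuples, it is
  replaced by zero.
\<close>

definition stunted_cocycle :: "(nat \<Rightarrow> real) coch" where
  "stunted_cocycle s = (if \<exists>j\<le>3. tailsq (s j) \<le> 1/4 then 0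
     else xi 0 (s 0) (s 1) * (xi 1 (s 1) (s 2) * xi 2 (s 2) (s 3)))"

lemma ip_minus [simp]: "ip (\<lambda>i. - a i) b = - ip a b" "ip a (\<lambda>i. - b i) = - ip a b"
  by (auto simp: ip_def sum_negf)

lemma ip_self: "a \<in> sph 6 \<Longrightarrow> ip a a = 1"
  by (simp add: ip_def sph_def power2_eq_square)

lemma tailsq_minus [simp]: "tailsq (\<lambda>i. - a i) = tailsq a"
  by (simp add: tailsq_def)

lemma tailsq_based: "based a \<Longrightarrow> tailsq a = 0"
  by (auto simp: tailsq_def based_def)

lemma dist_sq_ip:
  assumes "a \<in> sph 6" "b \<in> sph 6"
  shows "(\<Sum>j\<le>6. (a j - b j)\<^sup>2) = 2 - 2 * ip a b"
proof -
  have "(\<Sum>j\<le>6. (a j - b j)\<^sup>2) = (\<Sum>j\<le>6. (a j)\<^sup>2) + (\<Sum>j\<le>6. (b j)\<^sup>2) - 2 * ip a b"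
    by (simp add: ip_def power2_diff sum.distrib sum_subtractf sum_distrib_left mult.assoc)
  then show ?thesis using assms by (simp add: sph_def)
qed

lemma coord_close_of_ip:
  assumes "a \<in> sph 6" "b \<in> sph 6" "ip a b \<ge> 99/100" "i \<le> 6"
  shows "\<bar>a i - b i\<bar> < 2/10"
proof -
  have "(a i - b i)\<^sup>2 \<le> (\<Sum>j\<le>6. (a j - b j)\<^sup>2)"
    using assms(4) by (intro member_le_sum) auto
  also have "\<dots> < (2/10)\<^sup>2"
    unfolding dist_sq_ip[OF assms(1,2)] using assms(3) by (simp add: power2_eq_square)
  finally show ?thesis by (metis abs_le_square_iff abs_numeral not_less abs_divide)
qed

text \<open>The squared distances from \<open>a\<close> are at most 2/100, so the one between
  \<open>b\<close> and \<open>c\<close> is at most 8/100, while orthogonal unit vectors have squared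
  distance 2.\<close>

lemma ip_triple:
  assumes "a \<in> sph 6" "b \<in> sph 6" "c \<in> sph 6" "ip a b \<ge> 99/100" "ip a c \<ge> 99/100"
  shows "ip b c > 0"
proof -
  have "(\<Sum>j\<le>6. (b j - c j)\<^sup>2) \<le> (\<Sum>j\<le>6. 2 * (a j - b j)\<^sup>2 + 2 * (a j - c j)\<^sup>2)"
  proof (rule sum_mono)
    fix j
    have "0 \<le> ((a j - b j) + (a j - c j))\<^sup>2" by simp
    then show "(b j - c j)\<^sup>2 \<le> 2 * (a j - b j)\<^sup>2 + 2 * (a j - c j)\<^sup>2"
      by (simp add: power2_eq_square algebra_simps)
  qed
  also have "\<dots> = 2 * (\<Sum>j\<le>6. (a j - b j)\<^sup>2) + 2 * (\<Sum>j\<le>6. (a j - c j)\<^sup>2)"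
    by (simp add: sum.distrib sum_distrib_left)
  finally show ?thesis
    using assms by (simp add: dist_sq_ip)
qed

text \<open>Expanding the sum of the 28 squares gives
  \<open>tailsq a + tailsq b - 2 * (P * ip a b)\<close>, and \<open>2 * \<bar>P\<bar>\<close> is at
  most \<open>tailsq a + tailsq b\<close>. If the inner product were below 99/100 in absolute value,
  then \<open>tailsq a + tailsq b\<close> would be at most 28/100, but it exceeds 1/2.\<close>

lemma ip_of_yclose:
  assumes "a \<in> sph 6" "b \<in> sph 6" "yclose a b" "tailsq a > 1/4" "tailsq b > 1/4"
  shows "\<bar>ip a b\<bar> \<ge> 99/100"
proof -
  define P where "P = (\<Sum>i\<in>{3..6}. a i * b i)"
  have na: "(\<Sum>j\<le>6. (a j)\<^sup>2) = 1" "(\<Sum>j\<le>6. (b j)\<^sup>2) = 1" using assms by (auto simp: sph_def)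
  have "(\<Sum>i\<in>{3..6}. \<Sum>j\<le>6. (a i * a j - b i * b j)\<^sup>2) =
        (\<Sum>i\<in>{3..6}. \<Sum>j\<le>6. (a i)\<^sup>2 * (a j)\<^sup>2) + (\<Sum>i\<in>{3..6}. \<Sum>j\<le>6. (b i)\<^sup>2 * (b j)\<^sup>2)
          - 2 * (\<Sum>i\<in>{3..6}. \<Sum>j\<le>6. (a i * b i) * (a j * b j))"
    unfolding sum_distrib_left sum.distrib[symmetric] sum_subtractf[symmetric]
    by (intro sum.cong refl) (simp add: power2_eq_square algebra_simps)
  also have "\<dots> = tailsq a * 1 + tailsq b * 1 - 2 * (P * ip a b)"
    unfolding sum_product[symmetric] na tailsq_def P_def ip_def ..
  finally have S: "(\<Sum>i\<in>{3..6}. \<Sum>j\<le>6. (a i * a j - b i * b j)\<^sup>2) = tailsq a + tailsq b - 2 * (P * ip a b)"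
    by simp
  have "(\<Sum>i\<in>{3..6::nat}. \<Sum>j\<le>6::nat. (a i * a j - b i * b j)\<^sup>2) \<le> (\<Sum>i\<in>{3..6::nat}. \<Sum>j\<le>6::nat. (1/100)\<^sup>2)"
  proof (intro sum_mono)
    fix i j :: nat assume "i \<in> {3..6}" "j \<in> {..6}"
    then have "\<bar>a i * a j - b i * b j\<bar> < 1/100" using assms(3) by (auto simp: yclose_def)
    then show "(a i * a j - b i * b j)\<^sup>2 \<le> (1/100)\<^sup>2" by (metis abs_le_square_iff less_imp_le abs_of_nonneg zero_le_divide_1_iff zero_le_numeral)
  qed
  also have "\<dots> = 28 / 10000" by (simp add: power2_eq_square)
  finally have le: "tailsq a + tailsq b - 28/10000 \<le> 2 * (P * ip a b)" using S by linarith
  have "2 * \<bar>P\<bar> \<le> tailsq a + tailsq b"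
  proof -
    have "\<bar>P\<bar> \<le> (\<Sum>i\<in>{3..6}. \<bar>a i * b i\<bar>)" unfolding P_def by (rule sum_abs)
    also have "\<dots> \<le> (\<Sum>i\<in>{3..6}. ((a i)\<^sup>2 + (b i)\<^sup>2) / 2)"
    proof (rule sum_mono)
      fix i
      have "0 \<le> (\<bar>a i\<bar> - \<bar>b i\<bar>)\<^sup>2" by simp
      then show "\<bar>a i * b i\<bar> \<le> ((a i)\<^sup>2 + (b i)\<^sup>2) / 2" by (simp add: power2_diff abs_mult)
    qed
    also have "\<dots> = (tailsq a + tailsq b) / 2"
      by (simp add: tailsq_def sum.distrib sum_divide_distrib[symmetric])
    finally show ?thesis by simp
  qed
  show ?thesis
  proof (rule ccontr)
    assume "\<not> ?thesis"
    then have lt: "\<bar>ip a b\<bar> \<le> 99/100" by simp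
    have "2 * (P * ip a b) \<le> (2 * \<bar>P\<bar>) * \<bar>ip a b\<bar>"
      by (metis abs_ge_self abs_mult mult.assoc abs_numeral)
    also have "\<dots> \<le> (tailsq a + tailsq b) * (99/100)"
      using \<open>2 * \<bar>P\<bar> \<le> tailsq a + tailsq b\<close> lt assms(4,5) by (intro mult_mono) auto
    finally show False using le assms(4,5) by simp
  qed
qed

lemma tailsq_yclose: "yclose a b \<Longrightarrow> \<bar>tailsq a - tailsq b\<bar> \<le> 4/100"
proof -
  assume y: "yclose a b"
  have "\<bar>tailsq a - tailsq b\<bar> = \<bar>\<Sum>i\<in>{3..6}. a i * a i - b i * b i\<bar>"
    by (simp add: tailsq_def sum_subtractf power2_eq_square)
  also have "\<dots> \<le> (\<Sum>i\<in>{3..6}. \<bar>a i * a i - b i * b i\<bar>)" by (rule sum_abs)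
  also have "\<dots> \<le> (\<Sum>i\<in>{3..6::nat}. 1/100)"
  proof (rule sum_mono)
    fix i :: nat assume "i \<in> {3..6}"
    then have "\<bar>a i * a i - b i * b i\<bar> < 1/100" using y unfolding yclose_def by auto
    then show "\<bar>a i * a i - b i * b i\<bar> \<le> 1/100" by simp
  qed
  also have "\<dots> = 4/100" by simp
  finally show ?thesis .
qed

text \<open>The first three squares sum to at least 1/2, which exceeds three times 16/100.\<close>

lemma head_coordinate_large:
  assumes "a \<in> sph 6" "tailsq a \<le> 1/2"
  obtains i where "i < 3" "\<bar>a i\<bar> \<ge> 4/10"
proof (rule ccontr)
  assume "\<not> thesis"
  then have lt: "\<bar>a i\<bar> < 4/10" if "i < 3" for i using that \<open>\<And>i. \<lbrakk>i < 3; 4/10 \<le> \<bar>a i\<bar>\<rbrakk> \<Longrightarrow> thesis\<close> not_less by blast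
  have "{..6::nat} = {..<3} \<union> {3..6}" by auto
  moreover have "(\<Sum>j\<in>{..<3} \<union> {3..6::nat}. (a j)\<^sup>2) = (\<Sum>j<3. (a j)\<^sup>2) + (\<Sum>j\<in>{3..6}. (a j)\<^sup>2)"
    by (rule sum.union_disjoint) auto
  ultimately have "1 = (\<Sum>i<3. (a i)\<^sup>2) + tailsq a"
    using assms(1) by (simp add: sph_def tailsq_def)
  moreover have "(\<Sum>i<3::nat. (a i)\<^sup>2) \<le> (\<Sum>i<3::nat. (4/10)\<^sup>2)"
  proof (rule sum_mono)
    fix i :: nat assume "i \<in> {..<3}"
    then have "\<bar>a i\<bar> \<le> \<bar>4/10\<bar>" using lt[of i] by simp
    then show "(a i)\<^sup>2 \<le> (4/10)\<^sup>2" using abs_le_square_iff by blast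
  qed
  ultimately show False using assms(2) by (simp add: power2_eq_square)
qed

text \<open>Every point is replaced by the one of its two signs that is close to \<open>s 0\<close>.
  For such lifts all inner products are positive, and \<open>xi\<close> becomes a plain sign
  change.\<close>

lemma align:
  fixes s :: "nat \<Rightarrow> nat \<Rightarrow> real"
  assumes s: "\<And>j. j \<le> n \<Longrightarrow> s j \<in> sph 6" and c: "\<And>j k. j \<le> n \<Longrightarrow> k \<le> n \<Longrightarrow> \<bar>ip (s j) (s k)\<bar> \<ge> 99/100"
  obtains t where "\<And>j. j \<le> n \<Longrightarrow> t j \<in> sph 6" "\<And>j k. j \<le> n \<Longrightarrow> k \<le> n \<Longrightarrow> ip (t j) (t k) \<ge> 99/100"
    "\<And>i j k. j \<le> n \<Longrightarrow> k \<le> n \<Longrightarrow> xi i (s j) (s k) = sg i (t j) + sg i (t k)" "t 0 = s 0"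
proof -
  define t where "t = (\<lambda>j. if ip (s 0) (s j) < 0 then (\<lambda>i. - s j i) else s j)"
  have t: "t j \<in> sph 6" if "j \<le> n" for j using s[OF that] by (auto simp: t_def sph_minus)
  have t0: "ip (s 0) (t j) \<ge> 99/100" if "j \<le> n" for j using c[of 0 j] that by (auto simp: t_def)
  have pos: "ip (t j) (t k) > 0" if "j \<le> n" "k \<le> n" for j k
    by (rule ip_triple[of "s 0"]) (use that s[of 0] t t0 in auto)
  have ip: "ip (t j) (t k) \<ge> 99/100" if "j \<le> n" "k \<le> n" for j k
    using pos[OF that] c[OF that] by (auto simp: t_def split: if_splits)
  have "xi i (s j) (s k) = sg i (t j) + sg i (t k)" if "j \<le> n" "k \<le> n" for i j k
  proof -
    have "ip (s j) (s k) \<noteq> 0" using c[OF that] by auto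
    then show ?thesis
      using pos[OF that] s[OF that(1)] s[OF that(2)]
      by (auto simp: xi_def t_def sg_minus ac_simps split: if_splits)
  qed
  moreover have "t 0 = s 0" using ip_self[OF s[of 0]] by (simp add: t_def)
  ultimately show ?thesis using that t ip by blast
qed

lemma edge3_eq_word: "edge3 (\<lambda>i. s i \<alpha>) = word [(\<alpha>, sg 0), (\<alpha>, sg 1), (\<alpha>, sg 2)] s"
  by (simp add: edge3_def cup_def numeral_2_eq_2 numeral_3_eq_3)

lemma cobd_edge3: "cobd 4 edge3 t = 0"
proof -
  have "cobd 4 edge3 t = cobd 4 (word [(0, sg 0), (0, sg 1), (0, sg 2)]) (\<lambda>i (\<alpha>::nat). t i)"
    unfolding cobd_def edge3_eq_word[symmetric] by (simp add: face_def if_distrib[where f = "\<lambda>f. f _"])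
  also have "\<dots> = 0"
    using cobd_word[of "[(0, sg 0), (0, sg 1), (0, sg 2)]"] by (simp add: eval_nat_numeral)
  finally show ?thesis .
qed

text \<open>Near the base point one of the first three coordinates is large, hence of constant sign
  on aligned lifts: they vary by less than 2/10, and it is at least 4/10. The corresponding factor
  vanishes.\<close>

lemma xi_product_zero:
  fixes s :: "nat \<Rightarrow> nat \<Rightarrow> real"
  assumes s: "\<And>j. j \<le> 3 \<Longrightarrow> s j \<in> sph 6" and y: "\<And>j k. j \<le> 3 \<Longrightarrow> k \<le> 3 \<Longrightarrow> yclose (s j) (s k)"
    and off: "\<And>j. j \<le> 3 \<Longrightarrow> tailsq (s j) > 1/4" and half: "tailsq (s 0) \<le> 1/2"
  shows "xi 0 (s 0) (s 1) * (xi 1 (s 1) (s 2) * xi 2 (s 2) (s 3)) = 0"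
proof -
  have c: "\<bar>ip (s j) (s k)\<bar> \<ge> 99/100" if "j \<le> 3" "k \<le> 3" for j k
    by (rule ip_of_yclose[OF s s y off off]) (use that in auto)
  obtain t where t: "\<And>j. j \<le> 3 \<Longrightarrow> t j \<in> sph 6" "\<And>j k. j \<le> 3 \<Longrightarrow> k \<le> 3 \<Longrightarrow> ip (t j) (t k) \<ge> 99/100"
    "\<And>i j k. j \<le> 3 \<Longrightarrow> k \<le> 3 \<Longrightarrow> xi i (s j) (s k) = sg i (t j) + sg i (t k)" "t 0 = s 0"
    using align[where s = s and n = 3, OF s c] by blast
  obtain i where i: "i < 3" "\<bar>s 0 i\<bar> \<ge> 4/10" using head_coordinate_large[OF s[of 0] half] by auto
  have cl: "\<bar>t j i - s 0 i\<bar> < \<bar>s 0 i\<bar>" if "j \<le> 3" for j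
    using coord_close_of_ip[OF t(1)[OF that] t(1)[of 0] t(2)[OF that], of i] i t(4) by auto
  have eq: "sg i (t j) = sg i (t k)" if "j \<le> 3" "k \<le> 3" for j k
    by (rule sg_eq) (rule mult_pos_of_close[OF cl[OF that(1)] cl[OF that(2)]])
  have "xi i (s j) (s k) = 0" if "j \<le> 3" "k \<le> 3" for j k
    unfolding t(3)[OF that] eq[OF that] by simp
  then show ?thesis using i(1) by (auto simp: less_Suc_eq numeral_3_eq_3 numeral_2_eq_2)
qed

text \<open>If some point has \<open>tailsq\<close> at most 1/4, then all have at most 1/4 + 4/100,
  and every face vanishes, by definition or by \<open>xi_product_zero\<close>. Otherwise aligned
  lifts turn all faces into \<open>edge3\<close>, which is a cocycle.\<close>

lemma stunted_cocycle_closed: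
  fixes s :: "nat \<Rightarrow> nat \<Rightarrow> real"
  assumes s: "\<And>j. j \<le> 4 \<Longrightarrow> s j \<in> sph 6" and y: "\<And>j k. j \<le> 4 \<Longrightarrow> k \<le> 4 \<Longrightarrow> yclose (s j) (s k)"
  shows "cobd 4 stunted_cocycle s = 0"
proof (cases "\<exists>j\<le>4. tailsq (s j) \<le> 1/4")
  case True
  then obtain m where m: "m \<le> 4" "tailsq (s m) \<le> 1/4" by blast
  have half: "tailsq (s j) \<le> 1/2" if "j \<le> 4" for j
    using tailsq_yclose[OF y[OF that m(1)]] m(2) by linarith
  have "stunted_cocycle (face l s) = 0" for l
  proof (cases "\<exists>j\<le>3. tailsq (face l s j) \<le> 1/4")
    case False
    have f: "\<exists>m\<le>4. face l s j = s m" if "j \<le> 3" for j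
      using that by (auto simp: face_def intro: exI[of _ j] exI[of _ "Suc j"])
    have "xi 0 (face l s 0) (face l s 1) * (xi 1 (face l s 1) (face l s 2) * xi 2 (face l s 2) (face l s 3)) = 0"
    proof (rule xi_product_zero)
      show "face l s j \<in> sph 6" if "j \<le> 3" for j using f[OF that] s by auto
      show "yclose (face l s j) (face l s k)" if "j \<le> 3" "k \<le> 3" for j k
        using f[OF that(1)] f[OF that(2)] y by auto
      show "tailsq (face l s j) > 1/4" if "j \<le> 3" for j using False that by auto
      show "tailsq (face l s 0) \<le> 1/2" using f[of 0] half by auto
    qed
    then show ?thesis by (simp add: stunted_cocycle_def)
  qed (simp add: stunted_cocycle_def)
  then show ?thesis by (simp add: cobd_def)
next
  case False
  then have off: "tailsq (s j) > 1/4" if "j \<le> 4" for j using that by auto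
  have c: "\<bar>ip (s j) (s k)\<bar> \<ge> 99/100" if "j \<le> 4" "k \<le> 4" for j k
    by (rule ip_of_yclose[OF s s y off off]) (use that in auto)
  obtain t where "\<And>j. j \<le> 4 \<Longrightarrow> t j \<in> sph 6" "\<And>j k. j \<le> 4 \<Longrightarrow> k \<le> 4 \<Longrightarrow> ip (t j) (t k) \<ge> 99/100"
    and t: "\<And>i j k. j \<le> 4 \<Longrightarrow> k \<le> 4 \<Longrightarrow> xi i (s j) (s k) = sg i (t j) + sg i (t k)" and "t 0 = s 0"
    using align[where s = s and n = 4, OF s c] by blast
  have "stunted_cocycle (face l s) = edge3 (face l t)" if "l \<le> 4" for l
  proof -
    have "xi i (face l s j) (face l s k) = sg i (face l t j) + sg i (face l t k)" if "j \<le> 3" "k \<le> 3" for i j k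
      using that by (auto simp: face_def t)
    moreover have "tailsq (face l s j) > 1/4" if "j \<le> 3" for j
      using off[of j] off[of "Suc j"] that by (simp add: face_def)
    then have "\<not> (\<exists>j\<le>3. tailsq (face l s j) \<le> 1/4)" by force
    ultimately show ?thesis
      unfolding stunted_cocycle_def edge3_def by (simp only: if_False, simp?)
  qed
  then have "cobd 4 stunted_cocycle s = cobd 4 edge3 t" by (simp add: cobd_def)
  then show ?thesis by (simp add: cobd_edge3)
qed

text \<open>On a fine tuple \<open>t\<close> of the sphere the class is the plain product of sign
  changes, whatever lifts \<open>s\<close> are chosen. This connects the class on the wedge with
  words on hemisphere chains.\<close>

lemma stunted_cocycle_eq_edge3:
  fixes s :: "nat \<Rightarrow> nat \<Rightarrow> real"
  assumes t: "\<And>j. j \<le> 3 \<Longrightarrow> t j \<in> sph 6" and cl: "\<And>i j k. j \<le> 3 \<Longrightarrow> k \<le> 3 \<Longrightarrow> \<bar>t j i - t k i\<bar> < 1/100"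
    and s: "\<And>j. j \<le> 3 \<Longrightarrow> (based (t j) \<and> based (s j)) \<or> s j = t j \<or> s j = (\<lambda>i. - t j i)"
  shows "stunted_cocycle s = edge3 t"
proof -
  have tl: "tailsq (s j) = tailsq (t j)" if "j \<le> 3" for j
    using s[OF that] tailsq_based by auto
  show ?thesis
  proof (cases "\<exists>j\<le>3. tailsq (t j) \<le> 1/4")
    case True
    then obtain m where m: "m \<le> 3" "tailsq (t m) \<le> 1/4" by blast
    then obtain i where i: "i < 3" "\<bar>t m i\<bar> \<ge> 4/10" using head_coordinate_large[OF t[OF m(1)]] by auto
    have cl: "\<bar>t j i - t m i\<bar> < \<bar>t m i\<bar>" if "j \<le> 3" for j
      using cl[OF that m(1), of i] i(2) by linarith
    have eq: "sg i (t j) = sg i (t k)" if "j \<le> 3" "k \<le> 3" for j k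
      by (rule sg_eq) (rule mult_pos_of_close[OF cl[OF that(1)] cl[OF that(2)]])
    have "sg i (t j) + sg i (t k) = 0" if "j \<le> 3" "k \<le> 3" for j k
      unfolding eq[OF that] by simp
    then have "edge3 t = 0"
      using i(1) by (auto simp: edge3_def less_Suc_eq numeral_3_eq_3 numeral_2_eq_2)
    moreover have "stunted_cocycle s = 0" using m tl by (auto simp: stunted_cocycle_def)
    ultimately show ?thesis by simp
  next
    case False
    then have off: "tailsq (t j) > 1/4" if "j \<le> 3" for j using that by auto
    have ipos: "ip (t j) (t k) > 0" if "j \<le> 3" "k \<le> 3" for j k
    proof -
      have "(\<Sum>i\<le>6::nat. (t j i - t k i)\<^sup>2) \<le> (\<Sum>i\<le>6::nat. (1/100)\<^sup>2)"
      proof (rule sum_mono)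
        fix i
        have "\<bar>t j i - t k i\<bar> \<le> \<bar>1/100\<bar>" using cl[OF that, of i] by simp
        then show "(t j i - t k i)\<^sup>2 \<le> (1/100)\<^sup>2" using abs_le_square_iff by blast
      qed
      then show ?thesis using dist_sq_ip[OF t[OF that(1)] t[OF that(2)]] by (simp add: power2_eq_square)
    qed
    have s': "s j = t j \<or> s j = (\<lambda>i. - t j i)" if "j \<le> 3" for j
      using s[OF that] off[OF that] tailsq_based[of "t j"] by auto
    have "xi i (s j) (s k) = sg i (t j) + sg i (t k)" if "j \<le> 3" "k \<le> 3" for i j k
      using s'[OF that(1)] s'[OF that(2)] ipos[OF that] t[OF that(1)] t[OF that(2)]
      by (auto simp: xi_def sg_minus ac_simps)
    moreover have "\<not> (\<exists>j\<le>3. tailsq (s j) \<le> 1/4)" using False tl by auto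
    ultimately show ?thesis
      unfolding stunted_cocycle_def edge3_def by (simp only: if_False, simp?)
  qed
qed

definition X_class :: "bool \<Rightarrow> (bool \<times> (nat \<Rightarrow> real) set set) set coch" where
  "X_class b s = stunted_cocycle (\<lambda>i. X_lift b (s i))"

lemma local_cocycle_X_class: "local_cocycle X_space 3 (X_class b)"
  unfolding local_cocycle_def
proof (intro conjI exI)
  have "cochain 3 stunted_cocycle"
    unfolding cochain_def
  proof (intro allI impI)
    fix s t :: "nat \<Rightarrow> nat \<Rightarrow> real" assume *: "\<forall>i\<le>3. s i = t i"
    then have iff: "(\<exists>j\<le>3. tailsq (s j) \<le> 1/4) \<longleftrightarrow> (\<exists>j\<le>3. tailsq (t j) \<le> 1/4)" by auto
    have e: "s 0 = t 0" "s 1 = t 1" "s 2 = t 2" "s 3 = t 3" using * by auto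
    show "stunted_cocycle s = stunted_cocycle t"
      unfolding stunted_cocycle_def e iff ..
  qed
  from cochain_comp[OF this, of "X_lift b"] show "cochain 3 (X_class b)"
    by (simp add: X_class_def[abs_def])
  let ?F = "(\<lambda>(i, j). X_coord b i j) ` ({3..6} \<times> {..6})"
  show "finite ?F" by simp
  show "(1/100 :: real) > 0" by simp
  show "\<forall>f\<in>?F. continuous_map X_space euclideanreal f"
    by (auto intro!: continuous_map_X_coord)
  show "\<forall>s. (\<forall>i\<le>Suc 3. s i \<in> topspace X_space) \<longrightarrow>
       (\<forall>f\<in>?F. \<forall>i\<le>Suc 3. \<forall>j\<le>Suc 3. \<bar>f (s i) - f (s j)\<bar> < 1/100) \<longrightarrow> cobd (Suc 3) (X_class b) s = 0"
  proof (intro allI impI)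
    fix s :: "nat \<Rightarrow> (bool \<times> (nat \<Rightarrow> real) set set) set"
    assume top: "\<forall>i\<le>Suc 3. s i \<in> topspace X_space"
      and cl: "\<forall>f\<in>?F. \<forall>i\<le>Suc 3. \<forall>j\<le>Suc 3. \<bar>f (s i) - f (s j)\<bar> < 1/100"
    have "cobd 4 stunted_cocycle (\<lambda>i. X_lift b (s i)) = 0"
    proof (rule stunted_cocycle_closed)
      show "X_lift b (s j) \<in> sph 6" if "j \<le> 4" for j using top that X_lift_sph by auto
      show "yclose (X_lift b (s j)) (X_lift b (s k))" if "j \<le> 4" "k \<le> 4" for j k
        unfolding yclose_def
      proof (intro ballI allI impI)
        fix i l :: nat assume "i \<in> {3..6}" "l \<le> 6"
        then have "X_coord b i l \<in> ?F" by (auto intro!: image_eqI[of _ _ "(i, l)"])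
        then have "\<bar>X_coord b i l (s j) - X_coord b i l (s k)\<bar> < 1/100" using cl that by auto
        then show "\<bar>X_lift b (s j) i * X_lift b (s j) l - X_lift b (s k) i * X_lift b (s k) l\<bar> < 1/100"
          by (simp add: X_coord_def)
      qed
    qed
    then show "cobd (Suc 3) (X_class b) s = 0"
      unfolding cobd_comp[of 4 stunted_cocycle] X_class_def[abs_def] by simp
  qed
qed

lemma local_cocycle_compose:
  assumes "local_cocycle X p \<phi>" "continuous_map B X h"
  shows "local_cocycle B p (\<lambda>s. \<phi> (\<lambda>i. h (s i)))"
proof -
  obtain F \<rho> where F: "finite F" "\<rho> > 0" "\<And>f. f \<in> F \<Longrightarrow> continuous_map X euclideanreal f"
    "\<And>s. (\<forall>i\<le>Suc p. s i \<in> topspace X) \<Longrightarrow>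
          (\<forall>f\<in>F. \<forall>i\<le>Suc p. \<forall>j\<le>Suc p. \<bar>f (s i) - f (s j)\<bar> < \<rho>) \<Longrightarrow> cobd (Suc p) \<phi> s = 0"
    and c: "cochain p \<phi>"
    using assms(1) unfolding local_cocycle_def by blast
  show ?thesis
    unfolding local_cocycle_def
  proof (intro conjI exI)
    show "cochain p (\<lambda>s. \<phi> (\<lambda>i. h (s i)))" by (rule cochain_comp[OF c])
    show "finite ((\<lambda>f. f \<circ> h) ` F)" using F(1) by simp
    show "\<rho> > 0" by (rule F(2))
    show "\<forall>f\<in>(\<lambda>f. f \<circ> h) ` F. continuous_map B euclideanreal f"
      using continuous_map_compose[OF assms(2) F(3)] by auto
    show "\<forall>s. (\<forall>i\<le>Suc p. s i \<in> topspace B) \<longrightarrow>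
       (\<forall>f\<in>(\<lambda>f. f \<circ> h) ` F. \<forall>i\<le>Suc p. \<forall>j\<le>Suc p. \<bar>f (s i) - f (s j)\<bar> < \<rho>) \<longrightarrow>
       cobd (Suc p) (\<lambda>s. \<phi> (\<lambda>i. h (s i))) s = 0"
    proof (intro allI impI)
      fix s :: "nat \<Rightarrow> 'b"
      assume *: "\<forall>i\<le>Suc p. s i \<in> topspace B"
        "\<forall>f\<in>(\<lambda>f. f \<circ> h) ` F. \<forall>i\<le>Suc p. \<forall>j\<le>Suc p. \<bar>f (s i) - f (s j)\<bar> < \<rho>"
      show "cobd (Suc p) (\<lambda>s. \<phi> (\<lambda>i. h (s i))) s = 0"
        unfolding cobd_comp[symmetric]
      proof (rule F(4))
        show "\<forall>i\<le>Suc p. h (s i) \<in> topspace X"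
          using *(1) continuous_map_image_subset_topspace[OF assms(2)] by auto
        show "\<forall>f\<in>F. \<forall>i\<le>Suc p. \<forall>j\<le>Suc p. \<bar>f (h (s i)) - f (h (s j))\<bar> < \<rho>"
          using *(2) by auto
      qed
    qed
  qed
qed

lemma word_append: "word (u @ v) s = word u s * word v (\<lambda>i. s (i + length u))"
proof (induction u arbitrary: s rule: word.induct)
  case (2 \<alpha> \<epsilon> ws)
  then show ?case by (simp add: cup_def mult.assoc)
qed simp

lemma word_eq_prod:
  "word ws s = (\<Prod>l<length ws. snd (ws ! l) (s l (fst (ws ! l))) + snd (ws ! l) (s (Suc l) (fst (ws ! l))))"
proof (induction ws arbitrary: s rule: word.induct)
  case (2 \<alpha> \<epsilon> ws)
  then show ?case by (simp add: cup_def prod.lessThan_Suc_shift del: prod.lessThan_Suc)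
qed simp

section \<open>The top class of a sphere\<close>

definition sphere_word :: "nat \<Rightarrow> nat \<Rightarrow> (nat \<times> ((nat \<Rightarrow> real) \<Rightarrow> bit)) list" where
  "sphere_word k \<alpha> = map (\<lambda>i. (\<alpha>, sg i)) [0..<k]"

text \<open>It counts simplices around the pole with last coordinate -1: there all coordinates below
  \<open>k\<close> change sign, and the last one is negative.\<close>

definition sphere_class :: "nat \<Rightarrow> (nat \<Rightarrow> real) coch" where
  "sphere_class k s = sg k (s 0) * word (sphere_word k 0) (\<lambda>i (\<alpha>::nat). s i)"

lemma sphere_word_comp: "word (sphere_word k 0) (\<lambda>i (\<beta>::nat). s i \<alpha>) = word (sphere_word k \<alpha>) s"
  unfolding word_eq_prod by (simp add: sphere_word_def)

lemma small_of_sg_neq: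
  assumes "sg i a + sg i b \<noteq> 0" "\<bar>a i - b i\<bar> < \<rho>" shows "\<bar>a i\<bar> < \<rho>"
proof (rule ccontr)
  assume "\<not> ?thesis"
  then have "\<bar>b i - a i\<bar> < \<bar>a i\<bar>" "\<bar>a i - a i\<bar> < \<bar>a i\<bar>" using assms(2) by auto
  then have "sg i b = sg i a" using sg_eq[of b i a] mult_pos_of_close by blast
  then show False using assms(1) by simp
qed

text \<open>The coboundary is the product of the sign changes of all \<open>k + 1\<close>
  coordinates. On a fine tuple a sign change makes a coordinate small, and not all coordinates of a
  unit vector are small.\<close>

lemma local_cocycle_sphere_class: "local_cocycle (nsphere k) k (sphere_class k)"
  unfolding local_cocycle_def
proof (intro conjI exI)
  have cw: "cochain k (\<lambda>s. word (sphere_word k 0) (\<lambda>i (\<alpha>::nat). s i))"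
    using cochain_word[of "sphere_word k 0"] by (auto simp: cochain_def sphere_word_def fun_eq_iff)
  have c0: "cochain 0 (\<lambda>s. sg k (s 0))" by (auto simp: cochain_def)
  have sc: "sphere_class k = cup 0 (\<lambda>s. sg k (s 0)) (\<lambda>s. word (sphere_word k 0) (\<lambda>i (\<alpha>::nat). s i))"
    by (auto simp: sphere_class_def cup_def)
  show "cochain k (sphere_class k)"
    unfolding sc using cochain_cup[OF c0 cw] by simp
  let ?F = "(\<lambda>i (x::nat\<Rightarrow>real). x i) ` {..k}"
  \<comment> \<open>Chosen so that \<open>(k + 1) * (2 * \<rho>)^2 < 1\<close>. The factor 2 arises
    because the sign changes occur at different points of the tuple and are compared at
    \<open>s 0\<close>.\<close>
  define \<rho> :: real where "\<rho> = 1 / (4 * (real k + 1))"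
  show "finite ?F" by simp
  show \<rho>: "\<rho> > 0" by (simp add: \<rho>_def)
  show "\<forall>f\<in>?F. continuous_map (nsphere k) euclideanreal f"
    using continuous_map_nsphere_projection by auto
  show "\<forall>s. (\<forall>i\<le>Suc k. s i \<in> topspace (nsphere k)) \<longrightarrow>
       (\<forall>f\<in>?F. \<forall>i\<le>Suc k. \<forall>j\<le>Suc k. \<bar>f (s i) - f (s j)\<bar> < \<rho>) \<longrightarrow> cobd (Suc k) (sphere_class k) s = 0"
  proof (intro allI impI)
    fix s :: "nat \<Rightarrow> nat \<Rightarrow> real"
    assume top: "\<forall>i\<le>Suc k. s i \<in> topspace (nsphere k)"
      and cl: "\<forall>f\<in>?F. \<forall>i\<le>Suc k. \<forall>j\<le>Suc k. \<bar>f (s i) - f (s j)\<bar> < \<rho>"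
    have cl: "\<bar>s i l - s j l\<bar> < \<rho>" if "l \<le> k" "i \<le> Suc k" "j \<le> Suc k" for i j l
      using cl that by auto
    have "cobd (Suc (0 + k)) (sphere_class k) s =
        (sg k (s 0) + sg k (s 1)) * word (sphere_word k 0) (\<lambda>i (\<alpha>::nat). s (Suc i))"
    proof -
      have "cobd (Suc 0) (\<lambda>s. sg k (s 0)) s = sg k (s 0) + sg k (s 1)"
        by (simp add: cobd_def face_def add.commute)
      moreover have "cobd (Suc k) (\<lambda>s. word (sphere_word k 0) (\<lambda>i (\<alpha>::nat). s i)) s = 0"
        unfolding cobd_comp[of "Suc k" "word (sphere_word k 0)" "\<lambda>x \<alpha>. x" s, symmetric]
        using cobd_word[of "sphere_word k 0"] by (simp add: sphere_word_def)
      ultimately show ?thesis unfolding sc cobd_cup[OF c0] by (simp add: cup_def)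
    qed
    also have "\<dots> = 0"
    proof (rule ccontr)
      assume "\<not> ?thesis"
      then have k: "sg k (s 0) + sg k (s 1) \<noteq> 0"
        and "word (sphere_word k 0) (\<lambda>i (\<alpha>::nat). s (Suc i)) \<noteq> 0" by auto
      then have l: "sg l (s (Suc l)) + sg l (s (Suc (Suc l))) \<noteq> 0" if "l < k" for l
        using that unfolding word_eq_prod by (simp add: sphere_word_def del: bit_not_zero_iff)
      have "\<bar>s 0 l\<bar> \<le> 2 * \<rho>" if "l \<le> k" for l
      proof (cases "l = k")
        case True
        then show ?thesis using small_of_sg_neq[OF k cl[of k 0 1]] \<rho> by simp
      next
        case False
        then have "l < k" using that by simp
        then have "\<bar>s (Suc l) l\<bar> < \<rho>" by (intro small_of_sg_neq[OF l cl]) auto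
        then show ?thesis using cl[of l 0 "Suc l"] \<open>l < k\<close> by linarith
      qed
      then have "(\<Sum>l\<le>k. (s 0 l)\<^sup>2) \<le> (\<Sum>l\<le>k. (2 * \<rho>)\<^sup>2)"
      proof (intro sum_mono)
        fix l assume "l \<in> {..k}"
        then have "\<bar>s 0 l\<bar> \<le> \<bar>2 * \<rho>\<bar>" using \<open>\<And>l. l \<le> k \<Longrightarrow> \<bar>s 0 l\<bar> \<le> 2 * \<rho>\<close>[of l] \<rho> by simp
        then show "(s 0 l)\<^sup>2 \<le> (2 * \<rho>)\<^sup>2" using abs_le_square_iff by blast
      qed
      also have "\<dots> = 1 / (4 * (real k + 1))"
        by (simp add: \<rho>_def power2_eq_square divide_simps)
      also have "\<dots> < 1" by (simp add: divide_simps)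
      finally show False using top by (auto simp: topspace_nsphere sph_def)
    qed
    finally show "cobd (Suc k) (sphere_class k) s = 0" by simp
  qed
qed

section \<open>Evaluation of the zero divisors\<close>

lemma spheres_coord_close:
  assumes "\<rho> > 0"
  obtains d where "d > 0" "\<And>x y \<alpha> i. x \<in> spheres r n \<Longrightarrow> y \<in> spheres r n \<Longrightarrow> \<alpha> < r \<Longrightarrow> dist x y < d \<Longrightarrow> \<bar>x \<alpha> i - y \<alpha> i\<bar> < \<rho>"
proof -
  let ?F = "(\<lambda>(\<alpha>, i) (x::nat\<Rightarrow>nat\<Rightarrow>real). x \<alpha> i) ` (SIGMA \<alpha>:{..<r}. {..n \<alpha>})"
  have "continuous_map (top_of_set (spheres r n)) (top_of_set (spheres r n)) id" by simp
  note A = this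
  have B: "finite ?F" by simp
  have C: "continuous_map (top_of_set (spheres r n)) euclideanreal f" if "f \<in> ?F" for f
    using that by (auto intro!: continuous_on_apply2)
  obtain d where d: "d > 0" "\<And>f x y. f \<in> ?F \<Longrightarrow> x \<in> spheres r n \<Longrightarrow> y \<in> spheres r n \<Longrightarrow> dist x y < d \<Longrightarrow> \<bar>f (id x) - f (id y)\<bar> < \<rho>"
    using uniformly_close_finite[OF compact_spheres A B C assms] by blast
  show ?thesis
  proof (rule that[OF d(1)])
    fix x y \<alpha> i assume *: "x \<in> spheres r n" "y \<in> spheres r n" "\<alpha> < r" "dist x y < d"
    show "\<bar>x \<alpha> i - y \<alpha> i\<bar> < \<rho>"
    proof (cases "i \<le> n \<alpha>")
      case True
      then have "(\<lambda>x. x \<alpha> i) \<in> ?F" using *(3) by (auto intro!: image_eqI[of _ _ "(\<alpha>, i)"])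
      from d(2)[OF this *(1,2,4)] show ?thesis by simp
    next
      case False
      then show ?thesis using * assms by (auto simp: spheres_def sph_def)
    qed
  qed
qed

text \<open>After division by antipodes the hemisphere chain is a cycle: by Stokes only boundary
  terms remain, and each cancels with its antipodal image.\<close>

lemma ev_cobd_invariant:
  assumes E: "hemisphere_chains r N \<eta> E" and \<mu>: "\<And>\<alpha>. \<alpha> \<ge> r \<Longrightarrow> \<mu> \<alpha> = 0" "deg r \<mu> = Suc n" "Suc n \<le> N"
    and K: "cochain n K" and inv: "\<And>\<alpha> s. \<alpha> < r \<Longrightarrow> (\<And>i. s i \<in> spheres r \<mu>) \<Longrightarrow> K (\<lambda>i. flip \<alpha> (s i)) = K s"
  shows "ev (cobd (Suc n) K) (E \<mu>) = 0"
proof -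
  have "bounds n (E \<mu>) (bdlist r E \<mu>)"
    using E \<mu> unfolding hemisphere_chains_def by simp
  then have "ev (cobd (Suc n) K) (E \<mu>) = ev K (bdlist r E \<mu>)" using K by (simp add: bounds_def)
  also have "\<dots> = 0"
    unfolding ev_bdlist
  proof (rule sum.neutral, rule ballI)
    fix \<alpha> assume "\<alpha> \<in> {..<r}"
    then have \<alpha>: "\<alpha> < r" by simp
    show "(if 0 < \<mu> \<alpha> then ev K (E (dcr \<mu> \<alpha>)) + ev (\<lambda>s. K (\<lambda>i. flip \<alpha> (s i))) (E (dcr \<mu> \<alpha>)) else 0) = 0"
    proof (cases "\<mu> \<alpha> > 0")
      case True
      have "deg r (dcr \<mu> \<alpha>) \<le> N" using deg_dcr[of \<alpha> r \<mu>] \<alpha> True \<mu>(2,3) by simp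
      moreover have "\<forall>\<gamma>\<ge>r. dcr \<mu> \<alpha> \<gamma> = 0" using \<mu>(1) by (auto simp: dcr_def)
      ultimately have fc: "fine_chain (cells r (dcr \<mu> \<alpha>)) \<eta> (deg r (dcr \<mu> \<alpha>)) (E (dcr \<mu> \<alpha>))"
        using E unfolding hemisphere_chains_def by blast
      have "s i \<in> spheres r \<mu>" if "s \<in> set (E (dcr \<mu> \<alpha>))" for s i
      proof -
        have "s i \<in> cells r (dcr \<mu> \<alpha>)" using fc that unfolding fine_chain_def by blast
        then show ?thesis using cells_dcr[of \<mu> \<alpha> "s i" r] True cells_subset_spheres by auto
      qed
      then have "ev (\<lambda>s. K (\<lambda>i. flip \<alpha> (s i))) (E (dcr \<mu> \<alpha>)) = ev K (E (dcr \<mu> \<alpha>))"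
        using inv[OF \<alpha>] by (intro ev_cong) blast
      then show ?thesis by simp
    qed simp
  qed
  finally show ?thesis .
qed

text \<open>The two components of \<open>q\<close> lie in different copies, and the class of a copy
  vanishes on the other one. Hence only one of the two pull-backs in each zero divisor
  survives.\<close>

lemma zero_divisor_X_class:
  fixes q :: "(nat \<Rightarrow> nat \<Rightarrow> real) \<Rightarrow> 'b \<times> 'b"
  assumes T: "\<And>j. j \<le> 3 \<Longrightarrow> s j 0 \<in> sph 6 \<and> s j 1 \<in> sph 6"
    and cl: "\<And>i j k. j \<le> 3 \<Longrightarrow> k \<le> 3 \<Longrightarrow> \<bar>s j 0 i - s k 0 i\<bar> < 1/100 \<and> \<bar>s j 1 i - s k 1 i\<bar> < 1/100"
    and q: "\<And>j. h (fst (q (s j))) = X_pt False (s j 0)" "\<And>j. h (snd (q (s j))) = X_pt True (s j 1)"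
  shows "zero_divisor q (\<lambda>t. X_class False (\<lambda>i. h (t i))) s = word [(0, sg 0), (0, sg 1), (0, sg 2)] s" (is ?F)
    "zero_divisor q (\<lambda>t. X_class True (\<lambda>i. h (t i))) s = word [(1, sg 0), (1, sg 1), (1, sg 2)] s" (is ?T)
proof -
  have eq: "stunted_cocycle (\<lambda>i. X_lift b (X_pt b (s i \<alpha>))) = edge3 (\<lambda>i. s i \<alpha>)" if "\<alpha> = 0 \<or> \<alpha> = 1" for \<alpha> b
  proof (rule stunted_cocycle_eq_edge3)
    fix j :: nat assume "j \<le> 3"
    then show a: "s j \<alpha> \<in> sph 6" using T that by auto
    show "(based (s j \<alpha>) \<and> based (X_lift b (X_pt b (s j \<alpha>)))) \<or> X_lift b (X_pt b (s j \<alpha>)) = s j \<alpha> \<or>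
        X_lift b (X_pt b (s j \<alpha>)) = (\<lambda>i. - s j \<alpha> i)"
      using X_lift_eq[OF a] by blast
    fix i k :: nat assume "k \<le> 3"
    then show "\<bar>s j \<alpha> i - s k \<alpha> i\<bar> < 1/100" using cl[OF \<open>j \<le> 3\<close>, of k i] that by auto
  qed
  have zero: "stunted_cocycle (\<lambda>i. X_lift b (X_pt (\<not> b) (s i \<alpha>))) = 0" if "\<alpha> = 0 \<or> \<alpha> = 1" for \<alpha> b
  proof -
    have "s 0 \<alpha> \<in> sph 6" using T[of 0] that by auto
    then have "tailsq (X_lift b (X_pt (\<not> b) (s 0 \<alpha>))) = 0" using X_lift_other tailsq_based by blast
    then show ?thesis by (auto simp: stunted_cocycle_def intro: exI[of _ 0])
  qed
  show ?F
    unfolding zero_divisor_def X_class_def q edge3_eq_word[symmetric]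
    using zero[of 1 False] eq[of 0 False] by simp
  show ?T
    unfolding zero_divisor_def X_class_def q edge3_eq_word[symmetric]
    using zero[of 0 True] eq[of 1 True] by simp
qed

abbreviation X_word :: "(nat \<times> ((nat \<Rightarrow> real) \<Rightarrow> bit)) list" where
  "X_word \<equiv> [(0, sg 0), (0, sg 1), (0, sg 2)] @ [(0, sg 0), (0, sg 1), (0, sg 2)] @
     [(1, sg 0), (1, sg 1), (1, sg 2)] @ [(1, sg 0), (1, sg 1), (1, sg 2)]"

lemma continuous_map_X_pt_coord:
  assumes "\<alpha> < r" "n \<alpha> = 6"
  shows "continuous_map (top_of_set (spheres r n)) X_space (\<lambda>z. X_pt b (z \<alpha>))"
proof -
  have "continuous_map (top_of_set (spheres r n)) (top_of_set (sph 6)) (\<lambda>z. z \<alpha>)"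
    using assms by (auto simp: continuous_map_in_subtopology spheres_def continuous_on_apply)
  from continuous_map_compose[OF this continuous_map_X_pt] show ?thesis by (simp add: comp_def)
qed

lemma flip_X_pt: "z \<in> spheres r n \<Longrightarrow> n \<alpha> = 6 \<Longrightarrow> \<alpha> < r \<Longrightarrow> X_pt b (flip \<beta> z \<alpha>) = X_pt b (z \<alpha>)"
  by (auto simp: flip_apply X_pt_minus spheres_def)

lemma hemisphere_chain_points:
  assumes "hemisphere_chains r N \<eta> E" "\<And>\<alpha>. \<alpha> \<ge> r \<Longrightarrow> \<mu> \<alpha> = 0" "deg r \<mu> = n" "n \<le> N" "s \<in> set (E \<mu>)"
  shows "s i \<in> spheres r \<mu>" "i \<le> n \<Longrightarrow> j \<le> n \<Longrightarrow> dist (s i) (s j) < \<eta>"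
proof -
  have "fine_chain (cells r \<mu>) \<eta> (deg r \<mu>) (E \<mu>)"
  proof -
    have "(\<forall>\<alpha>\<ge>r. \<mu> \<alpha> = 0) \<and> deg r \<mu> \<le> N" using assms(2-4) by simp
    then show ?thesis using assms(1) unfolding hemisphere_chains_def by blast
  qed
  then have *: "(\<forall>i. s i \<in> cells r \<mu>) \<and> (\<forall>i\<le>n. \<forall>j\<le>n. dist (s i) (s j) < \<eta>)"
    using assms(3,5) unfolding fine_chain_def by simp
  then show "s i \<in> spheres r \<mu>" using cells_subset_spheres by blast
  show "i \<le> n \<Longrightarrow> j \<le> n \<Longrightarrow> dist (s i) (s j) < \<eta>" using * by simp
qed

lemma cups_X_classes:
  fixes q :: "(nat \<Rightarrow> nat \<Rightarrow> real) \<Rightarrow> 'b \<times> 'b"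
  assumes T: "\<And>j. s j 0 \<in> sph 6 \<and> s j 1 \<in> sph 6"
    and cl: "\<And>i j k. j \<le> 12 \<Longrightarrow> k \<le> 12 \<Longrightarrow> \<bar>s j 0 i - s k 0 i\<bar> < 1/100 \<and> \<bar>s j 1 i - s k 1 i\<bar> < 1/100"
    and q: "\<And>j. h (fst (q (s j))) = X_pt False (s j 0)" "\<And>j. h (snd (q (s j))) = X_pt True (s j 1)"
  shows "cups [(3, zero_divisor q (\<lambda>t. X_class False (\<lambda>i. h (t i)))), (3, zero_divisor q (\<lambda>t. X_class False (\<lambda>i. h (t i)))),
      (3, zero_divisor q (\<lambda>t. X_class True (\<lambda>i. h (t i)))), (3, zero_divisor q (\<lambda>t. X_class True (\<lambda>i. h (t i))))] s =
      word X_word s"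
proof -
  define F where "F = zero_divisor q (\<lambda>t. X_class False (\<lambda>i. h (t i)))"
  define G where "G = zero_divisor q (\<lambda>t. X_class True (\<lambda>i. h (t i)))"
  define A where "A = [(0::nat, sg 0), (0, sg 1), (0, sg 2)]"
  define B where "B = [(1::nat, sg 0), (1, sg 1), (1, sg 2)]"
  have zd: "F (\<lambda>i. s (i + m)) = word A (\<lambda>i. s (i + m))" "G (\<lambda>i. s (i + m)) = word B (\<lambda>i. s (i + m))"
    if "m \<le> 9" for m
    unfolding F_def G_def A_def B_def
    by (rule zero_divisor_X_class[where s = "\<lambda>i. s (i + m)"]; use T cl[of "_ + m" "_ + m"] q that in simp)+
  have l: "length A = 3" "length B = 3" by (simp_all add: A_def B_def)
  have "cups [(3, F), (3, F), (3, G), (3, G)] s =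
      F (\<lambda>i. s (i + 0)) * (F (\<lambda>i. s (i + 3)) * (G (\<lambda>i. s (i + 6)) * G (\<lambda>i. s (i + 9))))"
    by (simp add: cup_def add.assoc)
  also have "\<dots> = word (A @ A @ B @ B) s"
    using zd(1)[of 0] zd(1)[of 3] zd(2)[of 6] zd(2)[of 9] by (simp add: word_append l add.assoc)
  finally show ?thesis unfolding F_def G_def A_def B_def .
qed

lemma TC_X_ge: "TC X_space \<ge> 4"
proof (rule ccontr)
  assume "\<not> TC X_space \<ge> 4"
  then have lt: "TC X_space < enat 4" by (simp add: not_le numeral_eq_enat)
  define \<mu> :: "nat \<Rightarrow> nat" where "\<mu> = (\<lambda>\<alpha>. if \<alpha> < 2 then 6 else 0)"
  define T where "T = spheres 2 \<mu>"
  define q where "q = (\<lambda>z::nat\<Rightarrow>nat\<Rightarrow>real. (X_pt False (z 0), X_pt True (z 1)))"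
  define ws where "ws = [(3::nat, X_class False), (3, X_class False), (3, X_class True), (3, X_class True)]"
  have cT: "compact T" unfolding T_def by (rule compact_spheres)
  have q: "continuous_map (top_of_set T) (prod_topology X_space X_space) q"
    unfolding q_def T_def by (intro continuous_map_pairedI continuous_map_X_pt_coord) (auto simp: \<mu>_def)
  have ws: "p > 0 \<and> local_cocycle X_space p \<phi>" if "(p, \<phi>) \<in> set ws" for p \<phi>
    using that local_cocycle_X_class by (auto simp: ws_def)
  have tot: "total ws = 12" by (simp add: ws_def)
  have len: "TC X_space < enat (length ws)" 
  proof -
    have "length ws = 4" by (simp add: ws_def)
    then show ?thesis using lt by (simp only:)
  qed
  obtain \<eta> where \<eta>: "\<eta> > 0"
    "\<And>z. fine_chain T \<eta> 12 z \<Longrightarrow>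
       (\<And>K. cochain (12 - 1) K \<Longrightarrow>
          (\<And>h s. (\<And>x. x \<in> T \<Longrightarrow> h x \<in> T \<and> q (h x) = q x) \<Longrightarrow> (\<And>i. s i \<in> T) \<Longrightarrow> K (\<lambda>i. h (s i)) = K s) \<Longrightarrow>
          ev (cobd 12 K) z = 0) \<Longrightarrow>
       ev (cups (map (\<lambda>(p, \<phi>). (p, zero_divisor q \<phi>)) ws)) z = 0"
    using TC_lower_bound[OF cT q ws len, unfolded tot] by blast
  obtain d where d: "d > 0" "\<And>x y \<alpha> i. x \<in> T \<Longrightarrow> y \<in> T \<Longrightarrow> \<alpha> < 2 \<Longrightarrow> dist x y < d \<Longrightarrow> \<bar>x \<alpha> i - y \<alpha> i\<bar> < 1/100"
    using spheres_coord_close[of "1/100" 2 \<mu>] unfolding T_def by auto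
  obtain E where E: "hemisphere_chains 2 12 (min \<eta> d) E"
    using hemisphere_chains_exist[of "min \<eta> d" 2 12] \<eta>(1) d(1) by auto
  have \<mu>0: "\<mu> \<alpha> = 0" if "\<alpha> \<ge> 2" for \<alpha> using that by (simp add: \<mu>_def)
  have deg: "deg 2 \<mu> = 12" by (simp add: deg_def \<mu>_def numeral_2_eq_2)
  have pts: "s i \<in> T" "i \<le> 12 \<Longrightarrow> j \<le> 12 \<Longrightarrow> dist (s i) (s j) < min \<eta> d" if "s \<in> set (E \<mu>)" for s i j
    using hemisphere_chain_points[OF E \<mu>0 deg _ that] by (simp_all add: T_def)
  have "ev (cups (map (\<lambda>(p, \<phi>). (p, zero_divisor q \<phi>)) ws)) (E \<mu>) = 0"
  proof (rule \<eta>(2))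
    show "fine_chain T \<eta> 12 (E \<mu>)"
      unfolding fine_chain_def
    proof (intro ballI conjI allI impI)
      fix s and i j :: nat assume s: "s \<in> set (E \<mu>)"
      show "s i \<in> T" by (rule pts(1)[OF s])
      assume "i \<le> 12" "j \<le> 12"
      then show "dist (s i) (s j) < \<eta>" using pts(2)[OF s, of i j] by simp
    qed
    fix K :: "(nat \<Rightarrow> nat \<Rightarrow> nat \<Rightarrow> real) \<Rightarrow> bit"
    assume K: "cochain (12 - 1) K" and inv: "\<And>h s. (\<And>x. x \<in> T \<Longrightarrow> h x \<in> T \<and> q (h x) = q x) \<Longrightarrow> (\<And>i. s i \<in> T) \<Longrightarrow> K (\<lambda>i. h (s i)) = K s"
    have "ev (cobd (Suc 11) K) (E \<mu>) = 0"
    proof (rule ev_cobd_invariant[OF E])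
      fix \<alpha> :: nat and s :: "nat \<Rightarrow> nat \<Rightarrow> nat \<Rightarrow> real" assume \<alpha>: "\<alpha> < 2" and s: "\<And>i. s i \<in> spheres 2 \<mu>"
      have "\<mu> 0 = 6" "\<mu> 1 = 6" by (simp_all add: \<mu>_def)
      then have "flip \<alpha> x \<in> T \<and> q (flip \<alpha> x) = q x" if "x \<in> T" for x
        using that flip_spheres[of x 2 \<mu> \<alpha>] \<alpha> flip_X_pt[of x 2 \<mu> 0 _ \<alpha>] flip_X_pt[of x 2 \<mu> 1 _ \<alpha>]
        by (simp add: T_def q_def)
      then show "K (\<lambda>i. flip \<alpha> (s i)) = K s"
        by (rule inv[of "flip \<alpha>" s]) (use s in \<open>simp_all add: T_def\<close>)
    next
      show "cochain 11 K" using K by simp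
    qed (use \<mu>0 deg in simp_all)
    then show "ev (cobd 12 K) (E \<mu>) = 0" by simp
  qed
  moreover have "ev (cups (map (\<lambda>(p, \<phi>). (p, zero_divisor q \<phi>)) ws)) (E \<mu>) = ev (word X_word) (E \<mu>)"
  proof (rule ev_cong)
    fix s assume s: "s \<in> set (E \<mu>)"
    have "s j 0 \<in> sph 6 \<and> s j 1 \<in> sph 6" for j
      using pts(1)[OF s, of j] by (simp add: T_def spheres_def \<mu>_def)
    moreover have "\<bar>s j 0 i - s k 0 i\<bar> < 1/100 \<and> \<bar>s j 1 i - s k 1 i\<bar> < 1/100" if "j \<le> 12" "k \<le> 12" for i j k
      using d(2)[OF pts(1)[OF s] pts(1)[OF s], of _ j k] pts(2)[OF s that] by simp
    ultimately show "cups (map (\<lambda>(p, \<phi>). (p, zero_divisor q \<phi>)) ws) s = word X_word s"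
      using cups_X_classes[of s "\<lambda>x. x" q] by (simp add: ws_def q_def del: cups.simps word.simps)
  qed
  moreover have "ev (word X_word) (E \<mu>) = 1"
  proof -
    have "\<mu> \<alpha> = length (filter (\<lambda>w. fst w = \<alpha>) X_word)" for \<alpha>
      by (cases "\<alpha> = 0"; cases "\<alpha> = 1") (auto simp: \<mu>_def)
    moreover have "\<alpha> < 2 \<and> odd_fun \<epsilon>" if "(\<alpha>, \<epsilon>) \<in> set X_word" for \<alpha> \<epsilon>
      using that by (auto simp: odd_fun_sg)
    moreover have "length X_word \<le> 12" by simp
    ultimately show ?thesis using ev_word_hemisphere_chain[OF E] by blast
  qed
  ultimately show False by simp
qed


lemma cups_append: "cups (u @ v) s = cups u s * cups v (\<lambda>i. s (i + total u))"
proof (induction u arbitrary: s rule: cups.induct)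
  case (2 p \<phi> ws)
  then show ?case by (simp add: cup_def mult.assoc add_ac)
qed simp

lemma TC_X_times_sphere_ge:
  assumes k: "k \<ge> 1"
  shows "TC (prod_topology X_space (nsphere k)) \<ge> 5"
proof (rule ccontr)
  let ?B = "prod_topology X_space (nsphere k)"
  assume "\<not> TC ?B \<ge> 5"
  then have lt: "TC ?B < enat 5" by (simp add: not_le numeral_eq_enat)
  define \<mu> :: "nat \<Rightarrow> nat" where "\<mu> = (\<lambda>\<alpha>. if \<alpha> < 2 then 6 else if \<alpha> = 2 then k else 0)"
  have \<mu>v: "\<mu> 0 = 6" "\<mu> 1 = 6" "\<mu> 2 = k" by (simp_all add: \<mu>_def)
  define T where "T = spheres 3 \<mu>"
  \<comment> \<open>The second point of the sphere is fixed, so that the zero divisor of the sphere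
    class reduces to the class at the first point; a constant tuple has no sign changes.\<close>
  define q where "q = (\<lambda>z::nat\<Rightarrow>nat\<Rightarrow>real. ((X_pt False (z 0), z 2), (X_pt True (z 1), e0)))"
  define F where "F = (\<lambda>b s. X_class b (\<lambda>i. fst (s i :: _ \<times> (nat \<Rightarrow> real))))"
  define S where "S = (\<lambda>s. sphere_class k (\<lambda>i. snd (s i :: (bool \<times> (nat \<Rightarrow> real) set set) set \<times> _)))"
  define us where "us = [(3::nat, F False), (3, F False), (3, F True), (3, F True)]"
  define ws where "ws = us @ [(k, S)]"
  have cT: "compact T" unfolding T_def by (rule compact_spheres)
  have q: "continuous_map (top_of_set T) (prod_topology ?B ?B) q"
    unfolding q_def T_def
  proof (intro continuous_map_pairedI continuous_map_X_pt_coord)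
    show "continuous_map (top_of_set (spheres 3 \<mu>)) (nsphere k) (\<lambda>z. z 2)"
      using \<mu>v by (auto simp: nsphere_eq_top_of_set continuous_map_in_subtopology spheres_def continuous_on_apply)
    show "continuous_map (top_of_set (spheres 3 \<mu>)) (nsphere k) (\<lambda>z. e0)"
      by (simp add: nsphere_eq_top_of_set)
  qed (use \<mu>v in auto)
  have F: "local_cocycle ?B 3 (F b)" for b
    unfolding F_def by (rule local_cocycle_compose[OF local_cocycle_X_class continuous_map_fst])
  have S: "local_cocycle ?B k S"
    unfolding S_def by (rule local_cocycle_compose[OF local_cocycle_sphere_class continuous_map_snd])
  have ws: "p > 0 \<and> local_cocycle ?B p \<phi>" if "(p, \<phi>) \<in> set ws" for p \<phi>
    using that F S k by (auto simp: ws_def us_def)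
  have tot: "total ws = 12 + k" by (simp add: ws_def us_def)
  have len: "TC ?B < enat (length ws)"
  proof -
    have "length ws = 5" by (simp add: ws_def us_def)
    then show ?thesis using lt by (simp only:)
  qed
  obtain \<eta> where \<eta>: "\<eta> > 0"
    "\<And>z. fine_chain T \<eta> (12 + k) z \<Longrightarrow>
       (\<And>K. cochain (12 + k - 1) K \<Longrightarrow>
          (\<And>h s. (\<And>x. x \<in> T \<Longrightarrow> h x \<in> T \<and> q (h x) = q x) \<Longrightarrow> (\<And>i. s i \<in> T) \<Longrightarrow> K (\<lambda>i. h (s i)) = K s) \<Longrightarrow>
          ev (cobd (12 + k) K) z = 0) \<Longrightarrow>
       ev (cups (map (\<lambda>(p, \<phi>). (p, zero_divisor q \<phi>)) ws)) z = 0"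
    using TC_lower_bound[OF cT q ws len, unfolded tot] by blast
  obtain d where d: "d > 0" "\<And>x y \<alpha> i. x \<in> T \<Longrightarrow> y \<in> T \<Longrightarrow> \<alpha> < 3 \<Longrightarrow> dist x y < d \<Longrightarrow> \<bar>x \<alpha> i - y \<alpha> i\<bar> < 1/100"
    using spheres_coord_close[of "1/100" 3 \<mu>] unfolding T_def by auto
  obtain E where E: "hemisphere_chains 3 (12 + k) (min \<eta> d) E"
    using hemisphere_chains_exist[of "min \<eta> d" 3 "12 + k"] \<eta>(1) d(1) by auto
  have \<mu>0: "\<mu> \<alpha> = 0" if "\<alpha> \<ge> 3" for \<alpha> using that by (simp add: \<mu>_def)
  have deg: "deg 3 \<mu> = 12 + k" using \<mu>v by (simp add: deg_def numeral_3_eq_3 numeral_2_eq_2)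
  have pts: "s i \<in> T" "i \<le> 12 + k \<Longrightarrow> j \<le> 12 + k \<Longrightarrow> dist (s i) (s j) < min \<eta> d" if "s \<in> set (E \<mu>)" for s i j
    using hemisphere_chain_points[OF E \<mu>0 deg _ that] by (simp_all add: T_def)
  \<comment> \<open>The sphere factor is not divided by antipodes, so the hemisphere in this
    direction is completed to the whole sphere.\<close>
  define z where "z = E \<mu> @ map (\<lambda>s i. flip 2 (s i)) (E \<mu>)"
  have zpts: "s i \<in> T" "i \<le> 12 + k \<Longrightarrow> j \<le> 12 + k \<Longrightarrow> dist (s i) (s j) < min \<eta> d" if s: "s \<in> set z" for s i j
  proof -
    obtain t where t: "t \<in> set (E \<mu>)" "s = t \<or> s = (\<lambda>i. flip 2 (t i))" using s by (auto simp: z_def)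
    have "flip 2 (t i) \<in> T" using pts(1)[OF t(1), of i] flip_spheres[of "t i" 3 \<mu> 2] by (simp add: T_def)
    then show "s i \<in> T" using t(2) pts(1)[OF t(1), of i] by auto
    assume "i \<le> 12 + k" "j \<le> 12 + k"
    from pts(2)[OF t(1) this] show "dist (s i) (s j) < min \<eta> d" using t(2) by (auto simp: dist_flip)
  qed
  have "ev (cups (map (\<lambda>(p, \<phi>). (p, zero_divisor q \<phi>)) ws)) z = 0"
  proof (rule \<eta>(2))
    show "fine_chain T \<eta> (12 + k) z"
      unfolding fine_chain_def
    proof (intro ballI conjI allI impI)
      fix s and i j :: nat assume s: "s \<in> set z"
      show "s i \<in> T" by (rule zpts(1)[OF s])
      assume "i \<le> 12 + k" "j \<le> 12 + k"
      then show "dist (s i) (s j) < \<eta>" using zpts(2)[OF s, of i j] by simp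
    qed
    fix K :: "(nat \<Rightarrow> nat \<Rightarrow> nat \<Rightarrow> real) \<Rightarrow> bit"
    assume K: "cochain (12 + k - 1) K" and inv: "\<And>h s. (\<And>x. x \<in> T \<Longrightarrow> h x \<in> T \<and> q (h x) = q x) \<Longrightarrow> (\<And>i. s i \<in> T) \<Longrightarrow> K (\<lambda>i. h (s i)) = K s"
    \<comment> \<open>The map \<open>q\<close> is invariant under the antipodes of the first two
      factors only; symmetrising over the third makes \<open>ev_cobd_invariant\<close>
      applicable.\<close>
    define K' where "K' = (\<lambda>s. K s + K (\<lambda>i. flip 2 (s i)))"
    have qflip: "flip \<alpha> x \<in> T \<and> q (flip \<alpha> x) = q x" if "x \<in> T" "\<alpha> < 2" for x \<alpha>
      using that \<mu>v flip_spheres[of x 3 \<mu> \<alpha>] flip_X_pt[of x 3 \<mu> 0 _ \<alpha>] flip_X_pt[of x 3 \<mu> 1 _ \<alpha>]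
      by (simp add: T_def q_def flip_apply)
    have "ev (cobd (Suc (11 + k)) K') (E \<mu>) = 0"
    proof (rule ev_cobd_invariant[OF E])
      have "cochain (11 + k) K" using K by simp
      then show "cochain (11 + k) K'"
        unfolding K'_def by (intro cochain_add) (auto intro: cochain_comp[of _ K])
    next
      fix \<alpha> :: nat and s :: "nat \<Rightarrow> nat \<Rightarrow> nat \<Rightarrow> real" assume \<alpha>: "\<alpha> < 3" and s: "\<And>i. s i \<in> spheres 3 \<mu>"
      show "K' (\<lambda>i. flip \<alpha> (s i)) = K' s"
      proof (cases "\<alpha> = 2")
        case True
        then show ?thesis by (simp add: K'_def add.commute)
      next
        case False
        then have "\<alpha> < 2" using \<alpha> by simp
        have "K (\<lambda>i. flip \<alpha> (s i)) = K s"
          by (rule inv[of "flip \<alpha>" s]) (use s qflip \<open>\<alpha> < 2\<close> in \<open>simp_all add: T_def\<close>)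
        moreover have "K (\<lambda>i. flip \<alpha> (flip 2 (s i))) = K (\<lambda>i. flip 2 (s i))"
          by (rule inv[of "flip \<alpha>" "\<lambda>i. flip 2 (s i)"])
             (use s qflip \<open>\<alpha> < 2\<close> flip_spheres[of _ 3 \<mu> 2] in \<open>simp_all add: T_def\<close>)
        ultimately show ?thesis by (simp add: K'_def flip_commute[of 2 \<alpha>])
      qed
    qed (use \<mu>0 deg in simp_all)
    moreover have "cobd (12 + k) K' = (\<lambda>s. cobd (12 + k) K s + cobd (12 + k) K (\<lambda>i. flip 2 (s i)))"
      unfolding K'_def by (rule ext) (simp only: cobd_add cobd_comp)
    ultimately show "ev (cobd (12 + k) K) z = 0"
      unfolding z_def by (simp add: ev_map ev_add[symmetric])
  qed
  moreover have "ev (cups (map (\<lambda>(p, \<phi>). (p, zero_divisor q \<phi>)) ws)) z = ev (word (X_word @ sphere_word k 2)) (E \<mu>)"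
  proof -
    have cups: "cups (map (\<lambda>(p, \<phi>). (p, zero_divisor q \<phi>)) ws) s =
        word X_word s * (sg k (s 12 2) * word (sphere_word k 2) (\<lambda>i. s (i + 12)))" if s: "s \<in> set z" for s
    proof -
      have "s j 0 \<in> sph (\<mu> 0) \<and> s j 1 \<in> sph (\<mu> 1)" for j
        using zpts(1)[OF s, of j] by (simp add: T_def spheres_def)
      then have "s j 0 \<in> sph 6 \<and> s j 1 \<in> sph 6" for j
        unfolding \<mu>v .
      moreover have "\<bar>s j 0 i - s l 0 i\<bar> < 1/100 \<and> \<bar>s j 1 i - s l 1 i\<bar> < 1/100" if "j \<le> 12" "l \<le> 12" for i j l
        using d(2)[OF zpts(1)[OF s] zpts(1)[OF s], of _ j l] zpts(2)[OF s, of j l] that by simp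
      ultimately have 1: "cups (map (\<lambda>(p, \<phi>). (p, zero_divisor q \<phi>)) us) s = word X_word s"
        using cups_X_classes[of s fst q] by (simp add: us_def q_def F_def del: cups.simps word.simps)
      have 2: "zero_divisor q S t = sg k (t 0 2) * word (sphere_word k 2) t" for t
      proof -
        have "word (sphere_word k 0) (\<lambda>i (\<alpha>::nat). e0) = 0"
          unfolding word_eq_prod using k
          by (intro prod_zero bexI[of _ 0]) (auto simp: sphere_word_def)
        then show ?thesis
          by (simp add: zero_divisor_def S_def sphere_class_def q_def sphere_word_comp)
      qed
      have 3: "total (map (\<lambda>(p, \<phi>). (p, zero_divisor q \<phi>)) us) = 12" by (simp add: us_def)
      show ?thesis
        unfolding ws_def map_append cups_append 1 3 by (simp add: cup_def 2)
    qed
    have "ev (cups (map (\<lambda>(p, \<phi>). (p, zero_divisor q \<phi>)) ws)) z =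
      ev (\<lambda>s. word X_word s * (sg k (s 12 2) * word (sphere_word k 2) (\<lambda>i. s (i + 12)))) z"
      by (rule ev_cong) (rule cups)
    \<comment> \<open>On antipodal simplices all sign changes agree, while the factors
      \<open>sg k\<close> add up to 1.\<close>
    also have "\<dots> = ev (word (X_word @ sphere_word k 2)) (E \<mu>)"
      unfolding z_def ev_simps ev_map ev_add[symmetric]
    proof (rule ev_cong)
      fix s assume s: "s \<in> set (E \<mu>)"
      have sT: "s i \<in> spheres 3 \<mu>" for i using pts(1)[OF s, of i] by (simp add: T_def)
      have "s 12 2 \<in> sph (\<mu> 2)" using sT[of 12] by (simp add: spheres_def)
      then have "s 12 2 \<in> sph k" unfolding \<mu>v .
      then have a: "sg k (flip 2 (s 12) 2) = sg k (s 12 2) + 1" by (simp add: flip_apply sg_minus)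
      have b: "word X_word (\<lambda>i. flip 2 (s i)) = word X_word s"
        by (rule word_flip[of s 3 \<mu>, OF sT]) (auto simp: odd_fun_sg)
      have c: "word (sphere_word k 2) (\<lambda>i. flip 2 (s (i + 12))) = word (sphere_word k 2) (\<lambda>i. s (i + 12))"
        by (rule word_flip[of "\<lambda>i. s (i + 12)" 3 \<mu>, OF sT]) (auto simp: odd_fun_sg sphere_word_def)
      have "length X_word = 12" by simp
      then show "word X_word s * (sg k (s 12 2) * word (sphere_word k 2) (\<lambda>i. s (i + 12))) +
         word X_word (\<lambda>i. flip 2 (s i)) * (sg k (flip 2 (s 12) 2) * word (sphere_word k 2) (\<lambda>i. flip 2 (s (i + 12)))) =
         word (X_word @ sphere_word k 2) s"
        unfolding word_append[of X_word] b c a by (simp only: distrib_right distrib_left mult_1_left bit_add_self_left)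
    qed
    finally show ?thesis .
  qed
  moreover have "ev (word (X_word @ sphere_word k 2)) (E \<mu>) = 1"
  proof -
    have "\<mu> \<alpha> = length (filter (\<lambda>w. fst w = \<alpha>) (X_word @ sphere_word k 2))" for \<alpha>
      by (cases "\<alpha> = 0"; cases "\<alpha> = 1"; cases "\<alpha> = 2") (auto simp: \<mu>_def sphere_word_def filter_map comp_def)
    moreover have "\<alpha> < 3 \<and> odd_fun \<epsilon>" if "(\<alpha>, \<epsilon>) \<in> set (X_word @ sphere_word k 2)" for \<alpha> \<epsilon>
      using that by (auto simp: odd_fun_sg sphere_word_def)
    moreover have "length (X_word @ sphere_word k 2) \<le> 12 + k" by (simp add: sphere_word_def)
    ultimately show ?thesis using ev_word_hemisphere_chain[OF E] by blast
  qed
  ultimately show False by simp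
qed

section \<open>Upper bounds from families of paths\<close>

text \<open>Paths in a quotient are constructed on lifts: the homotopy \<open>h\<close> has to descend along \<open>K\<close>.\<close>

definition motion ::
  "'z::topological_space set \<Rightarrow> ('z \<Rightarrow> 'q) \<Rightarrow> 'b topology \<Rightarrow> ('z \<Rightarrow> 'b) \<Rightarrow> ('z \<Rightarrow> 'b) \<Rightarrow> ('z \<Rightarrow> real \<Rightarrow> 'b) \<Rightarrow> bool" where
  "motion W K B f g h \<longleftrightarrow>
     continuous_map (top_of_set (W \<times> {0..1})) B (\<lambda>(z, t). h z t) \<and>
     (\<forall>z\<in>W. h z 0 = f z \<and> h z 1 = g z) \<and>
     (\<forall>z\<in>W. \<forall>z'\<in>W. K z = K z' \<longrightarrow> (\<forall>t\<in>{0..1::real}. h z t = h z' t))"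

definition path_family ::
  "'z::topological_space set \<Rightarrow> ('z \<Rightarrow> 'q) \<Rightarrow> 'b topology \<Rightarrow> ('z \<Rightarrow> 'b) \<Rightarrow> ('z \<Rightarrow> 'b) \<Rightarrow> bool" where
  "path_family W K B f g \<longleftrightarrow> (\<exists>h. motion W K B f g h)"

lemma motionD:
  assumes "motion W K B f g h"
  shows "continuous_map (top_of_set (W \<times> {0..1})) B (\<lambda>(z, t). h z t)"
    and "\<And>z. z \<in> W \<Longrightarrow> h z 0 = f z \<and> h z 1 = g z"
    and "\<And>z z' t. z \<in> W \<Longrightarrow> z' \<in> W \<Longrightarrow> K z = K z' \<Longrightarrow> t \<in> {0..1} \<Longrightarrow> h z t = h z' t"
  using assms unfolding motion_def by blast+

lemma motionI:
  assumes "continuous_map (top_of_set (W \<times> {0..1})) B (\<lambda>(z, t). h z t)"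
    "\<And>z. z \<in> W \<Longrightarrow> h z 0 = f z" "\<And>z. z \<in> W \<Longrightarrow> h z 1 = g z"
    "\<And>z z' t. z \<in> W \<Longrightarrow> z' \<in> W \<Longrightarrow> K z = K z' \<Longrightarrow> t \<in> {0..1::real} \<Longrightarrow> h z t = h z' t"
  shows "motion W K B f g h"
proof -
  have "\<forall>z\<in>W. h z 0 = f z \<and> h z 1 = g z" using assms(2,3) by blast
  moreover have "\<forall>z\<in>W. \<forall>z'\<in>W. K z = K z' \<longrightarrow> (\<forall>t\<in>{0..1}. h z t = h z' t)"
    by (intro ballI impI) (rule assms(4))
  ultimately show ?thesis unfolding motion_def using assms(1) by (intro conjI)
qed

lemma path_family_motion: "motion W K B f g h \<Longrightarrow> path_family W K B f g"
  unfolding path_family_def by (rule exI[of _ h])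

lemmas path_familyI = motionI[THEN path_family_motion]

lemma path_familyE:
  assumes "path_family W K B f g"
  obtains h where "motion W K B f g h"
  using assms unfolding path_family_def by blast

lemma path_family_cong:
  assumes "path_family W K B f g" "\<And>z. z \<in> W \<Longrightarrow> f z = f' z" "\<And>z. z \<in> W \<Longrightarrow> g z = g' z"
  shows "path_family W K B f' g'"
proof -
  obtain h where "motion W K B f g h" using assms(1) by (rule path_familyE)
  note h = motionD[OF this]
  show ?thesis
  proof (rule path_familyI[where h = h])
    show "h z 0 = f' z" if "z \<in> W" for z using h(2)[OF that] assms(2)[OF that] by simp
    show "h z 1 = g' z" if "z \<in> W" for z using h(2)[OF that] assms(3)[OF that] by simp
    show "h z t = h z' t" if "z \<in> W" "z' \<in> W" "K z = K z'" "t \<in> {0..1}" for z z' t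
      by (rule h(3)[OF that])
  qed (rule h(1))
qed

lemma path_family_subset:
  assumes "path_family W K B f g" "W' \<subseteq> W"
  shows "path_family W' K B f g"
proof -
  obtain h where "motion W K B f g h" using assms(1) by (rule path_familyE)
  note h = motionD[OF this]
  show ?thesis
  proof (rule path_familyI[where h = h])
    show "continuous_map (top_of_set (W' \<times> {0..1})) B (\<lambda>(z, t). h z t)"
      using assms(2) by (intro continuous_map_from_subtopology_mono[OF h(1)]) auto
    show "h z 0 = f z" "h z 1 = g z" if "z \<in> W'" for z
      using h(2)[of z] assms(2) that by auto
    show "h z t = h z' t" if "z \<in> W'" "z' \<in> W'" "K z = K z'" "t \<in> {0..1}" for z z' t
      by (rule h(3)) (use that assms(2) in auto)
  qed
qed

lemma continuous_map_reparam:
  assumes "continuous_map (top_of_set (W \<times> {0..1})) B (\<lambda>(z, t). h z t)"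
    "S \<subseteq> W \<times> {0..1::real}" "continuous_on {0..1} \<tau>" "\<And>p. p \<in> S \<Longrightarrow> \<tau> (snd p) \<in> {0..1}"
  shows "continuous_map (top_of_set S) B (\<lambda>(z, t). h z (\<tau> t))"
proof -
  have "continuous_on S (\<lambda>p. \<tau> (snd p))"
    by (rule continuous_on_compose2[OF assms(3)]) (use assms(2) in \<open>auto intro!: continuous_intros\<close>)
  then have "continuous_map (top_of_set S) (top_of_set (W \<times> {0..1})) (\<lambda>p. (fst p, \<tau> (snd p)))"
    using assms(2,4) by (force simp: continuous_map_in_subtopology intro!: continuous_intros)
  from continuous_map_compose[OF this assms(1)] show ?thesis
    by (simp add: comp_def case_prod_beta')
qed

lemma path_family_reverse:
  assumes "path_family W K B f g"
  shows "path_family W K B g f"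
proof -
  obtain h where "motion W K B f g h" using assms(1) by (rule path_familyE)
  note h = motionD[OF this]
  show ?thesis
  proof (rule path_familyI[where h = "\<lambda>z t. h z (1 - t)"])
    show "continuous_map (top_of_set (W \<times> {0..1})) B (\<lambda>(z, t). h z (1 - t))"
      by (rule continuous_map_reparam[OF h(1)]) (auto intro!: continuous_intros)
    show "h z (1 - 0) = g z" "h z (1 - 1) = f z" if "z \<in> W" for z
      using h(2)[OF that] by auto
    show "h z (1 - t) = h z' (1 - t)" if "z \<in> W" "z' \<in> W" "K z = K z'" "t \<in> {0..1}" for z z' t
      by (rule h(3)[OF that(1-3)]) (use that(4) in auto)
  qed
qed

lemma path_family_join:
  assumes "path_family W K B f g" "path_family W K B g k"
  shows "path_family W K B f k"
proof -
  obtain h where "motion W K B f g h" using assms(1) by (rule path_familyE)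
  note h = motionD[OF this]
  obtain h' where "motion W K B g k h'" using assms(2) by (rule path_familyE)
  note h' = motionD[OF this]
  define j where "j = (\<lambda>z t. if t \<le> 1/2 then h z (2 * t) else h' z (2 * t - 1))"
  show ?thesis
  proof (rule path_familyI[where h = j])
    let ?X = "top_of_set (W \<times> {0..1::real})"
    have "continuous_map ?X B (\<lambda>p. if snd p \<le> 1/2 then (case p of (z, t) \<Rightarrow> h z (2 * t)) else (case p of (z, t) \<Rightarrow> h' z (2 * t - 1)))"
    proof (rule continuous_map_cases_le)
      show "continuous_map ?X euclideanreal snd" by (auto intro!: continuous_intros)
      show "continuous_map (subtopology ?X {x \<in> topspace ?X. snd x \<le> 1/2}) B (\<lambda>(z, t). h z (2 * t))"
        unfolding subtopology_subtopology
        by (rule continuous_map_reparam[OF h(1)]) (auto intro!: continuous_intros)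
      show "continuous_map (subtopology ?X {x \<in> topspace ?X. 1/2 \<le> snd x}) B (\<lambda>(z, t). h' z (2 * t - 1))"
        unfolding subtopology_subtopology
        by (rule continuous_map_reparam[OF h'(1)]) (auto intro!: continuous_intros)
    next
      fix x assume "x \<in> topspace ?X" "snd x = (1/2::real)"
      then obtain z where "x = (z, 1/2)" "z \<in> W" by (cases x) auto
      then show "(case x of (z, t) \<Rightarrow> h z (2 * t)) = (case x of (z, t) \<Rightarrow> h' z (2 * t - 1))"
        using h(2)[of z] h'(2)[of z] by simp
    qed auto
    then show "continuous_map ?X B (\<lambda>(z, t). j z t)"
      by (simp add: j_def case_prod_unfold cong: if_cong)
    show "j z 0 = f z" "j z 1 = k z" if "z \<in> W" for z using h(2) h'(2) that by (auto simp: j_def)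
    show "j z t = j z' t" if "z \<in> W" "z' \<in> W" "K z = K z'" "t \<in> {0..1}" for z z' t
      using h(3)[OF that(1-3), of "2 * t"] h'(3)[OF that(1-3), of "2 * t - 1"] that(4) by (auto simp: j_def)
  qed
qed

lemma path_family_Pair:
  assumes "path_family W K B f g" "path_family W K B' f' g'"
  shows "path_family W K (prod_topology B B') (\<lambda>z. (f z, f' z)) (\<lambda>z. (g z, g' z))"
proof -
  obtain h where "motion W K B f g h" using assms(1) by (rule path_familyE)
  note h = motionD[OF this]
  obtain h' where "motion W K B' f' g' h'" using assms(2) by (rule path_familyE)
  note h' = motionD[OF this]
  show ?thesis
  proof (rule path_familyI[where h = "\<lambda>z t. (h z t, h' z t)"])
    show "continuous_map (top_of_set (W \<times> {0..1})) (prod_topology B B') (\<lambda>(z, t). (h z t, h' z t))"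
      using continuous_map_pairedI[OF h(1) h'(1)] by (simp add: case_prod_beta')
    show "(h z t, h' z t) = (h z' t, h' z' t)" if "z \<in> W" "z' \<in> W" "K z = K z'" "t \<in> {0..1}" for z z' t
      using h(3)[OF that] h'(3)[OF that] by simp
  qed (use h(2) h'(2) in auto)
qed

lemma path_family_map:
  assumes "path_family W K B f g" "continuous_map B B' \<phi>"
  shows "path_family W K B' (\<lambda>z. \<phi> (f z)) (\<lambda>z. \<phi> (g z))"
proof -
  obtain h where "motion W K B f g h" using assms(1) by (rule path_familyE)
  note h = motionD[OF this]
  show ?thesis
  proof (rule path_familyI[where h = "\<lambda>z t. \<phi> (h z t)"])
    show "continuous_map (top_of_set (W \<times> {0..1})) B' (\<lambda>(z, t). \<phi> (h z t))"
      using continuous_map_compose[OF h(1) assms(2)] by (simp add: case_prod_beta' comp_def)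
    show "\<phi> (h z t) = \<phi> (h z' t)" if "z \<in> W" "z' \<in> W" "K z = K z'" "t \<in> {0..1}" for z z' t
      using h(3)[OF that] by simp
    show "\<phi> (h z 0) = \<phi> (f z)" "\<phi> (h z 1) = \<phi> (g z)" if "z \<in> W" for z using h(2)[OF that] by simp_all
  qed
qed

text \<open>Paths over different regions are unrelated, so merging them takes disjointness;
  saturation with respect to \<open>K\<close> preserves the descent.\<close>

lemma path_family_disjoint_UN:
  assumes pf: "\<And>i. i \<in> I \<Longrightarrow> path_family (W i) K B f g"
    and op: "\<And>i. i \<in> I \<Longrightarrow> openin (top_of_set (\<Union>i\<in>I. W i)) (W i)"
    and disj: "\<And>i j. i \<in> I \<Longrightarrow> j \<in> I \<Longrightarrow> i \<noteq> j \<Longrightarrow> W i \<inter> W j = {}"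
    and sat: "\<And>i z z'. i \<in> I \<Longrightarrow> z \<in> W i \<Longrightarrow> z' \<in> (\<Union>i\<in>I. W i) \<Longrightarrow> K z = K z' \<Longrightarrow> z' \<in> W i"
  shows "path_family (\<Union>i\<in>I. W i) K B f g"
proof -
  have "\<exists>h. motion (W i) K B f g h" if "i \<in> I" for i
    using pf[OF that] unfolding path_family_def .
  then obtain h where h: "\<And>i. i \<in> I \<Longrightarrow> motion (W i) K B f g (h i)"
    by metis
  define \<iota> where "\<iota> = (\<lambda>z. SOME i. i \<in> I \<and> z \<in> W i)"
  have \<iota>: "\<iota> z = i" if "i \<in> I" "z \<in> W i" for i z
  proof -
    have "\<iota> z \<in> I \<and> z \<in> W (\<iota> z)" unfolding \<iota>_def by (rule someI[of _ i]) (use that in auto)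
    then show ?thesis using disj[of "\<iota> z" i] that by auto
  qed
  let ?U = "\<Union>i\<in>I. W i"
  show ?thesis
  proof (rule path_familyI[where h = "\<lambda>z. h (\<iota> z) z"])
    show "continuous_map (top_of_set (?U \<times> {0..1})) B (\<lambda>(z, t). h (\<iota> z) z t)"
    proof (rule pasting_lemma[where I = I and T = "\<lambda>i. W i \<times> {0..1}" and f = "\<lambda>i (z, t). h i z t"])
      fix i assume i: "i \<in> I"
      have "openin (prod_topology (top_of_set ?U) (top_of_set {0..1::real})) (W i \<times> {0..1})"
        unfolding openin_prod_Times_iff using op[OF i] by simp
      then show "openin (top_of_set (?U \<times> {0..1::real})) (W i \<times> {0..1})"
        unfolding prod_topology_subtopology_eu .
      have "?U \<times> {0..1} \<inter> W i \<times> {0..1::real} = W i \<times> {0..1}" using i by auto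
      then show "continuous_map (subtopology (top_of_set (?U \<times> {0..1})) (W i \<times> {0..1})) B (\<lambda>(z, t). h i z t)"
        using motionD(1)[OF h[OF i]] by (simp add: subtopology_subtopology)
    next
      fix i j x assume "i \<in> I" "j \<in> I" "x \<in> topspace (top_of_set (?U \<times> {0..1::real})) \<inter> W i \<times> {0..1} \<inter> W j \<times> {0..1}"
      then have "i = j" using disj[of i j] by auto
      then show "(case x of (z, t) \<Rightarrow> h i z t) = (case x of (z, t) \<Rightarrow> h j z t)" by simp
    next
      fix x assume "x \<in> topspace (top_of_set (?U \<times> {0..1::real}))"
      then obtain z t i where x: "x = (z, t)" "i \<in> I" "z \<in> W i" "t \<in> {0..1}" by auto
      then show "\<exists>j. j \<in> I \<and> x \<in> W j \<times> {0..1} \<and> (case x of (z, t) \<Rightarrow> h (\<iota> z) z t) = (case x of (z, t) \<Rightarrow> h j z t)"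
        using \<iota>[OF x(2,3)] by (intro exI[of _ i]) auto
    qed
    show "h (\<iota> z) z 0 = f z" "h (\<iota> z) z 1 = g z" if z: "z \<in> ?U" for z
    proof -
      obtain i where i: "i \<in> I" "z \<in> W i" using z by auto
      show "h (\<iota> z) z 0 = f z" "h (\<iota> z) z 1 = g z"
        unfolding \<iota>[OF i] using motionD(2)[OF h[OF i(1)] i(2)] by simp_all
    qed
    fix z z' t assume *: "z \<in> ?U" "z' \<in> ?U" "K z = K z'" "t \<in> {0..1::real}"
    then obtain i where i: "i \<in> I" "z \<in> W i" by auto
    then have z': "z' \<in> W i" using sat *(2,3) by blast
    show "h (\<iota> z) z t = h (\<iota> z') z' t"
      unfolding \<iota>[OF i] \<iota>[OF i(1) z'] by (rule motionD(3)[OF h[OF i(1)] i(2) z' *(3,4)])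
  qed
qed

text \<open>Half of the exponential law. Projection along a compact \<open>K\<close> is closed, so
  the parameters whose paths map \<open>K\<close> into an open set form an open set.\<close>

lemma continuous_map_into_path_space:
  fixes W :: "'z::topological_space set"
  assumes h: "continuous_map (top_of_set (W \<times> {0..1})) B (\<lambda>(z, t). h z t)"
  shows "continuous_map (top_of_set W) (path_space B) (\<lambda>z. restrict (h z) {0..1})"
proof -
  have h': "continuous_map (prod_topology (top_of_set W) (top_of_set {0..1})) B (\<lambda>(z, t). h z t)"
    using h by (simp add: prod_topology_subtopology_eu)
  have path: "pathin B (restrict (h z) {0..1})" if z: "z \<in> W" for z
  proof -
    have "continuous_map (top_of_set {0..1}) (prod_topology (top_of_set W) (top_of_set {0..1})) (\<lambda>t. (z, t))"
      using z by (intro continuous_map_pairedI) auto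
    from continuous_map_compose[OF this h'] show ?thesis
      unfolding pathin_def by (rule continuous_map_eq) auto
  qed
  show ?thesis
    unfolding path_space_def
  proof (rule continuous_on_generated_topo)
    fix U assume "U \<in> {{g \<in> extensional {0..1}. pathin B g \<and> g ` K \<subseteq> U} | K U. K \<subseteq> {0..1} \<and> compact K \<and> openin B U}"
    then obtain K V where U: "U = {g \<in> extensional {0..1}. pathin B g \<and> g ` K \<subseteq> V}" and K: "K \<subseteq> {0..1}" "compact K"
      and V: "openin B V" by blast
    define N where "N = {p \<in> W \<times> K. (case p of (z, t) \<Rightarrow> h z t) \<in> topspace B - V}"
    have hK: "continuous_map (prod_topology (top_of_set W) (top_of_set K)) B (\<lambda>(z, t). h z t)"
      unfolding prod_topology_subtopology_eu
      by (rule continuous_map_from_subtopology_mono[OF h]) (use K(1) in auto)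
    have V': "closedin B (topspace B - V)" using V by blast
    have cl: "closedin (prod_topology (top_of_set W) (top_of_set K)) N"
      using closedin_continuous_map_preimage[OF hK V'] by (simp add: N_def)
    have "compact_space (top_of_set K)" using K(2) by (simp add: compact_space_subtopology)
    then have "closedin (top_of_set W) (fst ` N)"
      using closed_map_fst[of "top_of_set K" "top_of_set W"] cl unfolding closed_map_def by blast
    then have "openin (top_of_set W) (W - fst ` N)"
      by (metis openin_diff openin_topspace topspace_euclidean_subtopology)
    moreover have "W - fst ` N = (\<lambda>z. restrict (h z) {0..1}) -` U \<inter> topspace (top_of_set W)"
    proof -
      have hB: "h z t \<in> topspace B" if "z \<in> W" "t \<in> K" for z t
        using continuous_map_image_subset_topspace[OF h] that K by force
      have "z \<notin> fst ` N \<longleftrightarrow> restrict (h z) {0..1} \<in> U" if z: "z \<in> W" for z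
      proof -
        have "z \<notin> fst ` N \<longleftrightarrow> (\<forall>t\<in>K. h z t \<in> V)"
          using z hB[OF z] by (force simp: N_def image_iff)
        also have "\<dots> \<longleftrightarrow> restrict (h z) {0..1} ` K \<subseteq> V" using K(1) by (auto simp: subset_iff)
        also have "\<dots> \<longleftrightarrow> restrict (h z) {0..1} \<in> U" using path[OF z] by (simp add: U)
        finally show ?thesis .
      qed
      then show ?thesis by auto
    qed
    ultimately show "openin (top_of_set W) ((\<lambda>z. restrict (h z) {0..1}) -` U \<inter> topspace (top_of_set W))" by simp
  next
    have "(\<lambda>z. restrict (h z) {0..1}) ` topspace (top_of_set W) \<subseteq> topspace (path_space B)"
      using path by (auto simp: topspace_path_space)
    then show "(\<lambda>z. restrict (h z) {0..1}) ` topspace (top_of_set W) \<subseteq>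
      \<Union> {{g \<in> extensional {0..1}. pathin B g \<and> g ` K \<subseteq> U} | K U. K \<subseteq> {0..1} \<and> compact K \<and> openin B U}"
      unfolding path_space_def topology_generated_by_topspace .
  qed
qed

text \<open>An open saturated region is given as the positivity set of a function rather than as a
  set, because the staircase compares partial sums of these functions.\<close>

definition cover_fun :: "'z::topological_space set \<Rightarrow> ('z \<Rightarrow> 'q) \<Rightarrow> ('z \<Rightarrow> real) \<Rightarrow> bool" where
  "cover_fun Z K F \<longleftrightarrow> continuous_on Z F \<and> (\<forall>z\<in>Z. F z \<ge> 0) \<and> (\<forall>z\<in>Z. \<forall>z'\<in>Z. K z = K z' \<longrightarrow> F z = F z')"

lemma cover_funD:
  assumes "cover_fun Z K F"
  shows "continuous_on Z F" "z \<in> Z \<Longrightarrow> F z \<ge> 0" "z \<in> Z \<Longrightarrow> z' \<in> Z \<Longrightarrow> K z = K z' \<Longrightarrow> F z = F z'"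
  using assms unfolding cover_fun_def by blast+

text \<open>A continuous map from a compact space onto a Hausdorff space is a quotient map.
  Saturated open sets and path-valued maps that are constant on the fibres of \<open>Q\<close>
  therefore descend.\<close>

theorem TC_upper_bound:
  fixes Z :: "'z::t2_space set"
  assumes Z: "compact Z" and Q: "continuous_map (top_of_set Z) (prod_topology B B) Q"
    and surj: "Q ` Z = topspace (prod_topology B B)" and B: "Hausdorff_space B"
    and F: "\<And>i. i \<le> n \<Longrightarrow> cover_fun Z Q (F i)"
    and cov: "\<And>z. z \<in> Z \<Longrightarrow> \<exists>i\<le>n. F i z > 0"
    and pf: "\<And>i. i \<le> n \<Longrightarrow> path_family {z \<in> Z. F i z > 0} Q B (\<lambda>z. fst (Q z)) (\<lambda>z. snd (Q z))"
  shows "TC B \<le> enat n"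
proof -
  have qm: "quotient_map (top_of_set Z) (prod_topology B B) Q"
    by (rule T1_Spaces.continuous_imp_quotient_map)
       (use Z Q surj B in \<open>auto simp: compact_space_subtopology Hausdorff_space_prod_topology\<close>)
  define U where "U = (\<lambda>i. Q ` {z \<in> Z. F i z > 0})"
  have pre: "{z \<in> topspace (top_of_set Z). Q z \<in> U i} = {z \<in> Z. F i z > 0}" if "i \<le> n" for i
  proof (intro Collect_cong iffI)
    fix z assume "z \<in> topspace (top_of_set Z) \<and> Q z \<in> U i"
    then obtain z' where z': "z \<in> Z" "z' \<in> Z" "F i z' > 0" "Q z = Q z'" by (auto simp: U_def)
    have "F i z = F i z'" by (rule cover_funD(3)[OF F[OF that] z'(1,2,4)])
    then show "z \<in> Z \<and> 0 < F i z" using z' by simp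
  qed (auto simp: U_def)
  have op: "openin (prod_topology B B) (U i)" if "i \<le> n" for i
  proof -
    have "openin (top_of_set Z) (Z \<inter> F i -` {0<..})"
      by (rule continuous_openin_preimage_gen[OF cover_funD(1)[OF F[OF that]]]) simp
    moreover have "Z \<inter> F i -` {0<..} = {z \<in> Z. F i z > 0}" by auto
    ultimately have "openin (top_of_set Z) {z \<in> topspace (top_of_set Z). Q z \<in> U i}" using pre[OF that] by simp
    moreover have "U i \<subseteq> topspace (prod_topology B B)" using surj by (auto simp: U_def)
    ultimately show ?thesis using qm unfolding quotient_map_def by blast
  qed
  have sec: "has_path_section B (U i)" if i: "i \<le> n" for i
  proof -
    define W where "W = {z \<in> Z. F i z > 0}"
    obtain h where "motion W Q B (\<lambda>z. fst (Q z)) (\<lambda>z. snd (Q z)) h"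
      using pf[OF i] unfolding W_def by (rule path_familyE)
    note h = motionD[OF this]
    \<comment> \<open>An arbitrary lift; the invariance of the motion makes the resulting path
      independent of it.\<close>
    define \<sigma> where "\<sigma> = (\<lambda>p. SOME z. z \<in> W \<and> Q z = p)"
    define s where "s = (\<lambda>p. restrict (h (\<sigma> p)) {0..1})"
    have \<sigma>: "\<sigma> (Q z) \<in> W \<and> Q (\<sigma> (Q z)) = Q z" if "z \<in> W" for z
      unfolding \<sigma>_def by (rule someI[of _ z]) (use that in auto)
    have sQ: "s (Q z) = restrict (h z) {0..1}" if "z \<in> W" for z
      unfolding s_def using h(3)[of "\<sigma> (Q z)" z] \<sigma>[OF that] that by (auto simp: fun_eq_iff)
    have "quotient_map (subtopology (top_of_set Z) W) (subtopology (prod_topology B B) (U i)) Q"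
      using quotient_map_restriction[OF qm, of "U i" W] pre[OF i] op[OF i] by (simp add: W_def)
    moreover have "subtopology (top_of_set Z) W = top_of_set W"
      by (simp add: subtopology_subtopology W_def Int_absorb1 subset_iff)
    ultimately have qW: "quotient_map (top_of_set W) (subtopology (prod_topology B B) (U i)) Q" by simp
    have "continuous_map (top_of_set W) (path_space B) (s \<circ> Q)"
      by (rule continuous_map_eq[OF continuous_map_into_path_space[OF h(1)]]) (simp add: sQ)
    then have "continuous_map (subtopology (prod_topology B B) (U i)) (path_space B) s"
      by (rule continuous_compose_quotient_map[OF qW])
    moreover have "path_ends (s p) = p" if p: "p \<in> U i" for p
    proof -
      obtain z where z: "z \<in> W" "p = Q z" using p unfolding U_def W_def by blast
      show ?thesis unfolding z(2) sQ[OF z(1)] using h(2)[OF z(1)] by (simp add: path_ends_def)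
    qed
    ultimately show ?thesis unfolding has_path_section_def by blast
  qed
  have "(\<Union>i\<le>n. U i) = topspace (prod_topology B B)"
  proof
    show "(\<Union>i\<le>n. U i) \<subseteq> topspace (prod_topology B B)" using surj by (auto simp: U_def)
    show "topspace (prod_topology B B) \<subseteq> (\<Union>i\<le>n. U i)"
    proof
      fix p assume "p \<in> topspace (prod_topology B B)"
      then obtain z where z: "z \<in> Z" "p = Q z" unfolding surj[symmetric] by blast
      obtain i where "i \<le> n" "F i z > 0" using cov[OF z(1)] by blast
      then show "p \<in> (\<Union>i\<le>n. U i)" using z by (auto simp: U_def)
    qed
  qed
  then show ?thesis
    unfolding TC_def using op sec by (intro Inf_lower) blast
qed

lemma cover_funI:
  assumes "continuous_on Z F" "\<And>z. z \<in> Z \<Longrightarrow> F z \<ge> 0"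
    "\<And>z z'. z \<in> Z \<Longrightarrow> z' \<in> Z \<Longrightarrow> K z = K z' \<Longrightarrow> F z = F z'"
  shows "cover_fun Z K F"
proof -
  have "\<forall>z\<in>Z. \<forall>z'\<in>Z. K z = K z' \<longrightarrow> F z = F z'" by (intro ballI impI) (rule assms(3))
  then show ?thesis unfolding cover_fun_def using assms(1,2) by blast
qed

lemma cover_fun_sum:
  assumes "\<And>i. i \<in> I \<Longrightarrow> cover_fun Z K (F i)"
  shows "cover_fun Z K (\<lambda>z. \<Sum>i\<in>I. F i z)"
proof (rule cover_funI)
  show "continuous_on Z (\<lambda>z. \<Sum>i\<in>I. F i z)"
    by (intro continuous_on_sum cover_funD(1)[OF assms])
  show "(\<Sum>i\<in>I. F i z) \<ge> 0" if "z \<in> Z" for z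
    by (intro sum_nonneg cover_funD(2)[OF assms that])
  show "(\<Sum>i\<in>I. F i z) = (\<Sum>i\<in>I. F i z')" if "z \<in> Z" "z' \<in> Z" "K z = K z'" for z z'
    by (intro sum.cong refl cover_funD(3)[OF assms that])
qed

text \<open>Regions are indexed by all natural numbers and may be empty. How many are used is
  recorded separately at each point, by its least positive index.\<close>

definition planner ::
  "'z::topological_space set \<Rightarrow> ('z \<Rightarrow> 'q) \<Rightarrow> 'b topology \<Rightarrow> ('z \<Rightarrow> 'b) \<Rightarrow> ('z \<Rightarrow> 'b) \<Rightarrow> (nat \<Rightarrow> 'z \<Rightarrow> real) \<Rightarrow> bool" where
  "planner Z K B f g F \<longleftrightarrow>
     (\<forall>i. cover_fun Z K (F i) \<and> path_family {z \<in> Z. F i z > 0} K B f g)"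

lemma plannerD:
  assumes "planner Z K B f g F"
  shows "cover_fun Z K (F i)" "path_family {z \<in> Z. F i z > 0} K B f g"
  using assms unfolding planner_def by blast+

text \<open>The indices \<open>i\<close> and \<open>j\<close> of the two covers advance alternately along a staircase of partial sums, so
  the regions belonging to the same total index are disjoint.\<close>

definition stair :: "(nat \<Rightarrow> 'z \<Rightarrow> real) \<Rightarrow> (nat \<Rightarrow> 'z \<Rightarrow> real) \<Rightarrow> nat \<Rightarrow> nat \<Rightarrow> 'z \<Rightarrow> real" where
  "stair F G i j z = max 0 (min (min (F i z) (G j z))
     (min ((\<Sum>l\<le>j. G l z) - (\<Sum>l<i. F l z)) ((\<Sum>l\<le>i. F l z) - (\<Sum>l<j. G l z))))"

text \<open>Lay intervals of lengths \<open>F 0 z\<close>, \<open>F 1 z\<close>, ... end to end on a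
  line, and likewise for \<open>G\<close>. The condition says that the \<open>i\<close>-th and the
  \<open>j\<close>-th interval are nonempty and overlap.\<close>

lemma stair_pos:
  "stair F G i j z > 0 \<longleftrightarrow> F i z > 0 \<and> G j z > 0 \<and>
     (\<Sum>l<i. F l z) < (\<Sum>l\<le>j. G l z) \<and> (\<Sum>l<j. G l z) < (\<Sum>l\<le>i. F l z)"
  by (auto simp: stair_def)

lemma cover_fun_stair:
  assumes F: "\<And>i. cover_fun Z K (F i)" and G: "\<And>j. cover_fun Z K (G j)"
  shows "cover_fun Z K (stair F G i j)"
proof (rule cover_funI)
  have c: "continuous_on Z (F i)" "continuous_on Z (G j)" for i j
    using F G cover_funD(1) by blast+
  show "continuous_on Z (stair F G i j)"
    unfolding stair_def[abs_def] by (intro continuous_intros c)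
  show "stair F G i j z = stair F G i j z'" if "z \<in> Z" "z' \<in> Z" "K z = K z'" for z z'
  proof -
    have "F i z = F i z'" "G i z = G i z'" for i
      by (rule cover_funD(3)[OF F that], rule cover_funD(3)[OF G that])
    then show ?thesis by (simp add: stair_def)
  qed
qed (simp add: stair_def)

text \<open>If \<open>i < i'\<close>, then \<open>j' < j\<close>. The \<open>F\<close>-interval
  \<open>i\<close> ends before \<open>i'\<close> begins, and the \<open>G\<close>-interval
  \<open>j'\<close> ends before \<open>j\<close> begins, so the overlaps of \<open>i\<close> with
  \<open>j\<close> and of \<open>i'\<close> with \<open>j'\<close> contradict each other.\<close>

lemma stair_disjoint:
  assumes "\<And>i. F i z \<ge> 0" "\<And>j. G j z \<ge> 0"
    "stair F G i j z > 0" "stair F G i' j' z > 0" "i + j = i' + j'"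
  shows "i = i'"
  using assms
proof (induction i i' arbitrary: j j' rule: linorder_wlog)
  case (le i i')
  show ?case
  proof (rule ccontr)
    assume "i \<noteq> i'"
    then have lt: "i < i'" "j' < j" using le by auto
    have "(\<Sum>l\<le>i. F l z) \<le> (\<Sum>l<i'. F l z)" "(\<Sum>l\<le>j'. G l z) \<le> (\<Sum>l<j. G l z)"
      using lt le(2,3) by (auto intro!: sum_mono2)
    then show False using le(4,5) unfolding stair_pos by linarith
  qed
next
  case (sym i i')
  show ?case by (rule sym(1)[OF sym(2,3,5,4) sym(6)[symmetric], symmetric])
qed

definition least_pos :: "(nat \<Rightarrow> 'z \<Rightarrow> real) \<Rightarrow> 'z \<Rightarrow> nat \<Rightarrow> bool" where
  "least_pos F z i \<longleftrightarrow> F i z > 0 \<and> (\<forall>i'<i. F i' z = 0)"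

definition stair_cover ::
  "'z set \<Rightarrow> (nat \<Rightarrow> 'z \<Rightarrow> real) \<Rightarrow> (nat \<Rightarrow> 'z \<Rightarrow> real) \<Rightarrow> (nat \<Rightarrow> 'z \<Rightarrow> real) \<Rightarrow> bool" where
  "stair_cover Z F G H \<longleftrightarrow>
     (\<forall>z\<in>Z. \<forall>i j. least_pos F z i \<longrightarrow> least_pos G z j \<longrightarrow> H (i + j) z > 0)"

text \<open>Regions with equal \<open>i + j\<close> are disjoint and are merged into one. The
  intervals of the two least positive indices both start at 0, so they overlap, and the region with
  their sum as index contains the point.\<close>

theorem planner_prod:
  assumes "planner Z K B f g F" "planner Z K B' f' g' G"
  obtains H where "planner Z K (prod_topology B B') (\<lambda>z. (f z, f' z)) (\<lambda>z. (g z, g' z)) H"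
    "stair_cover Z F G H"
proof -
  note F = plannerD[OF assms(1)] and G = plannerD[OF assms(2)]
  define H where "H = (\<lambda>s z. \<Sum>i\<le>s. stair F G i (s - i) z)"
  let ?W = "\<lambda>s i. {z \<in> Z. stair F G i (s - i) z > 0}"
  have cs: "cover_fun Z K (stair F G i j)" for i j by (rule cover_fun_stair[OF F(1) G(1)])
  have nn: "stair F G i j z \<ge> 0" for i j z by (simp add: stair_def)
  have W: "{z \<in> Z. H s z > 0} = (\<Union>i\<in>{..s}. ?W s i)" for s
  proof -
    have "H s z > 0 \<longleftrightarrow> (\<exists>i\<in>{..s}. stair F G i (s - i) z > 0)" for z
      unfolding H_def by (meson nn finite_atMost less_le_not_le sum_nonneg sum_nonpos sum_pos2 not_le)
    then show ?thesis by auto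
  qed
  have opn: "openin (top_of_set Z) (?W s i)" for s i
  proof -
    have "openin (top_of_set Z) (Z \<inter> stair F G i (s - i) -` {0<..})"
      by (rule continuous_openin_preimage_gen[OF cover_funD(1)[OF cs]]) simp
    moreover have "Z \<inter> stair F G i (s - i) -` {0<..} = ?W s i" by auto
    ultimately show ?thesis by simp
  qed
  have "path_family (\<Union>i\<in>{..s}. ?W s i) K (prod_topology B B') (\<lambda>z. (f z, f' z)) (\<lambda>z. (g z, g' z))" for s
  proof (rule path_family_disjoint_UN)
    fix i assume i: "i \<in> {..s}"
    show "path_family (?W s i) K (prod_topology B B') (\<lambda>z. (f z, f' z)) (\<lambda>z. (g z, g' z))"
      by (intro path_family_Pair path_family_subset[OF F(2)] path_family_subset[OF G(2)])
         (auto simp: stair_pos)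
    show "openin (top_of_set (\<Union>i\<in>{..s}. ?W s i)) (?W s i)"
      by (rule openin_subset_trans[OF opn]) (use i in auto)
  next
    fix i j assume ij: "i \<in> {..s}" "j \<in> {..s}" "i \<noteq> j"
    have "i = j" if "z \<in> ?W s i" "z \<in> ?W s j" for z
      by (rule stair_disjoint[of F z G i "s - i" j "s - j"])
         (use that ij cover_funD(2)[OF F(1)] cover_funD(2)[OF G(1)] in auto)
    then show "?W s i \<inter> ?W s j = {}" using ij(3) by blast
  next
    fix i z z' assume z: "z \<in> ?W s i" "z' \<in> (\<Union>i\<in>{..s}. ?W s i)" "K z = K z'"
    then have "z \<in> Z" "z' \<in> Z" by auto
    then have "stair F G i (s - i) z = stair F G i (s - i) z'" by (rule cover_funD(3)[OF cs _ _ z(3)])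
    then show "z' \<in> ?W s i" using z(1) \<open>z' \<in> Z\<close> by simp
  qed
  moreover have "cover_fun Z K (H s)" for s
    unfolding H_def by (rule cover_fun_sum) (rule cs)
  ultimately have pl: "planner Z K (prod_topology B B') (\<lambda>z. (f z, f' z)) (\<lambda>z. (g z, g' z)) H"
    unfolding planner_def W by blast
  have pos: "H (i + j) z > 0" if z: "z \<in> Z" "least_pos F z i" "least_pos G z j" for z i j
  proof -
    have "(\<Sum>l<i. F l z) = 0" "(\<Sum>l<j. G l z) = 0" using z(2,3) by (auto simp: least_pos_def)
    moreover have "F i z > 0" "G j z > 0" using z(2,3) by (simp_all add: least_pos_def)
    moreover have "F i z \<le> (\<Sum>l\<le>i. F l z)" "G j z \<le> (\<Sum>l\<le>j. G l z)"
      using cover_funD(2)[OF F(1) z(1)] cover_funD(2)[OF G(1) z(1)] by (auto intro!: member_le_sum)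
    ultimately have "stair F G i j z > 0" unfolding stair_pos by linarith
    moreover have "stair F G i j z \<le> H (i + j) z"
      unfolding H_def using member_le_sum[of i "{..i+j}" "\<lambda>i'. stair F G i' (i + j - i') z"] nn by simp
    ultimately show ?thesis by linarith
  qed
  show ?thesis by (rule that[OF pl]) (use pos in \<open>auto simp: stair_cover_def\<close>)
qed

lemma planner_map:
  assumes "planner Z K B f g F" "continuous_map B B' \<phi>"
  shows "planner Z K B' (\<lambda>z. \<phi> (f z)) (\<lambda>z. \<phi> (g z)) F"
  unfolding planner_def using plannerD(1)[OF assms(1)] path_family_map[OF plannerD(2)[OF assms(1)] assms(2)] by blast

lemma planner_reverse:
  assumes "planner Z K B f g F"
  shows "planner Z K B g f F"
  unfolding planner_def using plannerD(1)[OF assms(1)] path_family_reverse[OF plannerD(2)[OF assms(1)]] by blast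

lemma planner_join:
  assumes "planner Z K B f g F" "planner Z K B g h F"
  shows "planner Z K B f h F"
  unfolding planner_def
  using plannerD(1)[OF assms(1)] path_family_join[OF plannerD(2)[OF assms(1)] plannerD(2)[OF assms(2)]] by blast

lemma least_pos_exists:
  assumes "i \<le> n" "F i z > 0" "\<And>i. F i z \<ge> 0"
  obtains j where "j \<le> n" "least_pos F z j"
proof -
  define j where "j = (LEAST i. F i z > 0)"
  have "F j z > 0" unfolding j_def by (rule LeastI[of "\<lambda>i. F i z > 0" i]) (rule assms(2))
  moreover have "j \<le> n" using Least_le[of "\<lambda>i. F i z > 0" i] assms(1,2) by (simp add: j_def)
  moreover have "F i' z = 0" if "i' < j" for i'
    using not_less_Least[of i' "\<lambda>i. F i z > 0"] that assms(3)[of i'] by (simp add: j_def)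
  ultimately show ?thesis using that by (simp add: least_pos_def)
qed

theorem TC_le_planner:
  fixes Z :: "'z::t2_space set"
  assumes "compact Z" "continuous_map (top_of_set Z) (prod_topology B B) Q"
    "Q ` Z = topspace (prod_topology B B)" "Hausdorff_space B"
    "planner Z Q B (\<lambda>z. fst (Q z)) (\<lambda>z. snd (Q z)) F"
    "\<And>z. z \<in> Z \<Longrightarrow> \<exists>i\<le>n. F i z > 0"
  shows "TC B \<le> enat n"
  by (rule TC_upper_bound[OF assms(1-4) plannerD(1)[OF assms(5)] assms(6) plannerD(2)[OF assms(5)]])

section \<open>Points of the wedge given by nonzero vectors\<close>

definition vecs :: "nat \<Rightarrow> (nat \<Rightarrow> real) set" where
  "vecs n = {a. (\<forall>i>n. a i = 0) \<and> (\<exists>i\<le>n. a i \<noteq> 0)}"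

definition nrm :: "nat \<Rightarrow> (nat \<Rightarrow> real) \<Rightarrow> real" where
  "nrm n a = sqrt (\<Sum>i\<le>n. (a i)\<^sup>2)"

definition nrml :: "nat \<Rightarrow> (nat \<Rightarrow> real) \<Rightarrow> nat \<Rightarrow> real" where
  "nrml n a = (\<lambda>i. a i / nrm n a)"

lemma vecsI: "(\<And>i. i > n \<Longrightarrow> a i = 0) \<Longrightarrow> i \<le> n \<Longrightarrow> a i \<noteq> 0 \<Longrightarrow> a \<in> vecs n"
  by (auto simp: vecs_def)

lemma nrm_pos:
  assumes "a \<in> vecs n" shows "nrm n a > 0"
proof -
  obtain i where i: "i \<le> n" "a i \<noteq> 0" using assms by (auto simp: vecs_def)
  have "(a i)\<^sup>2 \<le> (\<Sum>i\<le>n. (a i)\<^sup>2)" using i(1) by (intro member_le_sum) auto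
  moreover have "(a i)\<^sup>2 > 0" using i(2) by simp
  ultimately have "(\<Sum>i\<le>n. (a i)\<^sup>2) > 0" by linarith
  then show ?thesis by (simp add: nrm_def)
qed

lemma nrml_sph:
  assumes "a \<in> vecs n" shows "nrml n a \<in> sph n"
proof -
  have "(\<Sum>i\<le>n. (a i)\<^sup>2) > 0" using nrm_pos[OF assms] by (simp add: nrm_def)
  then have "(\<Sum>i\<le>n. (a i / nrm n a)\<^sup>2) = 1"
    by (simp add: nrm_def power_divide flip: sum_divide_distrib)
  then show ?thesis using assms by (auto simp: nrml_def sph_def vecs_def)
qed

lemma nrml_of_sph: "a \<in> sph n \<Longrightarrow> nrml n a = a"
  by (simp add: nrml_def nrm_def sph_def)

lemma sph_vecs:
  assumes "a \<in> sph n" shows "a \<in> vecs n"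
proof (rule ccontr)
  assume "a \<notin> vecs n"
  then have "\<forall>i\<le>n. a i = 0" using assms by (auto simp: vecs_def sph_def)
  then show False using assms by (simp add: sph_def)
qed

lemma nrml_scale:
  assumes "c \<noteq> 0"
  shows "nrml n (\<lambda>i. c * a i) = (if c > 0 then nrml n a else (\<lambda>i. - nrml n a i))"
proof -
  have "nrm n (\<lambda>i. c * a i) = \<bar>c\<bar> * nrm n a"
    by (simp add: nrm_def power_mult_distrib real_sqrt_mult flip: sum_distrib_left)
  then show ?thesis using assms by (auto simp: nrml_def fun_eq_iff)
qed

lemma based_nrml: "based a \<Longrightarrow> based (nrml n a)"
  by (simp add: based_def nrml_def)

lemma continuous_on_nrml:
  assumes "\<And>i. continuous_on S (\<lambda>z. f z i)" "\<And>z. z \<in> S \<Longrightarrow> f z \<in> vecs n"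
  shows "continuous_on S (\<lambda>z. nrml n (f z))"
proof (rule continuous_on_coordinatewise_then_product)
  fix i
  have "nrm n (f z) \<noteq> 0" if "z \<in> S" for z using nrm_pos[OF assms(2)[OF that]] by simp
  moreover have "continuous_on S (\<lambda>z. nrm n (f z))"
    unfolding nrm_def by (intro continuous_intros assms(1))
  ultimately show "continuous_on S (\<lambda>z. nrml n (f z) i)"
    unfolding nrml_def by (intro continuous_on_divide assms(1)) auto
qed

definition proj :: "bool \<Rightarrow> (nat \<Rightarrow> real) \<Rightarrow> (bool \<times> (nat \<Rightarrow> real) set set) set" where
  "proj b a = X_pt b (nrml 6 a)"

definition same_lift :: "bool \<Rightarrow> (nat \<Rightarrow> real) \<Rightarrow> bool \<Rightarrow> (nat \<Rightarrow> real) \<Rightarrow> bool" where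
  "same_lift b a b' a' \<longleftrightarrow> (based a \<and> based a') \<or> (b' = b \<and> (\<exists>c. c \<noteq> 0 \<and> a' = (\<lambda>i. c * a i)))"

lemma proj_eqI:
  assumes "a \<in> vecs 6" "a' \<in> vecs 6" "same_lift b a b' a'"
  shows "proj b a = proj b' a'"
  unfolding proj_def X_pt_eq_iff[OF nrml_sph[OF assms(1)] nrml_sph[OF assms(2)]]
  using assms(3) nrml_scale based_nrml unfolding same_lift_def by metis

lemma proj_sph: "a \<in> sph 6 \<Longrightarrow> proj b a = X_pt b a"
  by (simp add: proj_def nrml_of_sph)

definition star :: "(bool \<times> (nat \<Rightarrow> real) set set) set" where
  "star = X_pt False e0"

lemma based_e0: "based e0"
  by (simp add: based_def e0_def)

lemma proj_based: "a \<in> vecs 6 \<Longrightarrow> based a \<Longrightarrow> proj b a = star"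
  unfolding star_def proj_def
  by (subst X_pt_eq_iff) (auto simp: nrml_sph based_nrml based_e0)

lemma continuous_map_X_pt_bool:
  fixes \<beta> :: "'z::topological_space \<Rightarrow> bool"
  assumes "continuous_on S f" "\<And>z. z \<in> S \<Longrightarrow> f z \<in> sph 6" "continuous_on S \<beta>"
  shows "continuous_map (top_of_set S) X_space (\<lambda>z. X_pt (\<beta> z) (f z))"
proof (rule pasting_lemma[where I = UNIV and T = "\<lambda>b. S \<inter> \<beta> -` {b}" and f = "\<lambda>b z. X_pt b (f z)"])
  fix b :: bool
  show "openin (top_of_set S) (S \<inter> \<beta> -` {b})"
    by (rule continuous_openin_preimage_gen[OF assms(3)]) (rule open_discrete)
  have "continuous_map (top_of_set (S \<inter> \<beta> -` {b})) (top_of_set (sph 6)) f"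
    using assms(1,2) by (auto simp: continuous_map_in_subtopology intro: continuous_on_subset)
  from continuous_map_compose[OF this continuous_map_X_pt]
  show "continuous_map (subtopology (top_of_set S) (S \<inter> \<beta> -` {b})) X_space (\<lambda>z. X_pt b (f z))"
    by (simp add: comp_def subtopology_subtopology Int_absorb1)
qed auto

lemma continuous_map_proj:
  fixes \<beta> :: "'z::topological_space \<Rightarrow> bool"
  assumes "\<And>i. continuous_on S (\<lambda>z. f z i)" "\<And>z. z \<in> S \<Longrightarrow> f z \<in> vecs 6" "continuous_on S \<beta>"
  shows "continuous_map (top_of_set S) X_space (\<lambda>z. proj (\<beta> z) (f z))"
  unfolding proj_def
  by (intro continuous_map_X_pt_bool continuous_on_nrml assms nrml_sph)

abbreviation seg :: "(nat \<Rightarrow> real) \<Rightarrow> (nat \<Rightarrow> real) \<Rightarrow> real \<Rightarrow> nat \<Rightarrow> real" where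
  "seg a d t \<equiv> \<lambda>i. (1 - t) * a i + t * d i"

lemma continuous_on_fst_comp: "continuous_on W f \<Longrightarrow> continuous_on (W \<times> T) (\<lambda>p. f (fst p))"
  by (rule continuous_on_compose2[of W f _ fst]) (auto intro!: continuous_intros)

lemma continuous_on_seg:
  assumes "continuous_on W (\<lambda>z. A z i)" "continuous_on W (\<lambda>z. D z i)"
  shows "continuous_on (W \<times> {0..1}) (\<lambda>p. seg (A (fst p)) (D (fst p)) (snd p) i)"
  by (intro continuous_intros continuous_on_fst_comp[OF assms(1)] continuous_on_fst_comp[OF assms(2)])

text \<open>Since \<open>proj\<close> ignores nonzero factors, segments between lifts can be used
  directly and descend if both ends are rescaled together. Over the base point neither copy nor lift
  is determined, hence the separate case in \<open>inv\<close>.\<close>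

lemma motion_proj_seg:
  fixes \<beta> :: "'z::topological_space \<Rightarrow> bool"
  assumes b: "continuous_on W \<beta>"
    and A: "\<And>i. continuous_on W (\<lambda>z. A z i)" and D: "\<And>i. continuous_on W (\<lambda>z. D z i)"
    and nz: "\<And>z t. z \<in> W \<Longrightarrow> t \<in> {0..1} \<Longrightarrow> seg (A z) (D z) t \<in> vecs 6"
    and inv: "\<And>z z'. z \<in> W \<Longrightarrow> z' \<in> W \<Longrightarrow> K z = K z' \<Longrightarrow>
      (based (A z) \<and> based (D z) \<and> based (A z') \<and> based (D z')) \<or>
      (\<beta> z' = \<beta> z \<and> (\<exists>c. c \<noteq> 0 \<and> (\<forall>i. A z' i = c * A z i \<and> D z' i = c * D z i)))"
  shows "motion W K X_space (\<lambda>z. proj (\<beta> z) (A z)) (\<lambda>z. proj (\<beta> z) (D z))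
    (\<lambda>z t. proj (\<beta> z) (seg (A z) (D z) t))"
proof (rule motionI)
  have "continuous_on (W \<times> {0..1::real}) (\<lambda>p. \<beta> (fst p))"
    by (rule continuous_on_fst_comp[OF b])
  then have "continuous_map (top_of_set (W \<times> {0..1})) X_space (\<lambda>p. proj (\<beta> (fst p)) (seg (A (fst p)) (D (fst p)) (snd p)))"
    by (intro continuous_map_proj continuous_on_seg A D) (auto intro!: nz)
  then show "continuous_map (top_of_set (W \<times> {0..1})) X_space (\<lambda>(z, t). proj (\<beta> z) (seg (A z) (D z) t))"
    by (simp add: case_prod_unfold)
  fix z z' t assume z: "z \<in> W" "z' \<in> W" "K z = K z'" "t \<in> {0..1::real}"
  have "same_lift (\<beta> z) (seg (A z) (D z) t) (\<beta> z') (seg (A z') (D z') t)"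
    using inv[OF z(1-3)]
  proof
    assume "\<beta> z' = \<beta> z \<and> (\<exists>c. c \<noteq> 0 \<and> (\<forall>i. A z' i = c * A z i \<and> D z' i = c * D z i))"
    then obtain c where c: "\<beta> z' = \<beta> z" "c \<noteq> 0" "\<And>i. A z' i = c * A z i" "\<And>i. D z' i = c * D z i" by blast
    have "seg (A z') (D z') t = (\<lambda>i. c * seg (A z) (D z) t i)" by (simp add: c(3,4) algebra_simps)
    then show ?thesis using c(1,2) unfolding same_lift_def by blast
  qed (simp add: same_lift_def based_def)
  then show "proj (\<beta> z) (seg (A z) (D z) t) = proj (\<beta> z') (seg (A z') (D z') t)"
    by (intro proj_eqI nz z)
qed simp_all

lemma path_family_nrml_seg:
  assumes A: "\<And>i. continuous_on W (\<lambda>z. A z i)" and D: "\<And>i. continuous_on W (\<lambda>z. D z i)"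
    and nz: "\<And>z t. z \<in> W \<Longrightarrow> t \<in> {0..1} \<Longrightarrow> seg (A z) (D z) t \<in> vecs n"
    and inv: "\<And>z z'. z \<in> W \<Longrightarrow> z' \<in> W \<Longrightarrow> K z = K z' \<Longrightarrow> A z = A z' \<and> D z = D z'"
  shows "path_family W K (nsphere n) (\<lambda>z. nrml n (A z)) (\<lambda>z. nrml n (D z))"
proof (rule path_familyI[where h = "\<lambda>z t. nrml n (seg (A z) (D z) t)"])
  have "continuous_on (W \<times> {0..1}) (\<lambda>p. nrml n (seg (A (fst p)) (D (fst p)) (snd p)))"
    by (intro continuous_on_nrml continuous_on_seg A D) (auto intro!: nz)
  then show "continuous_map (top_of_set (W \<times> {0..1})) (nsphere n) (\<lambda>(z, t). nrml n (seg (A z) (D z) t))"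
    unfolding nsphere_eq_top_of_set continuous_map_in_subtopology case_prod_unfold
    by (auto intro!: nrml_sph nz)
  fix z z' t assume "z \<in> W" "z' \<in> W" "K z = K z'"
  then show "nrml n (seg (A z) (D z) t) = nrml n (seg (A z') (D z') t)"
    using inv[of z z'] by simp
qed simp_all

section \<open>Contractions of the wedge\<close>

text \<open>A vector of \<open>R^7\<close> is split as \<open>(u, v, w)\<close> with \<open>u\<close> and \<open>v\<close> in \<open>R^3\<close> and \<open>w\<close> real.\<close>

definition usq :: "(nat \<Rightarrow> real) \<Rightarrow> real" where "usq a = (\<Sum>i<3. (a i)\<^sup>2)"
definition vsq :: "(nat \<Rightarrow> real) \<Rightarrow> real" where "vsq a = (\<Sum>i<3. (a (i + 3))\<^sup>2)"

lemma usq_vsq_sph: "a \<in> sph 6 \<Longrightarrow> usq a + vsq a + (a 6)\<^sup>2 = 1"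
  by (simp add: sph_def usq_def vsq_def eval_nat_numeral)

lemma usq_nonneg [simp]: "usq a \<ge> 0" and vsq_nonneg [simp]: "vsq a \<ge> 0"
  by (simp_all add: usq_def vsq_def sum_nonneg)

lemma usq_pos: "usq a > 0 \<longleftrightarrow> (\<exists>i<3. a i \<noteq> 0)"
  and vsq_pos: "vsq a > 0 \<longleftrightarrow> (\<exists>i<3. a (i + 3) \<noteq> 0)"
  by (auto simp: usq_def vsq_def sum_nonneg_eq_0_iff less_le intro!: sum_nonneg)

lemma usq_scale: "usq (\<lambda>i. - a i) = usq a" and vsq_scale: "vsq (\<lambda>i. - a i) = vsq a"
  by (simp_all add: usq_def vsq_def)

lemma vsq_based: "based a \<Longrightarrow> vsq a = 0"
  by (simp add: based_def vsq_def)

lemma usq_based: "a \<in> sph 6 \<Longrightarrow> based a \<Longrightarrow> usq a = 1"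
  using usq_vsq_sph[of a] vsq_based[of a] by (simp add: based_def)

lemma continuous_on_usq [continuous_intros]: "(\<And>i. continuous_on S (\<lambda>z. f z i)) \<Longrightarrow> continuous_on S (\<lambda>z. usq (f z))"
  and continuous_on_vsq [continuous_intros]: "(\<And>i. continuous_on S (\<lambda>z. f z i)) \<Longrightarrow> continuous_on S (\<lambda>z. vsq (f z))"
  unfolding usq_def vsq_def by (intro continuous_intros; assumption)+

definition upart :: "(nat \<Rightarrow> real) \<Rightarrow> nat \<Rightarrow> real" where
  "upart a = (\<lambda>i. if i < 3 then a i else 0)"
definition vpart :: "(nat \<Rightarrow> real) \<Rightarrow> nat \<Rightarrow> real" where
  "vpart a = (\<lambda>i. if i < 3 then a (i + 3) else 0)"

lemma continuous_on_upart: "(\<And>i. continuous_on S (\<lambda>z. f z i)) \<Longrightarrow> continuous_on S (\<lambda>z. upart (f z) i)"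
  and continuous_on_vpart: "(\<And>i. continuous_on S (\<lambda>z. f z i)) \<Longrightarrow> continuous_on S (\<lambda>z. vpart (f z) i)"
  by (cases "i < 3"; simp add: upart_def vpart_def)+

lemma based_upart: "based (upart a)" and based_vpart: "based (vpart a)"
  by (auto simp: based_def upart_def vpart_def)

text \<open>A point of the wedge depending on a parameter, given by its copy \<open>\<beta>\<close>
  and a lift \<open>y\<close>; \<open>K\<close> tells which parameters have to be treated
  alike.\<close>

locale X_family =
  fixes W :: "'z::topological_space set" and K :: "'z \<Rightarrow> 'q" and \<beta> :: "'z \<Rightarrow> bool" and y :: "'z \<Rightarrow> nat \<Rightarrow> real"
  assumes cont_\<beta>: "continuous_on W \<beta>" and cont_y: "\<And>i. continuous_on W (\<lambda>z. y z i)"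
    and y_sph: "\<And>z. z \<in> W \<Longrightarrow> y z \<in> sph 6"
    and K_X: "\<And>z z'. z \<in> W \<Longrightarrow> z' \<in> W \<Longrightarrow> K z = K z' \<Longrightarrow> X_pt (\<beta> z) (y z) = X_pt (\<beta> z') (y z')"
begin

lemma K_cases:
  assumes "z \<in> W" "z' \<in> W" "K z = K z'"
  obtains "based (y z)" "based (y z')" | "\<beta> z' = \<beta> z" "y z' = y z" | "\<beta> z' = \<beta> z" "y z' = (\<lambda>i. - y z i)"
  using K_X[OF assms] unfolding X_pt_eq_iff[OF y_sph[OF assms(1)] y_sph[OF assms(2)]] by blast

lemma y_zero: "z \<in> W \<Longrightarrow> i > 6 \<Longrightarrow> y z i = 0"
  using y_sph[of z] by (simp add: sph_def)

lemma
  assumes a: "z \<in> W" "z' \<in> W" "K z = K z'"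
  shows usq_K: "usq (y z) = usq (y z')" and vsq_K: "vsq (y z) = vsq (y z')"
    and wsq_K: "(y z 6)\<^sup>2 = (y z' 6)\<^sup>2"
proof -
  have "usq (y z) = usq (y z') \<and> vsq (y z) = vsq (y z') \<and> (y z 6)\<^sup>2 = (y z' 6)\<^sup>2"
    using a
  proof (cases rule: K_cases)
    case 1
    then have "y z 6 = 0" "y z' 6 = 0" by (simp_all add: based_def)
    then show ?thesis using 1 by (simp add: usq_based y_sph a(1,2) vsq_based)
  qed (simp_all add: usq_scale vsq_scale)
  then show "usq (y z) = usq (y z')" "vsq (y z) = vsq (y z')" "(y z 6)\<^sup>2 = (y z' 6)\<^sup>2" by blast+
qed

lemma restrict:
  assumes "W' \<subseteq> W"
  shows "X_family W' K \<beta> y"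
proof
  show "X_pt (\<beta> z) (y z) = X_pt (\<beta> z') (y z')" if "z \<in> W'" "z' \<in> W'" "K z = K z'" for z z'
    by (rule K_X) (use that assms in auto)
  show "continuous_on W' \<beta>" "continuous_on W' (\<lambda>z. y z i)" for i
    using continuous_on_subset[OF cont_\<beta> assms] continuous_on_subset[OF cont_y assms] by auto
  show "y z \<in> sph 6" if "z \<in> W'" for z by (rule y_sph) (use that assms in auto)
qed

text \<open>The target \<open>D\<close> changes sign together with the lift, so the segment
  descends. Being based, it ends at \<open>star\<close>, and points starting at \<open>star\<close>
  stay there.\<close>

lemma contraction:
  assumes D: "\<And>i. continuous_on W (\<lambda>z. D z i)"
    and bD: "\<And>z. z \<in> W \<Longrightarrow> based (D z)"
    and nz: "\<And>z t. z \<in> W \<Longrightarrow> t \<in> {0..1} \<Longrightarrow> \<exists>i\<le>6. (1 - t) * y z i + t * D z i \<noteq> 0"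
    and inv: "\<And>z z'. z \<in> W \<Longrightarrow> z' \<in> W \<Longrightarrow> K z = K z' \<Longrightarrow> y z' = y z \<Longrightarrow> \<beta> z' = \<beta> z \<Longrightarrow> D z' = D z"
    and inv': "\<And>z z'. z \<in> W \<Longrightarrow> z' \<in> W \<Longrightarrow> K z = K z' \<Longrightarrow> y z' = (\<lambda>i. - y z i) \<Longrightarrow> \<beta> z' = \<beta> z \<Longrightarrow> D z' = (\<lambda>i. - D z i)"
  shows "path_family W K X_space (\<lambda>z. X_pt (\<beta> z) (y z)) (\<lambda>_. star)"
proof -
  have v: "seg (y z) (D z) t \<in> vecs 6" if "z \<in> W" "t \<in> {0..1}" for z t
    using nz[OF that] y_zero[OF that(1)] bD[OF that(1)] by (auto simp: vecs_def based_def)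
  have "path_family W K X_space (\<lambda>z. proj (\<beta> z) (y z)) (\<lambda>z. proj (\<beta> z) (D z))"
  proof (rule path_family_motion[OF motion_proj_seg[OF cont_\<beta> cont_y D v]])
    fix z z' assume *: "z \<in> W" "z' \<in> W" "K z = K z'"
    then show "(based (y z) \<and> based (D z) \<and> based (y z') \<and> based (D z')) \<or>
      (\<beta> z' = \<beta> z \<and> (\<exists>c. c \<noteq> 0 \<and> (\<forall>i. y z' i = c * y z i \<and> D z' i = c * D z i)))"
    proof (cases rule: K_cases)
      case 1 then show ?thesis using bD * by blast
    next
      case 2 then show ?thesis using inv[OF *] by (intro disjI2 conjI exI[of _ 1]) simp_all
    next
      case 3 then show ?thesis using inv'[OF *] by (intro disjI2 conjI exI[of _ "-1"]) simp_all
    qed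
  qed
  then show ?thesis
  proof (rule path_family_cong)
    fix z assume z: "z \<in> W"
    show "proj (\<beta> z) (y z) = X_pt (\<beta> z) (y z)" by (rule proj_sph[OF y_sph[OF z]])
    show "proj (\<beta> z) (D z) = star" using v[OF z, of 1] bD[OF z] by (intro proj_based) simp_all
  qed
qed

definition cF :: "nat \<Rightarrow> 'z \<Rightarrow> real" where
  "cF i z = (if i = 0 then usq (y z) else if i = 1 then vsq (y z) else if i = 2 then (y z 6)\<^sup>2 else 0)"

lemma cF_cover: "z \<in> W \<Longrightarrow> \<exists>i\<le>2. cF i z > 0"
proof -
  assume "z \<in> W"
  then have "usq (y z) + vsq (y z) + (y z 6)\<^sup>2 = 1" by (intro usq_vsq_sph y_sph)
  moreover have "usq (y z) \<ge> 0" "vsq (y z) \<ge> 0" "(y z 6)\<^sup>2 \<ge> 0" by simp_all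
  ultimately have "usq (y z) > 0 \<or> vsq (y z) > 0 \<or> (y z 6)\<^sup>2 > 0" by linarith
  then have "cF 0 z > 0 \<or> cF 1 z > 0 \<or> cF 2 z > 0" by (simp add: cF_def)
  moreover have "i \<le> 2 \<longleftrightarrow> i = 0 \<or> i = 1 \<or> i = 2" for i :: nat by auto
  ultimately show ?thesis by blast
qed

lemma cover_fun_cF: "cover_fun W K (cF i)"
proof (rule cover_funI)
  show "continuous_on W (cF i)"
  proof -
    have "continuous_on W (\<lambda>z. usq (y z))" "continuous_on W (\<lambda>z. vsq (y z))" "continuous_on W (\<lambda>z. (y z 6)\<^sup>2)"
      by (intro continuous_intros cont_y)+
    then show ?thesis unfolding cF_def[abs_def] by (cases "i = 0"; cases "i = 1"; cases "i = 2") simp_all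
  qed
  show "cF i z = cF i z'" if "z \<in> W" "z' \<in> W" "K z = K z'" for z z'
    using usq_K[OF that] vsq_K[OF that] wsq_K[OF that] by (simp add: cF_def)
qed (simp add: cF_def)

lemma contraction_u:
  assumes "\<And>z. z \<in> W \<Longrightarrow> usq (y z) > 0"
  shows "path_family W K X_space (\<lambda>z. X_pt (\<beta> z) (y z)) (\<lambda>_. star)"
proof (rule contraction[of "\<lambda>z. upart (y z)"])
  fix z t assume "z \<in> W" "t \<in> {0..1::real}"
  then obtain i where i: "i < 3" "y z i \<noteq> 0" using assms[of z] unfolding usq_pos by blast
  then show "\<exists>i\<le>6. (1 - t) * y z i + t * upart (y z) i \<noteq> 0"
    by (intro exI[of _ i]) (simp add: upart_def algebra_simps)
next
  show "continuous_on W (\<lambda>z. upart (y z) i)" for i by (intro continuous_on_upart cont_y)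
  show "upart (y z') = (\<lambda>i. - upart (y z) i)" if "y z' = (\<lambda>i. - y z i)" for z z'
    by (simp add: that upart_def fun_eq_iff)
qed (simp_all add: based_upart)

lemma contraction_v:
  assumes "\<And>z. z \<in> W \<Longrightarrow> vsq (y z) > 0"
  shows "path_family W K X_space (\<lambda>z. X_pt (\<beta> z) (y z)) (\<lambda>_. star)"
proof (rule contraction[of "\<lambda>z. vpart (y z)"])
  fix z t assume "z \<in> W" "t \<in> {0..1::real}"
  then obtain i where i: "i < 3" "y z (i + 3) \<noteq> 0" using assms[of z] unfolding vsq_pos by blast
  then show "\<exists>i\<le>6. (1 - t) * y z i + t * vpart (y z) i \<noteq> 0"
  \<comment> \<open>Until the end \<open>v\<close> survives in its own coordinates, and at the end
    in the first three.\<close>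
  proof (cases "t = 1")
    case True then show ?thesis using i by (intro exI[of _ i]) (simp add: vpart_def)
  next
    case False then show ?thesis using i by (intro exI[of _ "i + 3"]) (simp add: vpart_def)
  qed
next
  show "continuous_on W (\<lambda>z. vpart (y z) i)" for i by (intro continuous_on_vpart cont_y)
  show "vpart (y z') = (\<lambda>i. - vpart (y z) i)" if "y z' = (\<lambda>i. - y z i)" for z z'
    by (simp add: that vpart_def fun_eq_iff)
qed (simp_all add: based_vpart)

lemma contraction_w:
  assumes "\<And>z. z \<in> W \<Longrightarrow> y z 6 \<noteq> 0"
  shows "path_family W K X_space (\<lambda>z. X_pt (\<beta> z) (y z)) (\<lambda>_. star)"
proof (rule contraction[of "\<lambda>z i. if i = 0 then y z 6 else 0"])
  show "continuous_on W (\<lambda>z. if i = 0 then y z 6 else 0)" for i :: nat by (cases "i = 0") (simp_all add: cont_y)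
  fix z t assume "z \<in> W" "t \<in> {0..1::real}"
  then have "y z 6 \<noteq> 0" using assms by simp
  then show "\<exists>i\<le>6. (1 - t) * y z i + t * (if i = 0 then y z 6 else 0) \<noteq> 0"
  proof (cases "t = 1")
    case True then show ?thesis using \<open>y z 6 \<noteq> 0\<close> by (intro exI[of _ 0]) simp
  next
    case False then show ?thesis using \<open>y z 6 \<noteq> 0\<close> by (intro exI[of _ 6]) simp
  qed
next
  show "(\<lambda>i::nat. if i = 0 then y z' 6 else 0) = (\<lambda>i. - (if i = 0 then y z 6 else 0))"
    if "y z' = (\<lambda>i. - y z i)" for z z' by (simp add: that fun_eq_iff)
  show "(\<lambda>i::nat. if i = 0 then y z' 6 else 0) = (\<lambda>i. if i = 0 then y z 6 else 0)"
    if "y z' = y z" for z z' by (simp add: that fun_eq_iff)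
qed (simp_all add: based_def)

end

lemma (in X_family) planner_cF: "planner W K X_space (\<lambda>z. X_pt (\<beta> z) (y z)) (\<lambda>_. star) cF"
  unfolding planner_def
proof (intro allI conjI cover_fun_cF)
  fix i
  interpret W': X_family "{z \<in> W. cF i z > 0}" K \<beta> y by (rule restrict) auto
  consider "i = 0" | "i = 1" | "i = 2" | "i > 2" by linarith
  then show "path_family {z \<in> W. cF i z > 0} K X_space (\<lambda>z. X_pt (\<beta> z) (y z)) (\<lambda>_. star)"
  proof cases
    case 1 then show ?thesis by (intro W'.contraction_u) (auto simp: cF_def)
  next
    case 2 then show ?thesis by (intro W'.contraction_v) (auto simp: cF_def)
  next
    case 3 then show ?thesis by (intro W'.contraction_w) (auto simp: cF_def)
  next
    case 4 then show ?thesis by (intro W'.contraction_w) (auto simp: cF_def)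
  qed
qed

text \<open>The two stages are planned as the two components of a product and then concatenated over
  its regions, so the indices add.\<close>

lemma planner_trans:
  assumes "planner Z K B f c F" "planner Z K B c g G"
  obtains H where "planner Z K B f g H" "stair_cover Z F G H"
proof -
  obtain H where pl: "planner Z K (prod_topology B B) (\<lambda>z. (f z, c z)) (\<lambda>z. (c z, g z)) H"
    and pos: "stair_cover Z F G H"
    using planner_prod[OF assms] by blast
  have "planner Z K B f c H" "planner Z K B c g H"
    using planner_map[OF pl continuous_map_fst] planner_map[OF pl continuous_map_snd] by simp_all
  then have "planner Z K B f g H" by (rule planner_join)
  then show ?thesis by (rule that[OF _ pos])
qed

lemma stair_cover_exists:
  assumes "stair_cover Z F G H" "z \<in> Z" "least_pos F z i" "least_pos G z j" "i + j \<le> n"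
  shows "\<exists>i\<le>n. H i z > 0"
  using assms unfolding stair_cover_def by blast

lemma path_family_const:
  assumes "continuous_map (top_of_set W) B f" "\<And>z z'. z \<in> W \<Longrightarrow> z' \<in> W \<Longrightarrow> K z = K z' \<Longrightarrow> f z = f z'"
  shows "path_family W K B f f"
proof (rule path_familyI[where h = "\<lambda>z t. f z"])
  have "continuous_map (top_of_set (W \<times> {0..1::real})) (top_of_set W) fst"
    by (auto simp: continuous_map_in_subtopology intro!: continuous_intros)
  from continuous_map_compose[OF this assms(1)]
  show "continuous_map (top_of_set (W \<times> {0..1::real})) B (\<lambda>(z, t). f z)"
    by (simp add: comp_def case_prod_unfold)
  show "f z = f z'" if "z \<in> W" "z' \<in> W" "K z = K z'" for z z' by (rule assms(2)[OF that])
qed simp_all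

lemma continuous_on_coord_snd:
  "continuous_on S (\<lambda>z::'a::topological_space \<times> ('b \<Rightarrow> 'c \<Rightarrow> 'd::topological_space). snd z \<alpha> i)"
proof -
  have "continuous_on (UNIV :: ('b \<Rightarrow> 'c \<Rightarrow> 'd::topological_space) set) (\<lambda>x. x \<alpha> i)" by (rule continuous_on_apply2)
  from continuous_on_compose2[OF this continuous_on_snd[OF continuous_on_id]] show ?thesis by auto
qed

lemma compact_bools_Times: "compact S \<Longrightarrow> compact ((UNIV :: (bool \<times> bool) set) \<times> S)"
  by (rule compact_Times[OF finite_imp_compact]) auto

lemma continuous_map_X_pt_fst:
  assumes "S \<subseteq> {z. snd z \<alpha> \<in> sph 6}" "continuous_on S \<beta>"
  shows "continuous_map (top_of_set S) X_space (\<lambda>z. X_pt (\<beta> z) (snd z (\<alpha> :: nat)))"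
proof (rule continuous_map_X_pt_bool)
  show "continuous_on S (\<lambda>z. snd z \<alpha>)" by (rule continuous_on_coord) (intro continuous_intros)
qed (use assms in auto)

theorem TC_X_le: "TC X_space \<le> 4"
proof -
  define Z where "Z = (UNIV :: (bool \<times> bool) set) \<times> spheres 2 (\<lambda>_. 6)"
  define x where "x = (\<lambda>z::(bool \<times> bool) \<times> (nat \<Rightarrow> nat \<Rightarrow> real). X_pt (fst (fst z)) (snd z 0))"
  define x' where "x' = (\<lambda>z::(bool \<times> bool) \<times> (nat \<Rightarrow> nat \<Rightarrow> real). X_pt (snd (fst z)) (snd z 1))"
  define Q where "Q = (\<lambda>z. (x z, x' z))"
  have sph: "snd z 0 \<in> sph 6" "snd z 1 \<in> sph 6" if "z \<in> Z" for z
    using that by (auto simp: Z_def spheres_def)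
  have cb: "continuous_on Z (\<lambda>z. fst (fst z))" "continuous_on Z (\<lambda>z. snd (fst z))"
    by (intro continuous_intros)+
  interpret A: X_family Z Q "\<lambda>z. fst (fst z)" "\<lambda>z. snd z 0"
    by unfold_locales (simp_all add: cb continuous_on_coord_snd sph Q_def x_def)
  interpret B: X_family Z Q "\<lambda>z. snd (fst z)" "\<lambda>z. snd z 1"
    by unfold_locales (simp_all add: cb continuous_on_coord_snd sph[unfolded One_nat_def] Q_def x'_def)
  obtain H where pl: "planner Z Q X_space x x' H" and sc: "stair_cover Z A.cF B.cF H"
    using planner_trans[OF A.planner_cF planner_reverse[OF B.planner_cF]] unfolding x_def x'_def .
  have "TC X_space \<le> enat 4"
  proof (rule TC_le_planner[of Z _ Q H])
    show "compact Z" unfolding Z_def by (intro compact_bools_Times compact_spheres)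
    show "continuous_map (top_of_set Z) (prod_topology X_space X_space) Q"
      unfolding Q_def x_def x'_def
      by (intro continuous_map_pairedI continuous_map_X_pt_fst cb) (use sph in blast)+
    show "Q ` Z = topspace (prod_topology X_space X_space)"
    proof (intro subset_antisym subsetI)
      fix p assume "p \<in> topspace (prod_topology X_space X_space)"
      then obtain b a b' a' where p: "p = (X_pt b a, X_pt b' a')" "a \<in> sph 6" "a' \<in> sph 6"
        by (auto simp: topspace_X)
      let ?z = "((b, b'), \<lambda>\<alpha>::nat. if \<alpha> = 0 then a else if \<alpha> = 1 then a' else (\<lambda>_. 0))"
      have "?z \<in> Z" using p(2,3) by (auto simp: Z_def spheres_def)
      then show "p \<in> Q ` Z" by (rule rev_image_eqI) (simp add: p Q_def x_def x'_def)
    next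
      fix p assume "p \<in> Q ` Z"
      then obtain z where "p = Q z" "z \<in> Z" by blast
      then show "p \<in> topspace (prod_topology X_space X_space)"
        using X_pt_in[OF sph(1)] X_pt_in[OF sph(2)] by (simp add: Q_def x_def x'_def)
    qed
    show "Hausdorff_space X_space" by (rule Hausdorff_X)
    show "planner Z Q X_space (\<lambda>z. fst (Q z)) (\<lambda>z. snd (Q z)) H"
      using pl by (simp add: Q_def)
    fix z assume z: "z \<in> Z"
    obtain i where i: "i \<le> 2" "least_pos A.cF z i"
      using A.cF_cover[OF z] cover_funD(2)[OF A.cover_fun_cF z] least_pos_exists by metis
    obtain j where j: "j \<le> 2" "least_pos B.cF z j"
      using B.cF_cover[OF z] cover_funD(2)[OF B.cover_fun_cF z] least_pos_exists by metis
    show "\<exists>i\<le>4. H i z > 0" by (rule stair_cover_exists[OF sc z i(2) j(2)]) (use i j in simp)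
  qed
  then show ?thesis by (simp add: numeral_eq_enat)
qed

section \<open>A homotopy from the path towards d to the path towards -d\<close>

text \<open>
  Let \<open>e0, e1, e5, e6\<close> be basis vectors. The paths \<open>hh b l d\<close> lead from
  \<open>e6\<close> to the base point. At \<open>l = 0\<close> and \<open>l = 1\<close> they rest
  at \<open>e6\<close> for a while and then follow the segment towards \<open>d\<close> and
  \<open>-d\<close>, respectively. As \<open>l\<close> decreases from 1 to 1/2, the path starts
  with a growing part of the polygon from \<open>e6\<close> through \<open>e5\<close> to
  \<open>-e6\<close> and then goes straight to \<open>-d\<close>. At \<open>l = 1/2\<close> its
  second part is antipodal to the segment from \<open>e6\<close> to \<open>d\<close>, and its
  first part is a loop, which is contracted in the quotient: for \<open>l\<close> between 1/2 and
  1/3 the corner \<open>e5\<close> moves to \<open>e0\<close>, which represents the base point;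
  for \<open>l\<close> between 1/3 and 1/6 the second half of the loop is made to start at
  \<open>-e0\<close> instead, where all intermediate starting points represent the base point; now
  the second half is the reverse of the first, and the loop retracts to \<open>e6\<close>. The
  functions \<open>Lp\<close> and \<open>Lm\<close> are lifts of the two halves.
\<close>

definition hx :: "real \<Rightarrow> real \<Rightarrow> real" where
  "hx l t = 1 - (1 - max (-1) (4 * l - 3)) * min (2 * t) 1"

definition ht :: "real \<Rightarrow> real" where "ht t = max 0 (2 * t - 1)"
text \<open>Parameters of the stages below \<open>l = 1/2\<close>: \<open>h\<sigma>\<close> falls
  from 1 to 0 between 1/2 and 1/3, \<open>h\<nu>\<close> falls from 1 to -1 between 1/3 and 1/6,
  where \<open>Lm\<close> passes through \<open>e1\<close> when it is 0, and \<open>h\<rho>\<close>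
  grows from 0 to 1 between 1/6 and 0.\<close>

definition h\<rho> :: "real \<Rightarrow> real" where "h\<rho> l = max 0 (1 - 6 * l)"
definition h\<sigma> :: "real \<Rightarrow> real" where "h\<sigma> l = min 1 (max 0 (6 * l - 2))"
definition h\<nu> :: "real \<Rightarrow> real" where "h\<nu> l = min 1 (max (-1) (12 * l - 3))"

definition bas :: "nat \<Rightarrow> nat \<Rightarrow> real" where "bas i = (\<lambda>j. if j = i then 1 else 0)"

definition Lp :: "real \<Rightarrow> (nat \<Rightarrow> real) \<Rightarrow> real \<Rightarrow> nat \<Rightarrow> real" where
  "Lp l d t = (\<lambda>j. (1 - ht t) * (max (hx l t) (h\<rho> l) * bas 6 j +
     (1 - max (hx l t) (h\<rho> l)) * ((1 - h\<sigma> l) * bas 0 j + h\<sigma> l * bas 5 j)) - ht t * d j)"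

definition Lm :: "real \<Rightarrow> (nat \<Rightarrow> real) \<Rightarrow> real \<Rightarrow> nat \<Rightarrow> real" where
  "Lm l d t = (\<lambda>j. (1 - ht t) * (- max (- hx l t) (h\<rho> l) * bas 6 j +
     (1 - max (- hx l t) (h\<rho> l)) * ((1 - h\<sigma> l) * (h\<nu> l * bas 0 j + (1 - \<bar>h\<nu> l\<bar>) * bas 1 j) + h\<sigma> l * bas 5 j))
     - ht t * d j)"

definition hh :: "bool \<Rightarrow> real \<Rightarrow> (nat \<Rightarrow> real) \<Rightarrow> real \<Rightarrow> (bool \<times> (nat \<Rightarrow> real) set set) set" where
  "hh b l d t = (if 0 \<le> hx l t then proj b (Lp l d t) else proj b (Lm l d t))"

text \<open>The lifts are exchanged during the first half of the path, except for
  \<open>l = 3/4\<close>, where the second half starts at the corner \<open>e5\<close>.\<close>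

lemma hx_zero:
  assumes "hx l t = 0" "ht t > 0" shows "l = 3/4"
  using assms by (auto simp: hx_def ht_def max_def min_def split: if_splits)

text \<open>As \<open>d\<close> lives in the first three coordinates, it cannot cancel the
  coefficients of \<open>e5\<close> and \<open>e6\<close>. Where these vanish before the end,
  \<open>l\<close> is at most 1/3, and by \<open>hx_zero\<close> the motion towards
  \<open>-d\<close> has not begun; the coefficient of \<open>e0\<close> is then 1.\<close>

lemma Lp_vecs:
  assumes "l \<in> {0..1}" "d \<in> vecs 2" "t \<in> {0..1}" "0 \<le> hx l t"
  shows "Lp l d t \<in> vecs 6"
proof -
  have t: "0 \<le> ht t" "ht t \<le> 1" using assms(3) by (auto simp: ht_def)
  have z: "Lp l d t i = 0" if "i > 6" for i
    using that assms(2) by (simp add: Lp_def bas_def vecs_def)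
  obtain i where i: "i \<le> 2" "d i \<noteq> 0" using assms(2) by (auto simp: vecs_def)
  have d: "d 5 = 0" "d 6 = 0" using assms(2) by (auto simp: vecs_def)
  consider "ht t = 1" | "ht t < 1" "max (hx l t) (h\<rho> l) > 0" | "ht t < 1" "h\<sigma> l > 0" "max (hx l t) (h\<rho> l) = 0"
    | "ht t < 1" "h\<sigma> l = 0" "max (hx l t) (h\<rho> l) = 0"
    using t assms(4) by (fastforce simp: h\<sigma>_def)
  then show ?thesis
  proof cases
    case 1 then show ?thesis using i by (intro vecsI[of 6 _ i] z) (simp_all add: Lp_def)
  next
    case 2 then show ?thesis using d by (intro vecsI[of 6 _ 6] z) (simp_all add: Lp_def bas_def)
  next
    case 3 then show ?thesis using d by (intro vecsI[of 6 _ 5] z) (simp_all add: Lp_def bas_def)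
  next
    case 4
    then have "hx l t = 0" using assms(4) by linarith
    then have "ht t = 0" using hx_zero[of l t] 4(2) t by (force simp: h\<sigma>_def)
    then show ?thesis using 4 by (intro vecsI[of 6 _ 0] z) (simp_all add: Lp_def bas_def)
  qed
qed

lemma Lm_vecs:
  assumes "l \<in> {0..1}" "d \<in> vecs 2" "t \<in> {0..1}" "hx l t \<le> 0"
  shows "Lm l d t \<in> vecs 6"
proof -
  have t: "0 \<le> ht t" "ht t \<le> 1" using assms(3) by (auto simp: ht_def)
  have z: "Lm l d t i = 0" if "i > 6" for i
    using that assms(2) by (simp add: Lm_def bas_def vecs_def)
  obtain i where i: "i \<le> 2" "d i \<noteq> 0" using assms(2) by (auto simp: vecs_def)
  have d: "d 5 = 0" "d 6 = 0" using assms(2) by (auto simp: vecs_def)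
  consider "ht t = 1" | "ht t < 1" "max (- hx l t) (h\<rho> l) > 0" | "ht t < 1" "h\<sigma> l > 0" "max (- hx l t) (h\<rho> l) = 0"
    | "ht t < 1" "h\<sigma> l = 0" "max (- hx l t) (h\<rho> l) = 0"
    using t assms(4) by (fastforce simp: h\<sigma>_def)
  then show ?thesis
  proof cases
    case 1 then show ?thesis using i by (intro vecsI[of 6 _ i] z) (simp_all add: Lm_def)
  next
    case 2 then show ?thesis using d by (intro vecsI[of 6 _ 6] z) (simp_all add: Lm_def bas_def)
  next
    case 3 then show ?thesis using d by (intro vecsI[of 6 _ 5] z) (simp_all add: Lm_def bas_def)
  next
    case 4
    then have "hx l t = 0" using assms(4) by linarith
    then have "ht t = 0" using hx_zero[of l t] 4(2) t by (force simp: h\<sigma>_def)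
    then have L: "Lm l d t 0 = h\<nu> l" "Lm l d t 1 = 1 - \<bar>h\<nu> l\<bar>" using 4 by (simp_all add: Lm_def bas_def)
    show ?thesis
    proof (cases "h\<nu> l = 0")
      case True then show ?thesis using L by (intro vecsI[of 6 _ 1] z) simp_all
    next
      case False then show ?thesis using L by (intro vecsI[of 6 _ 0] z) simp_all
    qed
  qed
qed

lemma proj_uminus:
  assumes "a \<in> vecs 6" shows "proj b (\<lambda>i. - a i) = proj b a"
proof (rule proj_eqI[symmetric])
  show "(\<lambda>i. - a i) \<in> vecs 6" using assms by (auto simp: vecs_def)
  show "same_lift b a b (\<lambda>i. - a i)"
    unfolding same_lift_def by (intro disjI2 conjI exI[of _ "-1"]) simp_all
qed (rule assms)

text \<open>Where the lifts meet, they are antipodal for \<open>l < 1/6\<close>, both over the base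
  point between 1/6 and 1/3, and equal for larger \<open>l\<close>.\<close>

lemma Lp_Lm:
  assumes "l \<in> {0..1}" "d \<in> vecs 2" "t \<in> {0..1}" "hx l t = 0"
  shows "proj b (Lp l d t) = proj b (Lm l d t)"
proof -
  have v: "Lp l d t \<in> vecs 6" "Lm l d t \<in> vecs 6" using assms by (auto intro: Lp_vecs Lm_vecs)
  have ht0: "ht t = 0" if "l < 3/4" using hx_zero[OF assms(4)] that by (force simp: ht_def)
  consider "l < 1/6" | "1/6 \<le> l" "l \<le> 1/3" | "1/3 < l" by linarith
  then show ?thesis
  proof cases
    case 1
    have "Lm l d t = (\<lambda>i. - Lp l d t i)"
      using 1 assms(1) ht0 by (auto simp: Lp_def Lm_def assms(4) h\<rho>_def h\<sigma>_def h\<nu>_def algebra_simps)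
    then show ?thesis using proj_uminus[OF v(1)] by simp
  next
    case 2
    then have "based (Lp l d t)" "based (Lm l d t)"
      using ht0 by (auto simp: based_def Lp_def Lm_def assms(4) h\<rho>_def h\<sigma>_def bas_def)
    then show ?thesis using proj_based v by simp
  next
    case 3
    then have "Lp l d t = Lm l d t" by (simp add: Lp_def Lm_def assms(4) h\<rho>_def h\<nu>_def)
    then show ?thesis by simp
  qed
qed

lemma vecs_mono: "m \<le> n \<Longrightarrow> d \<in> vecs m \<Longrightarrow> d \<in> vecs n"
  by (auto simp: vecs_def intro: order_trans)

lemma based_vecs2: "d \<in> vecs 2 \<Longrightarrow> based d"
  by (simp add: vecs_def based_def)

lemma bas6_vecs: "bas 6 \<in> vecs 6"
  by (intro vecsI[of _ _ 6]) (simp_all add: bas_def)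

lemma seg_bas6_vecs:
  assumes "d \<in> vecs 2" shows "seg (bas 6) d t \<in> vecs 6"
proof (cases "t = 1")
  case True then show ?thesis using vecs_mono[OF _ assms, of 6] by simp
next
  case False
  have "d i = 0" if "i > 2" for i using assms that by (simp add: vecs_def)
  then show ?thesis using False by (intro vecsI[of _ _ 6]) (simp_all add: bas_def)
qed

lemma hh_0:
  assumes "l \<in> {0..1}" shows "hh b l d 0 = proj b (bas 6)"
proof -
  have "max 1 (h\<rho> l) = 1" using assms by (simp add: h\<rho>_def)
  then show ?thesis by (simp add: hh_def hx_def Lp_def ht_def)
qed

lemma hh_1:
  assumes "l \<in> {0..1}" "d \<in> vecs 2" shows "hh b l d 1 = star"
proof -
  have v: "(\<lambda>i. - d i) \<in> vecs 6" using vecs_mono[OF _ assms(2), of 6] by (simp add: vecs_def)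
  have "Lp l d 1 = (\<lambda>i. - d i)" "Lm l d 1 = (\<lambda>i. - d i)" by (simp_all add: Lp_def Lm_def ht_def)
  moreover have "proj b (\<lambda>i. - d i) = star"
    by (rule proj_based[OF v]) (use based_vecs2[OF assms(2)] in \<open>simp add: based_def\<close>)
  ultimately show ?thesis by (simp add: hh_def)
qed

text \<open>At \<open>l = 0\<close> the retraction is complete: the lift rests at \<open>e6\<close>
  or \<open>-e6\<close>, and the second half runs from \<open>-e6\<close> to \<open>-d\<close>,
  antipodal to the segment from \<open>e6\<close> to \<open>d\<close>.\<close>

lemma hh_left:
  assumes "d \<in> vecs 2" "t \<in> {0..1}"
  shows "hh b 0 d t = proj b (seg (bas 6) d (ht t))"
proof (cases "0 \<le> hx 0 t")
  case True
  then have "ht t = 0" by (auto simp: hx_def ht_def min_def split: if_splits)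
  moreover have "max (hx 0 t) 1 = 1" using assms(2) by (simp add: hx_def)
  ultimately show ?thesis using True by (simp add: hh_def Lp_def h\<rho>_def)
next
  case False
  have "max (- hx 0 t) 1 = 1" using assms(2) by (simp add: hx_def)
  then have "Lm 0 d t = (\<lambda>i. - seg (bas 6) d (ht t) i)" by (simp add: Lm_def h\<rho>_def)
  then show ?thesis using False proj_uminus[OF seg_bas6_vecs[OF assms(1)]] by (simp add: hh_def)
qed

lemma hh_right:
  shows "hh b 1 d t = proj b (seg (bas 6) (\<lambda>i. - d i) (ht t))"
  by (simp add: hh_def hx_def Lp_def h\<rho>_def)

lemma continuous_on_hx [continuous_intros]:
  "continuous_on S f \<Longrightarrow> continuous_on S g \<Longrightarrow> continuous_on S (\<lambda>p. hx (f p) (g p))"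
  unfolding hx_def by (intro continuous_intros)

lemma continuous_on_ht [continuous_intros]: "continuous_on S f \<Longrightarrow> continuous_on S (\<lambda>p. ht (f p))"
  unfolding ht_def by (intro continuous_intros)

text \<open>The two lifts are glued along \<open>hx = 0\<close>; by \<open>Lp_Lm\<close> they
  represent the same points there even where they differ.\<close>

lemma motion_hh:
  fixes \<beta> :: "'z::topological_space \<Rightarrow> bool"
  assumes b: "continuous_on W \<beta>" and l: "continuous_on W l" and d: "\<And>i. continuous_on W (\<lambda>z. d z i)"
    and ld: "\<And>z. z \<in> W \<Longrightarrow> l z \<in> {0..1} \<and> d z \<in> vecs 2"
    and inv: "\<And>z z'. z \<in> W \<Longrightarrow> z' \<in> W \<Longrightarrow> K z = K z' \<Longrightarrow> \<beta> z = \<beta> z' \<and> l z = l z' \<and> d z = d z'"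
  shows "motion W K X_space (\<lambda>z. proj (\<beta> z) (bas 6)) (\<lambda>_. star) (\<lambda>z. hh (\<beta> z) (l z) (d z))"
  unfolding motion_def
proof (intro conjI ballI impI)
  let ?T = "W \<times> {0..1::real}"
  let ?x = "\<lambda>p. hx (l (fst p)) (snd p)"
  have cb: "continuous_on S (\<lambda>p. \<beta> (fst p))" and cl: "continuous_on S (\<lambda>p. l (fst p))"
    and cd: "\<And>i. continuous_on S (\<lambda>p. d (fst p) i)" if "S \<subseteq> ?T" for S
    using continuous_on_subset[OF continuous_on_fst_comp that] b l d by blast+
  have cx: "continuous_on ?T ?x" by (intro continuous_intros cl subset_refl)
  have "continuous_map (top_of_set ?T) X_space
     (\<lambda>p. if 0 \<le> ?x p then proj (\<beta> (fst p)) (Lp (l (fst p)) (d (fst p)) (snd p))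
          else proj (\<beta> (fst p)) (Lm (l (fst p)) (d (fst p)) (snd p)))"
  proof (rule continuous_map_cases_le)
    have S: "?T \<inter> {x \<in> ?T. 0 \<le> ?x x} \<subseteq> ?T" "?T \<inter> {x \<in> ?T. ?x x \<le> 0} \<subseteq> ?T" by auto
    show "continuous_map (subtopology (top_of_set ?T) {x \<in> topspace (top_of_set ?T). 0 \<le> ?x x}) X_space
        (\<lambda>p. proj (\<beta> (fst p)) (Lp (l (fst p)) (d (fst p)) (snd p)))"
      unfolding subtopology_subtopology topspace_euclidean_subtopology
    proof (rule continuous_map_proj[OF _ _ cb[OF S(1)]])
      show "continuous_on (?T \<inter> {x \<in> ?T. 0 \<le> ?x x}) (\<lambda>p. Lp (l (fst p)) (d (fst p)) (snd p) i)" for i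
        unfolding Lp_def h\<rho>_def h\<sigma>_def by (intro continuous_intros cl[OF S(1)] cd[OF S(1)])
    qed (use ld Lp_vecs in auto)
    show "continuous_map (subtopology (top_of_set ?T) {x \<in> topspace (top_of_set ?T). ?x x \<le> 0}) X_space
        (\<lambda>p. proj (\<beta> (fst p)) (Lm (l (fst p)) (d (fst p)) (snd p)))"
      unfolding subtopology_subtopology topspace_euclidean_subtopology
    proof (rule continuous_map_proj[OF _ _ cb[OF S(2)]])
      show "continuous_on (?T \<inter> {x \<in> ?T. ?x x \<le> 0}) (\<lambda>p. Lm (l (fst p)) (d (fst p)) (snd p) i)" for i
        unfolding Lm_def h\<rho>_def h\<sigma>_def h\<nu>_def by (intro continuous_intros cl[OF S(2)] cd[OF S(2)])
    qed (use ld Lm_vecs in auto)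
  qed (use cx ld Lp_Lm in auto)
  then show "continuous_map (top_of_set ?T) X_space (\<lambda>(z, t). hh (\<beta> z) (l z) (d z) t)"
    by (simp add: hh_def case_prod_unfold cong: if_cong)
  fix z assume z: "z \<in> W"
  show "hh (\<beta> z) (l z) (d z) 0 = proj (\<beta> z) (bas 6)" using ld[OF z] by (intro hh_0) auto
  show "hh (\<beta> z) (l z) (d z) 1 = star" using ld[OF z] by (intro hh_1) auto
  fix z' and t :: real assume z': "z' \<in> W" "K z = K z'"
  then show "hh (\<beta> z) (l z) (d z) t = hh (\<beta> z') (l z') (d z') t" using inv[OF z z'] by simp
qed

section \<open>Families of paths for the product with a sphere\<close>

lemma motion_reparam:
  assumes h: "motion W K B f g h" and c: "continuous_on {0..1} \<tau>" and \<tau>: "\<And>t. t \<in> {0..1} \<Longrightarrow> \<tau> t \<in> {0..1::real}"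
    and ends: "\<tau> 0 = 0" "\<tau> 1 = 1"
  shows "motion W K B f g (\<lambda>z t. h z (\<tau> t))"
proof (rule motionI)
  note h = motionD[OF h]
  show "continuous_map (top_of_set (W \<times> {0..1})) B (\<lambda>(z, t). h z (\<tau> t))"
    by (rule continuous_map_reparam[OF h(1) _ c]) (use \<tau> in auto)
  show "h z (\<tau> 0) = f z" "h z (\<tau> 1) = g z" if "z \<in> W" for z using h(2)[OF that] by (simp_all add: ends)
  show "h z (\<tau> t) = h z' (\<tau> t)" if "z \<in> W" "z' \<in> W" "K z = K z'" "t \<in> {0..1}" for z z' t
    by (rule h(3)[OF that(1-3) \<tau>[OF that(4)]])
qed

lemma motion_cong:
  assumes "motion W K B f g h" "\<And>z. z \<in> W \<Longrightarrow> f z = f' z" "\<And>z. z \<in> W \<Longrightarrow> g z = g' z"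
  shows "motion W K B f' g' h"
proof -
  note h = motionD[OF assms(1)]
  show ?thesis
  proof (rule motionI[OF h(1)])
    show "h z 0 = f' z" "h z 1 = g' z" if "z \<in> W" for z using h(2)[OF that] assms(2,3)[OF that] by simp_all
    show "h z t = h z' t" if "z \<in> W" "z' \<in> W" "K z = K z'" "t \<in> {0..1}" for z z' t by (rule h(3)[OF that])
  qed
qed

lemma motion_closed_Un:
  assumes 1: "motion W1 K B f g h1" and 2: "motion W2 K B f g h2"
    and cl: "closedin (top_of_set (W1 \<union> W2)) W1" "closedin (top_of_set (W1 \<union> W2)) W2"
    and agree: "\<And>z t. z \<in> W1 \<Longrightarrow> z \<in> W2 \<Longrightarrow> t \<in> {0..1} \<Longrightarrow> h1 z t = h2 z t"
    and sat: "\<And>z z'. z \<in> W1 \<Longrightarrow> z' \<in> W2 \<Longrightarrow> K z = K z' \<Longrightarrow> z' \<in> W1 \<and> z \<in> W2"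
  shows "motion (W1 \<union> W2) K B f g (\<lambda>z t. if z \<in> W1 then h1 z t else h2 z t)"
proof (rule motionI)
  note h1 = motionD[OF 1] and h2 = motionD[OF 2]
  let ?T = "\<lambda>b. if b then W1 \<times> {0..1::real} else W2 \<times> {0..1}"
  show "continuous_map (top_of_set ((W1 \<union> W2) \<times> {0..1})) B (\<lambda>(z, t). if z \<in> W1 then h1 z t else h2 z t)"
  proof (rule pasting_lemma_closed[where I = "UNIV :: bool set" and T = ?T and f = "\<lambda>b (z, t). if b then h1 z t else h2 z t"])
    fix b :: bool
    have "closedin (prod_topology (top_of_set (W1 \<union> W2)) (top_of_set {0..1::real})) (?T b)"
      by (cases b) (simp_all only: if_True if_False closedin_prod_Times_iff cl closedin_self simp_thms)
    then show "closedin (top_of_set ((W1 \<union> W2) \<times> {0..1})) (?T b)"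
      unfolding prod_topology_subtopology_eu .
    have s: "(W1 \<union> W2) \<times> {0..1} \<inter> W1 \<times> {0..1::real} = W1 \<times> {0..1}" "(W1 \<union> W2) \<times> {0..1} \<inter> W2 \<times> {0..1::real} = W2 \<times> {0..1}"
      by auto
    show "continuous_map (subtopology (top_of_set ((W1 \<union> W2) \<times> {0..1})) (?T b)) B (\<lambda>(z, t). if b then h1 z t else h2 z t)"
      by (cases b) (simp_all only: if_True if_False subtopology_subtopology s h1(1) h2(1))
  next
    fix b c x assume *: "x \<in> topspace (top_of_set ((W1 \<union> W2) \<times> {0..1})) \<inter> ?T b \<inter> ?T c"
    show "(case x of (z, t) \<Rightarrow> if b then h1 z t else h2 z t) = (case x of (z, t) \<Rightarrow> if c then h1 z t else h2 z t)"
      using * agree[of "fst x" "snd x"] by (cases b; cases c; cases x) auto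
  next
    fix x assume "x \<in> topspace (top_of_set ((W1 \<union> W2) \<times> {0..1::real}))"
    then show "\<exists>b. b \<in> UNIV \<and> x \<in> ?T b \<and>
        (case x of (z, t) \<Rightarrow> if z \<in> W1 then h1 z t else h2 z t) = (case x of (z, t) \<Rightarrow> if b then h1 z t else h2 z t)"
      by (intro exI[of _ "fst x \<in> W1"]) (auto split: prod.split)
  qed simp
  show "(if z \<in> W1 then h1 z 0 else h2 z 0) = f z" "(if z \<in> W1 then h1 z 1 else h2 z 1) = g z" if "z \<in> W1 \<union> W2" for z
    using that h1(2)[of z] h2(2)[of z] by auto
  fix z z' t assume z: "z \<in> W1 \<union> W2" "z' \<in> W1 \<union> W2" "K z = K z'" "t \<in> {0..1::real}"
  show "(if z \<in> W1 then h1 z t else h2 z t) = (if z' \<in> W1 then h1 z' t else h2 z' t)"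
  proof (cases "z \<in> W1 \<longleftrightarrow> z' \<in> W1")
    case True
    then show ?thesis using h1(3)[OF _ _ z(3,4)] h2(3)[OF _ _ z(3,4)] z(1,2) by auto
  next
    case False
    then show ?thesis using sat[of z z'] sat[of z' z] z(1-3) by auto
  qed
qed

definition inprod :: "nat \<Rightarrow> (nat \<Rightarrow> real) \<Rightarrow> (nat \<Rightarrow> real) \<Rightarrow> real" where
  "inprod n a q = (\<Sum>i\<le>n. a i * q i)"

text \<open>This is the Gram determinant of \<open>a\<close> and \<open>q\<close> if \<open>q\<close> is a unit vector.\<close>

definition gram :: "nat \<Rightarrow> (nat \<Rightarrow> real) \<Rightarrow> (nat \<Rightarrow> real) \<Rightarrow> real" where
  "gram n a q = (\<Sum>i\<le>n. (a i - inprod n a q * q i)\<^sup>2)"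

lemma gram_nonneg: "gram n a q \<ge> 0"
  by (simp add: gram_def sum_nonneg)

lemma gram_eq_0: "gram n a q = 0 \<longleftrightarrow> (\<forall>i\<le>n. a i = inprod n a q * q i)"
  unfolding gram_def by (subst sum_nonneg_eq_0_iff) auto

lemma gram_seg:
  assumes "gram n a q > 0" "q \<in> sph n" "\<And>i. i > n \<Longrightarrow> a i = 0" "t \<in> {0..1}"
  shows "seg q a t \<in> vecs n"
proof (rule ccontr)
  assume "seg q a t \<notin> vecs n"
  then have z: "(1 - t) * q i + t * a i = 0" if "i \<le> n" for i
    using that assms(2,3) by (auto simp: vecs_def sph_def)
  have q: "(\<Sum>i\<le>n. (q i)\<^sup>2) = 1" using assms(2) by (simp add: sph_def)
  have "t \<noteq> 0" using z q by auto
  define c where "c = - (1 - t) / t"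
  have a: "a i = c * q i" if "i \<le> n" for i
    using z[OF that] \<open>t \<noteq> 0\<close> by (simp add: c_def field_simps)
  have "inprod n a q = (\<Sum>i\<le>n. c * (q i)\<^sup>2)"
    unfolding inprod_def by (intro sum.cong) (simp_all add: a power2_eq_square)
  then have "inprod n a q = c" by (simp add: q flip: sum_distrib_left)
  then have "gram n a q = 0" unfolding gram_eq_0 using a by simp
  then show False using assms(1) by simp
qed

lemma continuous_on_inprod [continuous_intros]:
  "(\<And>i. continuous_on S (\<lambda>z. a z i)) \<Longrightarrow> (\<And>i. continuous_on S (\<lambda>z. q z i)) \<Longrightarrow> continuous_on S (\<lambda>z. inprod n (a z) (q z))"
  unfolding inprod_def by (intro continuous_intros; assumption)

lemma continuous_on_gram [continuous_intros]:
  "(\<And>i. continuous_on S (\<lambda>z. a z i)) \<Longrightarrow> (\<And>i. continuous_on S (\<lambda>z. q z i)) \<Longrightarrow> continuous_on S (\<lambda>z. gram n (a z) (q z))"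
  unfolding gram_def by (intro continuous_intros; assumption)

locale XS_family = X_family W K \<beta> y
  for W :: "'z::topological_space set" and K :: "'z \<Rightarrow> 'q" and \<beta> y +
  fixes s s' :: "'z \<Rightarrow> nat \<Rightarrow> real" and k :: nat
  assumes cont_s: "\<And>i. continuous_on W (\<lambda>z. s z i)" and cont_s': "\<And>i. continuous_on W (\<lambda>z. s' z i)"
    and s_sph: "\<And>z. z \<in> W \<Longrightarrow> s z \<in> sph k" and s'_sph: "\<And>z. z \<in> W \<Longrightarrow> s' z \<in> sph k"
    and K_s: "\<And>z z'. z \<in> W \<Longrightarrow> z' \<in> W \<Longrightarrow> K z = K z' \<Longrightarrow> s z = s z' \<and> s' z = s' z'"
    and k_even: "even k" and k_ge: "k \<ge> 2"
begin

text \<open>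
  The second set for \<open>X\<close> is \<open>b > 0\<close> and the second set for the sphere
  uses paths through the direction of \<open>m\<close>. Both are chosen so that \<open>u\<close>,
  \<open>s + s'\<close> and \<open>b\<close> do not vanish simultaneously at a point where
  \<open>m\<close> is parallel to \<open>s\<close>. The scale \<open>r\<close> measures the
  distance from the locus \<open>u = v = 0\<close>, \<open>s' = -s\<close>. Where \<open>r \<ge>
  1\<close> the vector \<open>m\<close> points to \<open>e0\<close> and \<open>b\<close> vanishes
  only with \<open>v\<close> or \<open>s 0\<close>. For small \<open>r\<close> the coordinates
  \<open>(V 0, V 1)\<close>, \<open>(V 2, s 1)\<close>, \<open>(s 2, s 3)\<close>, ...,
  \<open>(s (k-2), s (k-1))\<close> are rotated by a right angle pairwise and added with the
  factor \<open>\<eta>\<close>; this pairing needs \<open>k\<close> to be even. The rotated vector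
  has no real eigenvalue, so a common zero forces \<open>v = 0\<close> and \<open>s\<close> to lie
  in the plane of \<open>e0\<close> and \<open>ek\<close>.
\<close>

definition V :: "'z \<Rightarrow> nat \<Rightarrow> real" where "V z i = y z 6 * y z (i + 3)"
definition ss :: "'z \<Rightarrow> real" where "ss z = (\<Sum>i\<le>k. (s z i + s' z i)\<^sup>2)"
text \<open>With the factor 4 the scale is at least 4 wherever \<open>y z 6 = 0\<close>, so
  \<open>w\<close> is nonzero at the thresholds 1, 2 and 3 used below.\<close>

definition r :: "'z \<Rightarrow> real" where "r z = 4 * (usq (y z) + vsq (y z) + ss z)"
text \<open>Positive only for \<open>r z < 1\<close> and \<open>s z k > -1/3\<close>. The linear
  factor is chosen so that its square never equals \<open>s z k + (s z k)^2\<close>, which is the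
  equation left at the end of \<open>no_common_zero\<close>.\<close>

definition \<eta> :: "'z \<Rightarrow> real" where "\<eta> z = max 0 (1 - r z) * max 0 (3/2 * s z k + 1/2)"
definition g :: "'z \<Rightarrow> nat \<Rightarrow> real" where
  "g z i = (if i = 0 then - s z 0 * V z 0 + \<eta> z * V z 1
    else if i = 1 then - s z 0 * V z 1 - \<eta> z * V z 0
    else if i = 2 then - s z 0 * V z 2 + \<eta> z * s z 1 else 0)"
definition b :: "'z \<Rightarrow> real" where "b z = usq (g z) + vsq (y z) * max 0 (r z - 1)"
text \<open>This is \<open>1 + s z k\<close> where \<open>s z k \<ge> -1/3\<close>, in particular
  where \<open>\<eta> z > 0\<close>, and stays away from zero elsewhere.\<close>

definition M :: "'z \<Rightarrow> real" where "M z = max (1 + s z k) (2/3)"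
definition \<tau> :: "'z \<Rightarrow> nat \<Rightarrow> real" where
  "\<tau> z i = (if i = 0 then - (\<eta> z)\<^sup>2 else if i = 1 then - \<eta> z * V z 2
    else if even i then \<eta> z * s z (i + 1) else - \<eta> z * s z (i - 1))"
text \<open>Where \<open>M z = 1 + s z k\<close>, the terms with \<open>\<tau>\<close> are, modulo
  multiples of \<open>s z\<close>, equal to \<open>M z\<close> times the parallel transport of
  \<open>\<tau> z\<close> from the pole \<open>ek\<close> to \<open>s z\<close>. In these terms
  \<open>m\<close> being parallel to \<open>s\<close> becomes a simple equation for the coordinates
  below \<open>k\<close>.\<close>

definition m :: "'z \<Rightarrow> nat \<Rightarrow> real" where
  "m z i = (if i < k then (if i = 0 then (M z)\<^sup>2 else 0) + M z * \<tau> z i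
    else if i = k then - (\<Sum>j<k. \<tau> z j * s z j) else 0)"

lemma cont_V: "continuous_on W (\<lambda>z. V z i)"
  unfolding V_def by (intro continuous_intros cont_y)

lemma cont_ss: "continuous_on W ss"
  unfolding ss_def by (intro continuous_intros cont_s cont_s')

lemma cont_r: "continuous_on W r"
  unfolding r_def by (intro continuous_intros cont_y cont_ss)

lemma cont_\<eta>: "continuous_on W \<eta>"
  unfolding \<eta>_def by (intro continuous_intros cont_r cont_s)

lemma cont_g: "continuous_on W (\<lambda>z. g z i)"
proof -
  have "continuous_on W (\<lambda>z. - s z 0 * V z 0 + \<eta> z * V z 1)" "continuous_on W (\<lambda>z. - s z 0 * V z 1 - \<eta> z * V z 0)"
    "continuous_on W (\<lambda>z. - s z 0 * V z 2 + \<eta> z * s z 1)"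
    by (intro continuous_intros cont_s cont_\<eta> cont_V)+
  then show ?thesis unfolding g_def by (cases "i = 0"; cases "i = 1"; cases "i = 2") simp_all
qed

lemma cont_b: "continuous_on W b"
  unfolding b_def by (intro continuous_intros cont_g cont_r cont_y)

lemma cont_M: "continuous_on W M"
  unfolding M_def by (intro continuous_intros cont_s)

lemma cont_\<tau>: "continuous_on W (\<lambda>z. \<tau> z i)"
proof -
  have "continuous_on W (\<lambda>z. - (\<eta> z)\<^sup>2)" "continuous_on W (\<lambda>z. - \<eta> z * V z 2)"
    "continuous_on W (\<lambda>z. \<eta> z * s z (i + 1))" "continuous_on W (\<lambda>z. - \<eta> z * s z (i - 1))"
    by (intro continuous_intros cont_s cont_\<eta> cont_V)+
  then show ?thesis unfolding \<tau>_def by (cases "i = 0"; cases "i = 1"; cases "even i") simp_all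
qed

lemma cont_m: "continuous_on W (\<lambda>z. m z i)"
proof -
  have "continuous_on W (\<lambda>z. (M z)\<^sup>2 + M z * \<tau> z i)" "continuous_on W (\<lambda>z. 0 + M z * \<tau> z i)"
    "continuous_on W (\<lambda>z. - (\<Sum>j<k. \<tau> z j * s z j))"
    by (intro continuous_intros cont_s cont_M cont_\<tau>)+
  then show ?thesis unfolding m_def by (cases "i < k"; cases "i = 0"; cases "i = k") simp_all
qed

lemma
  assumes a: "z \<in> W" "z' \<in> W" "K z = K z'"
  shows V_K: "V z = V z'" and r_K: "r z = r z'" and g_K: "g z = g z'"
    and b_K: "b z = b z'" and m_K: "m z = m z'" and ss_K: "ss z = ss z'"
proof -
  have s: "s z = s z'" "s' z = s' z'" using K_s[OF a] by auto
  show V: "V z = V z'"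
    using a
  proof (cases rule: K_cases)
    case 1 then show ?thesis by (simp add: V_def fun_eq_iff based_def)
  qed (simp_all add: V_def fun_eq_iff)
  show ss: "ss z = ss z'" by (simp add: ss_def s)
  show r: "r z = r z'" by (simp add: r_def usq_K[OF a] vsq_K[OF a] ss)
  have \<eta>: "\<eta> z = \<eta> z'" by (simp add: \<eta>_def r s)
  show g: "g z = g z'" unfolding g_def[abs_def] by (simp only: s V \<eta>)
  show "b z = b z'" by (simp add: b_def g r vsq_K[OF a])
  have "\<tau> z = \<tau> z'" unfolding \<tau>_def[abs_def] by (simp only: s V \<eta>)
  then show "m z = m z'" unfolding m_def[abs_def] M_def by (simp only: s)
qed

text \<open>A positive product of Gram determinants says that the intermediate direction is parallel
  to neither end, so both segments avoid the origin.\<close>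

definition sG :: "nat \<Rightarrow> 'z \<Rightarrow> real" where
  "sG i z = (if i = 0 then ss z else if i = 1 then gram k (m z) (s z) * gram k (m z) (s' z)
    else if i = 2 then gram k (bas 1) (s z) * gram k (bas 1) (s' z) else 0)"

lemma ss_nonneg: "ss z \<ge> 0"
  by (simp add: ss_def sum_nonneg)

lemma cover_fun_sG: "cover_fun W K (sG i)"
proof (rule cover_funI)
  have "continuous_on W (\<lambda>z. gram k (m z) (s z) * gram k (m z) (s' z))"
    "continuous_on W (\<lambda>z. gram k (bas 1) (s z) * gram k (bas 1) (s' z))"
    by (intro continuous_intros cont_s cont_s' cont_m)+
  then show "continuous_on W (sG i)"
    unfolding sG_def[abs_def] using cont_ss by (cases "i = 0"; cases "i = 1"; cases "i = 2") simp_all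
  show "sG i z = sG i z'" if "z \<in> W" "z' \<in> W" "K z = K z'" for z z'
    unfolding sG_def ss_K[OF that] m_K[OF that] by (simp only: K_s[OF that])
qed (simp add: sG_def ss_nonneg gram_nonneg)

lemma s_path_straight: "path_family {z \<in> W. ss z > 0} K (nsphere k) s s'"
proof (rule path_family_cong[OF path_family_nrml_seg[of _ s s' k K]])
  let ?W = "{z \<in> W. ss z > 0}"
  show "continuous_on ?W (\<lambda>z. s z i)" "continuous_on ?W (\<lambda>z. s' z i)" for i
    by (rule continuous_on_subset[OF cont_s], auto, rule continuous_on_subset[OF cont_s'], auto)
  show "nrml k (s z) = s z" "nrml k (s' z) = s' z" if "z \<in> ?W" for z
    using that by (simp_all add: nrml_of_sph s_sph s'_sph)
  show "s z = s z' \<and> s' z = s' z'" if "z \<in> ?W" "z' \<in> ?W" "K z = K z'" for z z'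
    by (rule K_s) (use that in auto)
  fix z and t :: real assume z: "z \<in> ?W" and t: "t \<in> {0..1}"
  then have sz: "s z \<in> sph k" "s' z \<in> sph k" by (auto simp: s_sph s'_sph)
  show "seg (s z) (s' z) t \<in> vecs k"
  proof (rule ccontr)
    assume "seg (s z) (s' z) t \<notin> vecs k"
    then have 0: "(1 - t) * s z i = - t * s' z i" if "i \<le> k" for i
      using that sz by (auto simp: vecs_def sph_def add_eq_0_iff)
    have "(\<Sum>i\<le>k. ((1 - t) * s z i)\<^sup>2) = (\<Sum>i\<le>k. (- t * s' z i)\<^sup>2)"
      by (intro sum.cong) (simp_all only: 0 atMost_iff)
    then have "(1 - t)\<^sup>2 = t\<^sup>2"
      using sz by (simp add: power_mult_distrib sph_def flip: sum_distrib_left)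
    then have t2: "t = 1/2" using t by (simp add: power2_eq_iff)
    have "s z i + s' z i = 0" if "i \<le> k" for i using 0[OF that] unfolding t2 by simp
    then have "ss z = 0" by (simp add: ss_def)
    then show False using z by simp
  qed
qed

lemma s_path_via:
  assumes a: "\<And>i. continuous_on W (\<lambda>z. a z i)" "\<And>z i. i > k \<Longrightarrow> a z i = 0"
    and W': "W' = {z \<in> W. gram k (a z) (s z) * gram k (a z) (s' z) > 0}"
    and K: "\<And>z z'. z \<in> W \<Longrightarrow> z' \<in> W \<Longrightarrow> K z = K z' \<Longrightarrow> a z = a z'"
  shows "path_family W' K (nsphere k) s s'"
proof -
  have gr: "gram k (a z) (s z) > 0" "gram k (a z) (s' z) > 0" if "z \<in> W'" for z
    using that gram_nonneg[of k "a z" "s z"] gram_nonneg[of k "a z" "s' z"] by (auto simp: W' zero_less_mult_iff)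
  have sub: "W' \<subseteq> W" by (auto simp: W')
  have 1: "path_family W' K (nsphere k) (\<lambda>z. nrml k (q z)) (\<lambda>z. nrml k (a z))"
    if q: "\<And>i. continuous_on W (\<lambda>z. q z i)" "\<And>z. z \<in> W \<Longrightarrow> q z \<in> sph k"
      "\<And>z. z \<in> W' \<Longrightarrow> gram k (a z) (q z) > 0" "\<And>z z'. z \<in> W \<Longrightarrow> z' \<in> W \<Longrightarrow> K z = K z' \<Longrightarrow> q z = q z'" for q
  proof (rule path_family_nrml_seg)
    show "continuous_on W' (\<lambda>z. q z i)" "continuous_on W' (\<lambda>z. a z i)" for i
      by (rule continuous_on_subset[OF q(1) sub], rule continuous_on_subset[OF a(1) sub])
    show "seg (q z) (a z) t \<in> vecs k" if "z \<in> W'" "t \<in> {0..1}" for z t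
      by (rule gram_seg[OF q(3)[OF that(1)] q(2) a(2) that(2)]) (use that(1) sub in auto)
    show "q z = q z' \<and> a z = a z'" if "z \<in> W'" "z' \<in> W'" "K z = K z'" for z z'
    proof -
      have w: "z \<in> W" "z' \<in> W" using that(1,2) sub by auto
      show ?thesis using q(4)[OF w that(3)] K[OF w that(3)] by (rule conjI)
    qed
  qed
  have "path_family W' K (nsphere k) (\<lambda>z. nrml k (s z)) (\<lambda>z. nrml k (a z))"
    by (rule 1[OF cont_s s_sph gr(1) conjunct1[OF K_s]])
  moreover have "path_family W' K (nsphere k) (\<lambda>z. nrml k (s' z)) (\<lambda>z. nrml k (a z))"
    by (rule 1[OF cont_s' s'_sph gr(2) conjunct2[OF K_s]])
  ultimately have "path_family W' K (nsphere k) (\<lambda>z. nrml k (s z)) (\<lambda>z. nrml k (s' z))"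
    by (rule path_family_join[OF _ path_family_reverse])
  then show ?thesis
    by (rule path_family_cong) (use sub in \<open>auto simp: nrml_of_sph s_sph s'_sph\<close>)
qed

lemma planner_sG: "planner W K (nsphere k) s s' sG"
  unfolding planner_def
proof (intro allI conjI cover_fun_sG)
  fix i :: nat
  have 1: "path_family {z \<in> W. gram k (m z) (s z) * gram k (m z) (s' z) > 0} K (nsphere k) s s'"
    by (rule s_path_via[OF cont_m _ refl m_K]) (simp add: m_def)
  have 2: "path_family {z \<in> W. gram k (bas 1) (s z) * gram k (bas 1) (s' z) > 0} K (nsphere k) s s'"
    by (rule s_path_via[OF _ _ refl]) (use k_ge in \<open>auto simp: bas_def\<close>)
  have 3: "path_family {z \<in> W. False} K (nsphere k) s s'"
    by (rule path_family_subset[OF 2]) simp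
  consider "i = 0" | "i = 1" | "i = 2" | "i > 2" by linarith
  then show "path_family {z \<in> W. sG i z > 0} K (nsphere k) s s'"
    by cases (use s_path_straight 1 2 3 in \<open>simp_all add: sG_def\<close>)
qed

end

lemma usq_0: "usq a = 0 \<longleftrightarrow> a 0 = 0 \<and> a 1 = 0 \<and> a 2 = 0"
  and vsq_0: "vsq a = 0 \<longleftrightarrow> a 3 = 0 \<and> a 4 = 0 \<and> a 5 = 0"
  by (auto simp: usq_def vsq_def eval_nat_numeral add_nonneg_eq_0_iff)

text \<open>In complex numbers the equations read \<open>(x + i e) (p + i q) = 0\<close>.\<close>

lemma rotation_eq_0:
  assumes "x * p = e * q" "x * q = - (e * p)" "e \<noteq> (0::real)"
  shows "p = 0 \<and> q = 0"
proof -
  have "(x\<^sup>2 + e\<^sup>2) * q = x * (x * q) + e * (e * q)" by (simp add: algebra_simps power2_eq_square)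
  also have "\<dots> = - e * (x * p) + e * (x * p)" using assms(1,2) by (simp add: algebra_simps)
  finally have "(x\<^sup>2 + e\<^sup>2) * q = 0" by simp
  moreover have "x\<^sup>2 + e\<^sup>2 > 0" using assms(3) by (simp add: add_nonneg_pos)
  ultimately have "q = 0" by (metis mult_eq_0_iff less_irrefl)
  then show ?thesis using assms(2,3) by simp
qed

context XS_family begin

lemma r_eq: "z \<in> W \<Longrightarrow> r z = 4 * (1 - (y z 6)\<^sup>2 + ss z)"
  using usq_vsq_sph[OF y_sph, of z] by (simp add: r_def)

lemma r_nonneg: "r z \<ge> 0"
  by (simp add: r_def ss_nonneg)

lemma y6_nonzero: "z \<in> W \<Longrightarrow> r z < 4 \<Longrightarrow> y z 6 \<noteq> 0"
  using r_eq[of z] ss_nonneg[of z] by auto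

lemma \<eta>_0: "r z \<ge> 1 \<Longrightarrow> \<eta> z = 0"
  by (simp add: \<eta>_def)

lemma b_nonneg: "b z \<ge> 0"
  by (simp add: b_def)

lemma b_eq_0: "b z = 0 \<longleftrightarrow> g z 0 = 0 \<and> g z 1 = 0 \<and> g z 2 = 0 \<and> vsq (y z) * max 0 (r z - 1) = 0"
  by (simp add: b_def add_nonneg_eq_0_iff usq_0)

lemma s'_eq:
  assumes z: "z \<in> W" and ss: "ss z = 0"
  shows "s' z = (\<lambda>i. - s z i)"
proof
  fix i
  have "(\<forall>i\<in>{..k}. (s z i + s' z i)\<^sup>2 = 0)"
    using ss unfolding ss_def by (subst (asm) sum_nonneg_eq_0_iff) auto
  then have "s z i + s' z i = 0" if "i \<le> k" using that by auto
  moreover have "s z i = 0" "s' z i = 0" if "i > k"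
    using that s_sph[OF z] s'_sph[OF z] by (auto simp: sph_def)
  ultimately show "s' z i = - s z i" by (cases "i \<le> k") auto
qed

lemma gram_s':
  assumes "z \<in> W" "ss z = 0" shows "gram k a (s' z) = gram k a (s z)"
  by (simp add: s'_eq[OF assms] gram_def inprod_def sum_negf)

lemma M_pos: "M z \<ge> 2/3"
  by (simp add: M_def)

text \<open>If all three functions vanish, then \<open>s' = -s\<close>, and \<open>s\<close> is
  parallel to \<open>e1\<close>, so \<open>s 0 = s k = 0\<close>. There \<open>\<eta>\<close> is at
  most 1/2, hence \<open>m 0 = M (M - \<eta>^2)\<close> is positive and \<open>m\<close> is not
  parallel to \<open>s\<close>.\<close>

lemma sG_exists:
  assumes z: "z \<in> W" shows "\<exists>i\<le>2. sG i z > 0"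
proof (rule ccontr)
  assume "\<not> ?thesis"
  then have "sG 0 z \<le> 0" "sG 1 z \<le> 0" "sG 2 z \<le> 0" by (auto simp: not_less)
  then have 0: "ss z = 0" "gram k (m z) (s z) * gram k (m z) (s' z) = 0" "gram k (bas 1) (s z) * gram k (bas 1) (s' z) = 0"
    using cover_funD(2)[OF cover_fun_sG z, of 0] cover_funD(2)[OF cover_fun_sG z, of 1] cover_funD(2)[OF cover_fun_sG z, of 2]
    by (auto simp: sG_def)
  then have "gram k (m z) (s z) = 0" "gram k (bas 1) (s z) = 0" using gram_s'[OF z 0(1)] by auto
  then have m: "m z i = inprod k (m z) (s z) * s z i" and e: "bas 1 i = inprod k (bas 1) (s z) * s z i" if "i \<le> k" for i
    using that unfolding gram_eq_0 by auto
  have "inprod k (bas 1) (s z) \<noteq> 0" using e[of 1] k_ge by (auto simp: bas_def)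
  then have s0: "s z 0 = 0" "s z k = 0" using e[of 0] e[of k] k_ge by (auto simp: bas_def)
  then have "m z 0 = 0" using m[of 0] by simp
  then have "M z * (M z - (\<eta> z)\<^sup>2) = 0"
    using k_ge by (simp add: m_def \<tau>_def algebra_simps power2_eq_square)
  then have "M z = (\<eta> z)\<^sup>2" using M_pos[of z] by auto
  moreover have "\<eta> z \<ge> 0" "\<eta> z \<le> 1/2"
    using r_nonneg[of z] s0(2) by (auto simp: \<eta>_def max_def)
  then have "(\<eta> z)\<^sup>2 \<le> (1/2)\<^sup>2" by (intro power_mono)
  ultimately show False using M_pos[of z] by (simp add: power2_eq_square)
qed

text \<open>On this locus only \<open>v\<close> contributes to \<open>r\<close>, and
  \<open>b = 0\<close> forces \<open>r \<le> 1\<close>, hence \<open>w\<close> is nonzero. If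
  \<open>\<eta> = 0\<close>, then \<open>m\<close> points to \<open>e0\<close>, so \<open>s\<close>
  is \<open>e0\<close> or \<open>-e0\<close> and \<open>s k = 0\<close>; thus \<open>r = 1\<close>,
  while \<open>g = 0\<close> gives \<open>v = 0\<close> and \<open>r = 0\<close>. If
  \<open>\<eta> > 0\<close>, the rotations eliminate \<open>v\<close> and all coordinates of
  \<open>s\<close> except \<open>0\<close> and \<open>k\<close>.\<close>

lemma no_common_zero:
  assumes z: "z \<in> W" and u: "usq (y z) = 0" and b: "b z = 0" and ss: "ss z = 0"
    and gm: "gram k (m z) (s z) * gram k (m z) (s' z) = 0"
  shows False
proof -
  define c where "c = inprod k (m z) (s z)"
  have "gram k (m z) (s z) = 0" using gm gram_s'[OF z ss] by auto
  then have m: "m z i = c * s z i" if "i \<le> k" for i using that unfolding gram_eq_0 c_def by auto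
  have r: "r z = 4 * vsq (y z)" by (simp add: r_def u ss)
  have g: "g z 0 = 0" "g z 1 = 0" "g z 2 = 0" and vr: "vsq (y z) * max 0 (r z - 1) = 0"
    using b unfolding b_eq_0 by blast+
  have r1: "r z \<le> 1" using vr r by (cases "vsq (y z) = 0") auto
  have w: "y z 6 \<noteq> 0" using y6_nonzero[OF z] r1 by simp
  have V: "V z 0 = 0 \<and> V z 1 = 0 \<and> V z 2 = 0 \<Longrightarrow> r z = 0"
    using w vsq_0[of "y z"] r by (simp add: V_def)
  have m0: "m z 0 = (M z)\<^sup>2 + M z * \<tau> z 0" using k_ge by (simp add: m_def)
  show False
  proof (cases "\<eta> z = 0")
    case True
    then have "\<tau> z i = 0" for i by (simp add: \<tau>_def)
    then have "m z 0 = (M z)\<^sup>2" "m z k = 0" using k_ge by (simp_all add: m_def)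
    moreover have "(M z)\<^sup>2 > 0" using M_pos[of z] by simp
    ultimately have c: "c \<noteq> 0" "s z 0 \<noteq> 0" "s z k = 0" using m[of 0] m[of k] by auto
    then have "r z \<noteq> 1 \<Longrightarrow> \<eta> z > 0" using r1 by (simp add: \<eta>_def)
    then have "r z = 1" using True by auto
    moreover have "V z 0 = 0 \<and> V z 1 = 0 \<and> V z 2 = 0" using g c True by (simp add: g_def)
    ultimately show False using V by simp
  next
    case False
    define e where "e = \<eta> z"
    define x where "x = s z 0"
    define zc where "zc = s z k"
    have e: "e > 0" using False by (auto simp: e_def \<eta>_def less_le)
    then have "3/2 * zc + 1/2 > 0" unfolding e_def zc_def \<eta>_def
      by (cases "3/2 * s z k + 1/2 > 0") simp_all
    then have Mz: "M z = 1 + zc" "1 + zc > 0" by (auto simp: M_def zc_def)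
    have norm: "(\<Sum>i<k. (s z i)\<^sup>2) = 1 - zc\<^sup>2"
      using s_sph[OF z] by (simp add: sph_def zc_def flip: lessThan_Suc_atMost)
    define T where "T = (\<Sum>j<k. \<tau> z j * s z j)"
    have T: "T = - c * zc" using m[of k] by (simp add: m_def T_def zc_def)
    have "(\<Sum>i<k. m z i * s z i) = (\<Sum>i<k. (if i = 0 then (M z)\<^sup>2 * s z i else 0) + M z * (\<tau> z i * s z i))"
      by (intro sum.cong) (auto simp: m_def algebra_simps)
    also have "\<dots> = (M z)\<^sup>2 * x + M z * T"
      using k_ge by (simp add: sum.distrib T_def x_def flip: sum_distrib_left)
    finally have "(M z)\<^sup>2 * x + M z * T = (\<Sum>i<k. c * (s z i)\<^sup>2)"
      using m by (simp add: power2_eq_square mult.assoc)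
    also have "\<dots> = c * (1 - zc\<^sup>2)" by (simp add: norm flip: sum_distrib_left)
    finally have "(1 + zc) * ((1 + zc) * x - c) = 0"
      unfolding Mz(1) T by (simp add: algebra_simps power2_eq_square)
    then have c: "c = (1 + zc) * x" using Mz(2) by auto
    \<comment> \<open>The factor \<open>c\<close> is known from pairing \<open>m\<close> with
      \<open>s\<close>, so \<open>1 + zc\<close> can be divided out. Apart from index 0, this is the
      eigenvector equation of the rotation.\<close>
    have eq: "(if i = 0 then 1 + zc else 0) + \<tau> z i = x * s z i" if "i < k" for i
    proof -
      have "(1 + zc) * ((if i = 0 then 1 + zc else 0) + \<tau> z i) = (1 + zc) * (x * s z i)"
        using m[of i] that by (auto simp: m_def Mz(1) c algebra_simps power2_eq_square)
      then show ?thesis using Mz(2) by simp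
    qed
    have "s z 1 = 0 \<and> V z 2 = 0"
    proof (rule rotation_eq_0[of x _ "- e"])
      show "x * s z 1 = - e * V z 2" using eq[of 1] k_ge by (simp add: \<tau>_def e_def)
      show "x * V z 2 = - (- e * s z 1)" using g(3) by (simp add: g_def x_def e_def)
    qed (use e in simp)
    moreover have "V z 0 = 0 \<and> V z 1 = 0"
      by (rule rotation_eq_0[of x _ e]) (use g e in \<open>auto simp: g_def x_def e_def\<close>)
    ultimately have s1: "s z 1 = 0" and "r z = 0" using V by auto
    then have e_eq: "e = 3/2 * zc + 1/2" using \<open>3/2 * zc + 1/2 > 0\<close> by (simp add: e_def \<eta>_def zc_def)
    have s0: "s z i = 0 \<and> s z (i + 1) = 0" if "even i" "i \<ge> 2" "i < k" for i
    proof (rule rotation_eq_0[of x _ e])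
      \<comment> \<open>Evenness of \<open>k\<close>: the partner of an even index below
        \<open>k\<close> is again below \<open>k\<close>.\<close>
      have "i + 1 < k" using that k_even by (auto elim!: evenE)
      then show "x * s z (i + 1) = - (e * s z i)" using eq[of "i + 1"] that by (simp add: \<tau>_def e_def)
      show "x * s z i = e * s z (i + 1)" using eq[of i] that by (simp add: \<tau>_def e_def)
    qed (use e in simp)
    have "s z i = 0" if "i < k" "i \<noteq> 0" for i
    proof (cases "even i")
      case True then show ?thesis using s0[of i] that by (cases "i \<ge> 2") auto
    next
      case odd: False
      then show ?thesis using s0[of "i - 1"] that s1 by (cases "i = 1") (auto elim!: oddE)
    qed
    then have "(\<Sum>i<k. (s z i)\<^sup>2) = (\<Sum>i<k. if i = 0 then x\<^sup>2 else 0)"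
      by (intro sum.cong) (auto simp: x_def)
    then have "x\<^sup>2 = 1 - zc\<^sup>2" using norm k_ge by simp
    moreover have "1 + zc - e\<^sup>2 = x\<^sup>2" using eq[of 0] k_ge by (simp add: \<tau>_def e_def x_def power2_eq_square)
    \<comment> \<open>Index 0 and the unit norm give \<open>e^2 = zc + zc^2\<close>, while
      \<open>r = 0\<close> gives \<open>e = 3/2 * zc + 1/2\<close>. The difference is a positive
      definite quadratic polynomial in \<open>zc\<close>. Without the term \<open>- \<eta>^2\<close>
      in \<open>\<tau>\<close> the solution \<open>zc = 0\<close> would remain.\<close>
    ultimately have "5/4 * (zc + 1/5)\<^sup>2 + 1/5 = 0" unfolding e_eq by (simp add: field_simps power2_eq_square)
    moreover have "5/4 * (zc + 1/5)\<^sup>2 \<ge> 0" by simp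
    ultimately show False by linarith
  qed
qed

definition bF :: "nat \<Rightarrow> 'z \<Rightarrow> real" where
  "bF i z = (if i = 0 then usq (y z) else if i = 1 then b z else if i = 2 then (y z 6)\<^sup>2 else 0)"

lemma cover_fun_bF: "cover_fun W K (bF i)"
proof (rule cover_funI)
  have "continuous_on W (\<lambda>z. usq (y z))" "continuous_on W (\<lambda>z. (y z 6)\<^sup>2)"
    by (intro continuous_intros cont_y)+
  then show "continuous_on W (bF i)"
    unfolding bF_def[abs_def] using cont_b by (cases "i = 0"; cases "i = 1"; cases "i = 2") simp_all
  show "bF i z = bF i z'" if "z \<in> W" "z' \<in> W" "K z = K z'" for z z'
    unfolding bF_def by (simp only: usq_K[OF that] b_K[OF that] wsq_K[OF that])
qed (simp add: bF_def b_nonneg)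

text \<open>Where \<open>u\<close> and \<open>w\<close> vanish, \<open>v\<close> is a unit vector
  and \<open>r\<close> is at least 4, so the second summand of \<open>b\<close> is positive.\<close>

lemma bF_exists:
  assumes z: "z \<in> W" shows "\<exists>i\<le>2. bF i z > 0"
proof (rule ccontr)
  assume "\<not> ?thesis"
  then have "bF 0 z \<le> 0" "bF 1 z \<le> 0" "bF 2 z \<le> 0" by (auto simp: not_less)
  then have 0: "usq (y z) = 0" "b z = 0" "y z 6 = 0"
    using b_nonneg[of z] usq_nonneg[of "y z"] by (auto simp: bF_def)
  then have "vsq (y z) = 1" using usq_vsq_sph[OF y_sph[OF z]] by simp
  moreover have "r z \<ge> 4" using r_eq[OF z] 0 ss_nonneg[of z] by simp
  ultimately show False using 0(2) by (simp add: b_eq_0)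
qed

text \<open>This is the saving of one region: both indices are 2 only where all hypotheses of
  \<open>no_common_zero\<close> hold.\<close>

lemma least_pos_pair:
  assumes z: "z \<in> W"
  obtains i j where "least_pos bF z i" "least_pos sG z j" "i + j \<le> 3"
proof -
  obtain i where i: "i \<le> 2" "least_pos bF z i"
    using bF_exists[OF z] cover_funD(2)[OF cover_fun_bF z] least_pos_exists by metis
  obtain j where j: "j \<le> 2" "least_pos sG z j"
    using sG_exists[OF z] cover_funD(2)[OF cover_fun_sG z] least_pos_exists by metis
  have "\<not> (i = 2 \<and> j = 2)"
  proof
    assume "i = 2 \<and> j = 2"
    then have "bF 0 z = 0" "bF 1 z = 0" "sG 0 z = 0" "sG 1 z = 0" using i j by (simp_all add: least_pos_def)
    then show False using no_common_zero[OF z] by (simp add: bF_def sG_def)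
  qed
  then have "i + j \<le> 3" using i j by linarith
  then show ?thesis using that i j by blast
qed

end

lemma seg_scale: "seg (\<lambda>i. c * a i) (\<lambda>i. c * d i) t = (\<lambda>i. c * seg a d t i)"
  by (simp add: algebra_simps)

context XS_family begin

text \<open>
  On \<open>b > 0\<close> the point \<open>(u, v, w)\<close> first moves to \<open>(\<kappa> u,
  \<kappa> v, w)\<close>. From there the path goes straight towards \<open>v\<close> where
  \<open>r \<ge> 2\<close>, and towards \<open>g\<close> where \<open>r \<le> 1\<close>. At
  \<open>r = 1\<close> the vector \<open>g\<close> is a multiple of \<open>v\<close>, positive or
  negative according to the sign of \<open>s 0\<close>; between \<open>r = 1\<close> and \<open>r
  = 2\<close> the two paths are joined by the homotopy \<open>hh\<close> with parameter
  \<open>lam\<close>.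
\<close>

definition \<kappa> :: "'z \<Rightarrow> real" where "\<kappa> z = min 1 (max 0 (r z - 2))"
definition A :: "'z \<Rightarrow> nat \<Rightarrow> real" where "A z i = (if i < 6 then \<kappa> z * y z i else y z i)"
text \<open>The factor of \<open>vpart\<close> is 1 for \<open>\<kappa> z = 1\<close> and
  \<open>w^2\<close> for \<open>\<kappa> z = 0\<close>; the latter makes \<open>D\<close> equal to
  \<open>w\<close> times \<open>dd\<close> at \<open>r z = 2\<close>.\<close>

definition D :: "'z \<Rightarrow> nat \<Rightarrow> real" where "D z i = (\<kappa> z + (1 - \<kappa> z) * (y z 6)\<^sup>2) * vpart (y z) i"
text \<open>At \<open>r z = 2\<close> this is 0. At \<open>r z = 1\<close> it is 1 or 0 according to
  the sign of \<open>s z 0\<close>. Between these values of \<open>r\<close> the denominator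
  vanishes only at \<open>r z = 1\<close>, \<open>s z 0 = 0\<close>, where \<open>b\<close>
  vanishes.\<close>

definition lam :: "'z \<Rightarrow> real" where
  "lam z = max 0 (s z 0) * (2 - r z) / (max 0 (s z 0) * (2 - r z) + (r z - 1) + max 0 (- s z 0))"
text \<open>The length factor runs from \<open>\<bar>s z 0\<bar>\<close> at \<open>r z = 1\<close>,
  as in \<open>g\<close>, to 1 at \<open>r z = 2\<close>, as in \<open>D\<close>.\<close>

definition \<mu> :: "'z \<Rightarrow> real" where "\<mu> z = (r z - 1) + (2 - r z) * \<bar>s z 0\<bar>"
definition dd :: "'z \<Rightarrow> nat \<Rightarrow> real" where "dd z i = (if i < 3 then \<mu> z * V z i else 0)"

lemma \<kappa>_bounds: "0 \<le> \<kappa> z" "\<kappa> z \<le> 1"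
  by (simp_all add: \<kappa>_def)

lemma b_pos_vsq:
  assumes z: "z \<in> W" and b: "b z > 0" and r: "r z \<ge> 1"
  shows "vsq (y z) > 0"
proof (rule ccontr)
  assume "\<not> ?thesis"
  then have v: "vsq (y z) = 0" using vsq_nonneg[of "y z"] by linarith
  then have "V z 0 = 0" "V z 1 = 0" "V z 2 = 0" by (simp_all add: V_def vsq_0)
  then have "b z = 0" unfolding b_eq_0 by (simp add: g_def \<eta>_0[OF r] v)
  then show False using b by simp
qed

text \<open>Over the base point \<open>r\<close> is at least 4 and \<open>v\<close> vanishes, so
  \<open>b\<close> does too. On \<open>b > 0\<close> the copy is therefore determined, and the lift
  up to sign.\<close>

lemma b_pos_not_based:
  assumes z: "z \<in> W" and b: "b z > 0" shows "\<not> based (y z)"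
proof
  assume bs: "based (y z)"
  then have "r z \<ge> 4" using r_eq[OF z] ss_nonneg[of z] by (simp add: based_def)
  then show False using b_pos_vsq[OF z b] vsq_based[OF bs] by simp
qed

lemma b_pos_K:
  assumes "z \<in> W" "z' \<in> W" "K z = K z'" "b z > 0"
  obtains e where "e \<noteq> 0" "e\<^sup>2 = 1" "\<beta> z' = \<beta> z" "\<And>i. y z' i = e * y z i"
  using assms(1-3)
proof (cases rule: K_cases)
  case 1 then show ?thesis using b_pos_not_based assms(1,4) by blast
next
  case 2 then show ?thesis using that[of 1] by simp
next
  case 3 then show ?thesis using that[of "-1"] by simp
qed

lemma cont_\<kappa>: "continuous_on W \<kappa>"
  unfolding \<kappa>_def by (intro continuous_intros cont_r)

lemma cont_A: "continuous_on W (\<lambda>z. A z i)"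
proof -
  have "continuous_on W (\<lambda>z. \<kappa> z * y z i)" by (intro continuous_intros cont_\<kappa> cont_y)
  then show ?thesis unfolding A_def using cont_y by (cases "i < 6") simp_all
qed

lemma cont_D: "continuous_on W (\<lambda>z. D z i)"
  unfolding D_def by (intro continuous_intros cont_\<kappa> cont_y continuous_on_vpart)

lemma AD_scale:
  assumes a: "z \<in> W" "z' \<in> W" "K z = K z'" and y: "\<And>i. y z' i = e * y z i" and e: "e\<^sup>2 = 1"
  shows "A z' i = e * A z i \<and> D z' i = e * D z i"
proof -
  have k: "\<kappa> z' = \<kappa> z" by (simp add: \<kappa>_def r_K[OF a])
  show ?thesis by (simp add: A_def D_def k y vpart_def power_mult_distrib e)
qed

lemma phase1: "path_family {z \<in> W. b z > 0} K X_space (\<lambda>z. X_pt (\<beta> z) (y z)) (\<lambda>z. proj (\<beta> z) (A z))"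
proof -
  let ?W = "{z \<in> W. b z > 0}"
  have sub: "?W \<subseteq> W" by auto
  have "path_family ?W K X_space (\<lambda>z. proj (\<beta> z) (y z)) (\<lambda>z. proj (\<beta> z) (A z))"
  proof (rule path_family_motion[OF motion_proj_seg])
    show "continuous_on ?W \<beta>" "continuous_on ?W (\<lambda>z. y z i)" "continuous_on ?W (\<lambda>z. A z i)" for i
      by (rule continuous_on_subset[OF _ sub], rule cont_\<beta> cont_y cont_A)+
    fix z and t :: real assume z: "z \<in> ?W" and t: "t \<in> {0..1}"
    have 0: "seg (y z) (A z) t i = 0" if "i > 6" for i
      using that y_zero[of z i] z by (simp add: A_def)
    show "seg (y z) (A z) t \<in> vecs 6"
    proof (cases "y z 6 = 0")
      case False
      then show ?thesis by (intro vecsI[of 6 _ 6, OF 0]) (simp_all add: A_def algebra_simps)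
    next
      \<comment> \<open>Where \<open>w = 0\<close> the scale \<open>r\<close> is at least 4, so
        \<open>\<kappa> = 1\<close> and the point rests.\<close>
      case True
      then have "\<kappa> z = 1" using r_eq[of z] z ss_nonneg[of z] by (simp add: \<kappa>_def)
      then have "seg (y z) (A z) t = y z" by (simp add: A_def fun_eq_iff algebra_simps)
      then show ?thesis using z sph_vecs[OF y_sph] by simp
    qed
  next
    fix z z' assume z: "z \<in> ?W" "z' \<in> ?W" "K z = K z'"
    then have z1: "z \<in> W" "z' \<in> W" "b z > 0" by auto
    obtain e where e: "e \<noteq> 0" "e\<^sup>2 = 1" "\<beta> z' = \<beta> z" "\<And>i. y z' i = e * y z i"
      using b_pos_K[OF z1(1,2) z(3) z1(3)] by blast
    then show "(based (y z) \<and> based (A z) \<and> based (y z') \<and> based (A z')) \<or>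
      (\<beta> z' = \<beta> z \<and> (\<exists>c. c \<noteq> 0 \<and> (\<forall>i. y z' i = c * y z i \<and> A z' i = c * A z i)))"
      using AD_scale[OF z1(1,2) z(3) e(4,2)] by blast
  qed
  then show ?thesis
    by (rule path_family_cong) (simp_all add: proj_sph y_sph)
qed

lemma seg_AD_vecs:
  assumes z: "z \<in> W" and b: "b z > 0" and r: "r z \<ge> 2" and t: "t \<in> {0..1}"
  shows "seg (A z) (D z) t \<in> vecs 6"
proof -
  have "vsq (y z) > 0" using b_pos_vsq[OF z b] r by simp
  then obtain i where i: "i < 3" "y z (i + 3) \<noteq> 0" unfolding vsq_pos by blast
  have 0: "seg (A z) (D z) t j = 0" if "j > 6" for j
    using that y_zero[OF z] by (simp add: A_def D_def vpart_def)
  have n: "\<kappa> z + (1 - \<kappa> z) * (y z 6)\<^sup>2 > 0"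
  proof (cases "\<kappa> z = 0")
    case True
    then have "r z \<le> 2" by (simp add: \<kappa>_def min_def max_def split: if_splits)
    then show ?thesis using True y6_nonzero[OF z] by simp
  next
    case False
    then have "\<kappa> z > 0" "(1 - \<kappa> z) * (y z 6)\<^sup>2 \<ge> 0" using \<kappa>_bounds[of z] by simp_all
    then show ?thesis by linarith
  qed
  consider "t = 1" | "t < 1" "y z 6 \<noteq> 0" | "t < 1" "y z 6 = 0" using t by fastforce
  then show ?thesis
  proof cases
    case 1
    then show ?thesis using i n by (intro vecsI[of 6 _ i, OF 0]) (simp_all add: D_def vpart_def)
  next
    case 2
    then show ?thesis by (intro vecsI[of 6 _ 6, OF 0]) (simp_all add: A_def D_def vpart_def)
  next
    case 3
    then have "\<kappa> z = 1" using r_eq[of z] z ss_nonneg[of z] by (simp add: \<kappa>_def)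
    then show ?thesis using i 3(1) by (intro vecsI[of 6 _ "i + 3", OF 0]) (simp_all add: A_def D_def vpart_def)
  qed
qed

text \<open>The segment is delayed by \<open>ht\<close> in order to agree with \<open>hh\<close>,
  which rests during the first half of the time.\<close>

definition h2 :: "'z \<Rightarrow> real \<Rightarrow> (bool \<times> (nat \<Rightarrow> real) set set) set" where
  "h2 z t = proj (\<beta> z) (seg (A z) (D z) (ht t))"

lemma motion_h2: "motion {z \<in> W. b z > 0 \<and> r z \<ge> 2} K X_space (\<lambda>z. proj (\<beta> z) (A z)) (\<lambda>_. star) h2"
proof -
  let ?W = "{z \<in> W. b z > 0 \<and> r z \<ge> 2}"
  have sub: "?W \<subseteq> W" by auto
  have "motion ?W K X_space (\<lambda>z. proj (\<beta> z) (A z)) (\<lambda>z. proj (\<beta> z) (D z)) (\<lambda>z t. proj (\<beta> z) (seg (A z) (D z) t))"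
  proof (rule motion_proj_seg)
    show "continuous_on ?W \<beta>" "continuous_on ?W (\<lambda>z. A z i)" "continuous_on ?W (\<lambda>z. D z i)" for i
      by (rule continuous_on_subset[OF _ sub], rule cont_\<beta> cont_A cont_D)+
    show "seg (A z) (D z) t \<in> vecs 6" if "z \<in> ?W" "t \<in> {0..1}" for z t
      using that by (intro seg_AD_vecs) auto
  next
    fix z z' assume z: "z \<in> ?W" "z' \<in> ?W" "K z = K z'"
    then have z1: "z \<in> W" "z' \<in> W" "b z > 0" by auto
    obtain e where e: "e \<noteq> 0" "e\<^sup>2 = 1" "\<beta> z' = \<beta> z" "\<And>i. y z' i = e * y z i"
      using b_pos_K[OF z1(1,2) z(3) z1(3)] by blast
    then show "(based (A z) \<and> based (D z) \<and> based (A z') \<and> based (D z')) \<or>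
      (\<beta> z' = \<beta> z \<and> (\<exists>c. c \<noteq> 0 \<and> (\<forall>i. A z' i = c * A z i \<and> D z' i = c * D z i)))"
      using AD_scale[OF z1(1,2) z(3) e(4,2)] by blast
  qed
  then have "motion ?W K X_space (\<lambda>z. proj (\<beta> z) (A z)) (\<lambda>_. star) (\<lambda>z t. proj (\<beta> z) (seg (A z) (D z) t))"
  proof (rule motion_cong)
    fix z assume "z \<in> ?W"
    then have "seg (A z) (D z) 1 \<in> vecs 6" by (intro seg_AD_vecs) auto
    then have "D z \<in> vecs 6" by simp
    then show "proj (\<beta> z) (D z) = star" by (rule proj_based) (simp add: D_def based_def vpart_def)
  qed simp
  then have "motion ?W K X_space (\<lambda>z. proj (\<beta> z) (A z)) (\<lambda>_. star) (\<lambda>z t. proj (\<beta> z) (seg (A z) (D z) (ht t)))"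
    by (rule motion_reparam) (auto simp: ht_def intro!: continuous_intros)
  then show ?thesis unfolding h2_def[abs_def] .
qed

lemma A_small_r:
  assumes z: "z \<in> W" and r: "r z \<le> 2"
  shows "A z = (\<lambda>i. y z 6 * bas 6 i)" "proj (\<beta> z) (A z) = proj (\<beta> z) (bas 6)"
proof -
  have "\<kappa> z = 0" using r by (simp add: \<kappa>_def)
  then show 1: "A z = (\<lambda>i. y z 6 * bas 6 i)"
    using y_zero[OF z] by (auto simp: A_def bas_def fun_eq_iff)
  have w: "y z 6 \<noteq> 0" using y6_nonzero[OF z] r by simp
  show "proj (\<beta> z) (A z) = proj (\<beta> z) (bas 6)"
  proof (rule proj_eqI[symmetric])
    show "same_lift (\<beta> z) (bas 6) (\<beta> z) (A z)"
      unfolding same_lift_def 1 using w by blast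
    show "A z \<in> vecs 6" unfolding 1 using w by (intro vecsI[of _ _ 6]) (simp_all add: bas_def)
  qed (rule bas6_vecs)
qed

lemma vecs2I: "(\<And>i. i > 2 \<Longrightarrow> a i = 0) \<Longrightarrow> usq a > 0 \<Longrightarrow> a \<in> vecs 2"
  unfolding usq_pos vecs_def by (auto simp: less_Suc_eq_le numeral_3_eq_3 numeral_2_eq_2)

lemma r1_cases:
  assumes z: "z \<in> W" and b: "b z > 0" and r: "1 \<le> r z" "r z \<le> 2"
  shows "r z > 1 \<or> s z 0 \<noteq> 0" "dd z \<in> vecs 2"
proof -
  show 1: "r z > 1 \<or> s z 0 \<noteq> 0"
  proof (rule ccontr)
    assume "\<not> ?thesis"
    then have "b z = 0" using r unfolding b_eq_0 by (simp add: g_def \<eta>_0)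
    then show False using b by simp
  qed
  have "vsq (y z) > 0" using b_pos_vsq[OF z b] r by simp
  then obtain i where i: "i < 3" "y z (i + 3) \<noteq> 0" unfolding vsq_pos by blast
  then have "V z i \<noteq> 0" using y6_nonzero[OF z] r by (simp add: V_def)
  moreover have "\<mu> z > 0"
  proof (cases "r z > 1")
    case True then show ?thesis using r unfolding \<mu>_def by (intro add_pos_nonneg) auto
  next
    case False then show ?thesis using 1 r unfolding \<mu>_def by (intro add_nonneg_pos) auto
  qed
  ultimately show "dd z \<in> vecs 2" using i(1) by (intro vecsI[of _ _ i]) (simp_all add: dd_def)
qed

lemma lam_denominator:
  assumes "r z > 1 \<or> s z 0 \<noteq> 0" "1 \<le> r z" "r z \<le> 2"
  shows "max 0 (s z 0) * (2 - r z) + (r z - 1) + max 0 (- s z 0) > 0"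
proof -
  have "max 0 (s z 0) * (2 - r z) \<ge> 0" "max 0 (- s z 0) \<ge> 0" using assms by simp_all
  show ?thesis
  proof (cases "r z > 1")
    case True then show ?thesis using \<open>max 0 (s z 0) * (2 - r z) \<ge> 0\<close> \<open>max 0 (- s z 0) \<ge> 0\<close> by linarith
  next
    case False
    then have "r z = 1" "s z 0 \<noteq> 0" using assms by auto
    then show ?thesis by (simp add: max_def)
  qed
qed

lemma motion_W1:
  "motion {z \<in> W. b z > 0 \<and> 1 \<le> r z \<and> r z \<le> 2} K X_space (\<lambda>z. proj (\<beta> z) (A z)) (\<lambda>_. star)
     (\<lambda>z. hh (\<beta> z) (lam z) (dd z))"
proof (rule motion_cong)
  let ?W = "{z \<in> W. b z > 0 \<and> 1 \<le> r z \<and> r z \<le> 2}"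
  have sub: "?W \<subseteq> W" by auto
  note c = continuous_on_subset[OF cont_s sub] continuous_on_subset[OF cont_r sub] continuous_on_subset[OF cont_V sub]
  show "motion ?W K X_space (\<lambda>z. proj (\<beta> z) (bas 6)) (\<lambda>_. star) (\<lambda>z. hh (\<beta> z) (lam z) (dd z))"
  proof (rule motion_hh)
    show "continuous_on ?W \<beta>" by (rule continuous_on_subset[OF cont_\<beta> sub])
    have "max 0 (s z 0) * (2 - r z) + (r z - 1) + max 0 (- s z 0) \<noteq> 0" if "z \<in> ?W" for z
      using lam_denominator[OF r1_cases(1)] that by fastforce
    then show "continuous_on ?W lam"
      unfolding lam_def by (intro continuous_intros c) auto
    have "continuous_on ?W (\<lambda>z. \<mu> z * V z i)" for i
      unfolding \<mu>_def by (intro continuous_intros c)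
    then show "continuous_on ?W (\<lambda>z. dd z i)" for i unfolding dd_def by (cases "i < 3") simp_all
  next
    fix z assume z: "z \<in> ?W"
    then have *: "max 0 (s z 0) * (2 - r z) + (r z - 1) + max 0 (- s z 0) > 0"
      using lam_denominator[OF r1_cases(1)] by auto
    have "0 \<le> max 0 (s z 0) * (2 - r z)" "0 \<le> (r z - 1)" "0 \<le> max 0 (- s z 0)" using z by auto
    then have "lam z \<in> {0..1}" unfolding lam_def atLeastAtMost_iff
      using * by (intro conjI divide_nonneg_pos) (simp_all add: divide_le_eq)
    then show "lam z \<in> {0..1} \<and> dd z \<in> vecs 2" using z r1_cases(2) by auto
  next
    fix z z' assume z: "z \<in> ?W" "z' \<in> ?W" "K z = K z'"
    then have z1: "z \<in> W" "z' \<in> W" "b z > 0" by auto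
    have "\<beta> z' = \<beta> z" using b_pos_K[OF z1(1,2) z(3) z1(3)] by blast
    moreover have "lam z = lam z'" "\<mu> z = \<mu> z'"
      unfolding lam_def \<mu>_def r_K[OF z1(1,2) z(3)] conjunct1[OF K_s[OF z1(1,2) z(3)]] by (rule refl)+
    moreover have "dd z = dd z'"
      unfolding dd_def[abs_def] V_K[OF z1(1,2) z(3)] \<open>\<mu> z = \<mu> z'\<close> ..
    ultimately show "\<beta> z = \<beta> z' \<and> lam z = lam z' \<and> dd z = dd z'" by simp
  qed
qed (simp_all add: A_small_r(2))

lemma g_vecs:
  assumes "b z > 0" "r z \<le> 1" shows "g z \<in> vecs 2"
proof (rule vecs2I)
  have "max 0 (r z - 1) = 0" using assms(2) by simp
  then show "usq (g z) > 0" using assms(1) unfolding b_def by simp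
qed (simp add: g_def)

lemma motion_W0:
  "motion {z \<in> W. b z > 0 \<and> r z \<le> 1} K X_space (\<lambda>z. proj (\<beta> z) (A z)) (\<lambda>_. star)
     (\<lambda>z. hh (\<beta> z) 0 (g z))"
proof (rule motion_cong)
  let ?W = "{z \<in> W. b z > 0 \<and> r z \<le> 1}"
  have sub: "?W \<subseteq> W" by auto
  show "motion ?W K X_space (\<lambda>z. proj (\<beta> z) (bas 6)) (\<lambda>_. star) (\<lambda>z. hh (\<beta> z) 0 (g z))"
  proof (rule motion_hh)
    show "continuous_on ?W \<beta>" by (rule continuous_on_subset[OF cont_\<beta> sub])
    show "continuous_on ?W (\<lambda>z. g z i)" for i by (rule continuous_on_subset[OF cont_g sub])
    show "0 \<in> {0..1::real} \<and> g z \<in> vecs 2" if "z \<in> ?W" for z using that g_vecs by auto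
    fix z z' assume z: "z \<in> ?W" "z' \<in> ?W" "K z = K z'"
    then have z1: "z \<in> W" "z' \<in> W" "b z > 0" by auto
    have "\<beta> z' = \<beta> z" using b_pos_K[OF z1(1,2) z(3) z1(3)] by blast
    then show "\<beta> z = \<beta> z' \<and> (0::real) = 0 \<and> g z = g z'" using g_K[OF z1(1,2) z(3)] by simp
  qed simp
qed (simp_all add: A_small_r(2))

text \<open>Here \<open>\<eta> = 0\<close> and \<open>g = - s 0 * V\<close>. For
  \<open>s 0 < 0\<close> this is \<open>dd\<close> and \<open>lam = 0\<close>; for
  \<open>s 0 > 0\<close> it is \<open>-dd\<close> and \<open>lam = 1\<close>, and the right end of
  \<open>hh\<close> for \<open>dd\<close> is the left end for \<open>-dd\<close>.\<close>

lemma agree_1: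
  assumes z: "z \<in> W" "b z > 0" and r: "r z = 1" and t: "t \<in> {0..1}"
  shows "hh (\<beta> z) (lam z) (dd z) t = hh (\<beta> z) 0 (g z) t"
proof -
  have g: "g z i = (if i < 3 then - s z 0 * V z i else 0)" for i
  proof -
    consider "i = 0" | "i = 1" | "i = 2" | "i > 2" by linarith
    then show ?thesis by cases (simp_all add: g_def \<eta>_0 r)
  qed
  have "s z 0 \<noteq> 0" using r1_cases(1)[OF z] r by simp
  then consider "s z 0 > 0" | "s z 0 < 0" by linarith
  then show ?thesis
  proof cases
    case 1
    then have "lam z = 1" by (simp add: lam_def r)
    moreover have "g z = (\<lambda>i. - dd z i)" using 1 by (simp add: dd_def \<mu>_def r g fun_eq_iff)
    ultimately show ?thesis using hh_right[of "\<beta> z" "dd z" t] hh_left[OF g_vecs[OF z(2)] t, of "\<beta> z"] r by simp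
  next
    case 2
    then have "lam z = 0" by (simp add: lam_def r)
    moreover have "dd z = g z" using 2 by (simp add: dd_def \<mu>_def r g fun_eq_iff)
    ultimately show ?thesis by simp
  qed
qed

text \<open>At \<open>r = 2\<close> both ends \<open>A\<close> and \<open>D\<close> of the segment
  are \<open>w\<close> times those of the segment from \<open>e6\<close> to \<open>dd\<close>, and
  \<open>lam = 0\<close>.\<close>

lemma agree_2:
  assumes z: "z \<in> W" "b z > 0" and r: "r z = 2" and t: "t \<in> {0..1}"
  shows "h2 z t = hh (\<beta> z) (lam z) (dd z) t"
proof -
  have dv: "dd z \<in> vecs 2" using r1_cases(2)[OF z] r by simp
  have w: "y z 6 \<noteq> 0" using y6_nonzero[OF z(1)] r by simp
  have A: "A z = (\<lambda>i. y z 6 * bas 6 i)" using A_small_r(1)[OF z(1)] r by simp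
  have D: "D z = (\<lambda>i. y z 6 * dd z i)"
    by (simp add: D_def dd_def \<kappa>_def \<mu>_def r V_def vpart_def fun_eq_iff power2_eq_square)
  have "proj (\<beta> z) (seg (bas 6) (dd z) (ht t)) = proj (\<beta> z) (seg (A z) (D z) (ht t))"
  proof (rule proj_eqI)
    show "seg (bas 6) (dd z) (ht t) \<in> vecs 6" by (rule seg_bas6_vecs[OF dv])
    show "seg (A z) (D z) (ht t) \<in> vecs 6" by (rule seg_AD_vecs) (use z r t in \<open>auto simp: ht_def\<close>)
    show "same_lift (\<beta> z) (seg (bas 6) (dd z) (ht t)) (\<beta> z) (seg (A z) (D z) (ht t))"
      unfolding A D seg_scale same_lift_def using w by blast
  qed
  moreover have "lam z = 0" by (simp add: lam_def r)
  ultimately show ?thesis using hh_left[OF dv t] by (simp add: h2_def)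
qed

lemma closedin_r:
  assumes "U \<subseteq> W" "closed S" shows "closedin (top_of_set U) (U \<inter> r -` S)"
  by (rule continuous_closedin_preimage[OF continuous_on_subset[OF cont_r assms(1)] assms(2)])

lemma phase2: "path_family {z \<in> W. b z > 0} K X_space (\<lambda>z. proj (\<beta> z) (A z)) (\<lambda>_. star)"
proof -
  define W2 where "W2 = {z \<in> W. b z > 0 \<and> r z \<ge> 2}"
  define W1 where "W1 = {z \<in> W. b z > 0 \<and> 1 \<le> r z \<and> r z \<le> 2}"
  define W0 where "W0 = {z \<in> W. b z > 0 \<and> r z \<le> 1}"
  note d = W0_def W1_def W2_def
  have sub: "W1 \<union> W0 \<subseteq> W" "W2 \<union> (W1 \<union> W0) \<subseteq> W" by (auto simp: d)
  define h where "h = (\<lambda>z t. if z \<in> W1 then hh (\<beta> z) (lam z) (dd z) t else hh (\<beta> z) 0 (g z) t)"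
  have m: "motion (W1 \<union> W0) K X_space (\<lambda>z. proj (\<beta> z) (A z)) (\<lambda>_. star) h"
    unfolding h_def
  proof (rule motion_closed_Un[OF motion_W1[folded W1_def] motion_W0[folded W0_def]])
    have "(W1 \<union> W0) \<inter> r -` {1..} = W1" "(W1 \<union> W0) \<inter> r -` {..1} = W0" by (auto simp: d)
    then show "closedin (top_of_set (W1 \<union> W0)) W1" "closedin (top_of_set (W1 \<union> W0)) W0"
      using closedin_r[OF sub(1), of "{1..}"] closedin_r[OF sub(1), of "{..1}"] by simp_all
    show "hh (\<beta> z) (lam z) (dd z) t = hh (\<beta> z) 0 (g z) t" if "z \<in> W1" "z \<in> W0" "t \<in> {0..1}" for z t
      using that by (intro agree_1) (auto simp: d)
    fix z z' assume z: "z \<in> W1" "z' \<in> W0" "K z = K z'"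
    then have "r z = r z'" by (intro r_K) (auto simp: d)
    then show "z' \<in> W1 \<and> z \<in> W0" using z(1,2) by (auto simp: d)
  qed
  have "motion (W2 \<union> (W1 \<union> W0)) K X_space (\<lambda>z. proj (\<beta> z) (A z)) (\<lambda>_. star) (\<lambda>z t. if z \<in> W2 then h2 z t else h z t)"
  proof (rule motion_closed_Un[OF motion_h2[folded W2_def] m])
    have "(W2 \<union> (W1 \<union> W0)) \<inter> r -` {2..} = W2" "(W2 \<union> (W1 \<union> W0)) \<inter> r -` {..2} = W1 \<union> W0" by (auto simp: d)
    then show "closedin (top_of_set (W2 \<union> (W1 \<union> W0))) W2" "closedin (top_of_set (W2 \<union> (W1 \<union> W0))) (W1 \<union> W0)"
      using closedin_r[OF sub(2), of "{2..}"] closedin_r[OF sub(2), of "{..2}"] by simp_all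
    fix z and t :: real assume z: "z \<in> W2" "z \<in> W1 \<union> W0" and t: "t \<in> {0..1}"
    then have *: "z \<in> W1" "z \<in> W" "b z > 0" "r z = 2" by (auto simp: d)
    show "h2 z t = h z t" using agree_2[OF *(2-4) t] *(1) by (simp add: h_def)
  next
    fix z z' assume z: "z \<in> W2" "z' \<in> W1 \<union> W0" "K z = K z'"
    then have "r z = r z'" by (intro r_K) (auto simp: d)
    then show "z' \<in> W2 \<and> z \<in> W1 \<union> W0" using z(1,2) by (auto simp: d)
  qed
  moreover have "W2 \<union> (W1 \<union> W0) = {z \<in> W. b z > 0}" by (auto simp: d)
  ultimately show ?thesis by (simp add: path_family_motion)
qed

lemma planner_bF: "planner W K X_space (\<lambda>z. X_pt (\<beta> z) (y z)) (\<lambda>_. star) bF"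
  unfolding planner_def
proof (intro allI conjI cover_fun_bF)
  fix i :: nat
  have c: "path_family {z \<in> W. cF j z > 0} K X_space (\<lambda>z. X_pt (\<beta> z) (y z)) (\<lambda>_. star)" for j
    by (rule plannerD(2)[OF planner_cF])
  show "path_family {z \<in> W. bF i z > 0} K X_space (\<lambda>z. X_pt (\<beta> z) (y z)) (\<lambda>_. star)"
  proof (cases "i = 1")
    case True
    then have "{z \<in> W. bF i z > 0} = {z \<in> W. b z > 0}" by (simp add: bF_def)
    then show ?thesis using path_family_join[OF phase1 phase2] by simp
  next
    case False
    then have "{z \<in> W. bF i z > 0} = {z \<in> W. cF i z > 0}" by (simp add: bF_def cF_def)
    then show ?thesis using c[of i] by simp
  qed
qed

end

text \<open>The index is at most 3 for moving \<open>(x, s)\<close> to \<open>(star, s')\<close> and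
  at most 2 for moving on to \<open>(x', s')\<close>.\<close>

theorem TC_X_times_sphere_le:
  assumes "even k" "k \<ge> 2"
  shows "TC (prod_topology X_space (nsphere k)) \<le> 5"
proof -
  define Z where "Z = (UNIV :: (bool \<times> bool) set) \<times> spheres 4 (\<lambda>\<alpha>. if \<alpha> < 2 then 6 else k)"
  define x where "x = (\<lambda>z::(bool \<times> bool) \<times> (nat \<Rightarrow> nat \<Rightarrow> real). X_pt (fst (fst z)) (snd z 0))"
  define x' where "x' = (\<lambda>z::(bool \<times> bool) \<times> (nat \<Rightarrow> nat \<Rightarrow> real). X_pt (snd (fst z)) (snd z 1))"
  define s where "s = (\<lambda>z::(bool \<times> bool) \<times> (nat \<Rightarrow> nat \<Rightarrow> real). snd z 2)"
  define s' where "s' = (\<lambda>z::(bool \<times> bool) \<times> (nat \<Rightarrow> nat \<Rightarrow> real). snd z 3)"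
  define Q where "Q = (\<lambda>z. ((x z, s z), (x' z, s' z)))"
  let ?B = "prod_topology X_space (nsphere k)"
  have sph: "snd z 0 \<in> sph 6" "snd z 1 \<in> sph 6" "s z \<in> sph k" "s' z \<in> sph k" if "z \<in> Z" for z
  proof -
    have "snd z \<alpha> \<in> sph (if \<alpha> < 2 then 6 else k)" if "\<alpha> < 4" for \<alpha>
      using \<open>z \<in> Z\<close> that by (auto simp: Z_def spheres_def)
    from this[of 0] this[of 1] this[of 2] this[of 3]
    show "snd z 0 \<in> sph 6" "snd z 1 \<in> sph 6" "s z \<in> sph k" "s' z \<in> sph k"
      by (simp_all add: s_def s'_def)
  qed
  have cb: "continuous_on Z (\<lambda>z. fst (fst z))" "continuous_on Z (\<lambda>z. snd (fst z))"
    by (intro continuous_intros)+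
  interpret A: XS_family Z Q "\<lambda>z. fst (fst z)" "\<lambda>z. snd z 0" s s' k
    by unfold_locales (simp_all add: cb continuous_on_coord_snd sph Q_def x_def s_def[THEN fun_cong] s'_def[THEN fun_cong] assms
        sph(3,4)[unfolded s_def s'_def])
  interpret B: X_family Z Q "\<lambda>z. snd (fst z)" "\<lambda>z. snd z 1"
    by unfold_locales (simp_all add: cb continuous_on_coord_snd sph[unfolded One_nat_def] Q_def x'_def)
  have cs: "continuous_map (top_of_set Z) (nsphere k) s" "continuous_map (top_of_set Z) (nsphere k) s'"
    unfolding nsphere_eq_top_of_set continuous_map_in_subtopology s_def s'_def
    using sph(3,4) unfolding s_def s'_def by (auto intro!: continuous_on_coord[where f = snd] continuous_on_snd continuous_on_id)
  have cx: "continuous_map (top_of_set Z) X_space x" "continuous_map (top_of_set Z) X_space x'"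
    unfolding x_def x'_def by (intro continuous_map_X_pt_fst cb; use sph in blast)+
  obtain G where G: "planner Z Q ?B (\<lambda>z. (x z, s z)) (\<lambda>z. (star, s' z)) G" and scG: "stair_cover Z A.bF A.sG G"
    using planner_prod[OF A.planner_bF A.planner_sG] unfolding x_def by blast
  have P: "planner Z Q ?B (\<lambda>z. (star, s' z)) (\<lambda>z. (x' z, s' z)) B.cF"
    unfolding planner_def
  proof (intro allI conjI B.cover_fun_cF path_family_Pair)
    fix i
    show "path_family {z \<in> Z. B.cF i z > 0} Q X_space (\<lambda>_. star) x'"
      unfolding x'_def by (rule path_family_reverse[OF plannerD(2)[OF B.planner_cF]])
    show "path_family {z \<in> Z. B.cF i z > 0} Q (nsphere k) s' s'"
      by (rule path_family_subset[of Z]) (auto intro!: path_family_const cs simp: Q_def)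
  qed
  obtain H where pl: "planner Z Q ?B (\<lambda>z. (x z, s z)) (\<lambda>z. (x' z, s' z)) H" and sc: "stair_cover Z G B.cF H"
    using planner_trans[OF G P] by blast
  have "TC ?B \<le> enat 5"
  proof (rule TC_le_planner[of Z _ Q H])
    show "compact Z" unfolding Z_def by (intro compact_bools_Times compact_spheres)
    show "continuous_map (top_of_set Z) (prod_topology ?B ?B) Q"
      unfolding Q_def by (intro continuous_map_pairedI cs cx)
    show "Q ` Z = topspace (prod_topology ?B ?B)"
    proof (intro subset_antisym subsetI)
      fix p assume "p \<in> topspace (prod_topology ?B ?B)"
      then obtain b a b' a' c c' where p: "p = ((X_pt b a, c), (X_pt b' a', c'))" "a \<in> sph 6" "a' \<in> sph 6"
          "c \<in> sph k" "c' \<in> sph k"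
        by (auto simp: topspace_X topspace_nsphere)
      let ?z = "((b, b'), \<lambda>\<alpha>::nat. if \<alpha> = 0 then a else if \<alpha> = 1 then a' else if \<alpha> = 2 then c else
        if \<alpha> = 3 then c' else (\<lambda>_. 0))"
      have "?z \<in> Z" using p(2-5) by (auto simp: Z_def spheres_def)
      then show "p \<in> Q ` Z" by (rule rev_image_eqI) (simp add: p Q_def x_def x'_def s_def s'_def)
    next
      fix p assume "p \<in> Q ` Z"
      then obtain z where z: "p = Q z" "z \<in> Z" by blast
      then show "p \<in> topspace (prod_topology ?B ?B)"
        using X_pt_in[OF sph(1)[OF z(2)]] X_pt_in[OF sph(2)[OF z(2)]] sph(3,4)[OF z(2)]
        by (simp add: Q_def x_def x'_def topspace_nsphere)
    qed
    show "Hausdorff_space ?B"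
      unfolding Hausdorff_space_prod_topology using Hausdorff_X
      by (simp add: nsphere_eq_top_of_set Hausdorff_space_subtopology)
    show "planner Z Q ?B (\<lambda>z. fst (Q z)) (\<lambda>z. snd (Q z)) H"
      using pl by (simp add: Q_def)
    fix z assume z: "z \<in> Z"
    obtain i j where ij: "least_pos A.bF z i" "least_pos A.sG z j" "i + j \<le> 3"
      using A.least_pos_pair[OF z] by blast
    have "G (i + j) z > 0" using scG z ij unfolding stair_cover_def by blast
    \<comment> \<open>The merged region with index \<open>i + j\<close> contains \<open>z\<close>,
      so the least index of \<open>G\<close> is at most 3.\<close>
    then obtain l where l: "l \<le> 3" "least_pos G z l"
      using least_pos_exists[OF ij(3)] cover_funD(2)[OF plannerD(1)[OF G] z] by metis
    obtain j where j: "j \<le> 2" "least_pos B.cF z j"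
      using B.cF_cover[OF z] cover_funD(2)[OF B.cover_fun_cF z] least_pos_exists by metis
    show "\<exists>i\<le>5. H i z > 0" by (rule stair_cover_exists[OF sc z l(2) j(2)]) (use l j in simp)
  qed
  then show ?thesis by (simp add: numeral_eq_enat)
qed

theorem theorem1p5:
  fixes k :: nat
  assumes "even k" and "k \<ge> 2"
  shows "TC X_space = 4 \<and> TC (prod_topology X_space (nsphere k)) = 5"
proof
  show "TC X_space = 4" using TC_X_ge TC_X_le by (rule antisym[rotated])
  have "k \<ge> 1" using assms(2) by simp
  then show "TC (prod_topology X_space (nsphere k)) = 5"
    using TC_X_times_sphere_ge TC_X_times_sphere_le[OF assms] by (intro antisym) auto
qed

end
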